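(* Let $F$ be a finite-rank free group, let $\Phi\in\mathrm{Out}(F)$ be linearly growing, and let $G=F\rtimes_\Phi\mathbb Z$. Suppose that $G$ virtually has good edge measurements, i.e. that after passing to a suitable finite-index subgroup the $\Delta$-edge measurements $\pi^i_w$ can be chosen so that for all white vertices $w$ of $\Delta$ and all $i\in J_w$ there exists $K_i\in\mathbb Z-\{0\}$ such that $\pi^i_w(g)=K_i$ for all $e\in\mathbf E_i(w)$ and all $g$ in the conjugacy class represented by $p_e$. Then $G$ acts freely on a CAT(0) cube complex.
   Context: No finite-dimensionality, properness or cocompactness of the cube complex or action is required. $F\rtimes_\Phi\langle t\rangle=\langle F,t\mid tft^{-1}=\phi(f)\rangle$ for $\phi\in\Phi$. $\Phi$ is linearly growing if conjugacy lengths $\ell(\Phi^n(g))$ of all nontrivial $g\in F$ grow at most linearly in $n$ (each being bounded above and below by positive multiples of $n^{d'}$ with $d'\le1$) and some grow linearly; it is UPG if moreover its image in $GL_{\mathrm{rank} F}(\mathbb Z)$ is unipotent (this holds for some positive power). **Torus splitting.** Let $\Phi$ be linearly growing and UPG and $G=F\rtimes_\Phi\langle t\rangle$. By Andrew–Martino and Dahmani–Touikan there is a finite connected bipartite graph $\Delta$ (black and white vertices; every edge $e$ is oriented from its black vertex $e^-$ to its white vertex $e^+$; no black vertex is a leaf) such that $F$ and $G$ split as graphs of groups over $\Delta$ with: vertex groups $F_v$ of finite rank, and $G_v=F_v\times\langle t_v\rangle$ with $t_v\in Ft$; $\mathrm{rank} F_v=1$ and $G_v$ is a maximal $\mathbb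 Z^2$ subgroup if $v$ is black; $\mathrm{rank} F_v\geq2$ and $G_v$ is a maximal free-times-$\mathbb Z$ subgroup if $v$ is white; distinct white vertices have distinct $t_v$; edge groups $F_e=\langle r_e\rangle$ (maximal cyclic in $F$) and $G_e=\langle r_e\rangle\times\langle t_e\rangle$; the map to the black vertex group is an isomorphism sending $r_e$ to a generator $r_{e^-}$ of $F_{e^-}$ and $t_e\mapsto t_{e^-}$; the map to the white vertex group sends $r_e\mapsto p_e\in F_{e^+}$ and $t_e\mapsto p_e^{k(e)}t_{e^+}$ with $k(e)\in\mathbb Z$; the centre of each $G_v$ lies in the image of each incident edge group; the $G$-action on the Bass–Serre tree is $4$-acylindrical; $k(e)\ne k(e')$ for distinct edges $e,e'$ at a common black vertex; distinct black neighbours of a white vertex in the Bass–Serre tree have stabilisers with cyclic intersection. **Graph of spaces.** Each black $X_v$ is a circle graph, each white $X_w$ is a finite graph with $\pi_1(X_w,x_w)=F_w$; $Y$ is formed from $\bigsqcup_vX_v$ by attaching for each edge $e$ a cylinder $X_{e^-}\times[-1,1]$, by the identity at $-1$ and at $+1$ by an immersed combinatorial circuit $p_e\to X_{e^+}$ representing the conjugacy class of $p_e$; for distinct $e_1,e_2$ ending at $w$ all components of the fibre product $p_{e_1}\otimes_{X_w}p_{e_2}$ are contractible. $\pi_1Y=F$, and the homeomorphism $\varphi:Y\to Y$ that is the identity on $\bigsqcup X_v$ and a $k(e)$-fold Dehn twist on the $e$-cylinder represents $\Phi$; its mapping torus $M_\varphi$ has $\pi_1M_\varphi=G$. $Y$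 is $\mathcal P$-clean if every $p_e$ is an embedded circuit and starred if $\Delta$ contains no $2$-cycle (two edges with the same endpoints). If $Y_1\to Y$ is a finite cover to which $\varphi$ lifts, some positive power of the lift fixes the vertex spaces of $Y_1$ and its mapping torus has $\pi_1$ a finite-index subgroup of $G$; the induced splittings over the underlying graph of $Y_1$ have all the properties above. By such passages to finite index, every $G$ virtually satisfies: $\Phi$ UPG, $Y$ $\mathcal P$-clean and starred, and the following. **$\Delta$-edge measurements.** For a white vertex $w$ let $\mathbf E(w)=\{e:e^+=w\}$ and for a black vertex $b$ let $\mathbf E(b)=\{e:e^-=b\}$. For each white $w$ there is a partition $\mathbf E(w)=\bigsqcup_{i\in J_w}\mathbf E_i(w)$ (index sets $J_w$ disjoint for different $w$) such that: (1) for all $i\in J_w$ and $e,e'\in\mathbf E_i(w)$, $k(e)=k(e')$ and there is a bijection $f\mapsto f'$ from $\mathbf E(e^-)$ to $\mathbf E((e')^-)$ with $k(f)=k(f')$; (2) for each $i\in J_w$ there is a homomorphism $\pi^i_w:\pi_1(X_w,x_w)\to\mathbb Z$, called a $\Delta$-edge measurement, with $\pi^i_w(g)\ne0$ for every $e\in\mathbf E_i(w)$ and $g$ in the conjugacy class represented by $p_e$; (3) $\pi^i_w(g)=0$ for $g$ in the conjugacy class of $p_f$ with $f\in\mathbf E(w)-\mathbf E_i(w)$. The hypothesis of the claim concerns a finite-index subgroup of $G$ in this form and such a choice of partitions and homomorphisms for it. *)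

theory Defs
  imports
    "HOL-Algebra.Group_Action"
    "HOL-Algebra.Elementary_Groups"
    "HOL-Algebra.Generated_Groups"
    "HOL-Algebra.Left_Coset"
    "Graph_Theory.Digraph_Component"
    "Jordan_Normal_Form.Matrix"
begin

section \<open>Walks, homotopy of walks, groups of loops\<close>

text \<open>
  A walk over a set \<open>L\<close> of letters, each letter \<open>x\<close> leading from \<open>i x\<close> to \<open>t x\<close>.  The same notion
  serves edge paths in graphs and in cube complexes, and words in graphs of groups.
\<close>

fun walk :: "'l set \<Rightarrow> ('l \<Rightarrow> 'v) \<Rightarrow> ('l \<Rightarrow> 'v) \<Rightarrow> 'v \<Rightarrow> 'l list \<Rightarrow> 'v \<Rightarrow> bool" where
  "walk L i t u [] v \<longleftrightarrow> u = v"
| "walk L i t u (x # xs) v \<longleftrightarrow> x \<in> L \<and> i x = u \<and> walk L i t (t x) xs v"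

text \<open>
  Homotopy within the set \<open>P\<close> of walks: the equivalence relation generated by replacing a factor
  \<open>l\<close> by \<open>r\<close> for \<open>(l, r) \<in> R\<close>, all intermediate words staying in \<open>P\<close>.
\<close>

definition elementary_move :: "('l list \<times> 'l list) set \<Rightarrow> 'l list \<Rightarrow> 'l list \<Rightarrow> bool" where
  "elementary_move R u v \<longleftrightarrow> (\<exists>x y l r. (l, r) \<in> R \<and> u = x @ l @ y \<and> v = x @ r @ y)"

definition homotopic_in :: "'l list set \<Rightarrow> ('l list \<times> 'l list) set \<Rightarrow> 'l list \<Rightarrow> 'l list \<Rightarrow> bool" where
  "homotopic_in P R = equivclp (\<lambda>u v. u \<in> P \<and> v \<in> P \<and> elementary_move R u v)"

definition homotopy_class :: "'l list set \<Rightarrow> ('l list \<times> 'l list) set \<Rightarrow> 'l list \<Rightarrow> 'l list set" where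
  "homotopy_class P R u = {v \<in> P. homotopic_in P R u v}"

definition loop_group :: "'l list set \<Rightarrow> ('l list \<times> 'l list) set \<Rightarrow> 'l list set monoid" where
  "loop_group P R =
    \<lparr>carrier = homotopy_class P R ` P,
     monoid.mult = (\<lambda>A B. \<Union>u\<in>A. \<Union>v\<in>B. homotopy_class P R (u @ v)),
     one = homotopy_class P R []\<rparr>"

section \<open>Graphs\<close>

text \<open>
  A graph (1-complex, with loops and multiple edges allowed) is given by a directed multigraph, the
  direction of an arc being an auxiliary orientation of the edge.  A dart is an oriented edge:
  \<open>(a, True)\<close> is the arc \<open>a\<close> traversed forwards, \<open>(a, False)\<close> backwards.
\<close>

definition darts :: "('v, 'e) pre_digraph \<Rightarrow> ('e \<times> bool) set" where
  "darts X = arcs X \<times> UNIV"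

definition org :: "('v, 'e) pre_digraph \<Rightarrow> 'e \<times> bool \<Rightarrow> 'v" where
  "org X d = (if snd d then tail X (fst d) else head X (fst d))"

definition ter :: "('v, 'e) pre_digraph \<Rightarrow> 'e \<times> bool \<Rightarrow> 'v" where
  "ter X d = (if snd d then head X (fst d) else tail X (fst d))"

definition flip :: "'e \<times> bool \<Rightarrow> 'e \<times> bool" where
  "flip d = (fst d, \<not> snd d)"

abbreviation edge_path :: "('v, 'e) pre_digraph \<Rightarrow> 'v \<Rightarrow> ('e \<times> bool) list \<Rightarrow> 'v \<Rightarrow> bool" where
  "edge_path X \<equiv> walk (darts X) (org X) (ter X)"

definition reduced :: "('e \<times> bool) list \<Rightarrow> bool" where
  "reduced w \<longleftrightarrow> successively (\<lambda>x y. y \<noteq> flip x) w"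

definition backtracks :: "('v, 'e) pre_digraph \<Rightarrow> (('e \<times> bool) list \<times> ('e \<times> bool) list) set" where
  "backtracks X = {([d, flip d], []) | d. d \<in> darts X}"

definition closed_paths :: "('v, 'e) pre_digraph \<Rightarrow> 'v \<Rightarrow> ('e \<times> bool) list set" where
  "closed_paths X x = {w. edge_path X x w x}"

definition graph_pi1 :: "('v, 'e) pre_digraph \<Rightarrow> 'v \<Rightarrow> ('e \<times> bool) list set monoid" where
  "graph_pi1 X x = loop_group (closed_paths X x) (backtracks X)"

definition path_class :: "('v, 'e) pre_digraph \<Rightarrow> 'v \<Rightarrow> ('e \<times> bool) list \<Rightarrow> ('e \<times> bool) list set" where
  "path_class X x w = homotopy_class (closed_paths X x) (backtracks X) w"

text \<open>A connected 1-complex is contractible iff it is a tree, i.e. iff it is simply connected.\<close>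

definition contractible_components :: "('v, 'e) pre_digraph \<Rightarrow> bool" where
  "contractible_components X \<longleftrightarrow>
    (\<forall>x\<in>verts X. \<forall>w\<in>closed_paths X x. homotopic_in (closed_paths X x) (backtracks X) w [])"

subsection \<open>Combinatorial circuits\<close>

definition circle_graph :: "nat \<Rightarrow> (nat, nat) pre_digraph" where
  "circle_graph n = \<lparr>verts = {..<n}, arcs = {..<n}, tail = (\<lambda>i. i), head = (\<lambda>i. Suc i mod n)\<rparr>"

definition circuit :: "('v, 'e) pre_digraph \<Rightarrow> ('e \<times> bool) list \<Rightarrow> bool" where
  "circuit X c \<longleftrightarrow> c \<noteq> [] \<and> edge_path X (org X (hd c)) c (org X (hd c))"

text \<open>The combinatorial map from the circle graph with \<open>length c\<close> vertices to \<open>X\<close> given by \<open>c\<close>.\<close>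

definition circuit_vert :: "('v, 'e) pre_digraph \<Rightarrow> ('e \<times> bool) list \<Rightarrow> nat \<Rightarrow> 'v" where
  "circuit_vert X c i = org X (c ! i)"

definition circuit_dart :: "('e \<times> bool) list \<Rightarrow> nat \<times> bool \<Rightarrow> 'e \<times> bool" where
  "circuit_dart c d = (if snd d then c ! fst d else flip (c ! fst d))"

definition immersed_circuit :: "('v, 'e) pre_digraph \<Rightarrow> ('e \<times> bool) list \<Rightarrow> bool" where
  "immersed_circuit X c \<longleftrightarrow> circuit X c \<and>
    (\<forall>d\<in>darts (circle_graph (length c)). \<forall>d'\<in>darts (circle_graph (length c)).
      org (circle_graph (length c)) d = org (circle_graph (length c)) d' \<and>
      circuit_dart c d = circuit_dart c d' \<longrightarrow> d = d')"

definition embedded_circuit :: "('v, 'e) pre_digraph \<Rightarrow> ('e \<times> bool) list \<Rightarrow> bool" where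
  "embedded_circuit X c \<longleftrightarrow> circuit X c \<and>
    inj_on (circuit_vert X c) (verts (circle_graph (length c))) \<and>
    inj_on (circuit_dart c) (darts (circle_graph (length c)))"

text \<open>
  Fibre product of two combinatorial maps \<open>A \<rightarrow> X\<close> and \<open>B \<rightarrow> X\<close>, given on vertices and darts.  Its
  edges are pairs of edges with the same image; each is oriented so that its first component is
  traversed forwards, the second component then being a dart of \<open>B\<close>.
\<close>

definition fibre_product ::
  "('a, 'c) pre_digraph \<Rightarrow> ('a \<Rightarrow> 'v) \<Rightarrow> ('c \<times> bool \<Rightarrow> 'e \<times> bool) \<Rightarrow>
   ('b, 'd) pre_digraph \<Rightarrow> ('b \<Rightarrow> 'v) \<Rightarrow> ('d \<times> bool \<Rightarrow> 'e \<times> bool) \<Rightarrow>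
   ('a \<times> 'b, 'c \<times> ('d \<times> bool)) pre_digraph" where
  "fibre_product A fv fd B gv gd =
    \<lparr>verts = {(a, b) \<in> verts A \<times> verts B. fv a = gv b},
     arcs = {(a, d) \<in> arcs A \<times> darts B. fd (a, True) = gd d},
     tail = (\<lambda>(a, d). (tail A a, org B d)),
     head = (\<lambda>(a, d). (head A a, ter B d))\<rparr>"

definition circuit_fibre_product ::
  "('v, 'e) pre_digraph \<Rightarrow> ('e \<times> bool) list \<Rightarrow> ('e \<times> bool) list \<Rightarrow>
   (nat \<times> nat, nat \<times> (nat \<times> bool)) pre_digraph" where
  "circuit_fibre_product X c c' =
    fibre_product (circle_graph (length c)) (circuit_vert X c) (circuit_dart c)
                  (circle_graph (length c')) (circuit_vert X c') (circuit_dart c')"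

definition represented_class ::
  "('v, 'e) pre_digraph \<Rightarrow> 'v \<Rightarrow> ('e \<times> bool) list \<Rightarrow> ('e \<times> bool) list set set" where
  "represented_class X x c =
    {path_class X x (q @ c @ rev (map flip q)) | q. edge_path X x q (org X (hd c))}"

section \<open>Free groups and outer automorphisms\<close>

definition words_over :: "'a set \<Rightarrow> ('a \<times> bool) list set" where
  "words_over B = {w. set w \<subseteq> B \<times> UNIV}"

definition word_val :: "('a, 'm) monoid_scheme \<Rightarrow> ('a \<times> bool) list \<Rightarrow> 'a" where
  "word_val G w =
    foldr (\<lambda>d g. (if snd d then fst d else inv\<^bsub>G\<^esub> (fst d)) \<otimes>\<^bsub>G\<^esub> g) w \<one>\<^bsub>G\<^esub>"

definition reduced_words :: "'a set \<Rightarrow> ('a \<times> bool) list set" where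
  "reduced_words B = {w \<in> words_over B. reduced w}"

definition free_basis :: "('a, 'm) monoid_scheme \<Rightarrow> 'a set \<Rightarrow> bool" where
  "free_basis G B \<longleftrightarrow> group G \<and> B \<subseteq> carrier G \<and>
    bij_betw (word_val G) (reduced_words B) (carrier G)"

definition free_group :: "('a, 'm) monoid_scheme \<Rightarrow> bool" where
  "free_group G \<longleftrightarrow> (\<exists>B. free_basis G B)"

definition free_of_rank :: "('a, 'm) monoid_scheme \<Rightarrow> nat \<Rightarrow> bool" where
  "free_of_rank G n \<longleftrightarrow> (\<exists>B. free_basis G B \<and> finite B \<and> card B = n)"

definition finite_rank_free :: "('a, 'm) monoid_scheme \<Rightarrow> bool" where
  "finite_rank_free G \<longleftrightarrow> (\<exists>n. free_of_rank G n)"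

definition Inn :: "('a, 'm) monoid_scheme \<Rightarrow> ('a \<Rightarrow> 'a) set" where
  "Inn F = (\<lambda>h. \<lambda>x\<in>carrier F. h \<otimes>\<^bsub>F\<^esub> x \<otimes>\<^bsub>F\<^esub> inv\<^bsub>F\<^esub> h) ` carrier F"

definition Out :: "('a, 'm) monoid_scheme \<Rightarrow> ('a \<Rightarrow> 'a) set monoid" where
  "Out F = AutoGroup F Mod Inn F"

definition conj_length :: "('a, 'm) monoid_scheme \<Rightarrow> 'a set \<Rightarrow> 'a \<Rightarrow> nat" where
  "conj_length F B g =
    (LEAST n. \<exists>h\<in>carrier F. \<exists>w\<in>words_over B.
      length w = n \<and> word_val F w = h \<otimes>\<^bsub>F\<^esub> g \<otimes>\<^bsub>F\<^esub> inv\<^bsub>F\<^esub> h)"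

text \<open>The conjugacy length of \<open>\<Phi>\<^sup>n(g)\<close> is bounded above and below by positive multiples of \<open>n\<^sup>d\<close>.\<close>

definition grows_like ::
  "('a, 'm) monoid_scheme \<Rightarrow> 'a set \<Rightarrow> ('a \<Rightarrow> 'a) set \<Rightarrow> 'a \<Rightarrow> nat \<Rightarrow> bool" where
  "grows_like F B \<Phi> g d \<longleftrightarrow>
    (\<exists>c C::real. c > 0 \<and> C > 0 \<and>
      (\<forall>n\<ge>1. \<forall>\<psi> \<in> \<Phi> [^]\<^bsub>Out F\<^esub> (n::nat).
        c * real n ^ d \<le> real (conj_length F B (\<psi> g)) \<and>
        real (conj_length F B (\<psi> g)) \<le> C * real n ^ d))"

definition linearly_growing :: "('a, 'm) monoid_scheme \<Rightarrow> ('a \<Rightarrow> 'a) set \<Rightarrow> bool" where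
  "linearly_growing F \<Phi> \<longleftrightarrow>
    (\<exists>B. finite B \<and> free_basis F B \<and>
      (\<forall>g\<in>carrier F - {\<one>\<^bsub>F\<^esub>}. \<exists>d\<le>1. grows_like F B \<Phi> g d) \<and>
      (\<exists>g\<in>carrier F - {\<one>\<^bsub>F\<^esub>}. grows_like F B \<Phi> g 1))"

definition exponent_sum :: "('a, 'm) monoid_scheme \<Rightarrow> 'a set \<Rightarrow> 'a \<Rightarrow> 'a \<Rightarrow> int" where
  "exponent_sum F B b g =
    (\<Sum>d\<leftarrow>the_inv_into (reduced_words B) (word_val F) g.
      if fst d = b then (if snd d then 1 else -1) else 0)"

text \<open>Matrix of the automorphism induced on the abelianisation, with respect to the basis \<open>bs\<close>.\<close>

definition abelianised_matrix :: "('a, 'm) monoid_scheme \<Rightarrow> 'a list \<Rightarrow> ('a \<Rightarrow> 'a) \<Rightarrow> int mat" where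
  "abelianised_matrix F bs \<phi> =
    mat (length bs) (length bs) (\<lambda>(i, j). exponent_sum F (set bs) (bs ! i) (\<phi> (bs ! j)))"

definition unipotent_mat :: "int mat \<Rightarrow> bool" where
  "unipotent_mat A \<longleftrightarrow> (\<exists>k. (A - 1\<^sub>m (dim_row A)) ^\<^sub>m k = 0\<^sub>m (dim_row A) (dim_row A))"

definition UPG :: "('a, 'm) monoid_scheme \<Rightarrow> ('a \<Rightarrow> 'a) set \<Rightarrow> bool" where
  "UPG F \<Phi> \<longleftrightarrow> linearly_growing F \<Phi> \<and>
    (\<exists>bs. distinct bs \<and> free_basis F (set bs) \<and>
      (\<forall>\<phi>\<in>\<Phi>. unipotent_mat (abelianised_matrix F bs \<phi>)))"

section \<open>Free-by-cyclic groups\<close>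

text \<open>The semidirect product with \<open>t = (\<one>, 1)\<close> and \<open>t f t\<^sup>-\<^sup>1 = \<phi> f\<close>; the pair \<open>(f, m)\<close> is \<open>f t\<^sup>m\<close>.\<close>

definition semidirect_Z :: "('a, 'm) monoid_scheme \<Rightarrow> ('a \<Rightarrow> 'a) \<Rightarrow> ('a \<times> int) monoid" where
  "semidirect_Z F \<phi> =
    \<lparr>carrier = carrier F \<times> UNIV,
     monoid.mult = (\<lambda>(f, m) (g, n). (f \<otimes>\<^bsub>F\<^esub> (\<phi> [^]\<^bsub>AutoGroup F\<^esub> (m::int)) g, m + n)),
     one = (\<one>\<^bsub>F\<^esub>, 0)\<rparr>"

definition fibre :: "('a, 'm) monoid_scheme \<Rightarrow> ('a \<times> int) set" where
  "fibre F = carrier F \<times> {0}"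

abbreviation sub :: "'g monoid \<Rightarrow> 'g set \<Rightarrow> 'g monoid" where
  "sub G H \<equiv> G\<lparr>carrier := H\<rparr>"

text \<open>Internal form: \<open>G\<close> is the semidirect product of its normal subgroup \<open>F\<close> and \<open>\<langle>t\<rangle> \<cong> \<int>\<close>.\<close>

definition free_by_cyclic :: "'g monoid \<Rightarrow> 'g set \<Rightarrow> 'g \<Rightarrow> bool" where
  "free_by_cyclic G F t \<longleftrightarrow> F \<lhd> G \<and> finite_rank_free (sub G F) \<and> t \<in> carrier G \<and>
    bij_betw (\<lambda>(f, n). f \<otimes>\<^bsub>G\<^esub> t [^]\<^bsub>G\<^esub> n) (F \<times> (UNIV :: int set)) (carrier G)"

definition monodromy :: "'g monoid \<Rightarrow> 'g set \<Rightarrow> 'g \<Rightarrow> ('g \<Rightarrow> 'g) set" where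
  "monodromy G F t =
    Inn (sub G F) #>\<^bsub>AutoGroup (sub G F)\<^esub> (\<lambda>x\<in>F. t \<otimes>\<^bsub>G\<^esub> x \<otimes>\<^bsub>G\<^esub> inv\<^bsub>G\<^esub> t)"

section \<open>Graphs of groups\<close>

record ('v, 'e, 'g) graph_of_groups = "('v, 'e) pre_digraph" +
  vgrp :: "'v \<Rightarrow> 'g monoid"
  egrp :: "'e \<Rightarrow> 'g monoid"
  tail_emb :: "'e \<Rightarrow> 'g \<Rightarrow> 'g"
  head_emb :: "'e \<Rightarrow> 'g \<Rightarrow> 'g"

definition wf_graph_of_groups :: "('v, 'e, 'g) graph_of_groups \<Rightarrow> bool" where
  "wf_graph_of_groups \<G> \<longleftrightarrow>
    wf_digraph (pre_digraph.truncate \<G>) \<and> connected (pre_digraph.truncate \<G>) \<and>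
    (\<forall>v\<in>verts \<G>. group (vgrp \<G> v)) \<and>
    (\<forall>e\<in>arcs \<G>. group (egrp \<G> e) \<and>
      tail_emb \<G> e \<in> mon (egrp \<G> e) (vgrp \<G> (tail \<G> e)) \<and>
      head_emb \<G> e \<in> mon (egrp \<G> e) (vgrp \<G> (head \<G> e)))"

text \<open>
  The fundamental group of a graph of groups at \<open>v\<close> consists of the loops at \<open>v\<close> in the path group,
  i.e. words \<open>g\<^sub>0 d\<^sub>1 g\<^sub>1 \<dots> d\<^sub>n g\<^sub>n\<close> of vertex group elements and darts, modulo the relations below.
\<close>

datatype ('v, 'e, 'g) gog_letter = Grp 'v 'g | Dart 'e bool

definition gog_letters :: "('v, 'e, 'g) graph_of_groups \<Rightarrow> ('v, 'e, 'g) gog_letter set" where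
  "gog_letters \<G> = {Grp v g | v g. v \<in> verts \<G> \<and> g \<in> carrier (vgrp \<G> v)} \<union>
                   {Dart e b | e b. e \<in> arcs \<G>}"

fun gog_org :: "('v, 'e, 'g) graph_of_groups \<Rightarrow> ('v, 'e, 'g) gog_letter \<Rightarrow> 'v" where
  "gog_org \<G> (Grp v g) = v"
| "gog_org \<G> (Dart e b) = (if b then tail \<G> e else head \<G> e)"

fun gog_ter :: "('v, 'e, 'g) graph_of_groups \<Rightarrow> ('v, 'e, 'g) gog_letter \<Rightarrow> 'v" where
  "gog_ter \<G> (Grp v g) = v"
| "gog_ter \<G> (Dart e b) = (if b then head \<G> e else tail \<G> e)"

definition gog_loops ::
  "('v, 'e, 'g) graph_of_groups \<Rightarrow> 'v \<Rightarrow> ('v, 'e, 'g) gog_letter list set" where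
  "gog_loops \<G> v = {w. walk (gog_letters \<G>) (gog_org \<G>) (gog_ter \<G>) v w v}"

inductive_set gog_relations ::
  "('v, 'e, 'g) graph_of_groups \<Rightarrow>
   (('v, 'e, 'g) gog_letter list \<times> ('v, 'e, 'g) gog_letter list) set"
  for \<G> :: "('v, 'e, 'g) graph_of_groups" where
  unit: "v \<in> verts \<G> \<Longrightarrow> ([Grp v \<one>\<^bsub>vgrp \<G> v\<^esub>], []) \<in> gog_relations \<G>"
| product: "\<lbrakk>v \<in> verts \<G>; g \<in> carrier (vgrp \<G> v); h \<in> carrier (vgrp \<G> v)\<rbrakk> \<Longrightarrow>
    ([Grp v g, Grp v h], [Grp v (g \<otimes>\<^bsub>vgrp \<G> v\<^esub> h)]) \<in> gog_relations \<G>"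
| cancel: "e \<in> arcs \<G> \<Longrightarrow> ([Dart e b, Dart e (\<not> b)], []) \<in> gog_relations \<G>"
| edge: "\<lbrakk>e \<in> arcs \<G>; c \<in> carrier (egrp \<G> e)\<rbrakk> \<Longrightarrow>
    ([Dart e True, Grp (head \<G> e) (head_emb \<G> e c), Dart e False],
     [Grp (tail \<G> e) (tail_emb \<G> e c)]) \<in> gog_relations \<G>"

definition gog_pi1 ::
  "('v, 'e, 'g) graph_of_groups \<Rightarrow> 'v \<Rightarrow> ('v, 'e, 'g) gog_letter list set monoid" where
  "gog_pi1 \<G> v = loop_group (gog_loops \<G> v) (gog_relations \<G>)"

fun letter_val :: "'g monoid \<Rightarrow> ('e \<Rightarrow> 'g) \<Rightarrow> ('v, 'e, 'g) gog_letter \<Rightarrow> 'g" where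
  "letter_val G s (Grp v g) = g"
| "letter_val G s (Dart e b) = (if b then s e else inv\<^bsub>G\<^esub> (s e))"

definition gog_val :: "'g monoid \<Rightarrow> ('e \<Rightarrow> 'g) \<Rightarrow> ('v, 'e, 'g) gog_letter list \<Rightarrow> 'g" where
  "gog_val G s w = foldr (\<lambda>x g. letter_val G s x \<otimes>\<^bsub>G\<^esub> g) w \<one>\<^bsub>G\<^esub>"

text \<open>
  \<open>G\<close> splits as the graph of groups \<open>\<G>\<close>.  The vertex groups are embedded in the fundamental group
  once paths from the base point have been chosen, so they are taken to be subgroups of \<open>G\<close>; the
  elements \<open>s e\<close> realise the edges, and evaluation is required to identify the fundamental group
  with \<open>G\<close>.
\<close>

definition splits_as :: "'g monoid \<Rightarrow> ('v, 'e, 'g) graph_of_groups \<Rightarrow> ('e \<Rightarrow> 'g) \<Rightarrow> bool" where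
  "splits_as G \<G> s \<longleftrightarrow> wf_graph_of_groups \<G> \<and>
    (\<forall>v\<in>verts \<G>. subgroup (carrier (vgrp \<G> v)) G \<and> vgrp \<G> v = sub G (carrier (vgrp \<G> v))) \<and>
    (\<forall>e\<in>arcs \<G>. s e \<in> carrier G \<and>
      (\<forall>c\<in>carrier (egrp \<G> e).
        s e \<otimes>\<^bsub>G\<^esub> head_emb \<G> e c \<otimes>\<^bsub>G\<^esub> inv\<^bsub>G\<^esub> (s e) = tail_emb \<G> e c)) \<and>
    (\<forall>v\<in>verts \<G>. (\<lambda>A. the_elem (gog_val G s ` A)) \<in> iso (gog_pi1 \<G> v) G)"

subsection \<open>The Bass--Serre tree\<close>

text \<open>
  The edge \<open>g A\<^sub>e\<close>, where \<open>A\<^sub>e\<close> is the image of the edge group in the tail vertex group, joins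
  \<open>g G\<^bsub>tail e\<^esub>\<close> to \<open>g s\<^sub>e G\<^bsub>head e\<^esub>\<close>.  An element \<open>g\<close> of \<open>G\<close> acts by \<open>(x, C) \<mapsto> (x, g C)\<close>.
\<close>

definition Bass_Serre_tree ::
  "'g monoid \<Rightarrow> ('v, 'e, 'g) graph_of_groups \<Rightarrow> ('e \<Rightarrow> 'g) \<Rightarrow> ('v \<times> 'g set, 'e \<times> 'g set) pre_digraph"
  where
  "Bass_Serre_tree G \<G> s =
    \<lparr>verts = {(v, C). v \<in> verts \<G> \<and> C \<in> lcosets\<^bsub>G\<^esub> (carrier (vgrp \<G> v))},
     arcs = {(e, C). e \<in> arcs \<G> \<and> C \<in> lcosets\<^bsub>G\<^esub> (tail_emb \<G> e ` carrier (egrp \<G> e))},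
     tail = (\<lambda>(e, C). (tail \<G> e, C <#>\<^bsub>G\<^esub> carrier (vgrp \<G> (tail \<G> e)))),
     head = (\<lambda>(e, C). (head \<G> e, (C #>\<^bsub>G\<^esub> s e) <#>\<^bsub>G\<^esub> carrier (vgrp \<G> (head \<G> e))))\<rparr>"

definition coset_stabiliser :: "'g monoid \<Rightarrow> 'x \<times> 'g set \<Rightarrow> 'g set" where
  "coset_stabiliser G x = {g \<in> carrier G. g <#\<^bsub>G\<^esub> snd x = snd x}"

text \<open>
  Sela's convention: only segments of length greater than \<open>n\<close> are required to have trivial
  pointwise stabiliser.
\<close>

definition acylindrical :: "'g monoid \<Rightarrow> ('v \<times> 'g set, 'e \<times> 'g set) pre_digraph \<Rightarrow> nat \<Rightarrow> bool" where
  "acylindrical G T n \<longleftrightarrow>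
    (\<forall>x\<in>verts T. \<forall>w y. edge_path T x w y \<and> reduced w \<and> length w > n \<longrightarrow>
      (\<forall>g\<in>carrier G. (\<forall>d\<in>set w. g \<in> coset_stabiliser G (fst d)) \<longrightarrow> g = \<one>\<^bsub>G\<^esub>))"

section \<open>The torus splitting\<close>

definition internal_direct_product :: "'g monoid \<Rightarrow> 'g set \<Rightarrow> 'g set \<Rightarrow> 'g set \<Rightarrow> bool" where
  "internal_direct_product G A B H \<longleftrightarrow> subgroup A G \<and> subgroup B G \<and> subgroup H G \<and>
    (\<lambda>(a, b). a \<otimes>\<^bsub>G\<^esub> b) \<in> iso (sub G A \<times>\<times> sub G B) (sub G H)"

definition maximal_subgroup_with :: "('g set \<Rightarrow> bool) \<Rightarrow> 'g monoid \<Rightarrow> 'g set \<Rightarrow> bool" where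
  "maximal_subgroup_with P G H \<longleftrightarrow> subgroup H G \<and> P H \<and>
    (\<forall>K. subgroup K G \<and> P K \<and> H \<subseteq> K \<longrightarrow> K = H)"

definition is_Z2 :: "'g monoid \<Rightarrow> 'g set \<Rightarrow> bool" where
  "is_Z2 G H \<longleftrightarrow> sub G H \<cong> integer_group \<times>\<times> integer_group"

definition is_free_times_Z :: "'g monoid \<Rightarrow> 'g set \<Rightarrow> bool" where
  "is_free_times_Z G H \<longleftrightarrow>
    (\<exists>A. subgroup A G \<and> free_group (sub G A) \<and> sub G H \<cong> sub G A \<times>\<times> integer_group)"

definition is_cyclic :: "'g monoid \<Rightarrow> 'g set \<Rightarrow> bool" where
  "is_cyclic G H \<longleftrightarrow> (\<exists>c\<in>carrier G. H = generate G {c})"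

definition centre_of :: "'g monoid \<Rightarrow> 'g set \<Rightarrow> 'g set" where
  "centre_of G H = {z \<in> H. \<forall>g\<in>H. z \<otimes>\<^bsub>G\<^esub> g = g \<otimes>\<^bsub>G\<^esub> z}"

text \<open>
  Data of a torus splitting over the bipartite graph \<open>\<Delta>\<close>, whose arcs run from black (tail) to white
  (head) vertices.  \<open>VG\<close>, \<open>VF\<close>, \<open>EG\<close> are the groups \<open>G\<^sub>v\<close>, \<open>F\<^sub>v\<close>, \<open>G\<^sub>e\<close>; \<open>rv\<close> gives the generators
  \<open>r\<^sub>v\<close> of the black \<open>F\<^sub>v\<close>; \<open>embB\<close>, \<open>embW\<close> are the edge maps to the black and white vertex groups;
  \<open>stab e\<close> is the element of \<open>F\<close> realising the edge \<open>e\<close>.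
\<close>

record ('v, 'e, 'g) torus_splitting =
  \<Delta> :: "('v, 'e) pre_digraph"
  black :: "'v set"
  white :: "'v set"
  VG :: "'v \<Rightarrow> 'g set"
  VF :: "'v \<Rightarrow> 'g set"
  tv :: "'v \<Rightarrow> 'g"
  rv :: "'v \<Rightarrow> 'g"
  EG :: "'e \<Rightarrow> 'g set"
  re :: "'e \<Rightarrow> 'g"
  te :: "'e \<Rightarrow> 'g"
  embB :: "'e \<Rightarrow> 'g \<Rightarrow> 'g"
  embW :: "'e \<Rightarrow> 'g \<Rightarrow> 'g"
  pe :: "'e \<Rightarrow> 'g"
  ke :: "'e \<Rightarrow> int"
  stab :: "'e \<Rightarrow> 'g"

definition EF :: "'g monoid \<Rightarrow> ('v, 'e, 'g) torus_splitting \<Rightarrow> 'e \<Rightarrow> 'g set" where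
  "EF G S e = generate G {re S e}"

definition gog_G :: "'g monoid \<Rightarrow> ('v, 'e, 'g) torus_splitting \<Rightarrow> ('v, 'e, 'g) graph_of_groups" where
  "gog_G G S =
    \<lparr>verts = verts (\<Delta> S), arcs = arcs (\<Delta> S), tail = tail (\<Delta> S), head = head (\<Delta> S),
     vgrp = (\<lambda>v. sub G (VG S v)), egrp = (\<lambda>e. sub G (EG S e)),
     tail_emb = embB S, head_emb = embW S\<rparr>"

definition gog_F :: "'g monoid \<Rightarrow> ('v, 'e, 'g) torus_splitting \<Rightarrow> ('v, 'e, 'g) graph_of_groups" where
  "gog_F G S =
    \<lparr>verts = verts (\<Delta> S), arcs = arcs (\<Delta> S), tail = tail (\<Delta> S), head = head (\<Delta> S),
     vgrp = (\<lambda>v. sub G (VF S v)), egrp = (\<lambda>e. sub G (EF G S e)),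
     tail_emb = embB S, head_emb = embW S\<rparr>"

definition edges_at_black :: "('v, 'e, 'g) torus_splitting \<Rightarrow> 'v \<Rightarrow> 'e set" where
  "edges_at_black S b = {e \<in> arcs (\<Delta> S). tail (\<Delta> S) e = b}"

definition edges_at_white :: "('v, 'e, 'g) torus_splitting \<Rightarrow> 'v \<Rightarrow> 'e set" where
  "edges_at_white S w = {e \<in> arcs (\<Delta> S). head (\<Delta> S) e = w}"

definition torus_graph :: "('v, 'e, 'g) torus_splitting \<Rightarrow> bool" where
  "torus_graph S \<longleftrightarrow> fin_digraph (\<Delta> S) \<and> connected (\<Delta> S) \<and>
    verts (\<Delta> S) = black S \<union> white S \<and> black S \<inter> white S = {} \<and>
    (\<forall>e\<in>arcs (\<Delta> S). tail (\<Delta> S) e \<in> black S \<and> head (\<Delta> S) e \<in> white S) \<and>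
    (\<forall>b\<in>black S. card (edges_at_black S b) \<noteq> 1)"

definition torus_vertex_groups ::
  "'g monoid \<Rightarrow> 'g set \<Rightarrow> 'g \<Rightarrow> ('v, 'e, 'g) torus_splitting \<Rightarrow> bool" where
  "torus_vertex_groups G F t S \<longleftrightarrow>
    (\<forall>v\<in>verts (\<Delta> S). VF S v \<subseteq> F \<and> finite_rank_free (sub G (VF S v)) \<and>
      tv S v \<in> F #>\<^bsub>G\<^esub> t \<and>
      internal_direct_product G (VF S v) (generate G {tv S v}) (VG S v)) \<and>
    (\<forall>v\<in>black S. free_of_rank (sub G (VF S v)) 1 \<and>
      maximal_subgroup_with (is_Z2 G) G (VG S v)) \<and>
    (\<forall>v\<in>white S. (\<exists>n\<ge>2. free_of_rank (sub G (VF S v)) n) \<and>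
      maximal_subgroup_with (is_free_times_Z G) G (VG S v)) \<and>
    inj_on (tv S) (white S)"

definition torus_edge_groups ::
  "'g monoid \<Rightarrow> 'g set \<Rightarrow> ('v, 'e, 'g) torus_splitting \<Rightarrow> bool" where
  "torus_edge_groups G F S \<longleftrightarrow>
    (\<forall>b\<in>black S. rv S b \<in> VF S b \<and> generate G {rv S b} = VF S b) \<and>
    (\<forall>e\<in>arcs (\<Delta> S). let b = tail (\<Delta> S) e; w = head (\<Delta> S) e in
      re S e \<in> F \<and> te S e \<in> carrier G \<and>
      (\<forall>x\<in>F. EF G S e \<subseteq> generate G {x} \<longrightarrow> generate G {x} = EF G S e) \<and>
      internal_direct_product G (EF G S e) (generate G {te S e}) (EG S e) \<and>
      embB S e \<in> iso (sub G (EG S e)) (sub G (VG S b)) \<and>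
      embB S e (re S e) = rv S b \<and> embB S e (te S e) = tv S b \<and>
      embW S e \<in> mon (sub G (EG S e)) (sub G (VG S w)) \<and>
      pe S e \<in> VF S w \<and>
      embW S e (re S e) = pe S e \<and>
      embW S e (te S e) = pe S e [^]\<^bsub>G\<^esub> ke S e \<otimes>\<^bsub>G\<^esub> tv S w)"

definition torus_splitting_of ::
  "'g monoid \<Rightarrow> 'g set \<Rightarrow> 'g \<Rightarrow> ('v, 'e, 'g) torus_splitting \<Rightarrow> bool" where
  "torus_splitting_of G F t S \<longleftrightarrow>
    torus_graph S \<and> torus_vertex_groups G F t S \<and> torus_edge_groups G F S \<and>
    splits_as G (gog_G G S) (stab S) \<and> splits_as (sub G F) (gog_F G S) (stab S) \<and>
    (\<forall>e\<in>arcs (\<Delta> S).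
      centre_of G (VG S (tail (\<Delta> S) e)) \<subseteq> embB S e ` EG S e \<and>
      centre_of G (VG S (head (\<Delta> S) e)) \<subseteq> embW S e ` EG S e) \<and>
    (\<forall>e\<in>arcs (\<Delta> S). \<forall>e'\<in>arcs (\<Delta> S).
      tail (\<Delta> S) e = tail (\<Delta> S) e' \<and> e \<noteq> e' \<longrightarrow> ke S e \<noteq> ke S e') \<and>
    (let T = Bass_Serre_tree G (gog_G G S) (stab S) in
      acylindrical G T 4 \<and>
      (\<forall>a\<in>arcs T. \<forall>a'\<in>arcs T. head T a = head T a' \<and> tail T a \<noteq> tail T a' \<longrightarrow>
        is_cyclic G (coset_stabiliser G (tail T a) \<inter> coset_stabiliser G (tail T a'))))"

section \<open>The graph of spaces\<close>

text \<open>
  \<open>circ e\<close> is the circuit \<open>p\<^sub>e\<close> along which the cylinder of \<open>e\<close> is attached to the white vertex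
  graph.  Its domain is identified with the circle \<open>X\<^bsub>tail e\<^esub>\<close> only up to subdivision, so their
  lengths are unrelated.  \<open>ident v\<close> identifies \<open>\<pi>\<^sub>1(X\<^sub>v, x\<^sub>v)\<close> with \<open>F\<^sub>v\<close>.
\<close>

record ('v, 'e, 'g) graph_of_spaces =
  X :: "'v \<Rightarrow> (nat, nat) pre_digraph"
  bp :: "'v \<Rightarrow> nat"
  ident :: "'v \<Rightarrow> (nat \<times> bool) list set \<Rightarrow> 'g"
  circ :: "'e \<Rightarrow> (nat \<times> bool) list"

text \<open>
  Effect of the Dehn twist \<open>\<phi> : Y \<rightarrow> Y\<close> on the fundamental groupoid: vertex spaces are fixed, and a
  path crossing the \<open>e\<close>-cylinder towards the white side picks up \<open>p\<^sub>e\<^bsup>k(e)\<^esup>\<close>.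
\<close>

fun twist_letter ::
  "'g monoid \<Rightarrow> ('v, 'e, 'g) torus_splitting \<Rightarrow> ('v, 'e, 'g) gog_letter \<Rightarrow> ('v, 'e, 'g) gog_letter list"
  where
  "twist_letter G S (Grp v g) = [Grp v g]"
| "twist_letter G S (Dart e b) =
    (if b then [Dart e True, Grp (head (\<Delta> S) e) (pe S e [^]\<^bsub>G\<^esub> ke S e)]
     else [Grp (head (\<Delta> S) e) (pe S e [^]\<^bsub>G\<^esub> (- ke S e)), Dart e False])"

definition dehn_twist ::
  "'g monoid \<Rightarrow> ('v, 'e, 'g) torus_splitting \<Rightarrow>
   ('v, 'e, 'g) gog_letter list \<Rightarrow> ('v, 'e, 'g) gog_letter list" where
  "dehn_twist G S w = concat (map (twist_letter G S) w)"

definition graph_of_spaces_for ::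
  "'g monoid \<Rightarrow> 'g set \<Rightarrow> 'g \<Rightarrow> ('v, 'e, 'g) torus_splitting \<Rightarrow> ('v, 'e, 'g) graph_of_spaces \<Rightarrow> bool"
  where
  "graph_of_spaces_for G F t S Y \<longleftrightarrow>
    (\<forall>v\<in>verts (\<Delta> S). fin_digraph (X Y v) \<and> connected (X Y v) \<and> bp Y v \<in> verts (X Y v) \<and>
      ident Y v \<in> iso (graph_pi1 (X Y v) (bp Y v)) (sub G (VF S v))) \<and>
    (\<forall>b\<in>black S. \<exists>n\<ge>1. X Y b = circle_graph n \<and> bp Y b = 0 \<and>
      ident Y b (path_class (X Y b) 0 (map (\<lambda>i. (i, True)) [0..<n])) = rv S b) \<and>
    (\<forall>e\<in>arcs (\<Delta> S). let w = head (\<Delta> S) e in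
      immersed_circuit (X Y w) (circ Y e) \<and>
      ident Y w ` represented_class (X Y w) (bp Y w) (circ Y e) =
        {f \<otimes>\<^bsub>G\<^esub> pe S e \<otimes>\<^bsub>G\<^esub> inv\<^bsub>G\<^esub> f | f. f \<in> VF S w}) \<and>
    (\<forall>w\<in>white S. \<forall>e\<in>edges_at_white S w. \<forall>e'\<in>edges_at_white S w. e \<noteq> e' \<longrightarrow>
      contractible_components (circuit_fibre_product (X Y w) (circ Y e) (circ Y e'))) \<and>
    (\<forall>v\<in>verts (\<Delta> S). \<exists>\<phi>\<in>monodromy G F t. \<forall>u\<in>gog_loops (gog_F G S) v.
      \<phi> (gog_val G (stab S) u) = gog_val G (stab S) (dehn_twist G S u))"

definition P_clean :: "('v, 'e, 'g) torus_splitting \<Rightarrow> ('v, 'e, 'g) graph_of_spaces \<Rightarrow> bool" where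
  "P_clean S Y \<longleftrightarrow> (\<forall>e\<in>arcs (\<Delta> S). embedded_circuit (X Y (head (\<Delta> S) e)) (circ Y e))"

definition starred :: "('v, 'e, 'g) torus_splitting \<Rightarrow> bool" where
  "starred S \<longleftrightarrow> \<not> (\<exists>e\<in>arcs (\<Delta> S). \<exists>e'\<in>arcs (\<Delta> S). e \<noteq> e' \<and>
    tail (\<Delta> S) e = tail (\<Delta> S) e' \<and> head (\<Delta> S) e = head (\<Delta> S) e')"

section \<open>Edge measurements\<close>

record ('v, 'e) edge_measurements =
  J :: "'v \<Rightarrow> nat set"
  block :: "'v \<Rightarrow> nat \<Rightarrow> 'e set"
  meas :: "'v \<Rightarrow> nat \<Rightarrow> (nat \<times> bool) list set \<Rightarrow> int"

abbreviation circ_class ::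
  "('v, 'e, 'g) graph_of_spaces \<Rightarrow> 'v \<Rightarrow> 'e \<Rightarrow> (nat \<times> bool) list set set" where
  "circ_class Y w e \<equiv> represented_class (X Y w) (bp Y w) (circ Y e)"

definition edge_partition ::
  "('v, 'e, 'g) torus_splitting \<Rightarrow> ('v, 'e) edge_measurements \<Rightarrow> bool" where
  "edge_partition S M \<longleftrightarrow>
    disjoint_family_on (J M) (white S) \<and>
    (\<forall>w\<in>white S. disjoint_family_on (block M w) (J M w) \<and> (\<forall>i\<in>J M w. block M w i \<noteq> {}) \<and>
      (\<Union>i\<in>J M w. block M w i) = edges_at_white S w)"

definition edge_measurements_for ::
  "('v, 'e, 'g) torus_splitting \<Rightarrow> ('v, 'e, 'g) graph_of_spaces \<Rightarrow> ('v, 'e) edge_measurements \<Rightarrow> bool"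
  where
  "edge_measurements_for S Y M \<longleftrightarrow> edge_partition S M \<and>
    (\<forall>w\<in>white S. \<forall>i\<in>J M w.
      (\<forall>e\<in>block M w i. \<forall>e'\<in>block M w i. ke S e = ke S e' \<and>
        (\<exists>\<beta>. bij_betw \<beta> (edges_at_black S (tail (\<Delta> S) e)) (edges_at_black S (tail (\<Delta> S) e')) \<and>
          (\<forall>f\<in>edges_at_black S (tail (\<Delta> S) e). ke S f = ke S (\<beta> f)))) \<and>
      meas M w i \<in> hom (graph_pi1 (X Y w) (bp Y w)) integer_group \<and>
      (\<forall>e\<in>block M w i. \<forall>g\<in>circ_class Y w e. meas M w i g \<noteq> 0) \<and>
      (\<forall>f\<in>edges_at_white S w - block M w i. \<forall>g\<in>circ_class Y w f. meas M w i g = 0))"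

definition good_edge_measurements ::
  "('v, 'e, 'g) torus_splitting \<Rightarrow> ('v, 'e, 'g) graph_of_spaces \<Rightarrow> ('v, 'e) edge_measurements \<Rightarrow> bool"
  where
  "good_edge_measurements S Y M \<longleftrightarrow>
    (\<forall>w\<in>white S. \<forall>i\<in>J M w. \<exists>K\<noteq>0. \<forall>e\<in>block M w i. \<forall>g\<in>circ_class Y w e. meas M w i g = K)"

text \<open>
  Naturals suffice as names of the vertices and edges of the finite graph \<open>\<Delta>\<close> and of the finite
  graphs \<open>X\<^sub>v\<close>, and as indices of the partitions.
\<close>

definition has_good_edge_measurements :: "'g monoid \<Rightarrow> 'g set \<Rightarrow> 'g \<Rightarrow> bool" where
  "has_good_edge_measurements G F t \<longleftrightarrow>
    UPG (sub G F) (monodromy G F t) \<and>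
    (\<exists>(S :: (nat, nat, 'g) torus_splitting) Y M.
      torus_splitting_of G F t S \<and> graph_of_spaces_for G F t S Y \<and>
      P_clean S Y \<and> starred S \<and>
      edge_measurements_for S Y M \<and> good_edge_measurements S Y M)"

text \<open>The finite-index subgroup \<open>H\<close> is \<open>(H \<inter> F) \<rtimes> \<langle>t\<rangle>\<close> for a suitable \<open>t \<in> H\<close>.\<close>

definition virtually_has_good_edge_measurements :: "'g monoid \<Rightarrow> 'g set \<Rightarrow> bool" where
  "virtually_has_good_edge_measurements G F \<longleftrightarrow>
    (\<exists>H t. subgroup H G \<and> finite (rcosets\<^bsub>G\<^esub> H) \<and>
      free_by_cyclic (sub G H) (H \<inter> F) t \<and>
      has_good_edge_measurements (sub G H) (H \<inter> F) t)"

section \<open>CAT(0) cube complexes\<close>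

text \<open>
  A cube complex is represented by the collection of the vertex sets of its cubes.  A chart
  identifies the vertices of an \<open>n\<close>-cube with the subsets of \<open>{..<n}\<close>, and faces with the intervals
  \<open>{A..B}\<close> of subsets.  Cubes are embedded and meet in common faces or not at all; this loses nothing
  here, as every CAT(0) cube complex has these properties.
\<close>

definition cubical_complex :: "'x set set \<Rightarrow> bool" where
  "cubical_complex \<C> \<longleftrightarrow>
    (\<forall>C\<in>\<C>. \<exists>n \<chi>. bij_betw \<chi> (Pow {..<n::nat}) C \<and>
      {D \<in> \<C>. D \<subseteq> C} = {\<chi> ` {A..B} | A B. A \<subseteq> B \<and> B \<subseteq> {..<n}}) \<and>
    (\<forall>C\<in>\<C>. \<forall>D\<in>\<C>. C \<inter> D = {} \<or> C \<inter> D \<in> \<C>)"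

definition adjacent :: "'x set set \<Rightarrow> 'x \<Rightarrow> 'x \<Rightarrow> bool" where
  "adjacent \<C> u v \<longleftrightarrow> u \<noteq> v \<and> {u, v} \<in> \<C>"

definition link :: "'x set set \<Rightarrow> 'x \<Rightarrow> 'x set set" where
  "link \<C> v = {{u \<in> C. adjacent \<C> v u} | C. C \<in> \<C> \<and> v \<in> C}"

definition flag :: "'x set set \<Rightarrow> bool" where
  "flag K \<longleftrightarrow> (\<forall>\<sigma>. finite \<sigma> \<and> (\<forall>a\<in>\<sigma>. \<forall>b\<in>\<sigma>. {a, b} \<in> K) \<longrightarrow> \<sigma> \<in> K)"

definition nonpositively_curved :: "'x set set \<Rightarrow> bool" where
  "nonpositively_curved \<C> \<longleftrightarrow> (\<forall>v\<in>\<Union>\<C>. flag (link \<C> v))"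

text \<open>Edge paths are lists of ordered pairs of adjacent vertices.\<close>

abbreviation cc_path :: "'x set set \<Rightarrow> 'x \<Rightarrow> ('x \<times> 'x) list \<Rightarrow> 'x \<Rightarrow> bool" where
  "cc_path \<C> \<equiv> walk {(u, v). adjacent \<C> u v} fst snd"

definition cc_relations :: "'x set set \<Rightarrow> (('x \<times> 'x) list \<times> ('x \<times> 'x) list) set" where
  "cc_relations \<C> =
    {([(u, v), (v, u)], []) | u v. adjacent \<C> u v} \<union>
    {([(a, b), (b, c)], [(a, d), (d, c)]) | a b c d.
      {a, b, c, d} \<in> \<C> \<and> card {a, b, c, d} = 4 \<and>
      adjacent \<C> a b \<and> adjacent \<C> b c \<and> adjacent \<C> a d \<and> adjacent \<C> d c}"

definition simply_connected_cc :: "'x set set \<Rightarrow> bool" where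
  "simply_connected_cc \<C> \<longleftrightarrow> \<Union>\<C> \<noteq> {} \<and>
    (\<forall>u\<in>\<Union>\<C>. \<forall>v\<in>\<Union>\<C>. \<exists>w. cc_path \<C> u w v) \<and>
    (\<forall>u\<in>\<Union>\<C>. \<forall>w. cc_path \<C> u w u \<longrightarrow>
      homotopic_in {w. cc_path \<C> u w u} (cc_relations \<C>) w [])"

text \<open>
  The usual combinatorial definition, without any restriction on dimension or local finiteness
  (Gromov's link condition; Leary in infinite dimensions).
\<close>

definition CAT0_cube_complex :: "'x set set \<Rightarrow> bool" where
  "CAT0_cube_complex \<C> \<longleftrightarrow> cubical_complex \<C> \<and> nonpositively_curved \<C> \<and> simply_connected_cc \<C>"

text \<open>
  Actions are by cubical automorphisms.  Such an automorphism fixes a point of the complex iff it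
  preserves the cube containing that point in its interior (it then fixes the barycentre), so an
  action is free iff no nontrivial element preserves a cube.
\<close>

definition acts_freely_on_cube_complex ::
  "('g, 'm) monoid_scheme \<Rightarrow> ('g \<Rightarrow> 'x \<Rightarrow> 'x) \<Rightarrow> 'x set set \<Rightarrow> bool" where
  "acts_freely_on_cube_complex G \<rho> \<C> \<longleftrightarrow>
    group_action G (\<Union>\<C>) \<rho> \<and>
    (\<forall>g\<in>carrier G. \<forall>C\<in>\<C>. \<rho> g ` C \<in> \<C>) \<and>
    (\<forall>g\<in>carrier G - {\<one>\<^bsub>G\<^esub>}. \<forall>C\<in>\<C>. \<rho> g ` C \<noteq> C)"

text \<open>
  The statement needs some type for the vertices of the complex.  A group acting freely on some
  CAT(0) cube complex acts freely on the convex hull of an orbit, which has countably many vertices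
  when the group is countable, so sets of sets of group elements suffice.
\<close>

definition acts_freely_on_CAT0_cube_complex :: "('g, 'm) monoid_scheme \<Rightarrow> bool" where
  "acts_freely_on_CAT0_cube_complex G \<longleftrightarrow>
    (\<exists>(\<C> :: 'g set set set set) \<rho>. CAT0_cube_complex \<C> \<and> acts_freely_on_cube_complex G \<rho> \<C>)"

end

theory Submission
  imports Defs "HOL-Library.Countable_Set"
begin

text \<open>
  If a group acts on the finite subsets of a set \<open>Z\<close> by maps \<open>B \<mapsto> \<pi> ` B \<triangle> D\<close>, with permutations \<open>\<pi>\<close> and
  finite sets \<open>D\<close>, then it acts on the cube complex with these subsets as vertices, a cube of possibly infinite
  dimension, which is CAT(0).  The elements of \<open>Z\<close> play the part of walls, and \<open>D\<close> is the set of walls that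
  separate the vertex \<open>{}\<close> from its image.  If the powers of every nontrivial element move \<open>{}\<close> across an
  unbounded number of walls, no cube is preserved, so the action is free (\<open>acts_freely_of_wall_action\<close>).
  Such actions can be added and can be induced from subgroups of finite index, and \<open>G\<close> is torsion-free.  It
  therefore suffices to find, for a subgroup of finite index with a torus splitting, finitely many actions
  such that every nontrivial element escapes in one of them, in this sense.

  By the universal property of the splitting, an action is given by affine maps for the elements of the vertex
  groups and for the edges of \<open>\<Delta>\<close>, subject to the relations of the path group (\<open>compatible_iff\<close>).  Four
  families of walls are used.

  The edges of the Bass--Serre tree take care of all elements that are not conjugate into a vertex group
  (\<open>elliptic_or_escapes\<close>).  The points of the line, translated by the exponent of \<open>t\<close>, take care
  of all elements outside the fibre \<open>F\<close>.  There remain the elements of the groups \<open>F\<^sub>v\<close>.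

  The horizontal walls are the pieces of surfaces that are transverse to the flow in the mapping torus.
  Let \<open>\<kappa>\<close> exceed all \<open>\<bar>k(e)\<bar>\<close>.  Every black torus carries two families of parallel lines, on which \<open>r\<^sup>x t\<^sup>y\<close> acts as the
  translation by \<open>R(\<plusminus>x + \<kappa>y)\<close>.  Seen from the white vertex at the other end of an edge \<open>e\<close>, where \<open>t\<close> is replaced by
  \<open>p\<^sup>k t\<close>, the two families are cut into \<open>\<kappa> + k\<close> and \<open>\<kappa> - k\<close> sheets, and such an interleaving turns the translation
  into one by a function that is \<open>R\<close> on \<open>t\<close> and \<open>-R/(\<kappa> + k)\<close> or \<open>R/(\<kappa> - k)\<close> on \<open>p\<^sub>e\<close> (\<open>sheet_map_line_shift\<close>,
  \<open>sheet_height_edge\<close>).  The number \<open>2\<kappa>\<close> of sheets is the same for all edges, so they can be continued over the white vertex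
  as soon as there are homomorphisms \<open>F\<^sub>w \<rightarrow> \<int>\<close> with these values on all \<open>p\<^sub>e\<close> at once.  They exist because the
  measurement for a block has the same nonzero value on all \<open>p\<^sub>e\<close> of the block, on which \<open>k\<close> is constant, and
  vanishes on the others (\<open>scaled_measurements\<close>).  The horizontal walls take care of the black groups \<open>F\<^sub>b\<close>
  and of all elements of \<open>F\<^sub>w\<close> with a power conjugate to a nontrivial power of some \<open>p\<^sub>e\<close>.

  The vertical walls take care of the other elements of \<open>F\<^sub>w\<close>.  They come from the Cayley tree of \<open>F\<^sub>w\<close>.  The edges of
  the tree are walls for \<open>F\<^sub>w\<close>, but to pass to the neighbouring vertex groups, the number of walls crossed by the
  powers of \<open>p\<^sub>e\<close> must be bounded.  So an edge on the axis of a conjugate of some \<open>p\<^sub>e\<close> also crosses the wall of its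
  translate by \<open>K\<close> periods back along this axis, for a large \<open>K\<close>, where these translates for all axes through the edge are given
  the same wall.  The walls along an axis then come in two copies, shifted by \<open>K\<close> periods, so that the walls crossed by \<open>p\<^sub>e\<close> form a
  coboundary (\<open>cocycle_axis\<close>).  As the axes of different conjugates overlap in bounded segments
  (\<open>commensurable_edge_conjugates\<close>, \<open>product_of_long_powers\<close>), the axis of an element that is not
  commensurable to any \<open>p\<^sub>e\<close> has an edge in each period that follows none of these axes for long, and the wall of this
  edge crosses it only once (\<open>clear_isolated\<close>, \<open>cocycle_unbounded\<close>).
\<close>

section \<open>The cube of finite subsets of a set\<close>

definition symdiff :: "'z set \<Rightarrow> 'z set \<Rightarrow> 'z set" (infixl "\<triangle>" 65) where
  "A \<triangle> B = {x. (x \<in> A) \<noteq> (x \<in> B)}"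

lemma in_symdiff [simp]: "x \<in> A \<triangle> B \<longleftrightarrow> (x \<in> A) \<noteq> (x \<in> B)"
  by (simp add: symdiff_def)

lemma symdiff_assoc: "(A \<triangle> B) \<triangle> C = A \<triangle> (B \<triangle> C)"
  by (auto simp: set_eq_iff)

lemma symdiff_commute: "A \<triangle> B = B \<triangle> A"
  by (auto simp: set_eq_iff)

lemma symdiff_left_commute: "A \<triangle> (B \<triangle> C) = B \<triangle> (A \<triangle> C)"
  by (auto simp: set_eq_iff)

lemmas symdiff_ac = symdiff_assoc symdiff_commute symdiff_left_commute

lemma symdiff_empty [simp]: "A \<triangle> {} = A" "{} \<triangle> A = A"
  by (auto simp: set_eq_iff)

lemma symdiff_self [simp]: "A \<triangle> A = {}"
  by (auto simp: set_eq_iff)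

lemma symdiff_cancel [simp]: "A \<triangle> (A \<triangle> B) = B"
  by (auto simp: set_eq_iff)

lemma symdiff_subset: "A \<subseteq> C \<Longrightarrow> B \<subseteq> C \<Longrightarrow> A \<triangle> B \<subseteq> C"
  by auto

lemma symdiff_subset_Un: "A \<triangle> B \<subseteq> A \<union> B"
  by auto

lemma symdiff_between: "A \<subseteq> C \<Longrightarrow> A \<triangle> D \<subseteq> C - A \<longleftrightarrow> A \<subseteq> D \<and> D \<subseteq> C"
  unfolding subset_iff by auto

lemma finite_symdiff [simp]: "finite A \<Longrightarrow> finite B \<Longrightarrow> finite (A \<triangle> B)"
  by (rule finite_subset[OF symdiff_subset_Un]) simp

lemma image_symdiff_on:
  assumes "inj_on f Z" "A \<subseteq> Z" "B \<subseteq> Z"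
  shows "f ` (A \<triangle> B) = f ` A \<triangle> f ` B"
proof -
  have f: "f z \<in> f ` C \<longleftrightarrow> z \<in> C" if "C \<subseteq> Z" "z \<in> Z" for C z
    using that assms(1) by (auto dest: inj_onD)
  show ?thesis
  proof (rule Set.set_eqI)
    fix y
    show "y \<in> f ` (A \<triangle> B) \<longleftrightarrow> y \<in> f ` A \<triangle> f ` B"
    proof (cases "y \<in> f ` Z")
      case True
      then obtain z where "z \<in> Z" "y = f z" by blast
      then show ?thesis
        using f[of A z] f[of B z] f[of "A \<triangle> B" z] assms symdiff_subset[of A Z B] by simp
    qed (use assms in auto)
  qed
qed

lemma image_symdiff: "inj f \<Longrightarrow> f ` (A \<triangle> B) = f ` A \<triangle> f ` B"
  by (rule image_symdiff_on[of f UNIV]) auto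

lemma symdiff_Fpow: "A \<in> Fpow Z \<Longrightarrow> B \<in> Fpow Z \<Longrightarrow> A \<triangle> B \<in> Fpow Z"
  by (simp add: Fpow_def symdiff_subset)

definition cube_at :: "'z set \<Rightarrow> 'z set \<Rightarrow> 'z set set" where
  "cube_at B S = (\<lambda>T. B \<triangle> T) ` Pow S"

definition finite_subset_cube :: "'z set \<Rightarrow> 'z set set set" where
  "finite_subset_cube Z = {cube_at B S | B S. B \<in> Fpow Z \<and> S \<in> Fpow Z}"

lemma Fpow_iff: "A \<in> Fpow Z \<longleftrightarrow> A \<subseteq> Z \<and> finite A"
  by (auto simp: Fpow_def)

lemma mem_cube_at: "V \<in> cube_at B S \<longleftrightarrow> B \<triangle> V \<subseteq> S"
proof
  assume "B \<triangle> V \<subseteq> S"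
  moreover have "V = B \<triangle> (B \<triangle> V)" by simp
  ultimately show "V \<in> cube_at B S" unfolding cube_at_def by blast
qed (auto simp: cube_at_def)

lemma cube_at_rebase: "V \<in> cube_at B S \<Longrightarrow> cube_at V S = cube_at B S"
  unfolding set_eq_iff mem_cube_at by (auto 0 3)

lemma cube_at_self [simp]: "B \<in> cube_at B S"
  by (simp add: mem_cube_at)

lemma cube_at_Int: "cube_at V S \<inter> cube_at V S' = cube_at V (S \<inter> S')"
  by (auto simp: mem_cube_at)

lemma cube_at_image:
  assumes "inj f" shows "(\<lambda>B. f ` B \<triangle> D) ` cube_at B S = cube_at (f ` B \<triangle> D) (f ` S)"
proof -
  have "(\<lambda>B. f ` B \<triangle> D) ` cube_at B S = (\<lambda>T. (f ` B \<triangle> D) \<triangle> f ` T) ` Pow S"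
    unfolding cube_at_def image_image by (simp add: image_symdiff[OF assms] symdiff_ac)
  also have "\<dots> = cube_at (f ` B \<triangle> D) (f ` S)"
    unfolding cube_at_def by (simp add: image_Pow_surj[symmetric] image_image)
  finally show ?thesis .
qed

lemma finite_subset_cubeI: "B \<in> Fpow Z \<Longrightarrow> S \<in> Fpow Z \<Longrightarrow> cube_at B S \<in> finite_subset_cube Z"
  unfolding finite_subset_cube_def by blast

lemma finite_subset_cubeE:
  assumes "C \<in> finite_subset_cube Z"
  obtains B S where "B \<in> Fpow Z" "S \<in> Fpow Z" "C = cube_at B S"
  using assms unfolding finite_subset_cube_def by blast

lemma finite_subset_cube_at:
  assumes "C \<in> finite_subset_cube Z" "V \<in> C"
  obtains S where "S \<in> Fpow Z" "C = cube_at V S"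
proof -
  obtain B S where BS: "S \<in> Fpow Z" "C = cube_at B S"
    using assms(1) by (elim finite_subset_cubeE)
  then have "C = cube_at V S" using assms(2) by (simp add: cube_at_rebase)
  then show ?thesis using that BS(1) by blast
qed

lemma subset_Fpow: "A \<subseteq> B \<Longrightarrow> B \<in> Fpow Z \<Longrightarrow> A \<in> Fpow Z"
  using finite_subset by (fastforce simp: Fpow_def)

lemma empty_Fpow: "{} \<in> Fpow Z"
  by (simp add: Fpow_def)

lemma Union_finite_subset_cube: "\<Union>(finite_subset_cube Z) = Fpow Z"
proof (intro equalityI subsetI)
  fix V assume "V \<in> \<Union>(finite_subset_cube Z)"
  then obtain C where "C \<in> finite_subset_cube Z" "V \<in> C" by blast
  then obtain B S where BS: "B \<in> Fpow Z" "S \<in> Fpow Z" "V \<in> cube_at B S"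
    by (elim finite_subset_cubeE) simp
  then obtain T where "T \<subseteq> S" "V = B \<triangle> T" unfolding cube_at_def by blast
  then show "V \<in> Fpow Z" using BS(1) symdiff_Fpow[OF BS(1) subset_Fpow[OF _ BS(2)]] by simp
next
  fix V assume "V \<in> Fpow Z"
  then have "cube_at V {} \<in> finite_subset_cube Z" by (intro finite_subset_cubeI empty_Fpow)
  then show "V \<in> \<Union>(finite_subset_cube Z)" using cube_at_self by blast
qed

lemma adjacent_finite_subset_cube:
  "adjacent (finite_subset_cube Z) u v \<longleftrightarrow> u \<in> Fpow Z \<and> (\<exists>s\<in>Z. v = u \<triangle> {s})"
proof
  assume adj: "adjacent (finite_subset_cube Z) u v"
  then have ne: "u \<noteq> v" and "{u, v} \<in> finite_subset_cube Z" by (simp_all add: adjacent_def)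
  then obtain B S where BS: "B \<in> Fpow Z" "S \<in> Fpow Z" "{u, v} = cube_at B S"
    by (elim finite_subset_cubeE)
  have uF: "u \<in> Fpow Z" using \<open>{u, v} \<in> finite_subset_cube Z\<close> Union_finite_subset_cube by blast
  have "u \<in> cube_at B S" using BS by blast
  then have c: "cube_at u S = {u, v}" using BS cube_at_rebase by metis
  have "u \<triangle> v \<noteq> {}" using ne by (metis symdiff_cancel symdiff_empty(1))
  then obtain s where s: "s \<in> u \<triangle> v" by blast
  have "v \<in> cube_at u S" using c by simp
  then have sS: "s \<in> S" using s unfolding mem_cube_at by blast
  have "u \<triangle> {s} \<in> cube_at u S" unfolding mem_cube_at using sS by simp
  then have "u \<triangle> {s} \<in> {u, v}" unfolding c .
  moreover have "u \<triangle> {s} \<noteq> u" by (metis symdiff_cancel symdiff_self insert_not_empty)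
  ultimately have "v = u \<triangle> {s}" by simp
  then show "u \<in> Fpow Z \<and> (\<exists>s\<in>Z. v = u \<triangle> {s})"
    using uF sS BS(2) unfolding Fpow_iff by blast
next
  assume "u \<in> Fpow Z \<and> (\<exists>s\<in>Z. v = u \<triangle> {s})"
  then obtain s where *: "u \<in> Fpow Z" "s \<in> Z" "v = u \<triangle> {s}" by blast
  have "cube_at u {s} = {u, v}" unfolding cube_at_def Pow_insert using * by auto
  moreover have "{s} \<in> Fpow Z" using * by (simp add: Fpow_def)
  then have "cube_at u {s} \<in> finite_subset_cube Z" using * finite_subset_cubeI by blast
  moreover have "u \<noteq> v" using * by (metis symdiff_cancel symdiff_self insert_not_empty)
  ultimately show "adjacent (finite_subset_cube Z) u v" unfolding adjacent_def by simp
qed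

text \<open>
  With respect to the chart \<open>T \<mapsto> B \<triangle> h ` T\<close> of the cube at \<open>B\<close>, the cube at \<open>B \<triangle> h ` A\<close> spanned by
  \<open>h ` (A' - A)\<close> is the interval \<open>{A..A'}\<close>.  Two cubes with a common vertex \<open>V\<close> are both of the form
  \<open>cube_at V S\<close>, and meet in the cube spanned by the common directions.
\<close>

lemma cubical_finite_subset_cube: "cubical_complex (finite_subset_cube Z)"
  unfolding cubical_complex_def
proof (intro conjI ballI)
  fix C assume "C \<in> finite_subset_cube Z"
  then obtain B S where BS: "B \<in> Fpow Z" "S \<in> Fpow Z" "C = cube_at B S"
    by (elim finite_subset_cubeE)
  then have "finite S" by (auto simp: Fpow_iff)
  then obtain n and h :: "nat \<Rightarrow> _" where h: "bij_betw h {..<n} S"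
    by (metis ex_bij_betw_nat_finite atLeast0LessThan)
  then have inj: "inj_on h {..<n}" and im: "h ` {..<n} = S" by (auto simp: bij_betw_def)
  define \<chi> where "\<chi> T = B \<triangle> h ` T" for T
  have "bij_betw \<chi> (Pow {..<n}) C"
  proof -
    have "bij_betw ((`) h) (Pow {..<n}) (Pow S)" using h by (rule bij_betw_Pow)
    moreover have "bij_betw (\<lambda>T. B \<triangle> T) (Pow S) C"
      unfolding BS cube_at_def by (rule bij_betw_imageI) (auto intro!: inj_onI simp: set_eq_iff)
    ultimately have "bij_betw ((\<lambda>T. B \<triangle> T) \<circ> (`) h) (Pow {..<n}) C" by (rule bij_betw_trans)
    then show ?thesis by (simp add: \<chi>_def[abs_def] comp_def)
  qed
  moreover have "{D \<in> finite_subset_cube Z. D \<subseteq> C} = {\<chi> ` {A..A'} |A A'. A \<subseteq> A' \<and> A' \<subseteq> {..<n}}"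
  proof (intro equalityI subsetI)
    fix D assume "D \<in> {D \<in> finite_subset_cube Z. D \<subseteq> C}"
    then obtain B1 S1 where D: "D = cube_at B1 S1" "D \<subseteq> C" unfolding finite_subset_cube_def by auto
    have "B1 \<in> C" using D by auto
    then have T1: "B \<triangle> B1 \<subseteq> S" unfolding BS mem_cube_at .
    have S1: "S1 \<subseteq> S"
    proof
      fix s assume "s \<in> S1"
      then have "B1 \<triangle> {s} \<in> D" unfolding D mem_cube_at by auto
      then have "B1 \<triangle> {s} \<in> cube_at B S" using D(2) unfolding BS by blast
      then have "B \<triangle> (B1 \<triangle> {s}) \<subseteq> S" unfolding mem_cube_at .
      moreover have "s \<in> B \<triangle> B1 \<or> s \<in> B \<triangle> (B1 \<triangle> {s})" by auto
      ultimately show "s \<in> S" using T1 by (meson subsetD)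
    qed
    define T1 where "T1 = {i \<in> {..<n}. h i \<in> B \<triangle> B1}"
    define U where "U = {i \<in> {..<n}. h i \<in> S1}"
    have "D = \<chi> ` {T1 - U..T1 \<union> U}"
    proof (intro equalityI subsetI)
      fix V assume "V \<in> D"
      then have V: "B1 \<triangle> V \<subseteq> S1" unfolding D mem_cube_at .
      define T where "T = {i \<in> {..<n}. h i \<in> B \<triangle> V}"
      have "B \<triangle> V = (B \<triangle> B1) \<triangle> (B1 \<triangle> V)" by (simp add: symdiff_assoc)
      then have "B \<triangle> V \<subseteq> S" using V S1 T1 by (metis symdiff_subset subset_trans)
      then have "h ` T = B \<triangle> V" unfolding T_def using im by auto
      then have "V = \<chi> T" unfolding \<chi>_def by simp
      moreover have "T \<in> {T1 - U..T1 \<union> U}" using V unfolding T_def T1_def U_def by auto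
      ultimately show "V \<in> \<chi> ` {T1 - U..T1 \<union> U}" by blast
    next
      fix V assume "V \<in> \<chi> ` {T1 - U..T1 \<union> U}"
      then obtain T where "T \<in> {T1 - U..T1 \<union> U}" "V = \<chi> T" by (rule imageE)
      then have T: "T1 - U \<subseteq> T" "T \<subseteq> T1 \<union> U" "V = B \<triangle> h ` T" by (simp_all add: \<chi>_def)
      have "B1 \<triangle> V \<subseteq> S1"
      proof
        fix x assume x: "x \<in> B1 \<triangle> V"
        have Tn: "T \<subseteq> {..<n}" using T unfolding T1_def U_def by auto
        have "x \<in> S" using x T1 Tn im unfolding T(3) by auto
        then obtain i where i: "i < n" "x = h i" using im by auto
        have "x \<in> h ` T \<longleftrightarrow> i \<in> T" using i inj Tn by (auto dest: inj_onD)
        then have "(i \<in> T) \<noteq> (i \<in> T1)" using x i unfolding T(3) T1_def by auto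
        then have "i \<in> U" using T(1,2) by auto
        then show "x \<in> S1" using i unfolding U_def by auto
      qed
      then show "V \<in> D" unfolding D mem_cube_at .
    qed
    moreover have "T1 - U \<subseteq> T1 \<union> U" "T1 \<union> U \<subseteq> {..<n}" unfolding T1_def U_def by auto
    ultimately show "D \<in> {\<chi> ` {A..A'} |A A'. A \<subseteq> A' \<and> A' \<subseteq> {..<n}}"
      by (intro CollectI exI conjI)
  next
    fix D assume "D \<in> {\<chi> ` {A..A'} |A A'. A \<subseteq> A' \<and> A' \<subseteq> {..<n}}"
    then obtain A A' where A: "A \<subseteq> A'" "A' \<subseteq> {..<n}" "D = \<chi> ` {A..A'}" by auto
    have sub: "h ` A' \<subseteq> S" using A im by auto
    have hA: "h ` A \<subseteq> h ` A'" using A by auto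
    have "D = cube_at (B \<triangle> h ` A) (h ` A' - h ` A)"
    proof (intro equalityI subsetI)
      fix V assume "V \<in> D"
      then obtain T where "A \<subseteq> T" "T \<subseteq> A'" "V = B \<triangle> h ` T" unfolding A \<chi>_def by auto
      then have V: "h ` A \<subseteq> h ` T" "h ` T \<subseteq> h ` A'" "B \<triangle> V = h ` T" by auto
      then show "V \<in> cube_at (B \<triangle> h ` A) (h ` A' - h ` A)"
        using hA by (simp add: mem_cube_at symdiff_assoc symdiff_left_commute[of B] V symdiff_between)
    next
      fix V assume V: "V \<in> cube_at (B \<triangle> h ` A) (h ` A' - h ` A)"
      define T where "T = {i \<in> A'. h i \<in> B \<triangle> V}"
      have hsub: "h ` A \<subseteq> B \<triangle> V" "B \<triangle> V \<subseteq> h ` A'"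
        using V hA by (simp_all add: mem_cube_at symdiff_assoc symdiff_left_commute[of B] symdiff_between)
      then have "h ` T = B \<triangle> V" unfolding T_def by blast
      then have "V = \<chi> T" unfolding \<chi>_def by simp
      moreover have "A \<subseteq> T" "T \<subseteq> A'" unfolding T_def using A hsub by auto
      ultimately show "V \<in> D" unfolding A by auto
    qed
    moreover have "h ` A \<in> Fpow Z" "h ` A' - h ` A \<in> Fpow Z"
      using subset_Fpow[OF _ BS(2)] order_trans[OF hA sub] order_trans[OF Diff_subset sub]
      by simp_all
    ultimately have "D \<in> finite_subset_cube Z"
      using finite_subset_cubeI[OF symdiff_Fpow[OF BS(1)]] by simp
    moreover have "D \<subseteq> C"
    proof -
      have "h ` T \<subseteq> S" if "T \<subseteq> A'" for T using image_mono[OF that] sub by (rule order_trans)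
      then show ?thesis unfolding A \<chi>_def BS by (auto simp: mem_cube_at)
    qed
    ultimately show "D \<in> {D \<in> finite_subset_cube Z. D \<subseteq> C}" by simp
  qed
  ultimately show "\<exists>n \<chi>. bij_betw \<chi> (Pow {..<n::nat}) C \<and>
      {D \<in> finite_subset_cube Z. D \<subseteq> C} = {\<chi> ` {A..B} |A B. A \<subseteq> B \<and> B \<subseteq> {..<n}}"
    by (intro exI conjI)
next
  fix C D assume C: "C \<in> finite_subset_cube Z" and D: "D \<in> finite_subset_cube Z"
  show "C \<inter> D = {} \<or> C \<inter> D \<in> finite_subset_cube Z"
  proof (cases "C \<inter> D = {}")
    case False
    then obtain V where V: "V \<in> C" "V \<in> D" by blast
    obtain S where S: "S \<in> Fpow Z" "C = cube_at V S"
      using C V(1) by (rule finite_subset_cube_at)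
    obtain S' where S': "S' \<in> Fpow Z" "D = cube_at V S'"
      using D V(2) by (rule finite_subset_cube_at)
    have "V \<in> Fpow Z" using V(1) C Union_finite_subset_cube by blast
    moreover have "C \<inter> D = cube_at V (S \<inter> S')" unfolding S S' cube_at_Int ..
    moreover have "S \<inter> S' \<in> Fpow Z" using S(1) by (rule subset_Fpow[OF Int_lower1])
    ultimately show ?thesis using finite_subset_cubeI[of V Z "S \<inter> S'"] by simp
  qed simp
qed

text \<open>
  The neighbours of a vertex correspond to the elements of \<open>Z\<close>, and any finite set of them spans a cube:
  all links are full simplices.
\<close>

lemma nonpositively_curved_finite_subset_cube: "nonpositively_curved (finite_subset_cube Z)"
  unfolding nonpositively_curved_def Union_finite_subset_cube
proof
  fix v assume v: "v \<in> Fpow Z"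
  have link: "\<sigma> \<in> link (finite_subset_cube Z) v \<longleftrightarrow> (\<exists>S\<in>Fpow Z. \<sigma> = (\<lambda>s. v \<triangle> {s}) ` S)" for \<sigma>
  proof -
    have star: "{u \<in> cube_at v S. adjacent (finite_subset_cube Z) v u} = (\<lambda>s. v \<triangle> {s}) ` S"
      if "S \<in> Fpow Z" for S
      using that v unfolding adjacent_finite_subset_cube mem_cube_at by (auto simp: Fpow_iff)
    have "C \<in> finite_subset_cube Z \<and> v \<in> C \<longleftrightarrow> (\<exists>S\<in>Fpow Z. C = cube_at v S)" for C
    proof
      assume C: "C \<in> finite_subset_cube Z \<and> v \<in> C"
      then obtain S where "S \<in> Fpow Z" "C = cube_at v S" by (elim conjE finite_subset_cube_at)
      then show "\<exists>S\<in>Fpow Z. C = cube_at v S" by blast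
    qed (auto intro: finite_subset_cubeI[OF v])
    then have "\<sigma> \<in> link (finite_subset_cube Z) v \<longleftrightarrow>
        (\<exists>S\<in>Fpow Z. \<sigma> = {u \<in> cube_at v S. adjacent (finite_subset_cube Z) v u})"
    proof -
      assume *: "\<And>C. C \<in> finite_subset_cube Z \<and> v \<in> C \<longleftrightarrow> (\<exists>S\<in>Fpow Z. C = cube_at v S)"
      have "\<sigma> \<in> link (finite_subset_cube Z) v \<longleftrightarrow> (\<exists>C. (C \<in> finite_subset_cube Z \<and> v \<in> C) \<and>
          \<sigma> = {u \<in> C. adjacent (finite_subset_cube Z) v u})"
        unfolding link_def by auto
      then show ?thesis unfolding * by auto
    qed
    then show ?thesis using star by auto
  qed
  show "flag (link (finite_subset_cube Z) v)"
    unfolding flag_def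
  proof (intro allI impI)
    fix \<sigma> assume *: "finite \<sigma> \<and> (\<forall>a\<in>\<sigma>. \<forall>b\<in>\<sigma>. {a, b} \<in> link (finite_subset_cube Z) v)"
    have "\<exists>s\<in>Z. a = v \<triangle> {s}" if "a \<in> \<sigma>" for a
    proof -
      have "{a, a} \<in> link (finite_subset_cube Z) v" using * that by blast
      then obtain S where S: "S \<in> Fpow Z" "{a, a} = (\<lambda>s. v \<triangle> {s}) ` S" unfolding link by blast
      then have "a \<in> (\<lambda>s. v \<triangle> {s}) ` S" by blast
      then show ?thesis using S(1) by (auto simp: Fpow_iff)
    qed
    then obtain f where f: "\<forall>a\<in>\<sigma>. f a \<in> Z \<and> a = v \<triangle> {f a}" by metis
    then have "\<sigma> = (\<lambda>s. v \<triangle> {s}) ` f ` \<sigma>" by (force simp: image_image)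
    moreover have "f ` \<sigma> \<in> Fpow Z" using f * by (auto simp: Fpow_iff)
    ultimately show "\<sigma> \<in> link (finite_subset_cube Z) v" unfolding link by blast
  qed
qed

subsection \<open>Simple connectivity\<close>

lemma walk_append: "walk L i t u (xs @ ys) v \<longleftrightarrow> (\<exists>z. walk L i t u xs z \<and> walk L i t z ys v)"
  by (induction xs arbitrary: u) auto

fun toggle_path :: "'z set \<Rightarrow> 'z list \<Rightarrow> ('z set \<times> 'z set) list" where
  "toggle_path u [] = []"
| "toggle_path u (s # ss) = (u, u \<triangle> {s}) # toggle_path (u \<triangle> {s}) ss"

definition toggle_end :: "'z set \<Rightarrow> 'z list \<Rightarrow> 'z set" where
  "toggle_end = foldl (\<lambda>u s. u \<triangle> {s})"

lemma toggle_path_append: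
  "toggle_path u (xs @ ys) = toggle_path u xs @ toggle_path (toggle_end u xs) ys"
  by (induction xs arbitrary: u) (auto simp: toggle_end_def)

lemma toggle_end_simps [simp]:
  "toggle_end u [] = u" "toggle_end u (s # ss) = toggle_end (u \<triangle> {s}) ss"
  "toggle_end u (xs @ ys) = toggle_end (toggle_end u xs) ys"
  by (simp_all add: toggle_end_def)

lemma toggle_end_Fpow: "u \<in> Fpow Z \<Longrightarrow> set ss \<subseteq> Z \<Longrightarrow> toggle_end u ss \<in> Fpow Z"
proof (induction ss arbitrary: u)
  case (Cons s ss)
  then have "u \<triangle> {s} \<in> Fpow Z" by (auto simp: Fpow_iff)
  then show ?case using Cons by simp
qed simp

lemma toggle_path_of_cc_path:
  assumes "cc_path (finite_subset_cube Z) u w v" "u \<in> Fpow Z"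
  obtains ss where "set ss \<subseteq> Z" "w = toggle_path u ss" "v = toggle_end u ss"
proof -
  have "\<exists>ss. set ss \<subseteq> Z \<and> w = toggle_path u ss \<and> v = toggle_end u ss"
    using assms
  proof (induction w arbitrary: u)
    case Nil
    then have "v = toggle_end u []" by simp
    then show ?case by (intro exI[of _ "[]"]) simp
  next
    case (Cons x w)
    obtain u' where x: "x = (u, u')" and adj: "adjacent (finite_subset_cube Z) u u'"
      and w: "cc_path (finite_subset_cube Z) u' w v" using Cons.prems by (cases x) auto
    obtain s where s: "s \<in> Z" "u' = u \<triangle> {s}" using adj unfolding adjacent_finite_subset_cube by blast
    have "u' \<in> Fpow Z" using s Cons.prems(2) by (auto simp: Fpow_iff)
    from Cons.IH[OF w this] obtain ss where ss: "set ss \<subseteq> Z" "w = toggle_path u' ss" "v = toggle_end u' ss"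
      by blast
    then show ?case using s x by (intro exI[of _ "s # ss"]) simp
  qed
  then show ?thesis using that by blast
qed

lemma cc_path_toggle_path:
  assumes "set ss \<subseteq> Z" "u \<in> Fpow Z"
  shows "cc_path (finite_subset_cube Z) u (toggle_path u ss) (toggle_end u ss)"
  using assms
proof (induction ss arbitrary: u)
  case (Cons s ss)
  then have "u \<triangle> {s} \<in> Fpow Z" by (auto simp: Fpow_iff)
  moreover have "adjacent (finite_subset_cube Z) u (u \<triangle> {s})"
    using Cons.prems unfolding adjacent_finite_subset_cube by auto
  ultimately show ?case using Cons by simp
qed simp

lemma homotopic_in_refl: "homotopic_in P R u u"
  by (simp add: homotopic_in_def)

lemma homotopic_in_trans: "homotopic_in P R u v \<Longrightarrow> homotopic_in P R v w \<Longrightarrow> homotopic_in P R u w"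
  unfolding homotopic_in_def by (rule equivclp_trans)

lemma homotopic_in_move:
  "x @ l @ y \<in> P \<Longrightarrow> x @ r @ y \<in> P \<Longrightarrow> (l, r) \<in> R \<Longrightarrow> homotopic_in P R (x @ l @ y) (x @ r @ y)"
  unfolding homotopic_in_def elementary_move_def by (intro r_into_equivclp) blast

lemma homotopic_in_invariant:
  assumes "homotopic_in P Q u w" and "\<And>x l r y. (l, r) \<in> Q \<Longrightarrow> x @ l @ y \<in> P \<Longrightarrow> x @ r @ y \<in> P \<Longrightarrow> f (x @ l @ y) = f (x @ r @ y)"
  shows "f u = f w"
  using assms(1) unfolding homotopic_in_def
proof (induction rule: equivclp_induct)
  case (step y z)
  then obtain a b where ab: "{a, b} = {y, z}" "a \<in> P" "b \<in> P" "elementary_move Q a b"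
    by (auto simp: insert_commute)
  then have "f a = f b" unfolding elementary_move_def using assms(2) by blast
  then show ?case using step(3) ab(1) by (auto simp: doubleton_eq_iff)
qed simp

context
  fixes Z :: "'z set" and u :: "'z set"
  assumes u: "u \<in> Fpow Z"
begin

abbreviation loop_homotopic :: "'z list \<Rightarrow> 'z list \<Rightarrow> bool" where
  "loop_homotopic a b \<equiv> homotopic_in {w. cc_path (finite_subset_cube Z) u w u}
     (cc_relations (finite_subset_cube Z)) (toggle_path u a) (toggle_path u b)"

lemma toggle_loop: "set a \<subseteq> Z \<Longrightarrow> toggle_end u a = u \<Longrightarrow>
    toggle_path u a \<in> {w. cc_path (finite_subset_cube Z) u w u}"
  using cc_path_toggle_path[OF _ u, of a] by simp

lemma square_relation:
  assumes a: "a \<in> Fpow Z" and sx: "s \<in> Z" "x \<in> Z" "s \<noteq> x"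
  shows "([(a, a \<triangle> {s}), (a \<triangle> {s}, a \<triangle> {s} \<triangle> {x})], [(a, a \<triangle> {x}), (a \<triangle> {x}, a \<triangle> {s} \<triangle> {x})])
      \<in> cc_relations (finite_subset_cube Z)"
proof -
  have comm: "a \<triangle> {s} \<triangle> {x} = a \<triangle> {x} \<triangle> {s}" by (simp add: symdiff_ac)
  have F: "a \<triangle> {s} \<in> Fpow Z" "a \<triangle> {x} \<in> Fpow Z" using a sx by (auto simp: Fpow_iff)
  have sxu: "{s} \<triangle> {x} = {s, x}" using sx by auto
  have "{a, a \<triangle> {s}, a \<triangle> {s} \<triangle> {x}, a \<triangle> {x}} = cube_at a {s, x}"
    unfolding cube_at_def Pow_insert symdiff_assoc sxu by auto
  moreover have "cube_at a {s, x} \<in> finite_subset_cube Z"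
    using a sx by (intro finite_subset_cubeI) (auto simp: Fpow_def)
  moreover have "card {a, a \<triangle> {s}, a \<triangle> {s} \<triangle> {x}, a \<triangle> {x}} = 4"
  proof -
    have ne: "a \<triangle> T = a \<triangle> T' \<longleftrightarrow> T = T'" for T T' :: "'z set" by (metis symdiff_cancel)
    have "distinct [a \<triangle> {}, a \<triangle> {s}, a \<triangle> {s, x}, a \<triangle> {x}]"
      unfolding distinct.simps list.set insert_iff empty_iff ne using sx by auto
    then have "card (set [a \<triangle> {}, a \<triangle> {s}, a \<triangle> {s, x}, a \<triangle> {x}]) = 4"
      by (subst distinct_card) auto
    then show ?thesis by (simp add: symdiff_assoc sxu)
  qed
  moreover have "adjacent (finite_subset_cube Z) a (a \<triangle> {s})" "adjacent (finite_subset_cube Z) a (a \<triangle> {x})"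
    "adjacent (finite_subset_cube Z) (a \<triangle> {s}) (a \<triangle> {s} \<triangle> {x})"
    unfolding adjacent_finite_subset_cube using a F sx by blast+
  moreover have "adjacent (finite_subset_cube Z) (a \<triangle> {x}) (a \<triangle> {s} \<triangle> {x})"
    unfolding adjacent_finite_subset_cube comm using F sx by blast
  ultimately show ?thesis unfolding cc_relations_def
    by (intro UnI2 CollectI exI[of _ a] exI[of _ "a \<triangle> {s}"] exI[of _ "a \<triangle> {s} \<triangle> {x}"]
        exI[of _ "a \<triangle> {x}"] conjI refl) simp_all
qed

lemma swap_toggles:
  assumes "set (p @ s # x # b) \<subseteq> Z" "toggle_end u (p @ s # x # b) = u" "s \<noteq> x"
  shows "loop_homotopic (p @ s # x # b) (p @ x # s # b)"
proof -
  let ?a = "toggle_end u p"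
  have comm: "?a \<triangle> {s} \<triangle> {x} = ?a \<triangle> {x} \<triangle> {s}" by (simp add: symdiff_ac)
  have aF: "?a \<in> Fpow Z" using assms toggle_end_Fpow[OF u] by auto
  have sx: "s \<in> Z" "x \<in> Z" using assms by auto
  have e: "toggle_end u (p @ x # s # b) = u" using assms(2) by (simp add: comm)
  note homotopic_in_move[OF _ _ square_relation[OF aF sx assms(3)],
      of "toggle_path u p" "toggle_path (?a \<triangle> {s} \<triangle> {x}) b"]
  moreover have "toggle_path u (p @ s # x # b) \<in> {w. cc_path (finite_subset_cube Z) u w u}"
    using assms by (intro toggle_loop)
  moreover have "toggle_path u (p @ x # s # b) \<in> {w. cc_path (finite_subset_cube Z) u w u}"
    using assms(1) e by (intro toggle_loop) auto
  ultimately show ?thesis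
    by (simp only: toggle_path_append toggle_path.simps append.simps comm)
qed

lemma cancel_toggles:
  assumes "set (p @ s # s # b) \<subseteq> Z" "toggle_end u (p @ s # s # b) = u"
  shows "loop_homotopic (p @ s # s # b) (p @ b)"
proof -
  let ?a = "toggle_end u p"
  have aF: "?a \<in> Fpow Z" using assms toggle_end_Fpow[OF u] by auto
  have bk: "?a \<triangle> {s} \<triangle> {s} = ?a" by (simp add: symdiff_assoc)
  have "s \<in> Z" using assms by auto
  then have "adjacent (finite_subset_cube Z) ?a (?a \<triangle> {s})"
    unfolding adjacent_finite_subset_cube using aF by blast
  then have "([(?a, ?a \<triangle> {s}), (?a \<triangle> {s}, ?a)], []) \<in> cc_relations (finite_subset_cube Z)"
    unfolding cc_relations_def by blast
  note homotopic_in_move[OF _ _ this, of "toggle_path u p" "toggle_path ?a b"]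
  moreover have "toggle_path u (p @ s # s # b) \<in> {w. cc_path (finite_subset_cube Z) u w u}"
    using assms by (intro toggle_loop)
  moreover have "toggle_path u (p @ b) \<in> {w. cc_path (finite_subset_cube Z) u w u}"
    using assms bk by (intro toggle_loop) auto
  ultimately show ?thesis
    by (simp only: toggle_path_append toggle_path.simps append.simps bk)
qed

lemma remove_toggle_pair:
  assumes "set (p @ s # a @ s # b) \<subseteq> Z" "toggle_end u (p @ s # a @ s # b) = u"
  shows "loop_homotopic (p @ s # a @ s # b) (p @ a @ b)"
  using assms
proof (induction a arbitrary: p)
  case Nil
  then show ?case using cancel_toggles by simp
next
  case (Cons x a)
  show ?case
  proof (cases "x = s")
    case True
    then show ?thesis using Cons.IH[of "p @ [s]"] Cons.prems by simp
  next
    case False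
    have "toggle_end u (p @ s # x # a @ s # b) = toggle_end u (p @ x # s # a @ s # b)"
      by (simp add: symdiff_ac)
    then have "loop_homotopic ((p @ [x]) @ s # a @ s # b) ((p @ [x]) @ a @ b)"
      using Cons.prems by (intro Cons.IH) auto
    moreover have "loop_homotopic (p @ s # x # a @ s # b) (p @ x # s # a @ s # b)"
      using swap_toggles[of p s x "a @ s # b"] False Cons.prems by auto
    ultimately show ?thesis using homotopic_in_trans by fastforce
  qed
qed

text \<open>
  A closed path toggles every element an even number of times.  By squares, two occurrences of an
  element are brought next to each other, where they cancel.
\<close>

lemma toggle_loop_null_homotopic:
  assumes "set ss \<subseteq> Z" "toggle_end u ss = u"
  shows "loop_homotopic ss []"
  using assms
proof (induction "length ss" arbitrary: ss rule: less_induct)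
  case less
  show ?case
  proof (cases ss)
    case Nil
    then show ?thesis by (simp add: homotopic_in_refl)
  next
    case (Cons s xs)
    have keep: "s \<in> toggle_end v ys \<longleftrightarrow> s \<in> v" if "s \<notin> set ys" for v ys
      using that by (induction ys arbitrary: v) auto
    have "s \<in> set xs"
    proof (rule ccontr)
      assume "s \<notin> set xs"
      then have "s \<in> toggle_end u ss \<longleftrightarrow> s \<notin> u" using keep[of xs "u \<triangle> {s}"] Cons by simp
      then show False using less.prems by simp
    qed
    then obtain a b where xs: "xs = a @ s # b" by (meson split_list)
    have one: "loop_homotopic ss (a @ b)"
      using remove_toggle_pair[of "[]" s a b] less.prems Cons xs by simp
    have comm: "toggle_end (v \<triangle> {s}) ys = toggle_end v ys \<triangle> {s}" for v ys
    proof (induction ys arbitrary: v)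
      case (Cons y ys)
      have "v \<triangle> {s} \<triangle> {y} = v \<triangle> {y} \<triangle> {s}" by (simp add: symdiff_ac)
      then show ?case using Cons by simp
    qed simp
    have "toggle_end u (a @ b) = u"
      using less.prems(2) Cons xs by (simp add: comm symdiff_assoc)
    then have "loop_homotopic (a @ b) []"
      using less.hyps[of "a @ b"] less.prems Cons xs by auto
    with one show ?thesis by (rule homotopic_in_trans)
  qed
qed

end

lemma simply_connected_finite_subset_cube: "simply_connected_cc (finite_subset_cube Z)"
  unfolding simply_connected_cc_def Union_finite_subset_cube
proof (intro conjI ballI allI impI)
  show "Fpow Z \<noteq> {}" by (auto simp: Fpow_def)
next
  fix u v assume u: "u \<in> Fpow Z" and v: "v \<in> Fpow Z"
  then have "finite (u \<triangle> v)" "u \<triangle> v \<subseteq> Z" by (auto simp: Fpow_iff)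
  then obtain ss where ss: "distinct ss" "set ss = u \<triangle> v" by (metis finite_distinct_list)
  have "toggle_end u ss = u \<triangle> set ss" using ss(1)
  proof (induction ss arbitrary: u)
    case (Cons s ss)
    then have "toggle_end u (s # ss) = u \<triangle> {s} \<triangle> set ss" by simp
    also have "\<dots> = u \<triangle> set (s # ss)" using Cons.prems by (auto simp: set_eq_iff)
    finally show ?case .
  qed simp
  then have "toggle_end u ss = v" using ss by simp
  then show "\<exists>w. cc_path (finite_subset_cube Z) u w v"
    using cc_path_toggle_path[OF _ u, of ss] ss \<open>u \<triangle> v \<subseteq> Z\<close> by auto
next
  fix u w assume u: "u \<in> Fpow Z" and "cc_path (finite_subset_cube Z) u w u"
  then obtain ss where "set ss \<subseteq> Z" "w = toggle_path u ss" "u = toggle_end u ss"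
    using toggle_path_of_cc_path by blast
  then show "homotopic_in {w. cc_path (finite_subset_cube Z) u w u} (cc_relations (finite_subset_cube Z)) w []"
    using toggle_loop_null_homotopic[OF u, of ss] by simp
qed

theorem CAT0_finite_subset_cube: "CAT0_cube_complex (finite_subset_cube Z)"
  by (simp add: CAT0_cube_complex_def cubical_finite_subset_cube
      nonpositively_curved_finite_subset_cube simply_connected_finite_subset_cube)

section \<open>Actions by affine maps on finite subsets\<close>

definition affine_map :: "('z \<Rightarrow> 'z) \<Rightarrow> 'z set \<Rightarrow> 'z set \<Rightarrow> 'z set" where
  "affine_map \<pi> D B = \<pi> ` B \<triangle> D"

definition is_affine :: "('z set \<Rightarrow> 'z set) \<Rightarrow> bool" where
  "is_affine f \<longleftrightarrow> (\<exists>\<pi> D. bij \<pi> \<and> finite D \<and> f = affine_map \<pi> D)"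

text \<open>
  Only the displacement of the vertex \<open>{}\<close> matters: any two vertices differ by finitely many walls, and affine
  maps preserve the number of walls between two vertices.
\<close>

definition wall_action :: "('g, 'm) monoid_scheme \<Rightarrow> ('g \<Rightarrow> 'z set \<Rightarrow> 'z set) \<Rightarrow> bool" where
  "wall_action G \<Theta> \<longleftrightarrow> (\<forall>g\<in>carrier G. is_affine (\<Theta> g)) \<and> \<Theta> \<one>\<^bsub>G\<^esub> = id \<and>
    (\<forall>g\<in>carrier G. \<forall>h\<in>carrier G. \<Theta> (g \<otimes>\<^bsub>G\<^esub> h) = \<Theta> g \<circ> \<Theta> h)"

definition escapes :: "('g, 'm) monoid_scheme \<Rightarrow> ('g \<Rightarrow> 'z set \<Rightarrow> 'z set) \<Rightarrow> 'g \<Rightarrow> bool" where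
  "escapes G \<Theta> g \<longleftrightarrow> (\<forall>k. \<exists>n::nat. k < card (\<Theta> (g [^]\<^bsub>G\<^esub> n) {}))"

lemma affine_map_empty [simp]: "affine_map \<pi> D {} = D"
  by (simp add: affine_map_def)

lemma is_affineI: "bij \<pi> \<Longrightarrow> finite D \<Longrightarrow> is_affine (affine_map \<pi> D)"
  unfolding is_affine_def by blast

lemma is_affineE:
  assumes "is_affine f"
  obtains \<pi> where "bij \<pi>" "finite (f {})" "f = affine_map \<pi> (f {})"
  using assms unfolding is_affine_def by auto

lemma affine_map_comp:
  assumes "inj \<pi>"
  shows "affine_map \<pi> D \<circ> affine_map \<pi>' D' = affine_map (\<pi> \<circ> \<pi>') (\<pi> ` D' \<triangle> D)"
  by (rule ext) (simp add: affine_map_def image_symdiff[OF assms] image_comp symdiff_assoc)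

lemma affine_map_id [simp]: "affine_map id {} = id" "affine_map (\<lambda>x. x) {} = id"
  by (auto simp: affine_map_def)

lemma is_affine_comp:
  assumes "is_affine f" "is_affine g"
  shows "is_affine (f \<circ> g)"
proof -
  obtain \<pi> D \<pi>' D' where *: "bij \<pi>" "finite D" "f = affine_map \<pi> D" "bij \<pi>'" "finite D'" "g = affine_map \<pi>' D'"
    using assms unfolding is_affine_def by blast
  show ?thesis
    unfolding * affine_map_comp[OF bij_is_inj[OF *(1)]]
    by (intro is_affineI bij_comp) (use * in auto)
qed

lemma is_affine_id: "is_affine id"
  using is_affineI[of id "{}"] by simp

lemma is_affine_finite: "is_affine f \<Longrightarrow> finite B \<Longrightarrow> finite (f B)"
  by (auto simp: is_affine_def affine_map_def)

lemma is_affine_card_symdiff: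
  assumes "is_affine f"
  shows "card (f A \<triangle> f B) = card (A \<triangle> B)"
proof -
  obtain \<pi> D where *: "bij \<pi>" "f = affine_map \<pi> D" using assms unfolding is_affine_def by blast
  have "f A \<triangle> f B = \<pi> ` (A \<triangle> B)"
    using *(1) by (simp add: * affine_map_def image_symdiff bij_is_inj) (auto simp: set_eq_iff)
  moreover have "inj_on \<pi> (A \<triangle> B)" using bij_is_inj[OF *(1)] by (rule inj_on_subset) simp
  ultimately show ?thesis by (simp add: card_image)
qed

lemma card_symdiff_triangle:
  assumes "finite A" "finite B" "finite C"
  shows "card (A \<triangle> C) \<le> card (A \<triangle> B) + card (B \<triangle> C)"
proof -
  have "A \<triangle> C \<subseteq> (A \<triangle> B) \<union> (B \<triangle> C)" by auto
  then have "card (A \<triangle> C) \<le> card ((A \<triangle> B) \<union> (B \<triangle> C))" using assms by (intro card_mono) auto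
  also have "\<dots> \<le> card (A \<triangle> B) + card (B \<triangle> C)" by (rule card_Un_le)
  finally show ?thesis .
qed

text \<open>
  Affine maps are isometries of the metric \<open>card (A \<triangle> B)\<close>, so the displacements of two vertices differ
  by at most twice their distance.
\<close>

lemma card_affine_conjugate:
  assumes "is_affine f" "is_affine f'" "is_affine h" "f' \<circ> f = id"
  shows "card (h {}) \<le> card ((f \<circ> h \<circ> f') {}) + 2 * card (f' {})"
proof -
  have fin: "finite (f {})" "finite (f' {})" "finite (h {})" "finite (h (f' {}))"
    using assms is_affine_finite by blast+
  have ff: "f' (f B) = B" for B using assms(4) by (metis comp_apply id_apply)
  have "card (h {}) = card ({} \<triangle> h {})" by simp
  also have "\<dots> \<le> card ({} \<triangle> h (f' {})) + card (h (f' {}) \<triangle> h {})"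
    using fin by (intro card_symdiff_triangle) auto
  also have "card (h (f' {}) \<triangle> h {}) = card (f' {})"
    using is_affine_card_symdiff[OF assms(3)] by simp
  also have "card ({} \<triangle> h (f' {})) \<le> card ({} \<triangle> f' {}) + card (f' {} \<triangle> h (f' {}))"
    using fin by (intro card_symdiff_triangle) auto
  also have "card (f' {} \<triangle> h (f' {})) = card (f' {} \<triangle> f' (f (h (f' {}))))" by (simp add: ff)
  also have "\<dots> = card (f (h (f' {})))"
    using is_affine_card_symdiff[OF assms(2), of "{}"] by simp
  finally show ?thesis by simp
qed

lemma wall_action_affine: "wall_action G \<Theta> \<Longrightarrow> g \<in> carrier G \<Longrightarrow> is_affine (\<Theta> g)"
  by (simp add: wall_action_def)

lemma wall_action_one: "wall_action G \<Theta> \<Longrightarrow> \<Theta> \<one>\<^bsub>G\<^esub> = id"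
  by (simp add: wall_action_def)

lemma wall_action_mult:
  "wall_action G \<Theta> \<Longrightarrow> g \<in> carrier G \<Longrightarrow> h \<in> carrier G \<Longrightarrow> \<Theta> (g \<otimes>\<^bsub>G\<^esub> h) B = \<Theta> g (\<Theta> h B)"
  by (simp add: wall_action_def)

lemma escapes_power:
  assumes "group G" "g \<in> carrier G" "escapes G \<Theta> (g [^]\<^bsub>G\<^esub> (m::nat))"
  shows "escapes G \<Theta> g"
proof -
  interpret group G by fact
  show ?thesis
    unfolding escapes_def
  proof
    fix k
    obtain n where "k < card (\<Theta> ((g [^]\<^bsub>G\<^esub> m) [^]\<^bsub>G\<^esub> (n::nat)) {})"
      using assms(3) unfolding escapes_def by blast
    then show "\<exists>n::nat. k < card (\<Theta> (g [^]\<^bsub>G\<^esub> n) {})"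
      using assms(2) by (auto simp: nat_pow_pow)
  qed
qed

subsection \<open>Free actions on cubes\<close>

text \<open>
  If \<open>g\<close> preserved a cube, the orbit of its vertices under the powers of \<open>g\<close> would stay in that
  finite cube, so that the empty set would be moved by a bounded amount.
\<close>

lemma escapes_moves_cube:
  assumes G: "group G" and act: "wall_action G \<Theta>" and g: "g \<in> carrier G" and esc: "escapes G \<Theta> g"
    and fin: "finite B" "finite S"
  shows "\<Theta> g ` cube_at B S \<noteq> cube_at B S"
proof
  interpret group G by fact
  assume inv: "\<Theta> g ` cube_at B S = cube_at B S"
  have powers: "\<Theta> (g [^]\<^bsub>G\<^esub> (n::nat)) B \<in> cube_at B S" for n
  proof (induction n)
    case 0
    then show ?case using wall_action_one[OF act] by simp
  next
    case (Suc n)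
    have "\<Theta> (g [^]\<^bsub>G\<^esub> Suc n) B = \<Theta> g (\<Theta> (g [^]\<^bsub>G\<^esub> n) B)"
      using wall_action_mult[OF act g nat_pow_closed[OF g]] nat_pow_Suc2[OF g] by simp
    then show ?case using Suc inv by blast
  qed
  obtain n :: nat where n: "card S + 2 * card B < card (\<Theta> (g [^]\<^bsub>G\<^esub> n) {})"
    using esc unfolding escapes_def by blast
  let ?f = "\<Theta> (g [^]\<^bsub>G\<^esub> n)"
  have aff: "is_affine ?f" using act g by (intro wall_action_affine) auto
  have finf: "finite (?f B)" "finite (?f {})" using aff fin is_affine_finite by blast+
  have "card (?f {}) \<le> card ({} \<triangle> ?f B) + card (?f B \<triangle> ?f {})"
    using card_symdiff_triangle[of "{}" "?f B" "?f {}"] finf by simp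
  also have "card ({} \<triangle> ?f B) \<le> card ({} \<triangle> B) + card (B \<triangle> ?f B)"
    using fin finf by (intro card_symdiff_triangle) auto
  also have "card (B \<triangle> ?f B) \<le> card S" using powers[of n] fin by (auto simp: mem_cube_at intro: card_mono)
  also have "card (?f B \<triangle> ?f {}) = card B" using is_affine_card_symdiff[OF aff, of B "{}"] by simp
  finally show False using n by simp
qed

lemma affine_map_cube_at:
  "inj \<pi> \<Longrightarrow> affine_map \<pi> D ` cube_at B S = cube_at (affine_map \<pi> D B) (\<pi> ` S)"
  using cube_at_image[of \<pi> D B S] by (simp add: affine_map_def[abs_def])

lemma image_cube_at:
  assumes "inj_on j Z" "B \<subseteq> Z" "S \<subseteq> Z"
  shows "(`) j ` cube_at B S = cube_at (j ` B) (j ` S)"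
proof -
  have "(`) j ` cube_at B S = (\<lambda>T. j ` (B \<triangle> T)) ` Pow S" unfolding cube_at_def image_image ..
  also have "\<dots> = (\<lambda>T. j ` B \<triangle> j ` T) ` Pow S"
    using assms by (intro image_cong refl image_symdiff_on[of j Z]) (auto simp del: in_symdiff)
  also have "\<dots> = cube_at (j ` B) (j ` S)"
    unfolding cube_at_def by (simp add: image_Pow_surj[symmetric] image_image)
  finally show ?thesis .
qed

text \<open>
  The walls that separate the base vertex from a translate of it form a countable invariant set, so
  the complex can be built on an arbitrary countable set of names.
\<close>

theorem acts_freely_of_wall_action:
  fixes G :: "('g, 'm) monoid_scheme" (structure) and \<Theta> :: "'g \<Rightarrow> 'z set \<Rightarrow> 'z set" and \<iota> :: "nat \<Rightarrow> 'g set"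
  assumes G: "group G" and cG: "countable (carrier G)" and act: "wall_action G \<Theta>"
    and esc: "\<And>g. g \<in> carrier G \<Longrightarrow> g \<noteq> \<one>\<^bsub>G\<^esub> \<Longrightarrow> escapes G \<Theta> g" and \<iota>: "inj \<iota>"
  shows "acts_freely_on_CAT0_cube_complex G"
proof -
  interpret group G by fact
  define Z0 where "Z0 = (\<Union>g\<in>carrier G. \<Theta> g {})"
  have "countable Z0" unfolding Z0_def
  proof (rule countable_UN[OF cG])
    fix g assume "g \<in> carrier G"
    then have "finite (\<Theta> g {})" using wall_action_affine[OF act] is_affine_finite by blast
    then show "countable (\<Theta> g {})" by (rule countable_finite)
  qed
  then obtain e :: "'z \<Rightarrow> nat" where e: "inj_on e Z0" by (rule countableE)
  define j where "j = \<iota> \<circ> e"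
  have j: "inj_on j Z0" unfolding j_def using e \<iota> by (intro comp_inj_on inj_on_subset[OF \<iota>]) auto
  define Z where "Z = j ` Z0"
  define pull where "pull v = {z \<in> Z0. j z \<in> v}" for v
  have pull_image: "pull (j ` B) = B" if "B \<subseteq> Z0" for B
    using that j unfolding pull_def by (auto dest: inj_onD)
  have image_pull: "j ` pull v = v" if "v \<subseteq> Z" for v
    using that unfolding pull_def Z_def by auto
  have pull_Fpow: "pull v \<in> Fpow Z0" if v: "v \<in> Fpow Z" for v
  proof -
    have "finite (j ` pull v)" using v image_pull by (simp add: Fpow_def)
    moreover have "inj_on j (pull v)" using j by (rule inj_on_subset) (auto simp: pull_def)
    ultimately show ?thesis by (auto simp: Fpow_def pull_def dest: finite_imageD)
  qed
  have image_Fpow: "j ` B \<in> Fpow Z" if "B \<in> Fpow Z0" for B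
    using that by (auto simp: Fpow_def Z_def)
  have lin: "\<exists>\<pi>. bij \<pi> \<and> \<Theta> g = affine_map \<pi> (\<Theta> g {}) \<and> \<pi> ` Z0 \<subseteq> Z0" if g: "g \<in> carrier G" for g
  proof -
    obtain \<pi> where \<pi>: "bij \<pi>" "\<Theta> g = affine_map \<pi> (\<Theta> g {})"
      using wall_action_affine[OF act g] by (rule is_affineE)
    have "\<pi> z \<in> Z0" if z: "z \<in> Z0" for z
    proof -
      obtain h where h: "h \<in> carrier G" "z \<in> \<Theta> h {}" using z by (auto simp: Z0_def)
      have "\<Theta> (g \<otimes> h) {} = \<pi> ` \<Theta> h {} \<triangle> \<Theta> g {}"
        unfolding wall_action_mult[OF act g h(1)] by (subst \<pi>(2)) (simp add: affine_map_def)
      moreover have "\<pi> z \<in> \<pi> ` \<Theta> h {}" using h by simp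
      ultimately have "\<pi> z \<in> \<Theta> (g \<otimes> h) {} \<or> \<pi> z \<in> \<Theta> g {}" by simp
      moreover have "g \<otimes> h \<in> carrier G" using g h(1) by simp
      ultimately show ?thesis using g unfolding Z0_def by (elim disjE) (rule UN_I, assumption+)+
    qed
    then show ?thesis using \<pi> by blast
  qed
  have \<Theta>_Fpow: "\<Theta> g B \<in> Fpow Z0" if g: "g \<in> carrier G" and B: "B \<in> Fpow Z0" for g B
  proof -
    obtain \<pi> where \<pi>: "bij \<pi>" "\<Theta> g = affine_map \<pi> (\<Theta> g {})" "\<pi> ` Z0 \<subseteq> Z0" using lin[OF g] by blast
    have "\<Theta> g {} \<in> Fpow Z0"
      using is_affine_finite[OF wall_action_affine[OF act g], of "{}"] g by (auto simp: Fpow_def Z0_def)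
    moreover have "\<pi> ` B \<in> Fpow Z0" using B \<pi>(3) by (auto simp: Fpow_def)
    ultimately have "\<pi> ` B \<triangle> \<Theta> g {} \<in> Fpow Z0" by (rule symdiff_Fpow[rotated])
    then show ?thesis using \<pi>(2) by (metis affine_map_def)
  qed
  define \<rho> where "\<rho> g = (\<lambda>v\<in>Fpow Z. j ` \<Theta> g (pull v))" for g
  have \<rho>_Fpow: "\<rho> g v \<in> Fpow Z" if "g \<in> carrier G" "v \<in> Fpow Z" for g v
    using that by (simp add: \<rho>_def image_Fpow \<Theta>_Fpow pull_Fpow)
  have \<rho>_image: "\<rho> g (j ` B) = j ` \<Theta> g B" if "B \<in> Fpow Z0" for g B
    using that image_Fpow[OF that] by (simp add: \<rho>_def pull_image Fpow_def)
  have \<rho>_mult: "\<rho> (g \<otimes> h) v = \<rho> g (\<rho> h v)" if gh: "g \<in> carrier G" "h \<in> carrier G" and v: "v \<in> Fpow Z" for g h v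
  proof -
    have "\<rho> g (\<rho> h v) = \<rho> g (j ` \<Theta> h (pull v))" using v by (simp add: \<rho>_def)
    also have "\<dots> = j ` \<Theta> g (\<Theta> h (pull v))" using gh v by (intro \<rho>_image \<Theta>_Fpow pull_Fpow)
    finally show ?thesis using wall_action_mult[OF act gh] v by (simp add: \<rho>_def)
  qed
  have \<rho>_one: "\<rho> \<one> v = v" if v: "v \<in> Fpow Z" for v
    using v wall_action_one[OF act] image_pull by (simp add: \<rho>_def Fpow_def)
  have \<rho>_bij: "bij_betw (\<rho> g) (Fpow Z) (Fpow Z)" if g: "g \<in> carrier G" for g
  proof (rule bij_betwI[of _ _ _ "\<rho> (inv g)"])
    show "\<rho> (inv g) (\<rho> g v) = v" if "v \<in> Fpow Z" for v
      using \<rho>_mult[of "inv g" g v] g that \<rho>_one by simp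
    show "\<rho> g (\<rho> (inv g) v) = v" if "v \<in> Fpow Z" for v
      using \<rho>_mult[of g "inv g" v] g that \<rho>_one by simp
  qed (use g \<rho>_Fpow in auto)
  have action: "group_action G (Fpow Z) \<rho>"
    unfolding group_action_def group_hom_def group_hom_axioms_def
  proof (intro conjI homI)
    show "group G" by (rule G)
    show "group (BijGroup (Fpow Z))" by (rule group_BijGroup)
    show car: "\<rho> g \<in> carrier (BijGroup (Fpow Z))" if "g \<in> carrier G" for g
      using \<rho>_bij[OF that] by (simp add: BijGroup_def Bij_def \<rho>_def)
    show "\<rho> (g \<otimes> h) = \<rho> g \<otimes>\<^bsub>BijGroup (Fpow Z)\<^esub> \<rho> h" if gh: "g \<in> carrier G" "h \<in> carrier G" for g h
    proof -
      have "\<rho> g \<in> Bij (Fpow Z)" "\<rho> h \<in> Bij (Fpow Z)"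
        using car gh by (simp_all add: BijGroup_def)
      then have "\<rho> g \<otimes>\<^bsub>BijGroup (Fpow Z)\<^esub> \<rho> h = compose (Fpow Z) (\<rho> g) (\<rho> h)"
        by (simp add: BijGroup_def)
      also have "\<dots> = \<rho> (g \<otimes> h)"
      proof (rule ext)
        fix v show "compose (Fpow Z) (\<rho> g) (\<rho> h) v = \<rho> (g \<otimes> h) v"
          using \<rho>_mult[OF gh, of v] by (cases "v \<in> Fpow Z") (simp_all add: compose_def \<rho>_def)
      qed
      finally show ?thesis by simp
    qed
  qed
  have cubes: "\<rho> g ` C \<in> finite_subset_cube Z \<and> (g \<noteq> \<one> \<longrightarrow> \<rho> g ` C \<noteq> C)"
    if g: "g \<in> carrier G" and C: "C \<in> finite_subset_cube Z" for g C
  proof -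
    obtain B' S' where "B' \<in> Fpow Z" "S' \<in> Fpow Z" "C = cube_at B' S'" using C by (rule finite_subset_cubeE)
    then obtain B S where BS: "B \<in> Fpow Z0" "S \<in> Fpow Z0" and C: "C = cube_at (j ` B) (j ` S)"
      using pull_Fpow image_pull by (metis Fpow_iff)
    have sub: "B \<subseteq> Z0" "S \<subseteq> Z0" and fin: "finite B" "finite S" using BS by (auto simp: Fpow_def)
    obtain \<pi> where \<pi>: "bij \<pi>" "\<Theta> g = affine_map \<pi> (\<Theta> g {})" "\<pi> ` Z0 \<subseteq> Z0" using lin[OF g] by blast
    have \<pi>S: "\<pi> ` S \<in> Fpow Z0" using BS \<pi>(3) by (auto simp: Fpow_def)
    have C': "C = (`) j ` cube_at B S" using image_cube_at[OF j sub] C by simp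
    have cubeF: "cube_at B S \<subseteq> Fpow Z0"
      using Union_finite_subset_cube finite_subset_cubeI[OF BS] by blast
    have im: "\<rho> g ` C = (`) j ` (\<Theta> g ` cube_at B S)"
      unfolding C' image_image using \<rho>_image cubeF by (intro image_cong) auto
    also have "\<Theta> g ` cube_at B S = cube_at (\<Theta> g B) (\<pi> ` S)"
      using \<pi>(1,2) affine_map_cube_at bij_is_inj by metis
    also have "(`) j ` \<dots> = cube_at (j ` \<Theta> g B) (j ` \<pi> ` S)"
      using \<Theta>_Fpow[OF g BS(1)] \<pi>S by (intro image_cube_at[OF j]) (auto simp: Fpow_def)
    finally have "\<rho> g ` C \<in> finite_subset_cube Z"
      using finite_subset_cubeI image_Fpow \<Theta>_Fpow[OF g BS(1)] \<pi>S by metis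
    moreover have "\<rho> g ` C \<noteq> C" if "g \<noteq> \<one>"
    proof
      assume "\<rho> g ` C = C"
      then have eq: "(`) j ` (\<Theta> g ` cube_at B S) = (`) j ` cube_at B S" using im C' by simp
      have "pull ` (`) j ` U = U" if "U \<subseteq> Fpow Z0" for U
      proof -
        have "pull ` (`) j ` U = (\<lambda>B. B) ` U"
          unfolding image_image using that pull_image by (intro image_cong) (auto simp: Fpow_def)
        then show ?thesis by simp
      qed
      moreover have "\<Theta> g ` cube_at B S \<subseteq> Fpow Z0" using cubeF \<Theta>_Fpow[OF g] by blast
      ultimately have "\<Theta> g ` cube_at B S = cube_at B S" using eq cubeF by metis
      then show False using escapes_moves_cube[OF G act g esc[OF g that] fin] by blast
    qed
    ultimately show ?thesis by blast
  qed
  have "acts_freely_on_cube_complex G \<rho> (finite_subset_cube Z)"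
    unfolding acts_freely_on_cube_complex_def Union_finite_subset_cube
    using action cubes by auto
  then show ?thesis
    unfolding acts_freely_on_CAT0_cube_complex_def using CAT0_finite_subset_cube by blast
qed

subsection \<open>Sums of actions\<close>

definition sum_action ::
  "('g \<Rightarrow> 'a set \<Rightarrow> 'a set) \<Rightarrow> ('g \<Rightarrow> 'b set \<Rightarrow> 'b set) \<Rightarrow> 'g \<Rightarrow> ('a + 'b) set \<Rightarrow> ('a + 'b) set" where
  "sum_action \<Theta> \<Theta>' g B = Inl ` \<Theta> g (Inl -` B) \<union> Inr ` \<Theta>' g (Inr -` B)"

lemma vimage_sum_action [simp]:
  "Inl -` sum_action \<Theta> \<Theta>' g B = \<Theta> g (Inl -` B)" "Inr -` sum_action \<Theta> \<Theta>' g B = \<Theta>' g (Inr -` B)"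
  by (auto simp: sum_action_def)

lemma vimage_symdiff: "f -` (A \<triangle> B) = f -` A \<triangle> f -` B"
  by auto

lemma sum_set_eqI: "Inl -` B = Inl -` C \<Longrightarrow> Inr -` B = Inr -` C \<Longrightarrow> B = C"
proof (rule Set.set_eqI)
  fix x :: "'a + 'b" assume "Inl -` B = Inl -` C" "Inr -` B = Inr -` C"
  then show "x \<in> B \<longleftrightarrow> x \<in> C" by (cases x) (auto simp: set_eq_iff)
qed

lemma wall_action_sum:
  assumes "wall_action G \<Theta>" "wall_action G \<Theta>'"
  shows "wall_action G (sum_action \<Theta> \<Theta>')"
  unfolding wall_action_def
proof (intro conjI ballI)
  fix g assume g: "g \<in> carrier G"
  obtain \<pi> where \<pi>: "bij \<pi>" "finite (\<Theta> g {})" "\<Theta> g = affine_map \<pi> (\<Theta> g {})"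
    using wall_action_affine[OF assms(1) g] by (rule is_affineE)
  obtain \<pi>' where \<pi>': "bij \<pi>'" "finite (\<Theta>' g {})" "\<Theta>' g = affine_map \<pi>' (\<Theta>' g {})"
    using wall_action_affine[OF assms(2) g] by (rule is_affineE)
  have "bij (map_sum \<pi> \<pi>')"
    by (rule o_bij[of "map_sum (inv_into UNIV \<pi>) (inv_into UNIV \<pi>')"])
      (use bij_is_inj[OF \<pi>(1)] bij_is_inj[OF \<pi>'(1)] bij_is_surj[OF \<pi>(1)] bij_is_surj[OF \<pi>'(1)]
        in \<open>simp_all add: map_sum.comp surj_iff map_sum.id\<close>)
  moreover have "finite (Inl ` \<Theta> g {} \<union> Inr ` \<Theta>' g {})" using \<pi> \<pi>' by simp
  moreover have "sum_action \<Theta> \<Theta>' g = affine_map (map_sum \<pi> \<pi>') (Inl ` \<Theta> g {} \<union> Inr ` \<Theta>' g {})"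
  proof
    fix B
    have l: "Inl -` (map_sum \<pi> \<pi>' ` B) = \<pi> ` (Inl -` B)"
    proof (intro equalityI subsetI)
      fix x assume "x \<in> Inl -` (map_sum \<pi> \<pi>' ` B)"
      then obtain y where "y \<in> B" "Inl x = map_sum \<pi> \<pi>' y" by blast
      then show "x \<in> \<pi> ` (Inl -` B)" by (cases y) auto
    qed force
    have r: "Inr -` (map_sum \<pi> \<pi>' ` B) = \<pi>' ` (Inr -` B)"
    proof (intro equalityI subsetI)
      fix x assume "x \<in> Inr -` (map_sum \<pi> \<pi>' ` B)"
      then obtain y where "y \<in> B" "Inr x = map_sum \<pi> \<pi>' y" by blast
      then show "x \<in> \<pi>' ` (Inr -` B)" by (cases y) auto
    qed force
    show "sum_action \<Theta> \<Theta>' g B = affine_map (map_sum \<pi> \<pi>') (Inl ` \<Theta> g {} \<union> Inr ` \<Theta>' g {}) B"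
    proof (rule sum_set_eqI)
      have L: "Inl -` (Inl ` \<Theta> g {} \<union> Inr ` \<Theta>' g {}) = \<Theta> g {}" by auto
      show "Inl -` sum_action \<Theta> \<Theta>' g B = Inl -` affine_map (map_sum \<pi> \<pi>') (Inl ` \<Theta> g {} \<union> Inr ` \<Theta>' g {}) B"
        unfolding vimage_sum_action affine_map_def vimage_symdiff l L by (subst \<pi>(3)) (simp only: affine_map_def)
      have R: "Inr -` (Inl ` \<Theta> g {} \<union> Inr ` \<Theta>' g {}) = \<Theta>' g {}" by auto
      show "Inr -` sum_action \<Theta> \<Theta>' g B = Inr -` affine_map (map_sum \<pi> \<pi>') (Inl ` \<Theta> g {} \<union> Inr ` \<Theta>' g {}) B"
        unfolding vimage_sum_action affine_map_def vimage_symdiff r R by (subst \<pi>'(3)) (simp only: affine_map_def)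
    qed
  qed
  ultimately show "is_affine (sum_action \<Theta> \<Theta>' g)" unfolding is_affine_def by blast
next
  show "sum_action \<Theta> \<Theta>' \<one>\<^bsub>G\<^esub> = id"
    by (rule ext, rule sum_set_eqI) (simp_all add: wall_action_one[OF assms(1)] wall_action_one[OF assms(2)])
next
  fix g h assume "g \<in> carrier G" "h \<in> carrier G"
  then show "sum_action \<Theta> \<Theta>' (g \<otimes>\<^bsub>G\<^esub> h) = sum_action \<Theta> \<Theta>' g \<circ> sum_action \<Theta> \<Theta>' h"
    by (intro ext sum_set_eqI) (simp_all add: wall_action_mult[OF assms(1)] wall_action_mult[OF assms(2)])
qed

lemma escapes_sum:
  assumes act: "wall_action G \<Theta>" "wall_action G \<Theta>'" and G: "group G" "g \<in> carrier G"
    and "escapes G \<Theta> g \<or> escapes G \<Theta>' g"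
  shows "escapes G (sum_action \<Theta> \<Theta>') g"
  unfolding escapes_def
proof
  interpret group G by fact
  fix k
  have fin: "finite (\<Theta> (g [^]\<^bsub>G\<^esub> (n::nat)) {})" "finite (\<Theta>' (g [^]\<^bsub>G\<^esub> (n::nat)) {})" for n
    using act G by (meson wall_action_affine is_affine_finite nat_pow_closed finite.emptyI)+
  have card: "card (sum_action \<Theta> \<Theta>' (g [^]\<^bsub>G\<^esub> (n::nat)) {}) =
      card (\<Theta> (g [^]\<^bsub>G\<^esub> n) {}) + card (\<Theta>' (g [^]\<^bsub>G\<^esub> n) {})" for n
    unfolding sum_action_def using fin[of n]
    by (subst card_Un_disjoint) (auto simp: card_image)
  obtain n :: nat where "k < card (\<Theta> (g [^]\<^bsub>G\<^esub> n) {}) \<or> k < card (\<Theta>' (g [^]\<^bsub>G\<^esub> n) {})"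
    using assms(5) unfolding escapes_def by blast
  then have "k < card (sum_action \<Theta> \<Theta>' (g [^]\<^bsub>G\<^esub> n) {})" unfolding card by linarith
  then show "\<exists>n::nat. k < card (sum_action \<Theta> \<Theta>' (g [^]\<^bsub>G\<^esub> n) {})" by blast
qed

subsection \<open>Induction from a subgroup of finite index\<close>

text \<open>
  For a left transversal \<open>(r c)\<inverse>\<close>, indexed by the right cosets \<open>c\<close>, left multiplication by \<open>g\<close> permutes
  the cosets by \<open>coset_perm g\<close> and acts on the fibre over \<open>c\<close> through the element \<open>coset_cocycle g c\<close> of
  the subgroup.
\<close>

locale finite_index_subgroup = group G for G (structure) +
  fixes H :: "'a set"
  assumes H: "subgroup H G" and fin: "finite (rcosets H)"
begin

definition rep :: "'a set \<Rightarrow> 'a" where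
  "rep c = (if c = H then \<one> else SOME x. x \<in> c)"

definition coset_perm :: "'a \<Rightarrow> 'a set \<Rightarrow> 'a set" where
  "coset_perm g c = (if c \<in> rcosets H then H #> (rep c \<otimes> inv g) else c)"

definition coset_cocycle :: "'a \<Rightarrow> 'a set \<Rightarrow> 'a" where
  "coset_cocycle g c = rep (coset_perm g c) \<otimes> g \<otimes> inv (rep c)"

definition induced :: "('a \<Rightarrow> 'z set \<Rightarrow> 'z set) \<Rightarrow> 'a \<Rightarrow> ('a set \<times> 'z) set \<Rightarrow> ('a set \<times> 'z) set" where
  "induced \<Theta> g B = {(c, z). if c \<in> rcosets H
     then z \<in> \<Theta> (coset_cocycle g (coset_perm (inv g) c)) (Pair (coset_perm (inv g) c) -` B) else (c, z) \<in> B}"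

lemma Hsub: "H \<subseteq> carrier G"
  using H by (rule subgroup.subset)

lemma H_in_rcosets: "H \<in> rcosets H"
  using subgroup.subgroup_in_rcosets[OF H is_group] .

lemma rep_in: assumes "c \<in> rcosets H" shows "rep c \<in> c" "rep c \<in> carrier G" "H #> rep c = c"
proof -
  obtain x where x: "x \<in> carrier G" "c = H #> x" using assms unfolding RCOSETS_def by blast
  have "x \<in> c" using x rcos_self[OF _ H] by simp
  then have "(SOME x. x \<in> c) \<in> c" by (rule someI)
  then show r: "rep c \<in> c" unfolding rep_def using subgroup.one_closed[OF H] by simp
  show "rep c \<in> carrier G" using r x r_coset_subset_G[OF Hsub] by blast
  show "H #> rep c = c" using repr_independence[OF _ x(1) H, of "rep c"] r x(2) by simp
qed

lemma coset_perm_closed: "c \<in> rcosets H \<Longrightarrow> g \<in> carrier G \<Longrightarrow> coset_perm g c \<in> rcosets H"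
  using rep_in(2) Hsub by (auto simp: coset_perm_def RCOSETS_def)

lemma coset_perm_eq:
  assumes "x \<in> carrier G" "g \<in> carrier G"
  shows "coset_perm g (H #> x) = H #> (x \<otimes> inv g)"
proof -
  have c: "H #> x \<in> rcosets H" using assms Hsub by (auto simp: RCOSETS_def)
  have "coset_perm g (H #> x) = H #> rep (H #> x) #> inv g"
    using c rep_in(2)[OF c] assms by (simp add: coset_perm_def coset_mult_assoc Hsub)
  then show ?thesis using rep_in(3)[OF c] assms by (simp add: coset_mult_assoc Hsub)
qed

lemma coset_perm_mult:
  assumes "g \<in> carrier G" "h \<in> carrier G" "c \<in> rcosets H"
  shows "coset_perm (g \<otimes> h) c = coset_perm g (coset_perm h c)"
proof -
  obtain x where x: "x \<in> carrier G" "c = H #> x" using assms(3) unfolding RCOSETS_def by blast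
  then show ?thesis using assms by (simp add: coset_perm_eq inv_mult_group m_assoc)
qed

lemma coset_perm_one: "c \<in> rcosets H \<Longrightarrow> coset_perm \<one> c = c"
  using coset_perm_eq[of _ "\<one>"] by (auto simp: RCOSETS_def)

lemma coset_perm_inv:
  assumes "g \<in> carrier G" "c \<in> rcosets H"
  shows "coset_perm (inv g) (coset_perm g c) = c" "coset_perm g (coset_perm (inv g) c) = c"
  using coset_perm_mult[of "inv g" g c] coset_perm_mult[of g "inv g" c] assms coset_perm_one by simp_all

lemma coset_cocycle_in: assumes "c \<in> rcosets H" "g \<in> carrier G" shows "coset_cocycle g c \<in> H"
proof -
  note c = rep_in(2)[OF assms(1)]
  have d: "coset_perm g c \<in> rcosets H" using coset_perm_closed assms .
  have "H #> rep (coset_perm g c) = H #> (rep c \<otimes> inv g)"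
    using rep_in(3)[OF d] assms by (simp add: coset_perm_def)
  moreover have "rep (coset_perm g c) \<in> H #> rep (coset_perm g c)" using rcos_self[OF rep_in(2)[OF d] H] .
  ultimately obtain h where h: "h \<in> H" "rep (coset_perm g c) = h \<otimes> (rep c \<otimes> inv g)"
    unfolding r_coset_def by auto
  then have "coset_cocycle g c = h"
    using assms(2) c Hsub by (auto simp: coset_cocycle_def m_assoc inv_solve_right)
  then show ?thesis using h by simp
qed

lemma coset_cocycle_mult:
  assumes "g \<in> carrier G" "h \<in> carrier G" "c \<in> rcosets H"
  shows "coset_cocycle (g \<otimes> h) c = coset_cocycle g (coset_perm h c) \<otimes> coset_cocycle h c"
proof -
  have "rep c \<in> carrier G" "rep (coset_perm h c) \<in> carrier G" "rep (coset_perm g (coset_perm h c)) \<in> carrier G"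
    using assms rep_in(2) coset_perm_closed by blast+
  then show ?thesis
    unfolding coset_cocycle_def coset_perm_mult[OF assms] using assms
    by (simp add: m_assoc inv_solve_left)
qed

lemma coset_cocycle_one: "c \<in> rcosets H \<Longrightarrow> coset_cocycle \<one> c = \<one>"
  using rep_in(2) by (simp add: coset_cocycle_def coset_perm_one)

lemma wall_action_induced:
  fixes \<Theta> :: "'a \<Rightarrow> 'z set \<Rightarrow> 'z set"
  assumes act: "wall_action (G\<lparr>carrier := H\<rparr>) \<Theta>"
  shows "wall_action G (induced \<Theta>)"
  unfolding wall_action_def
proof (intro conjI ballI)
  fix g assume g: "g \<in> carrier G"
  have ig: "inv g \<in> carrier G" using g by simp
  have "\<exists>\<pi>. bij \<pi> \<and> finite (\<Theta> h {}) \<and> \<Theta> h = affine_map \<pi> (\<Theta> h {})" if "h \<in> H" for h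
    using is_affineE[OF wall_action_affine[OF act, of h]] that by auto
  then obtain lin where lin: "\<And>h. h \<in> H \<Longrightarrow> bij (lin h)" "\<And>h. h \<in> H \<Longrightarrow> finite (\<Theta> h {})"
    "\<And>h. h \<in> H \<Longrightarrow> \<Theta> h = affine_map (lin h) (\<Theta> h {})" by metis
  define \<pi> where "\<pi> = (\<lambda>(c, z). if c \<in> rcosets H then (coset_perm g c, lin (coset_cocycle g c) z) else (c, z))"
  define D where "D = (\<Union>c\<in>rcosets H. Pair (coset_perm g c) ` \<Theta> (coset_cocycle g c) {})"
  define \<pi>' where "\<pi>' = (\<lambda>(c, z). if c \<in> rcosets H
      then (coset_perm (inv g) c, inv_into UNIV (lin (coset_cocycle g (coset_perm (inv g) c))) z) else (c, z))"
  have "bij \<pi>"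
  proof (rule o_bij[of \<pi>'])
    show "\<pi>' \<circ> \<pi> = id"
      using g coset_cocycle_in lin(1)
      by (auto simp: fun_eq_iff \<pi>_def \<pi>'_def coset_perm_closed coset_perm_inv bij_is_inj)
    show "\<pi> \<circ> \<pi>' = id"
      using g coset_cocycle_in lin(1)
      by (auto simp: fun_eq_iff \<pi>_def \<pi>'_def coset_perm_closed coset_perm_inv bij_is_surj surj_f_inv_f)
  qed
  moreover have "finite D"
    unfolding D_def using fin lin(2) coset_cocycle_in[OF _ g] by auto
  moreover have "induced \<Theta> g = affine_map \<pi> D"
  proof (rule ext, rule Set.set_eqI)
    fix B and x :: "'a set \<times> 'z"
    obtain c z where x: "x = (c, z)" by (cases x)
    show "x \<in> induced \<Theta> g B \<longleftrightarrow> x \<in> affine_map \<pi> D B"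
    proof (cases "c \<in> rcosets H")
      case True
      define d where "d = coset_perm (inv g) c"
      have d: "d \<in> rcosets H" "coset_perm g d = c"
        unfolding d_def using True g coset_perm_closed coset_perm_inv by auto
      have only_d: "e = d" if "e \<in> rcosets H" "coset_perm g e = c" for e
        unfolding d_def using that g coset_perm_inv(1) by auto
      note h = coset_cocycle_in[OF d(1) g]
      have "x \<in> \<pi> ` B \<longleftrightarrow> z \<in> lin (coset_cocycle g d) ` (Pair d -` B)"
      proof
        assume "x \<in> \<pi> ` B"
        then obtain e y where ey: "(e, y) \<in> B" "\<pi> (e, y) = (c, z)" using x by auto
        have "e \<in> rcosets H" using ey(2) True by (auto simp: \<pi>_def split: if_splits)
        then show "z \<in> lin (coset_cocycle g d) ` (Pair d -` B)"
          using ey only_d[of e] by (auto simp: \<pi>_def)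
      next
        assume "z \<in> lin (coset_cocycle g d) ` (Pair d -` B)"
        then obtain y where "(d, y) \<in> B" "z = lin (coset_cocycle g d) y" by auto
        then show "x \<in> \<pi> ` B" using x d by (auto simp: \<pi>_def intro!: image_eqI[of _ _ "(d, y)"])
      qed
      moreover have "x \<in> D \<longleftrightarrow> z \<in> \<Theta> (coset_cocycle g d) {}"
      proof
        assume "x \<in> D"
        then obtain e where e: "e \<in> rcosets H" "x \<in> Pair (coset_perm g e) ` \<Theta> (coset_cocycle g e) {}"
          unfolding D_def by blast
        then have "e = d" "z \<in> \<Theta> (coset_cocycle g e) {}" using only_d x by auto
        then show "z \<in> \<Theta> (coset_cocycle g d) {}" by simp
      next
        assume "z \<in> \<Theta> (coset_cocycle g d) {}"
        then show "x \<in> D" unfolding D_def x using d by (intro UN_I[of d]) auto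
      qed
      moreover have "x \<in> induced \<Theta> g B \<longleftrightarrow> z \<in> \<Theta> (coset_cocycle g d) (Pair d -` B)"
        using True by (simp add: induced_def x d_def)
      moreover have "\<Theta> (coset_cocycle g d) (Pair d -` B) =
          lin (coset_cocycle g d) ` (Pair d -` B) \<triangle> \<Theta> (coset_cocycle g d) {}"
        by (subst lin(3)[OF h]) (simp add: affine_map_def)
      ultimately show ?thesis by (simp add: affine_map_def)
    next
      case False
      have "x \<notin> D" unfolding D_def x using False g coset_perm_closed by auto
      moreover have "x \<in> \<pi> ` B \<longleftrightarrow> x \<in> B"
        using False g coset_perm_closed unfolding x \<pi>_def by (force split: if_splits)
      ultimately show ?thesis using False by (simp add: affine_map_def induced_def x)
    qed
  qed
  ultimately show "is_affine (induced \<Theta> g)" unfolding is_affine_def by blast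
next
  have "\<Theta> \<one> = id" using wall_action_one[OF act] by simp
  then show "induced \<Theta> \<one> = id"
    by (auto simp: fun_eq_iff induced_def coset_perm_one coset_cocycle_one)
next
  fix g h assume gh: "g \<in> carrier G" "h \<in> carrier G"
  show "induced \<Theta> (g \<otimes> h) = induced \<Theta> g \<circ> induced \<Theta> h"
  proof (rule ext, rule Set.set_eqI)
    fix B and x :: "'a set \<times> 'z"
    obtain c z where x: "x = (c, z)" by (cases x)
    show "x \<in> induced \<Theta> (g \<otimes> h) B \<longleftrightarrow> x \<in> (induced \<Theta> g \<circ> induced \<Theta> h) B"
    proof (cases "c \<in> rcosets H")
      case True
      define d where "d = coset_perm (inv g) c"
      define e where "e = coset_perm (inv h) d"
      have d: "d \<in> rcosets H" unfolding d_def using True gh coset_perm_closed by simp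
      have e: "e \<in> rcosets H" "coset_perm h e = d"
        unfolding e_def using d gh coset_perm_closed coset_perm_inv by auto
      have e': "coset_perm (inv (g \<otimes> h)) c = e"
        unfolding e_def d_def using True gh by (simp add: inv_mult_group coset_perm_mult)
      have "Pair d -` induced \<Theta> h B = \<Theta> (coset_cocycle h e) (Pair e -` B)"
        using d by (auto simp: induced_def e_def)
      then have "x \<in> (induced \<Theta> g \<circ> induced \<Theta> h) B \<longleftrightarrow>
          z \<in> \<Theta> (coset_cocycle g d) (\<Theta> (coset_cocycle h e) (Pair e -` B))"
        using True by (simp add: induced_def[of _ g] x d_def)
      also have "\<dots> \<longleftrightarrow> z \<in> \<Theta> (coset_cocycle g d \<otimes> coset_cocycle h e) (Pair e -` B)"
        using wall_action_mult[OF act, of "coset_cocycle g d" "coset_cocycle h e"]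
          coset_cocycle_in gh d e by simp
      also have "coset_cocycle g d \<otimes> coset_cocycle h e = coset_cocycle (g \<otimes> h) e"
        using coset_cocycle_mult[OF gh e(1)] e(2) by simp
      finally show ?thesis using True by (simp add: induced_def[of _ "g \<otimes> h"] x e')
    next
      case False
      then show ?thesis by (simp add: x induced_def)
    qed
  qed
qed

text \<open>
  On the slice over the trivial coset, an element of the subgroup acts as before.
\<close>

lemma escapes_induced:
  assumes act: "wall_action (G\<lparr>carrier := H\<rparr>) \<Theta>" and g: "g \<in> H" and esc: "escapes (G\<lparr>carrier := H\<rparr>) \<Theta> g"
  shows "escapes G (induced \<Theta>) g"
  unfolding escapes_def
proof
  fix k
  interpret S: subgroup H G by (rule H)
  have H1: "H #> \<one> = H" using Hsub by simp
  have slice: "Pair H -` induced \<Theta> h {} = \<Theta> h {}" if h: "h \<in> H" for h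
  proof -
    have hc: "h \<in> carrier G" using h Hsub by blast
    have p: "coset_perm (inv h) H = H"
      using coset_perm_eq[of \<one> "inv h"] hc H1 coset_join2[OF hc H h] by simp
    have "coset_perm h H = H" using coset_perm_inv(2)[OF hc H_in_rcosets] p by simp
    then have "coset_cocycle h H = h" using hc by (simp add: coset_cocycle_def rep_def)
    then show ?thesis using H_in_rcosets p by (auto simp: induced_def)
  qed
  obtain n where n: "k < card (\<Theta> (g [^]\<^bsub>G\<lparr>carrier := H\<rparr>\<^esub> (n::nat)) {})"
    using esc unfolding escapes_def by blast
  have pow: "g [^]\<^bsub>G\<lparr>carrier := H\<rparr>\<^esub> n = g [^] n" by (rule nat_pow_consistent[symmetric])
  have gn: "g [^] n \<in> H" using g by (induction n) auto
  have "finite (induced \<Theta> (g [^] n) {})"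
    using wall_action_affine[OF wall_action_induced[OF act]] is_affine_finite gn Hsub by blast
  then have "card (\<Theta> (g [^] n) {}) \<le> card (induced \<Theta> (g [^] n) {})"
    unfolding slice[OF gn, symmetric] by (intro card_inj_on_le[of "Pair H"]) (auto simp: inj_on_def)
  then show "\<exists>n::nat. k < card (induced \<Theta> (g [^] n) {})" using n unfolding pow by (auto intro: order_less_le_trans)
qed

lemma finite_index_power:
  assumes g: "g \<in> carrier G"
  obtains m :: nat where "0 < m" "g [^] m \<in> H"
proof -
  have "\<not> inj_on (\<lambda>n. H #> g [^] n) (UNIV :: nat set)"
  proof
    assume "inj_on (\<lambda>n. H #> g [^] n) (UNIV :: nat set)"
    moreover have "range (\<lambda>n::nat. H #> g [^] n) \<subseteq> rcosets H" using g by (auto simp: RCOSETS_def)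
    ultimately show False using fin finite_subset finite_imageD infinite_UNIV_nat by blast
  qed
  then obtain i j :: nat where ij: "i < j" "H #> g [^] i = H #> g [^] j"
    unfolding inj_on_def by (metis linorder_neqE_nat)
  have c: "g [^] i \<in> carrier G" "g [^] j \<in> carrier G" "g [^] (j - i) \<in> carrier G" using g by auto
  have "g [^] j \<in> H #> g [^] i" using ij rcos_self[OF c(2) H] by simp
  then obtain h where h: "h \<in> H" "g [^] j = h \<otimes> g [^] i" unfolding r_coset_def by blast
  have "g [^] j = g [^] (j - i) \<otimes> g [^] i" using ij g by (simp add: nat_pow_mult)
  then have "g [^] (j - i) = h" using h c Hsub by (metis right_cancel subsetD)
  then show ?thesis using that[of "j - i"] ij h by simp
qed

end

section \<open>Words in free groups\<close>

lemma flip_flip [simp]: "flip (flip d) = d"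
  by (simp add: flip_def)

lemma flip_neq [simp]: "flip d \<noteq> d" "d \<noteq> flip d"
  by (auto simp: flip_def prod_eq_iff)

definition winv :: "('a \<times> bool) list \<Rightarrow> ('a \<times> bool) list" where
  "winv w = rev (map flip w)"

lemma winv_simps [simp]:
  "winv [] = []" "winv (a @ b) = winv b @ winv a" "winv (d # a) = winv a @ [flip d]"
  "winv (winv a) = a" "length (winv a) = length a" "winv a = [] \<longleftrightarrow> a = []"
  by (simp_all add: winv_def rev_map[symmetric] comp_def)

lemma reduced_append:
  "reduced (a @ b) \<longleftrightarrow> reduced a \<and> reduced b \<and> (a = [] \<or> b = [] \<or> hd b \<noteq> flip (last a))"
  by (auto simp: reduced_def successively_append_iff)

lemma reduced_infix: "reduced (a @ b @ c) \<Longrightarrow> reduced b"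
  by (simp add: reduced_append)

lemma reduced_Nil [simp]: "reduced []" and reduced_singleton [simp]: "reduced [d]"
  by (simp_all add: reduced_def)

lemma reduced_winv: "reduced (winv w) \<longleftrightarrow> reduced w"
proof -
  have "successively (\<lambda>x y. flip x \<noteq> y) w \<longleftrightarrow> successively (\<lambda>x y. y \<noteq> flip x) w"
    by (rule arg_cong[where f = "\<lambda>P. successively P w"]) (auto intro!: ext)
  then show ?thesis
    by (simp add: reduced_def winv_def successively_map rev_map[symmetric])
qed

lemma words_over_simps [simp]:
  "[] \<in> words_over B" "d # a \<in> words_over B \<longleftrightarrow> fst d \<in> B \<and> a \<in> words_over B"
  "a @ b \<in> words_over B \<longleftrightarrow> a \<in> words_over B \<and> b \<in> words_over B"
  "winv a \<in> words_over B \<longleftrightarrow> a \<in> words_over B"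
  by (auto simp: words_over_def winv_def flip_def mem_Times_iff)

lemma not_successively_split:
  assumes "\<not> successively Q xs"
  obtains as x y bs where "xs = as @ [x, y] @ bs" "\<not> Q x y"
proof -
  have "\<exists>as x y bs. xs = as @ [x, y] @ bs \<and> \<not> Q x y" using assms
  proof (induction xs)
    case (Cons x xs)
    show ?case
    proof (cases "successively Q xs")
      case True
      then obtain y ys where "xs = y # ys" "\<not> Q x y" using Cons.prems by (cases xs) auto
      then have "x # xs = [] @ [x, y] @ ys \<and> \<not> Q x y" by simp
      then show ?thesis by blast
    next
      case False
      then obtain as z y bs where "xs = as @ [z, y] @ bs" "\<not> Q z y" using Cons.IH by blast
      then have "x # xs = (x # as) @ [z, y] @ bs \<and> \<not> Q z y" by simp
      then show ?thesis by blast
    qed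
  qed simp
  then show ?thesis using that by blast
qed

lemma not_reduced_split:
  assumes "\<not> reduced w"
  obtains a d b where "w = a @ [d, flip d] @ b"
  using assms unfolding reduced_def by (elim not_successively_split) auto

lemma reduced_product:
  assumes "reduced a" "reduced r"
  obtains a' z r' where "a = a' @ winv z" "r = z @ r'" "reduced (a' @ r')"
proof -
  have "\<exists>a' z r'. a = a' @ winv z \<and> r = z @ r' \<and> reduced (a' @ r')" using assms
  proof (induction a arbitrary: r rule: rev_induct)
    case Nil
    then have "[] = [] @ winv [] \<and> r = [] @ r \<and> reduced ([] @ r)" by simp
    then show ?case by blast
  next
    case (snoc x a)
    show ?case
    proof (cases "r = [] \<or> hd r \<noteq> flip x")
      case True
      then have "a @ [x] = (a @ [x]) @ winv [] \<and> r = [] @ r \<and> reduced ((a @ [x]) @ r)"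
        using snoc.prems reduced_append[of "[x]" r] by (auto simp: reduced_append)
      then show ?thesis by blast
    next
      case False
      then obtain r0 where r: "r = flip x # r0" by (cases r) auto
      then have "reduced r0" using snoc.prems(2) reduced_append[of "[flip x]" r0] by simp
      moreover have "reduced a" using snoc.prems(1) by (simp add: reduced_append)
      ultimately obtain a' z r' where "a = a' @ winv z" "r0 = z @ r'" "reduced (a' @ r')"
        using snoc.IH by blast
      then have "a @ [x] = a' @ winv (flip x # z) \<and> r = (flip x # z) @ r' \<and> reduced (a' @ r')"
        using r by simp
      then show ?thesis by blast
    qed
  qed
  then show ?thesis using that by blast
qed

subsection \<open>Periodic words\<close>

definition power_word :: "nat \<Rightarrow> 'b list \<Rightarrow> 'b list" where
  "power_word n u = concat (replicate n u)"

definition periodic :: "'b list \<Rightarrow> nat \<Rightarrow> 'b" where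
  "periodic u i = u ! (i mod length u)"

definition agree :: "nat \<Rightarrow> 'b list \<Rightarrow> 'b list \<Rightarrow> bool" where
  "agree m u v \<longleftrightarrow> (\<forall>i<m. periodic u i = periodic v i)"

lemma power_word_simps [simp]: "power_word 0 u = []" "power_word (Suc n) u = u @ power_word n u"
  by (simp_all add: power_word_def)

lemma power_word_add: "power_word (m + n) u = power_word m u @ power_word n u"
  by (induction m) auto

lemma power_word_Suc_right: "power_word (Suc n) u = power_word n u @ u"
  using power_word_add[of n 1 u] by simp

lemma length_power_word [simp]: "length (power_word n u) = n * length u"
  by (induction n) auto

lemma winv_power_word: "winv (power_word n u) = power_word n (winv u)"
proof (induction n)
  case (Suc n)
  then show ?case using power_word_Suc_right[of n "winv u"] by simp
qed simp

lemma nth_power_word: "i < n * length u \<Longrightarrow> power_word n u ! i = periodic u i"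
proof (induction n arbitrary: i)
  case (Suc n)
  show ?case
  proof (cases "i < length u")
    case True
    then show ?thesis by (simp add: nth_append periodic_def)
  next
    case False
    then have "power_word (Suc n) u ! i = periodic u (i - length u)"
      using Suc by (simp add: nth_append)
    also have "\<dots> = periodic u i" using False by (simp add: periodic_def le_mod_geq)
    finally show ?thesis .
  qed
qed simp

lemma periodic_rotate: "u \<noteq> [] \<Longrightarrow> periodic (rotate s u) i = periodic u (s + i)"
  by (simp add: periodic_def nth_rotate mod_simps)

lemma periodic_winv_rotate:
  assumes "u \<noteq> []" "i < a"
  shows "periodic (winv (rotate a u)) i = flip (periodic u (a - 1 - i))"
proof -
  let ?n = "length u"
  let ?k = "i mod ?n"
  have k: "?k < ?n" using assms by simp
  have "periodic (winv (rotate a u)) i = flip (rotate a u ! (?n - 1 - ?k))"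
    using k by (simp add: periodic_def winv_def rev_nth)
  also have "rotate a u ! (?n - 1 - ?k) = u ! ((a + (?n - 1 - ?k)) mod ?n)"
    using k by (simp add: nth_rotate)
  also have "(a + (?n - 1 - ?k)) mod ?n = (a - 1 - i) mod ?n"
  proof -
    define p where "p = ?n * (i div ?n)"
    have "i = p + ?k" unfolding p_def by simp
    then have "a + (?n - 1 - ?k) = (a - 1 - i) + (?n + p)" using k assms(2) by linarith
    also have "?n + p = ?n * Suc (i div ?n)" by (simp add: p_def)
    finally show ?thesis by (metis mod_mult_self2)
  qed
  finally show ?thesis by (simp add: periodic_def)
qed

lemma agree_mono: "agree m u v \<Longrightarrow> m' \<le> m \<Longrightarrow> agree m' u v"
  by (auto simp: agree_def)

lemma agree_sym: "agree m u v \<Longrightarrow> agree m v u"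
  by (auto simp: agree_def)

lemma agree_trans: "agree m u v \<Longrightarrow> agree m v w \<Longrightarrow> agree m u w"
  by (auto simp: agree_def)

lemma agree_rotate:
  "agree a u v \<Longrightarrow> u \<noteq> [] \<Longrightarrow> v \<noteq> [] \<Longrightarrow> agree (a - s) (rotate s u) (rotate s v)"
  by (auto simp: agree_def periodic_rotate)

lemma agree_unrotate:
  assumes "agree s u v" "agree m (rotate s u) (rotate s v)" "u \<noteq> []" "v \<noteq> []"
  shows "agree (s + m) u v"
  unfolding agree_def
proof (intro allI impI)
  fix i assume i: "i < s + m"
  show "periodic u i = periodic v i"
  proof (cases "i < s")
    case True
    then show ?thesis using assms(1) by (simp add: agree_def)
  next
    case False
    then have "periodic (rotate s u) (i - s) = periodic (rotate s v) (i - s)"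
      using assms(2) i by (simp add: agree_def)
    then show ?thesis using False assms(3,4) by (simp add: periodic_rotate)
  qed
qed

lemma agree_winv_rotate:
  assumes "agree a u v" "u \<noteq> []" "v \<noteq> []"
  shows "agree a (winv (rotate a u)) (winv (rotate a v))"
  using assms by (auto simp: agree_def periodic_winv_rotate)

lemma agree_power_word:
  assumes "agree (length u * length v) u v"
  shows "power_word (length v) u = power_word (length u) v"
  by (rule nth_equalityI) (use assms in \<open>auto simp: nth_power_word agree_def mult.commute\<close>)

lemma rotate_winv: "rotate s (winv u) = winv (rotate ((length u - 1) * s) u)"
proof (cases "u = []")
  case False
  let ?n = "length u"
  have "rotate s (rev (map flip u)) = rev (rotate (?n - s mod ?n) (map flip u))"
    using rotate_rev[of s "map flip u"] by simp
  also have "rotate (?n - s mod ?n) (map flip u) = rotate ((?n - 1) * s) (map flip u)"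
  proof -
    have "((?n - 1) * s) mod ?n = (?n - s mod ?n) mod ?n"
    proof -
      define q k where "q = s div ?n" and "k = s mod ?n"
      have s: "s = ?n * q + k" and k: "k < ?n" using False by (simp_all add: q_def k_def)
      obtain n' where n': "?n = Suc n'" using k by (cases ?n) auto
      show ?thesis
      proof (cases k)
        case 0
        have "(?n - 1) * s = ?n * ((?n - 1) * q)" using s 0 by simp
        then have "(?n - 1) * s mod ?n = 0" by (metis mod_mult_self1_is_0)
        then show ?thesis using 0 by (simp add: k_def[symmetric])
      next
        case (Suc k')
        have "(?n - 1) * s = n' * (Suc n' * q + Suc k')" using s n' Suc by simp
        also have "\<dots> = (n' - k') + Suc n' * (n' * q + k')"
          using k n' Suc by (simp add: algebra_simps)
        finally have "(?n - 1) * s = (?n - k) + ?n * (n' * q + k')" using n' Suc by simp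
        then show ?thesis unfolding k_def[symmetric] by (metis mod_mult_self2)
      qed
    qed
    then show ?thesis by (metis length_map rotate_conv_mod)
  qed
  finally show ?thesis by (simp add: winv_def rotate_map)
qed simp

definition cyc_reduced :: "('a \<times> bool) list \<Rightarrow> bool" where
  "cyc_reduced u \<longleftrightarrow> u \<noteq> [] \<and> reduced (u @ u)"

lemma cyc_reduced_power_word: "cyc_reduced u \<Longrightarrow> reduced (power_word n u)"
proof (induction n)
  case (Suc n)
  have "power_word n u = [] \<or> hd (power_word n u) = hd u"
    using Suc.prems by (cases n) (auto simp: cyc_reduced_def)
  then show ?case using Suc by (auto simp: cyc_reduced_def reduced_append)
qed simp

lemma cyc_reduced_winv: "cyc_reduced (winv u) \<longleftrightarrow> cyc_reduced u"
  using reduced_winv[of "u @ u"] by (auto simp: cyc_reduced_def)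

lemma cyc_reduced_rotate1: "cyc_reduced u \<Longrightarrow> cyc_reduced (rotate1 u)"
proof (cases u)
  case (Cons x v)
  assume "cyc_reduced u"
  then have "reduced (power_word 3 u)" by (rule cyc_reduced_power_word)
  then have "reduced ([x] @ (rotate1 u @ rotate1 u) @ v)"
    using Cons by (simp add: numeral_3_eq_3)
  then have "reduced (rotate1 u @ rotate1 u)" by (rule reduced_infix)
  then show ?thesis using Cons by (simp add: cyc_reduced_def)
qed simp

lemma cyc_reduced_rotate: "cyc_reduced u \<Longrightarrow> cyc_reduced (rotate n u)"
  by (induction n) (auto simp: cyc_reduced_rotate1)

definition segment :: "('a \<times> bool) list \<Rightarrow> nat \<Rightarrow> nat \<Rightarrow> ('a \<times> bool) list" where
  "segment u i j = map (periodic u) [i..<j]"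

lemma segment_power_word: "segment u 0 (n * length u) = power_word n u"
  by (rule nth_equalityI) (simp_all add: segment_def nth_power_word)

lemma segment_append: "i \<le> j \<Longrightarrow> j \<le> k \<Longrightarrow> segment u i k = segment u i j @ segment u j k"
  unfolding segment_def map_append[symmetric] using upt_add_eq_append[of i j "k - j"] by simp

lemma length_segment [simp]: "length (segment u i j) = j - i"
  by (simp add: segment_def)

lemma periodic_shift [simp]: "periodic u (i + k * length u) = periodic u i"
  by (simp add: periodic_def)

lemma reduced_segment:
  assumes "cyc_reduced u" shows "reduced (segment u i j)"
proof (cases "i \<le> j")
  case True
  have u: "0 < length u" using assms by (simp add: cyc_reduced_def)
  have "j \<le> j * length u" using u by (cases "length u") auto
  moreover from this have "i \<le> j * length u" by (rule order_trans[OF True])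
  ultimately have "power_word j u = segment u 0 i @ segment u i j @ segment u j (j * length u)"
    using True segment_append[of 0 i "j * length u" u] segment_append[of i j "j * length u" u]
    by (simp add: segment_power_word)
  then show ?thesis using cyc_reduced_power_word[OF assms, of j] by (auto simp: reduced_append)
qed (simp add: segment_def)

lemma set_segment: "u \<noteq> [] \<Longrightarrow> set (segment u i j) \<subseteq> set u"
  by (auto simp: segment_def periodic_def)

subsection \<open>Free groups with a basis\<close>

lemma (in group) inv_cancel:
  "a \<in> carrier G \<Longrightarrow> b \<in> carrier G \<Longrightarrow> inv a \<otimes> (a \<otimes> b) = b"
  "a \<in> carrier G \<Longrightarrow> b \<in> carrier G \<Longrightarrow> a \<otimes> (inv a \<otimes> b) = b"
  by (simp_all add: m_assoc[symmetric])

locale based_free_group =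
  fixes F :: "('a, 'm) monoid_scheme" (structure) and B :: "'a set"
  assumes basis: "free_basis F B"
begin

sublocale group F
  using basis by (simp add: free_basis_def)

lemma B_carrier: "B \<subseteq> carrier F"
  using basis by (simp add: free_basis_def)

abbreviation val :: "('a \<times> bool) list \<Rightarrow> 'a" where
  "val \<equiv> word_val F"

lemma val_Nil [simp]: "val [] = \<one>"
  by (simp add: word_val_def)

lemma val_Cons: "val (d # w) = (if snd d then fst d else inv (fst d)) \<otimes> val w"
  by (simp add: word_val_def)

lemma letter_closed: "fst d \<in> B \<Longrightarrow> (if snd d then fst d else inv (fst d)) \<in> carrier F"
  using B_carrier by auto

lemma val_closed [simp]: "w \<in> words_over B \<Longrightarrow> val w \<in> carrier F"
  by (induction w) (auto simp: val_Cons letter_closed simp del: if_image_distrib intro!: m_closed)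

lemma val_append: "a \<in> words_over B \<Longrightarrow> b \<in> words_over B \<Longrightarrow> val (a @ b) = val a \<otimes> val b"
  by (induction a) (simp_all add: val_Cons letter_closed m_assoc)

lemma val_singleton: "fst d \<in> B \<Longrightarrow> val [d] = (if snd d then fst d else inv (fst d))"
  using letter_closed[of d] by (simp add: val_Cons)

lemma val_cancel: "fst d \<in> B \<Longrightarrow> val [d, flip d] = \<one>"
  using B_carrier by (cases d) (auto simp: val_Cons flip_def)

lemma val_winv: "w \<in> words_over B \<Longrightarrow> val (winv w) = inv (val w)"
proof (induction w)
  case (Cons d w)
  then have d: "fst d \<in> B" "fst (flip d) \<in> B" and w: "w \<in> words_over B" by (auto simp: flip_def)
  have "val [flip d] = inv (val [d])"
    using d B_carrier by (auto simp: val_singleton flip_def)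
  then show ?case
    using Cons.IH[OF w] w d val_append[of "winv w" "[flip d]"] val_append[of "[d]" w]
    by (simp add: inv_mult_group)
qed simp

lemma val_power_word: "w \<in> words_over B \<Longrightarrow> val (power_word n w) = val w [^] n"
proof (induction n)
  case (Suc n)
  have "power_word n w \<in> words_over B" using Suc.prems by (induction n) auto
  then have "val (power_word (Suc n) w) = val w \<otimes> val w [^] n"
    using Suc val_append[of w "power_word n w"] by simp
  also have "\<dots> = val w [^] Suc n" using Suc.prems by (intro nat_pow_Suc2[symmetric]) simp
  finally show ?case .
qed simp

lemma power_word_over: "w \<in> words_over B \<Longrightarrow> power_word n w \<in> words_over B"
  by (induction n) auto

lemma reduced_val_inj: "r \<in> reduced_words B \<Longrightarrow> r' \<in> reduced_words B \<Longrightarrow> val r = val r' \<Longrightarrow> r = r'"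
  using basis by (auto simp: free_basis_def bij_betw_def dest: inj_onD)

lemma ex_reduced_word: assumes "g \<in> carrier F" obtains r where "r \<in> reduced_words B" "val r = g"
proof -
  have "g \<in> val ` reduced_words B" using basis assms by (simp add: free_basis_def bij_betw_def)
  then show ?thesis using that by blast
qed

lemma ex_reduction:
  assumes Q: "\<And>a d b. a @ [d, flip d] @ b \<in> words_over B \<Longrightarrow> Q (a @ [d, flip d] @ b) = Q (a @ b)"
    and u: "u \<in> words_over B"
  shows "\<exists>r\<in>reduced_words B. val r = val u \<and> Q r = Q u"
  using u
proof (induction "length u" arbitrary: u rule: less_induct)
  case less
  show ?case
  proof (cases "reduced u")
    case True
    then show ?thesis using less.prems by (auto simp: reduced_words_def)
  next
    case False
    then obtain a d b where u: "u = a @ [d, flip d] @ b" by (rule not_reduced_split)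
    have over: "a \<in> words_over B" "b \<in> words_over B" "fst d \<in> B" "[d, flip d] \<in> words_over B"
      using less.prems u by (auto simp: flip_def)
    have "val u = val (a @ b)"
      unfolding u using over val_cancel[of d] by (simp add: val_append del: append.simps words_over_simps(2))
    moreover have "Q u = Q (a @ b)" using Q less.prems u by simp
    moreover have "\<exists>r\<in>reduced_words B. val r = val (a @ b) \<and> Q r = Q (a @ b)"
      using less.hyps[of "a @ b"] u over by simp
    ultimately show ?thesis by simp
  qed
qed

text \<open>
  The universal property, for functions on words instead of homomorphisms: a function that is
  unchanged by free cancellation depends on the value only.
\<close>

lemma cancellation_invariant:
  assumes Q: "\<And>a d b. a @ [d, flip d] @ b \<in> words_over B \<Longrightarrow> Q (a @ [d, flip d] @ b) = Q (a @ b)"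
    and "u \<in> words_over B" "u' \<in> words_over B" "val u = val u'"
  shows "Q u = Q u'"
  using ex_reduction[of Q u] ex_reduction[of Q u'] assms reduced_val_inj by metis

lemma ex_cyc_reduction:
  assumes "g \<in> carrier F" "g \<noteq> \<one>"
  obtains q c where "q \<in> words_over B" "c \<in> words_over B" "cyc_reduced c"
    "g = val q \<otimes> val c \<otimes> inv (val q)"
proof -
  have "\<exists>q c. q \<in> words_over B \<and> c \<in> words_over B \<and> cyc_reduced c \<and> val r = val q \<otimes> val c \<otimes> inv (val q)"
    if "r \<in> reduced_words B" "r \<noteq> []" for r
    using that
  proof (induction "length r" arbitrary: r rule: less_induct)
    case less
    have r: "r \<in> words_over B" "reduced r" using less.prems by (auto simp: reduced_words_def)
    show ?case
    proof (cases "cyc_reduced r")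
      case True
      then have "[] \<in> words_over B \<and> r \<in> words_over B \<and> cyc_reduced r \<and> val r = val [] \<otimes> val r \<otimes> inv (val [])"
        using r by simp
      then show ?thesis by blast
    next
      case False
      then have h: "hd r = flip (last r)" using r less.prems(2) by (auto simp: cyc_reduced_def reduced_append)
      obtain x s where xs: "r = x # s" using less.prems by (cases r) auto
      have "s \<noteq> []" using xs h by auto
      then obtain t y where ty: "s = t @ [y]" by (cases s rule: rev_cases) auto
      have y: "y = flip x" using h xs ty by simp
      have rr: "r = [x] @ t @ [flip x]" using xs ty y by simp
      have t: "t \<in> words_over B" "reduced t" "fst x \<in> B" "fst (flip x) \<in> B"
        using r reduced_infix[of "[x]" t "[flip x]"] unfolding rr by (auto simp: flip_def)
      have "t \<noteq> []" using r(2) rr by (auto simp: reduced_def)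
      then obtain q c where qc: "q \<in> words_over B" "c \<in> words_over B" "cyc_reduced c"
        "val t = val q \<otimes> val c \<otimes> inv (val q)"
        using less.hyps[of t] t xs ty by (auto simp: reduced_words_def)
      have "val r = val [x] \<otimes> val t \<otimes> val (winv [x])"
        unfolding rr using t by (subst val_append, simp, simp, subst val_append) (simp_all add: m_assoc)
      also have "\<dots> = val (x # q) \<otimes> val c \<otimes> inv (val (x # q))"
        using t qc val_append[of "[x]" q] by (simp add: val_winv inv_mult_group m_assoc del: winv_simps)
      finally show ?thesis using qc t by (metis words_over_simps(2))
    qed
  qed
  moreover obtain r where "r \<in> reduced_words B" "val r = g" using assms(1) by (rule ex_reduced_word)
  moreover then have "r \<noteq> []" using assms(2) by auto
  ultimately show ?thesis using that by metis
qed

lemma cyc_reduced_val_power: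
  assumes "c \<in> words_over B" "cyc_reduced c" "n \<noteq> 0"
  shows "val c [^] (n::nat) \<noteq> \<one>"
proof
  assume "val c [^] n = \<one>"
  then have "val (power_word n c) = val []" using assms by (simp add: val_power_word)
  moreover have "power_word n c \<in> reduced_words B"
    using assms by (simp add: reduced_words_def power_word_over cyc_reduced_power_word)
  ultimately have "power_word n c = []" using reduced_val_inj[of "power_word n c" "[]"] by (simp add: reduced_words_def)
  then have "n * length c = 0" by (metis length_power_word list.size(3))
  then show False using assms by (simp add: cyc_reduced_def)
qed

lemma conj_nat_pow:
  assumes "x \<in> carrier F" "q \<in> carrier F"
  shows "(q \<otimes> x \<otimes> inv q) [^] (n::nat) = q \<otimes> x [^] n \<otimes> inv q"
  using assms by (induction n) (simp_all add: m_assoc inv_cancel)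

lemma torsion_free:
  assumes "g \<in> carrier F" "g \<noteq> \<one>" "n \<noteq> 0"
  shows "g [^] (n::nat) \<noteq> \<one>"
proof -
  obtain q c where qc: "q \<in> words_over B" "c \<in> words_over B" "cyc_reduced c"
    "g = val q \<otimes> val c \<otimes> inv (val q)" using assms ex_cyc_reduction by metis
  have "val q \<otimes> val c [^] n \<otimes> inv (val q) \<noteq> \<one>"
  proof
    assume "val q \<otimes> val c [^] n \<otimes> inv (val q) = \<one>"
    moreover have "inv (val q) \<otimes> (val q \<otimes> val c [^] n \<otimes> inv (val q)) \<otimes> val q = val c [^] n"
      using qc by (simp add: m_assoc inv_cancel)
    ultimately have "val c [^] n = \<one>" using qc by simp
    then show False using cyc_reduced_val_power qc assms(3) by blast
  qed
  then show ?thesis using qc conj_nat_pow by simp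
qed

lemma countable_carrier: assumes "finite B" shows "countable (carrier F)"
proof -
  have "countable (lists (B \<times> (UNIV :: bool set)))"
    using assms by (intro countable_lists countable_finite) auto
  moreover have "reduced_words B \<subseteq> lists (B \<times> UNIV)" by (auto simp: reduced_words_def words_over_def)
  ultimately have "countable (val ` reduced_words B)" using countable_subset by blast
  then show ?thesis using basis by (simp add: free_basis_def bij_betw_def)
qed

end

section \<open>Long powers of independent words\<close>

text \<open>
  The words in \<open>P\<close> are read along a finite number of orbits of lines in the Cayley tree, from all starting
  points.  By the last assumption, words with a common positive power are equal: a line and a direction determine the word that is
  read from a given point.  It implies that different lines have bounded overlaps.
\<close>

locale independent_words = based_free_group F B for F :: "('a, 'm) monoid_scheme" (structure) and B +
  fixes P :: "('a \<times> bool) list set"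
  assumes finP: "finite P"
    and P_over: "p \<in> P \<Longrightarrow> p \<in> words_over B"
    and P_cyc: "p \<in> P \<Longrightarrow> cyc_reduced p"
    and P_rotate: "p \<in> P \<Longrightarrow> rotate1 p \<in> P"
    and P_winv: "p \<in> P \<Longrightarrow> winv p \<notin> P"
    and indep: "p \<in> P \<union> winv ` P \<Longrightarrow> p' \<in> P \<union> winv ` P \<Longrightarrow> 0 < a \<Longrightarrow> 0 < b \<Longrightarrow>
      word_val F p [^] (a::nat) = word_val F p' [^] (b::nat) \<Longrightarrow> p = p'"
begin

definition R where "R = P \<union> winv ` P"

lemma R_over: "p \<in> R \<Longrightarrow> p \<in> words_over B"
  using P_over by (auto simp: R_def)

lemma R_cyc: "p \<in> R \<Longrightarrow> cyc_reduced p"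
  using P_cyc by (auto simp: R_def cyc_reduced_winv)

lemma R_nonempty: "p \<in> R \<Longrightarrow> p \<noteq> []"
  using R_cyc by (auto simp: cyc_reduced_def)

lemma R_winv: "p \<in> R \<Longrightarrow> winv p \<in> R"
  by (auto simp: R_def)

lemma P_in_R: "p \<in> P \<Longrightarrow> p \<in> R"
  by (simp add: R_def)

lemma P_rotate_n: "p \<in> P \<Longrightarrow> rotate n p \<in> P"
  by (induction n) (auto simp: P_rotate)

text \<open>
  A crude form of the theorem of Fine and Wilf: agreement for the product of the two lengths makes the powers
  of this length equal.
\<close>

lemma agree_common_power:
  assumes "u \<in> words_over B" "v \<in> words_over B" "agree (length u * length v) u v"
  shows "val u [^] length v = val v [^] length u"
  using agree_power_word[OF assms(3)] assms by (metis val_power_word)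

definition overlap :: nat where
  "overlap = Max ((\<lambda>(p, p'). length p * length p') ` (R \<times> R) \<union> {0})"

lemma overlap_bound:
  assumes "p \<in> R" "p' \<in> R" "agree overlap p p'"
  shows "p = p'"
proof -
  have "finite R" using finP by (simp add: R_def)
  then have "length p * length p' \<le> overlap"
    unfolding overlap_def using assms(1,2) by (intro Max_ge) force+
  then have "agree (length p * length p') p p'" using assms(3) agree_mono by blast
  then have "val p [^] length p' = val p' [^] length p"
    using assms(1,2) R_over by (intro agree_common_power) auto
  then show ?thesis
    using indep[of p p' "length p'" "length p"] assms(1,2) R_nonempty by (simp add: R_def)
qed

text \<open>
  Bounded cancellation: at most \<open>overlap\<close> letters cancel between consecutive factors, since different lines do
  not overlap for longer, so the first factor remains visible.
\<close>

lemma product_of_long_powers: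
  assumes "us \<noteq> []" "set us \<subseteq> R" "successively (\<lambda>u u'. u' \<noteq> winv u) us" "2 * overlap \<le> K"
  shows "\<exists>w\<in>reduced_words B. val w = val (concat (map (power_word K) us)) \<and> K - overlap \<le> length w \<and>
    (\<forall>i<K - overlap. w ! i = periodic (hd us) i)"
  using assms(1-3)
proof (induction us rule: induct_list012)
  case (2 u)
  then have u: "u \<in> R" by simp
  have len: "1 \<le> length u" using R_nonempty[OF u] by (cases u) auto
  then have lenK: "K \<le> K * length u" by simp
  have "power_word K u \<in> reduced_words B"
    using R_over[OF u] R_cyc[OF u] by (simp add: reduced_words_def power_word_over cyc_reduced_power_word)
  moreover have "K - overlap \<le> length (power_word K u)"
    unfolding length_power_word by (rule order_trans[OF diff_le_self lenK])
  moreover have "power_word K u ! i = periodic u i" if "i < K - overlap" for i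
    using that lenK by (intro nth_power_word) linarith
  ultimately show ?case by (intro bexI[of _ "power_word K u"]) auto
next
  case (3 u u2 us)
  then have u: "u \<in> R" "u2 \<in> R" "u2 \<noteq> winv u" by auto
  obtain w2 where w2: "w2 \<in> reduced_words B" "val w2 = val (concat (map (power_word K) (u2 # us)))"
    "K - overlap \<le> length w2" "\<forall>i<K - overlap. w2 ! i = periodic u2 i"
    using "3.IH"(2) "3.prems" by auto
  have ru: "reduced (power_word K u)" using R_cyc[OF u(1)] by (rule cyc_reduced_power_word)
  obtain a z r where azr: "power_word K u = a @ winv z" "w2 = z @ r" "reduced (a @ r)"
    using reduced_product[OF ru, of w2] w2(1) by (auto simp: reduced_words_def)
  have len: "1 \<le> length u" using R_nonempty[OF u(1)] by (cases u) auto
  then have lenK: "K \<le> K * length u" by simp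
  have "length z < overlap \<or> overlap = 0 \<and> z = []"
  proof (rule ccontr)
    assume *: "\<not> ?thesis"
    have "agree overlap (winv u) u2"
      unfolding agree_def
    proof (intro allI impI)
      fix i assume i: "i < overlap"
      have iz: "i < length z" using * i by linarith
      have "i < K * length u" using i assms(4) lenK by linarith
      then have "periodic (winv u) i = power_word K (winv u) ! i"
        using nth_power_word[of i K "winv u"] by simp
      also have "power_word K (winv u) = z @ winv a"
        using arg_cong[OF azr(1), of winv] by (simp add: winv_power_word)
      also have "(z @ winv a) ! i = w2 ! i" using iz azr(2) by (simp add: nth_append)
      also have "\<dots> = periodic u2 i" using w2(4) i assms(4) by simp
      finally show "periodic (winv u) i = periodic u2 i" .
    qed
    then show False using overlap_bound R_winv u by metis
  qed
  then have z: "length z \<le> overlap" by auto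
  have la: "length a = K * length u - length z" using arg_cong[OF azr(1), of length] by simp
  have lenw: "K - overlap \<le> length a" using la z lenK by linarith
  have over: "a \<in> words_over B" "z \<in> words_over B" "r \<in> words_over B"
    using power_word_over[OF R_over[OF u(1)], of K] w2(1) azr(1,2) by (auto simp: reduced_words_def)
  have usR: "concat (map (power_word K) (u2 # us)) \<in> words_over B"
  proof -
    have "concat (map (power_word K) vs) \<in> words_over B" if "set vs \<subseteq> R" for vs
      using that by (induction vs) (auto simp: power_word_over R_over)
    from this[of "u2 # us"] show ?thesis using "3.prems" by simp
  qed
  have "val (concat (map (power_word K) (u # u2 # us))) = val (power_word K u) \<otimes> val w2"
    using usR power_word_over[OF R_over[OF u(1)], of K] w2(2) by (simp add: val_append)
  also have "\<dots> = val a \<otimes> inv (val z) \<otimes> (val z \<otimes> val r)"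
    unfolding azr(1,2) using over by (simp add: val_append val_winv)
  also have "\<dots> = val (a @ r)" using over by (simp add: val_append m_assoc inv_cancel)
  finally have "val (a @ r) = val (concat (map (power_word K) (u # u2 # us)))" by simp
  moreover have "a @ r \<in> reduced_words B" using azr(3) over by (simp add: reduced_words_def)
  moreover have "(a @ r) ! i = periodic u i" if "i < K - overlap" for i
  proof -
    have "(a @ r) ! i = power_word K u ! i" using that lenw by (simp add: azr(1) nth_append)
    also have "\<dots> = periodic u i" using that lenK by (intro nth_power_word) linarith
    finally show ?thesis .
  qed
  ultimately show ?case using lenw by (intro bexI[of _ "a @ r"]) auto
qed simp

text \<open>
  A line is left by the axis at the end of a maximal stretch.  The constant leaves room for two consecutive vertices that
  have more than \<open>overlap\<close> letters of the stretch on either side.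
\<close>

definition stretch :: nat where "stretch = 2 * overlap + 5"

definition clear :: "('a \<times> bool) list \<Rightarrow> bool" where
  "clear c \<longleftrightarrow> (\<forall>v\<in>P. \<not> agree stretch c v \<and> \<not> agree stretch (winv c) v)"

lemma clear_winv: "clear (winv c) \<longleftrightarrow> clear c"
  by (auto simp: clear_def)

text \<open>
  If a line follows the axis for a maximal stretch, then no line does so from a vertex close to the end of this
  stretch: a second line would overlap the first one for too long, and the first one is about to leave.
\<close>

lemma ex_clear_edge:
  assumes c: "c \<in> words_over B" "c \<noteq> []"
    and unrelated: "\<And>i v a b. v \<in> R \<Longrightarrow> 0 < a \<Longrightarrow> 0 < b \<Longrightarrow>
      val (rotate i c) [^] (a::nat) \<noteq> val v [^] (b::nat)"
  shows "\<exists>j. clear (rotate j c) \<and> clear (rotate (Suc j) c)"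
proof (rule ccontr)
  assume none: "\<not> ?thesis"
  have rot_over: "rotate i c \<in> words_over B" for i using c by (auto simp: words_over_def)
  have no_agree: "\<not> agree (length c * length v) (rotate i c) v" "\<not> agree (length c * length v) (winv (rotate i c)) v"
    if v: "v \<in> R" for i v
  proof -
    have ne: "0 < length c" "0 < length v" using c R_nonempty[OF v] by auto
    show "\<not> agree (length c * length v) (rotate i c) v"
      using agree_common_power[of "rotate i c" v] rot_over R_over[OF v] unrelated[OF v ne(2,1)] by auto
    show "\<not> agree (length c * length v) (winv (rotate i c)) v"
    proof
      assume "agree (length c * length v) (winv (rotate i c)) v"
      then have "val (winv (rotate i c)) [^] length v = val v [^] length c"
        using agree_common_power[of "winv (rotate i c)" v] rot_over R_over[OF v] by simp
      then have "inv (val (rotate i c) [^] length v) = val v [^] length c"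
        using rot_over by (simp add: val_winv nat_pow_inv)
      then have "val (rotate i c) [^] length v = inv (val v [^] length c)"
        using rot_over R_over[OF v] by (metis inv_inv nat_pow_closed val_closed)
      then have "val (rotate i c) [^] length v = val (winv v) [^] length c"
        using R_over[OF v] by (simp add: val_winv nat_pow_inv)
      then show False using unrelated[OF R_winv[OF v] ne(2,1)] by blast
    qed
  qed
  \<comment> \<open>a line that follows the axis, in one of the two directions, and leaves it after \<open>a\<close> letters\<close>
  obtain i v where v: "v \<in> P" and "agree stretch (rotate i c) v \<or> agree stretch (winv (rotate i c)) v"
    using none unfolding clear_def by blast
  then obtain c' where c': "c' = rotate i c \<or> c' = winv (rotate i c)" and ag: "agree stretch c' v" by blast
  have c'ne: "c' \<noteq> []" "v \<noteq> []" using c' c R_nonempty[OF P_in_R[OF v]] by (metis rotate_is_Nil_conv winv_simps(6), simp)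
  have ex: "\<exists>n. \<not> agree n c' v" using c' no_agree[OF P_in_R[OF v]] by blast
  define a where "a = (LEAST n. \<not> agree n c' v) - 1"
  have least: "\<not> agree (LEAST n. \<not> agree n c' v) c' v" using ex by (rule LeastI_ex)
  have pos: "(LEAST n. \<not> agree n c' v) = Suc a"
  proof (cases "LEAST n. \<not> agree n c' v")
    case 0
    then show ?thesis using least by (simp add: agree_def)
  qed (simp add: a_def)
  then have a: "agree a c' v" "\<not> agree (Suc a) c' v"
    using least not_less_Least[of a "\<lambda>n. \<not> agree n c' v"] by simp_all
  have stretch_a: "stretch \<le> a" using ag a(2) agree_mono[of stretch c' v "Suc a"] by (metis not_less_eq_eq)
  have clear: "clear (rotate s c')" if s: "s + overlap + 2 = a \<or> s + overlap + 1 = a" for s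
    unfolding clear_def
  proof (intro ballI conjI notI)
    have tail: "agree (a - s) (rotate s c') (rotate s v)" using agree_rotate[OF a(1)] c'ne by blast
    have rv: "rotate s v \<in> P" using P_rotate_n[OF v] .
    fix v2 assume v2: "v2 \<in> P"
    {
      assume A: "agree stretch (rotate s c') v2"
      have "overlap \<le> a - s" "overlap \<le> stretch" using s by (auto simp: stretch_def)
      then have "agree overlap (rotate s v) v2"
        using agree_trans[OF agree_sym[OF agree_mono[OF tail]] agree_mono[OF A]] by blast
      then have "rotate s v = v2" using overlap_bound P_in_R rv v2 by blast
      then have "agree (s + stretch) c' v"
        using agree_unrotate[of s c' v stretch] A agree_mono[OF a(1), of s] s c'ne by auto
      moreover have "Suc a \<le> s + stretch" using s by (auto simp: stretch_def)
      ultimately show False using a(2) agree_mono by blast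
    next
      assume A: "agree stretch (winv (rotate s c')) v2"
      have "s \<le> a" using s by auto
      then have w: "agree s (winv (rotate s c')) (winv (rotate s v))"
        using agree_winv_rotate[OF agree_mono[OF a(1)]] c'ne by blast
      have "overlap \<le> s" "overlap \<le> stretch" using s stretch_a by (auto simp: stretch_def)
      then have "agree overlap (winv (rotate s v)) v2"
        using agree_trans[OF agree_sym[OF agree_mono[OF w]] agree_mono[OF A]] by blast
      then have "winv (rotate s v) = v2" using overlap_bound R_winv P_in_R rv v2 by blast
      then show False using P_winv[OF rv] v2 by simp
    }
  qed
  define s where "s = a - overlap - 2"
  have "s + overlap + 2 = a" "Suc s + overlap + 1 = a" using stretch_a by (simp_all add: s_def stretch_def)
  then have s: "clear (rotate s c')" "clear (rotate (Suc s) c')" using clear by blast+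
  show False
  proof (cases "c' = rotate i c")
    case True
    then have "clear (rotate (s + i) c) \<and> clear (rotate (Suc (s + i)) c)"
      using s by (simp add: rotate_rotate del: rotate_Suc)
    then show False using none by blast
  next
    case False
    then have c': "c' = winv (rotate i c)" using c' by simp
    define t where "t \<sigma> = (length c - 1) * \<sigma> + i" for \<sigma>
    have rt: "rotate \<sigma> c' = winv (rotate (t \<sigma>) c)" for \<sigma>
      unfolding c' rotate_winv t_def by (simp add: rotate_rotate)
    have "Suc (t (Suc s)) mod length c = t s mod length c"
    proof -
      obtain n where n: "length c = Suc n" using c(2) by (cases c) auto
      have "Suc (t (Suc s)) = t s + length c" using n by (simp add: t_def)
      then show ?thesis by simp
    qed
    then have "rotate (Suc (t (Suc s))) c = rotate (t s) c" by (metis rotate_conv_mod)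
    then have "clear (rotate (t (Suc s)) c) \<and> clear (rotate (Suc (t (Suc s))) c)"
      using s unfolding rt clear_winv by simp
    then show False using none by blast
  qed
qed

text \<open>
  With this exponent, \<open>stretch\<close> letters of each factor survive the cancellation on both sides.
\<close>

definition exponent :: nat where "exponent = stretch + 2 * overlap"

text \<open>
  The product starts with a long power of a word in \<open>P\<close>, up to bounded cancellation.  A product that ends on the axis
  is a segment of the axis, which would follow a line from a clear vertex.
\<close>

lemma clear_leaves_axis:
  assumes c: "c \<in> words_over B" "cyc_reduced c" and clear: "clear (rotate i c)"
    and us: "us \<noteq> []" "set us \<subseteq> R" "hd us \<in> P" "successively (\<lambda>u u'. u' \<noteq> winv u) us"
  shows "val (segment c 0 i') \<noteq> val (segment c 0 i) \<otimes> val (concat (map (power_word exponent) us))"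
proof
  assume eq: "val (segment c 0 i') = val (segment c 0 i) \<otimes> val (concat (map (power_word exponent) us))"
  have ne: "c \<noteq> []" using c by (simp add: cyc_reduced_def)
  obtain w where w: "w \<in> reduced_words B" "val w = val (concat (map (power_word exponent) us))"
    "exponent - overlap \<le> length w" "\<forall>i<exponent - overlap. w ! i = periodic (hd us) i"
    using product_of_long_powers[OF us(1,2,4), of exponent] by (auto simp: exponent_def)
  have over: "segment c j k \<in> words_over B" for j k
    using set_segment[OF ne] c(1) by (fastforce simp: words_over_def)
  have w_over: "w \<in> words_over B" using w(1) by (simp add: reduced_words_def)
  have st: "stretch \<le> exponent - overlap" "0 < stretch" by (simp_all add: exponent_def stretch_def)
  have from_val: "val w = inv (val (segment c 0 i)) \<otimes> val (segment c 0 i')"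
    using eq w(2) over w_over by (metis inv_cancel(1) val_closed)
  consider "i \<le> i'" | "i' < i" by linarith
  then show False
  proof cases
    case 1
    have "val (segment c 0 i') = val (segment c 0 i) \<otimes> val (segment c i i')"
      using segment_append[of 0 i i' c] 1 over by (simp add: val_append)
    then have "val w = val (segment c i i')" using from_val over by (simp add: inv_cancel)
    then have weq: "w = segment c i i'"
      using w(1) over reduced_segment[OF c(2)] by (intro reduced_val_inj) (auto simp: reduced_words_def)
    have "agree stretch (rotate i c) (hd us)"
      unfolding agree_def
    proof (intro allI impI)
      fix k assume k: "k < stretch"
      have "w ! k = periodic (rotate i c) k"
        using k st w(3) ne unfolding weq by (simp add: segment_def periodic_rotate)
      then show "periodic (rotate i c) k = periodic (hd us) k" using w(4) k st by auto
    qed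
    then show False using clear us(3) by (auto simp: clear_def)
  next
    case 2
    have "val (segment c 0 i) = val (segment c 0 i') \<otimes> val (segment c i' i)"
      using segment_append[of 0 i' i c] 2 over by (simp add: val_append)
    then have "val w = val (winv (segment c i' i))"
      using from_val over by (simp add: inv_mult_group m_assoc val_winv)
    then have weq: "w = winv (segment c i' i)"
      using w(1) over reduced_segment[OF c(2)]
      by (intro reduced_val_inj) (auto simp: reduced_words_def reduced_winv)
    have "agree stretch (winv (rotate i c)) (hd us)"
      unfolding agree_def
    proof (intro allI impI)
      fix k assume k: "k < stretch"
      have kl: "k < i - i'" using k st w(3) unfolding weq by simp
      have "w ! k = flip (periodic c (i - 1 - k))"
        using kl unfolding weq by (simp add: winv_def rev_nth segment_def)
      also have "\<dots> = periodic (winv (rotate i c)) k" using periodic_winv_rotate[OF ne, of k i] kl by simp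
      finally show "periodic (winv (rotate i c)) k = periodic (hd us) k" using w(4) k st by auto
    qed
    then show False using clear us(3) by (auto simp: clear_def)
  qed
qed

subsection \<open>Alternating products\<close>

fun alternating :: "bool \<Rightarrow> ('a \<times> bool) list list \<Rightarrow> ('a \<times> bool) list list" where
  "alternating s [] = []"
| "alternating s (v # vs) = (if s then v else winv v) # alternating (\<not> s) vs"

abbreviation alt_val :: "bool \<Rightarrow> ('a \<times> bool) list list \<Rightarrow> 'a" where
  "alt_val s vs \<equiv> val (concat (map (power_word exponent) (alternating s vs)))"

lemma alternating_append:
  "alternating s (vs @ ws) = alternating s vs @ alternating (s = even (length vs)) ws"
proof (induction vs arbitrary: s)
  case (Cons v vs)
  have "((\<not> s) = even (length vs)) = (s = even (length (v # vs)))" by auto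
  then show ?case using Cons[of "\<not> s"] by simp
qed simp

lemma alternating_R: "set vs \<subseteq> P \<Longrightarrow> set (alternating s vs) \<subseteq> R"
  by (induction vs arbitrary: s) (auto simp: R_def)

lemma powers_over: "set us \<subseteq> R \<Longrightarrow> concat (map (power_word k) us) \<in> words_over B"
  by (induction us) (auto simp: power_word_over R_over)

lemma alt_val_append:
  assumes "set vs \<subseteq> P" "set ws \<subseteq> P"
  shows "alt_val s (vs @ ws) = alt_val s vs \<otimes> alt_val (s = even (length vs)) ws"
  using assms alternating_R powers_over by (simp add: alternating_append val_append)

lemma alt_val_closed: "set vs \<subseteq> P \<Longrightarrow> alt_val s vs \<in> carrier F"
  using alternating_R powers_over by simp

lemma alt_val_singleton:
  assumes "v \<in> P"
  shows "alt_val s [v] = (if s then val v [^] exponent else inv (val v [^] exponent))"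
  using assms P_over by (auto simp: val_power_word val_winv nat_pow_inv)

text \<open>
  Equal neighbours in an alternating product are inverse to each other.  Cancelling them keeps the parity of the
  length, and ends with a product without cancellation between consecutive long powers.
\<close>

lemma alt_val_reduce:
  assumes "set vs \<subseteq> V" "V \<subseteq> P"
  shows "\<exists>ws. set ws \<subseteq> V \<and> alt_val s ws = alt_val s vs \<and> even (length ws) = even (length vs) \<and>
    successively (\<noteq>) ws"
  using assms(1)
proof (induction "length vs" arbitrary: vs rule: less_induct)
  case less
  show ?case
  proof (cases "successively (\<noteq>) vs")
    case False
    then obtain a v b where vs: "vs = a @ [v, v] @ b" by (elim not_successively_split) auto
    then have P: "set a \<subseteq> P" "v \<in> P" "set b \<subseteq> P" using less.prems assms(2) by auto
    have vv: "alt_val t [v, v] = \<one>" for t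
      using alt_val_append[of "[v]" "[v]" t] P(2) P_over[OF P(2)] by (cases t) (simp_all add: alt_val_singleton del: alternating.simps)
    let ?s = "s = even (length a)"
    have "alt_val ?s ([v, v] @ b) = alt_val ?s [v, v] \<otimes> alt_val (?s = even (length [v, v])) b"
      using P by (intro alt_val_append) auto
    also have "\<dots> = alt_val ?s b" using P alt_val_closed[of b] by (simp add: vv del: alternating.simps)
    finally have "alt_val s vs = alt_val s (a @ b)"
      unfolding vs using P alt_val_append[of a "[v, v] @ b" s] alt_val_append[of a b s] by simp
    moreover have "\<exists>ws. set ws \<subseteq> V \<and> alt_val s ws = alt_val s (a @ b) \<and>
        even (length ws) = even (length (a @ b)) \<and> successively (\<noteq>) ws"
      using less.hyps[of "a @ b"] less.prems vs by auto
    ultimately show ?thesis using vs by auto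
  qed (use less.prems in blast)
qed

lemma alternating_no_cancel:
  assumes "set vs \<subseteq> P" "successively (\<noteq>) vs"
  shows "successively (\<lambda>u u'. u' \<noteq> winv u) (alternating s vs)"
  using assms
proof (induction vs arbitrary: s rule: induct_list012)
  case (3 v v' vs)
  have vv: "v \<noteq> v'" and sub: "set (v' # vs) \<subseteq> P" "successively (\<noteq>) (v' # vs)" using 3 by simp_all
  then have "winv v' \<noteq> winv v" by (metis winv_simps(4))
  moreover have "successively (\<lambda>u u'. u' \<noteq> winv u) (alternating (\<not> s) (v' # vs))"
    using "3.IH"(2) sub by blast
  ultimately show ?case using vv by (cases s) simp_all
qed auto

text \<open>
  The stabiliser of a wall, where \<open>V\<close> are the lines through an edge: the wall contains the images of the edge
  under the elements \<open>alt_val True vs\<close>, those for lists of odd length with the opposite orientation.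
\<close>

definition wall_group :: "('a \<times> bool) list set \<Rightarrow> 'a set" where
  "wall_group V = generate F ((\<lambda>(v, v'). val v [^] exponent \<otimes> inv (val v' [^] exponent)) ` (V \<times> V))"

lemma wall_group_alternating:
  assumes "V \<subseteq> P" "x \<in> wall_group V"
  shows "\<exists>vs. set vs \<subseteq> V \<and> even (length vs) \<and> x = alt_val True vs"
  using assms(2) unfolding wall_group_def
proof (induction rule: generate.induct)
  case one
  show ?case by (intro exI[of _ "[]"]) simp
next
  case (incl h)
  then obtain v v' where v: "v \<in> V" "v' \<in> V" "h = val v [^] exponent \<otimes> inv (val v' [^] exponent)" by auto
  then have "v \<in> P" "v' \<in> P" using assms(1) by auto
  then have "h = alt_val True [v, v']"
    using v(3) alt_val_append[of "[v]" "[v']" True] by (simp add: alt_val_singleton del: alternating.simps)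
  then show ?case using v by (intro exI[of _ "[v, v']"]) simp
next
  case (inv h)
  then obtain v v' where v: "v \<in> V" "v' \<in> V" "h = val v [^] exponent \<otimes> inv (val v' [^] exponent)" by auto
  moreover have "val v \<in> carrier F" "val v' \<in> carrier F" using v assms(1) P_over by auto
  ultimately have "inv h = val v' [^] exponent \<otimes> inv (val v [^] exponent)" by (simp add: inv_mult_group)
  moreover have "v \<in> P" "v' \<in> P" using v assms(1) by auto
  ultimately have "inv h = alt_val True [v', v]"
    using alt_val_append[of "[v']" "[v]" True] by (simp add: alt_val_singleton del: alternating.simps)
  then show ?case using v by (intro exI[of _ "[v', v]"]) simp
next
  case (eng h1 h2)
  then obtain vs1 vs2 where "set vs1 \<subseteq> V" "even (length vs1)" "h1 = alt_val True vs1"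
    "set vs2 \<subseteq> V" "even (length vs2)" "h2 = alt_val True vs2" by blast
  then show ?case using alt_val_append[of vs1 vs2 True] assms(1)
    by (intro exI[of _ "vs1 @ vs2"]) auto
qed

text \<open>
  Elements of the wall group are alternating products of even length, and those in the second case of odd
  length.  Unless it is empty, such a product leaves the axis at a clear vertex.
\<close>

lemma clear_isolated:
  assumes c: "c \<in> words_over B" "cyc_reduced c" and clear: "clear (rotate i c)"
    and V: "V \<subseteq> P" and x: "x \<in> wall_group V"
  shows "val (segment c 0 i') = val (segment c 0 i) \<otimes> x \<Longrightarrow> x = \<one>"
    and "v \<in> V \<Longrightarrow> val (segment c 0 i') \<noteq> val (segment c 0 i) \<otimes> (x \<otimes> val v [^] exponent)"
proof -
  have leave: "val (segment c 0 i') \<noteq> val (segment c 0 i) \<otimes> alt_val True ws"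
    if ws: "set ws \<subseteq> V" "successively (\<noteq>) ws" "ws \<noteq> []" for ws
  proof (rule clear_leaves_axis[OF c clear])
    obtain v ws' where "ws = v # ws'" using ws(3) by (cases ws) auto
    then show "alternating True ws \<noteq> []" "hd (alternating True ws) \<in> P" using ws V by auto
    have "set ws \<subseteq> P" using ws(1) V by blast
    then show "set (alternating True ws) \<subseteq> R" "successively (\<lambda>u u'. u' \<noteq> winv u) (alternating True ws)"
      using ws(2) alternating_R alternating_no_cancel by blast+
  qed
  obtain vs where vs: "set vs \<subseteq> V" "even (length vs)" "x = alt_val True vs"
    using wall_group_alternating[OF V x] by blast
  show "x = \<one>" if "val (segment c 0 i') = val (segment c 0 i) \<otimes> x"
  proof -
    obtain ws where ws: "set ws \<subseteq> V" "alt_val True ws = alt_val True vs" "successively (\<noteq>) ws"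
      using alt_val_reduce[OF vs(1) V] by blast
    then have "ws = []" using leave[of ws] that vs by auto
    then show ?thesis using ws vs by simp
  qed
  show "val (segment c 0 i') \<noteq> val (segment c 0 i) \<otimes> (x \<otimes> val v [^] exponent)" if v: "v \<in> V"
  proof -
    have "set (vs @ [v]) \<subseteq> V" using vs v by simp
    then obtain ws where ws: "set ws \<subseteq> V" "alt_val True ws = alt_val True (vs @ [v])"
      "even (length ws) = even (length (vs @ [v]))" "successively (\<noteq>) ws"
      using alt_val_reduce[OF _ V] by blast
    have "ws \<noteq> []" using ws(3) vs(2) by auto
    then have "val (segment c 0 i') \<noteq> val (segment c 0 i) \<otimes> alt_val True (vs @ [v])"
      using leave[of ws] ws by simp
    moreover have "alt_val True (vs @ [v]) = x \<otimes> val v [^] exponent"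
      using alt_val_append[of vs "[v]" True] vs v V by (auto simp: alt_val_singleton simp del: alternating.simps)
    ultimately show ?thesis by simp
  qed
qed

end

section \<open>The universal property of a splitting\<close>

locale split_group = group G for G :: "'g monoid" (structure) +
  fixes \<G> :: "('v, 'e, 'g) graph_of_groups" and s :: "'e \<Rightarrow> 'g"
  assumes splits: "splits_as G \<G> s"
begin

abbreviation VG where "VG v \<equiv> carrier (vgrp \<G> v)"
abbreviation EG where "EG e \<equiv> carrier (egrp \<G> e)"
abbreviation val where "val \<equiv> gog_val G s"
abbreviation path where "path \<equiv> walk (gog_letters \<G>) (gog_org \<G>) (gog_ter \<G>)"

lemma wf: "wf_graph_of_groups \<G>"
  using splits by (simp add: splits_as_def)

lemma ends_in_verts: "e \<in> arcs \<G> \<Longrightarrow> tail \<G> e \<in> verts \<G>" "e \<in> arcs \<G> \<Longrightarrow> head \<G> e \<in> verts \<G>"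
  using wf by (auto simp: wf_graph_of_groups_def wf_digraph_def pre_digraph.defs)

lemma VG_subgroup: "v \<in> verts \<G> \<Longrightarrow> subgroup (VG v) G"
  using splits by (simp add: splits_as_def)

lemma VG_carrier: "v \<in> verts \<G> \<Longrightarrow> g \<in> VG v \<Longrightarrow> g \<in> carrier G"
  using VG_subgroup subgroup.subset by blast

lemma vgrp_ops:
  assumes "v \<in> verts \<G>"
  shows "x \<otimes>\<^bsub>vgrp \<G> v\<^esub> y = x \<otimes> y" "\<one>\<^bsub>vgrp \<G> v\<^esub> = \<one>"
proof -
  have *: "vgrp \<G> v = G\<lparr>carrier := VG v\<rparr>" using splits assms by (simp add: splits_as_def)
  show "x \<otimes>\<^bsub>vgrp \<G> v\<^esub> y = x \<otimes> y" "\<one>\<^bsub>vgrp \<G> v\<^esub> = \<one>" by (subst *, simp)+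
qed

lemma s_closed [simp]: "e \<in> arcs \<G> \<Longrightarrow> s e \<in> carrier G"
  using splits by (simp add: splits_as_def)

lemma edge_relation: "e \<in> arcs \<G> \<Longrightarrow> c \<in> EG e \<Longrightarrow> s e \<otimes> head_emb \<G> e c \<otimes> inv (s e) = tail_emb \<G> e c"
  using splits by (simp add: splits_as_def)

lemma emb_closed:
  assumes "e \<in> arcs \<G>" "c \<in> EG e"
  shows "tail_emb \<G> e c \<in> VG (tail \<G> e)" "head_emb \<G> e c \<in> VG (head \<G> e)"
  using assms wf by (auto simp: wf_graph_of_groups_def mon_def hom_def)

lemma letter_val_closed: "x \<in> gog_letters \<G> \<Longrightarrow> letter_val G s x \<in> carrier G"
  using VG_carrier by (auto simp: gog_letters_def)

lemma val_Nil [simp]: "val [] = \<one>"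
  by (simp add: gog_val_def)

lemma val_Cons: "val (x # w) = letter_val G s x \<otimes> val w"
  by (simp add: gog_val_def)

lemma path_letters: "path v w v' \<Longrightarrow> set w \<subseteq> gog_letters \<G>"
  by (induction w arbitrary: v) auto

lemma val_closed: "set w \<subseteq> gog_letters \<G> \<Longrightarrow> val w \<in> carrier G"
  by (induction w) (auto simp: val_Cons letter_val_closed)

lemma val_append: "set u \<subseteq> gog_letters \<G> \<Longrightarrow> set w \<subseteq> gog_letters \<G> \<Longrightarrow> val (u @ w) = val u \<otimes> val w"
  by (induction u) (auto simp: val_Cons letter_val_closed val_closed m_assoc)

lemma relation_val: "(l, r) \<in> gog_relations \<G> \<Longrightarrow> val l = val r"
proof (induction rule: gog_relations.induct)
  case (edge e c)
  then show ?case
    using edge_relation[of e c] emb_closed[of e c] ends_in_verts[of e] VG_carrier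
    by (simp add: val_Cons m_assoc)
qed (auto simp: val_Cons vgrp_ops VG_carrier)

lemma loops_letters: "w \<in> gog_loops \<G> v \<Longrightarrow> set w \<subseteq> gog_letters \<G>"
  using path_letters by (auto simp: gog_loops_def)

lemma val_homotopic:
  assumes "homotopic_in (gog_loops \<G> v) (gog_relations \<G>) u w"
  shows "val u = val w"
proof (rule homotopic_in_invariant[OF assms])
  fix x l r y assume *: "(l, r) \<in> gog_relations \<G>" "x @ l @ y \<in> gog_loops \<G> v" "x @ r @ y \<in> gog_loops \<G> v"
  then show "val (x @ l @ y) = val (x @ r @ y)"
    using loops_letters[OF *(2)] loops_letters[OF *(3)] relation_val[OF *(1)] by (simp add: val_append)
qed

lemma val_class:
  assumes "w \<in> gog_loops \<G> v"
  shows "the_elem (val ` homotopy_class (gog_loops \<G> v) (gog_relations \<G>) w) = val w"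
proof -
  have "val ` homotopy_class (gog_loops \<G> v) (gog_relations \<G>) w = {val w}"
    using assms val_homotopic homotopic_in_refl by (fastforce simp: homotopy_class_def)
  then show ?thesis by simp
qed

lemma pi1_carrier: "carrier (gog_pi1 \<G> v) = homotopy_class (gog_loops \<G> v) (gog_relations \<G>) ` gog_loops \<G> v"
  by (simp add: gog_pi1_def loop_group_def)

lemma pi1_bij: "v \<in> verts \<G> \<Longrightarrow> bij_betw (\<lambda>A. the_elem (val ` A)) (carrier (gog_pi1 \<G> v)) (carrier G)"
  using splits by (simp add: splits_as_def iso_def)

lemma ex_loop: assumes "v \<in> verts \<G>" "g \<in> carrier G" obtains w where "w \<in> gog_loops \<G> v" "val w = g"
proof -
  have "g \<in> (\<lambda>A. the_elem (val ` A)) ` carrier (gog_pi1 \<G> v)"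
    using pi1_bij[OF assms(1)] assms(2) by (simp add: bij_betw_def)
  then show ?thesis using that val_class unfolding pi1_carrier by force
qed

lemma homotopic_of_val:
  assumes "v \<in> verts \<G>" "u \<in> gog_loops \<G> v" "w \<in> gog_loops \<G> v" "val u = val w"
  shows "homotopic_in (gog_loops \<G> v) (gog_relations \<G>) u w"
proof -
  let ?c = "homotopy_class (gog_loops \<G> v) (gog_relations \<G>)"
  have "inj_on (\<lambda>A. the_elem (val ` A)) (?c ` gog_loops \<G> v)"
    using pi1_bij[OF assms(1)] by (simp add: bij_betw_def pi1_carrier)
  then have "?c u = ?c w" 
    by (rule inj_onD) (use assms in \<open>simp_all add: val_class\<close>)
  moreover have "w \<in> ?c w" using assms(3) homotopic_in_refl by (auto simp: homotopy_class_def)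
  ultimately show ?thesis by (auto simp: homotopy_class_def)
qed

subsection \<open>Evaluation of words\<close>

definition eval :: "(('v, 'e, 'g) gog_letter \<Rightarrow> 'x \<Rightarrow> 'x) \<Rightarrow> ('v, 'e, 'g) gog_letter list \<Rightarrow> 'x \<Rightarrow> 'x" where
  "eval \<alpha> w = foldr (\<lambda>x f. \<alpha> x \<circ> f) w id"

definition compatible :: "(('v, 'e, 'g) gog_letter \<Rightarrow> 'x \<Rightarrow> 'x) \<Rightarrow> bool" where
  "compatible \<alpha> \<longleftrightarrow> (\<forall>(l, r) \<in> gog_relations \<G>. eval \<alpha> l = eval \<alpha> r)"

text \<open>
  For a compatible \<open>\<alpha>\<close> the choice of the loop does not matter, as words with the same value are homotopic.
\<close>

definition extension :: "(('v, 'e, 'g) gog_letter \<Rightarrow> 'x \<Rightarrow> 'x) \<Rightarrow> 'v \<Rightarrow> 'g \<Rightarrow> 'x \<Rightarrow> 'x" where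
  "extension \<alpha> v g = eval \<alpha> (SOME w. w \<in> gog_loops \<G> v \<and> val w = g)"

lemma eval_simps [simp]:
  "eval \<alpha> [] = id" "eval \<alpha> (x # w) = \<alpha> x \<circ> eval \<alpha> w" "eval \<alpha> (u @ w) = eval \<alpha> u \<circ> eval \<alpha> w"
  by (simp_all add: eval_def) (induction u, simp_all add: comp_assoc)

lemma compatible_iff:
  "compatible \<alpha> \<longleftrightarrow>
    (\<forall>v\<in>verts \<G>. \<alpha> (Grp v \<one>) = id \<and> (\<forall>g\<in>VG v. \<forall>h\<in>VG v. \<alpha> (Grp v g) \<circ> \<alpha> (Grp v h) = \<alpha> (Grp v (g \<otimes> h)))) \<and>
    (\<forall>e\<in>arcs \<G>. (\<forall>b. \<alpha> (Dart e b) \<circ> \<alpha> (Dart e (\<not> b)) = id) \<and>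
      (\<forall>c\<in>EG e. \<alpha> (Dart e True) \<circ> \<alpha> (Grp (head \<G> e) (head_emb \<G> e c)) \<circ> \<alpha> (Dart e False) =
        \<alpha> (Grp (tail \<G> e) (tail_emb \<G> e c))))" (is "_ \<longleftrightarrow> ?R")
proof
  assume *: "compatible \<alpha>"
  then have c: "eval \<alpha> l = eval \<alpha> r" if "(l, r) \<in> gog_relations \<G>" for l r
    using that by (auto simp: compatible_def)
  have 1: "\<alpha> (Grp v \<one>) = id" if "v \<in> verts \<G>" for v
    using c[OF gog_relations.unit[OF that]] that by (simp add: vgrp_ops)
  have 2: "\<alpha> (Grp v g) \<circ> \<alpha> (Grp v h) = \<alpha> (Grp v (g \<otimes> h))" if "v \<in> verts \<G>" "g \<in> VG v" "h \<in> VG v" for v g h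
    using c[OF gog_relations.product[OF that]] that by (simp add: vgrp_ops)
  have 3: "\<alpha> (Dart e b) \<circ> \<alpha> (Dart e (\<not> b)) = id" if "e \<in> arcs \<G>" for e b
    using c[OF gog_relations.cancel[OF that, of b]] by simp
  have 4: "\<alpha> (Dart e True) \<circ> \<alpha> (Grp (head \<G> e) (head_emb \<G> e x)) \<circ> \<alpha> (Dart e False) =
        \<alpha> (Grp (tail \<G> e) (tail_emb \<G> e x))" if "e \<in> arcs \<G>" "x \<in> EG e" for e x
    using c[OF gog_relations.edge[OF that]] by (simp add: comp_assoc)
  show ?R using 1 2 3 4 by blast
next
  assume R: ?R
  have "eval \<alpha> l = eval \<alpha> r" if "(l, r) \<in> gog_relations \<G>" for l r
    using that
  proof (induction rule: gog_relations.induct)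
    case (edge e c)
    have "\<alpha> (Dart e True) \<circ> \<alpha> (Grp (head \<G> e) (head_emb \<G> e c)) \<circ> \<alpha> (Dart e False) =
        \<alpha> (Grp (tail \<G> e) (tail_emb \<G> e c))" using R edge by blast
    then show ?case by (simp add: comp_assoc)
  qed (use R in \<open>simp_all add: vgrp_ops\<close>)
  then show "compatible \<alpha>" by (auto simp: compatible_def)
qed

lemma eval_of_val:
  assumes "compatible \<alpha>" "v \<in> verts \<G>" "u \<in> gog_loops \<G> v" "w \<in> gog_loops \<G> v" "val u = val w"
  shows "eval \<alpha> u = eval \<alpha> w"
proof (rule homotopic_in_invariant[OF homotopic_of_val[OF assms(2-5)]])
  fix x l r y assume "(l, r) \<in> gog_relations \<G>"
  then have "eval \<alpha> l = eval \<alpha> r" using assms(1) by (auto simp: compatible_def)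
  then show "eval \<alpha> (x @ l @ y) = eval \<alpha> (x @ r @ y)" by simp
qed

lemma extension_val:
  assumes "compatible \<alpha>" "v \<in> verts \<G>" "w \<in> gog_loops \<G> v"
  shows "extension \<alpha> v (val w) = eval \<alpha> w"
proof -
  have "(SOME u. u \<in> gog_loops \<G> v \<and> val u = val w) \<in> gog_loops \<G> v \<and>
      val (SOME u. u \<in> gog_loops \<G> v \<and> val u = val w) = val w"
    by (rule someI[of "\<lambda>u. u \<in> gog_loops \<G> v \<and> val u = val w" w]) (use assms(3) in simp)
  then show ?thesis unfolding extension_def using eval_of_val[OF assms(1,2)] assms(3) by blast
qed

lemma loops_append: "u \<in> gog_loops \<G> v \<Longrightarrow> w \<in> gog_loops \<G> v \<Longrightarrow> u @ w \<in> gog_loops \<G> v"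
  by (auto simp: gog_loops_def walk_append)

lemma extension_mult:
  assumes "compatible \<alpha>" "v \<in> verts \<G>" "g \<in> carrier G" "h \<in> carrier G"
  shows "extension \<alpha> v (g \<otimes> h) = extension \<alpha> v g \<circ> extension \<alpha> v h"
proof -
  obtain u w where u: "u \<in> gog_loops \<G> v" "val u = g" and w: "w \<in> gog_loops \<G> v" "val w = h"
    using ex_loop assms by metis
  have "val (u @ w) = g \<otimes> h" using u w loops_letters by (simp add: val_append)
  then show ?thesis
    using extension_val[OF assms(1,2)] u w loops_append[OF u(1) w(1)] by (metis eval_simps(3))
qed

lemma wall_action_extension:
  assumes \<alpha>: "compatible \<alpha>" and v: "v \<in> verts \<G>" and aff: "\<And>x. x \<in> gog_letters \<G> \<Longrightarrow> is_affine (\<alpha> x)"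
  shows "wall_action G (extension \<alpha> v)"
  unfolding wall_action_def
proof (intro conjI ballI)
  have "[] \<in> gog_loops \<G> v" by (simp add: gog_loops_def)
  then show "extension \<alpha> v \<one> = id" using extension_val[OF \<alpha> v, of "[]"] by simp
  fix g assume "g \<in> carrier G"
  then obtain w where w: "w \<in> gog_loops \<G> v" "val w = g" using ex_loop[OF v] by blast
  have "is_affine (eval \<alpha> w)" if "set w \<subseteq> gog_letters \<G>" for w
    using that by (induction w) (auto simp: is_affine_id is_affine_comp aff)
  then show "is_affine (extension \<alpha> v g)" using w extension_val[OF \<alpha> v w(1)] loops_letters by metis
qed (rule extension_mult[OF \<alpha> v])

subsection \<open>Inverse paths\<close>

fun letter_inverse :: "('v, 'e, 'g) gog_letter \<Rightarrow> ('v, 'e, 'g) gog_letter" where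
  "letter_inverse (Grp v g) = Grp v (inv g)"
| "letter_inverse (Dart e b) = Dart e (\<not> b)"

definition path_inverse where "path_inverse w = rev (map letter_inverse w)"

lemma letter_inverse:
  assumes "x \<in> gog_letters \<G>"
  shows "letter_inverse x \<in> gog_letters \<G>" "gog_org \<G> (letter_inverse x) = gog_ter \<G> x"
    "gog_ter \<G> (letter_inverse x) = gog_org \<G> x" "letter_val G s (letter_inverse x) = inv (letter_val G s x)"
  using assms subgroup.m_inv_closed[OF VG_subgroup] VG_carrier by (auto simp: gog_letters_def)

lemma path_inverse: "path u w v \<Longrightarrow> path v (path_inverse w) u"
  by (induction w arbitrary: u) (auto simp: path_inverse_def walk_append letter_inverse)

lemma val_path_inverse: "set w \<subseteq> gog_letters \<G> \<Longrightarrow> val (path_inverse w) = inv (val w)"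
proof (induction w)
  case (Cons x w)
  moreover have "set (path_inverse w) \<subseteq> gog_letters \<G>"
    using Cons.prems letter_inverse(1) by (auto simp: path_inverse_def)
  ultimately show ?case
    using letter_inverse[of x] letter_val_closed[of x] val_closed[of w]
    by (simp add: path_inverse_def val_append val_Cons inv_mult_group)
qed (simp add: path_inverse_def)

lemma eval_path_inverse:
  assumes "compatible \<alpha>" "set w \<subseteq> gog_letters \<G>"
  shows "eval \<alpha> (path_inverse w) \<circ> eval \<alpha> w = id"
  using assms(2)
proof (induction w)
  case (Cons x w)
  have "\<alpha> (letter_inverse x) \<circ> \<alpha> x = id"
  proof (cases x)
    case (Grp v g)
    then have v: "v \<in> verts \<G>" "g \<in> VG v" using Cons.prems by (auto simp: gog_letters_def)
    then have "\<alpha> (Grp v (inv g)) \<circ> \<alpha> (Grp v g) = \<alpha> (Grp v (inv g \<otimes> g))"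
      using assms(1) subgroup.m_inv_closed[OF VG_subgroup] by (simp add: compatible_iff)
    then show ?thesis using Grp v assms(1) VG_carrier by (simp add: compatible_iff)
  next
    case (Dart e b)
    then have "e \<in> arcs \<G>" using Cons.prems by (auto simp: gog_letters_def)
    then have "\<alpha> (Dart e (\<not> b)) \<circ> \<alpha> (Dart e (\<not> \<not> b)) = id" using assms(1) unfolding compatible_iff by blast
    then show ?thesis using Dart by simp
  qed
  moreover have "eval \<alpha> (path_inverse (x # w)) \<circ> eval \<alpha> (x # w) =
      eval \<alpha> (path_inverse w) \<circ> (\<alpha> (letter_inverse x) \<circ> \<alpha> x) \<circ> eval \<alpha> w"
    by (simp add: path_inverse_def comp_assoc)
  ultimately have "eval \<alpha> (path_inverse (x # w)) \<circ> eval \<alpha> (x # w) = eval \<alpha> (path_inverse w) \<circ> eval \<alpha> w"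
    by (simp only: comp_id)
  also have "\<dots> = id" using Cons.prems by (intro Cons.IH) simp
  finally show ?case .
qed (simp add: path_inverse_def)

lemma ex_path:
  assumes u: "u \<in> verts \<G>" and v: "v \<in> verts \<G>" and y: "y \<in> carrier G"
  obtains w where "path u w v" "val w = y"
proof -
  have conn: "\<exists>w. path u w v"
  proof -
    have "connected (pre_digraph.truncate \<G>)" using wf by (simp add: wf_graph_of_groups_def)
    then have "(u, v) \<in> rtrancl_on (verts \<G>) (arcs_ends (with_proj (mk_symmetric (pre_digraph.truncate \<G>))))"
      using u v by (auto simp: connected_def strongly_connected_def reachable_def pre_digraph.defs mk_symmetric_def)
    then show ?thesis
    proof (induction rule: rtrancl_on_induct)
      case base
      have "path u [] u" by simp
      then show ?case by blast
    next
      case (step y z)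
      obtain e where e: "e \<in> arcs \<G>" "(y, z) = (tail \<G> e, head \<G> e) \<or> (y, z) = (head \<G> e, tail \<G> e)"
        using step(2) by (auto simp: arcs_ends_def arc_to_ends_def mk_symmetric_def pre_digraph.defs)
      have "Dart e b \<in> gog_letters \<G>" for b using e by (simp add: gog_letters_def)
      then have "path y [Dart e True] z \<or> path y [Dart e False] z" using e by auto
      then show ?case using step(5) walk_append by fast
    qed
  qed
  then obtain w where w: "path u w v" by blast
  then have wl: "set w \<subseteq> gog_letters \<G>" by (rule path_letters)
  obtain l where l: "l \<in> gog_loops \<G> u" "val l = y \<otimes> inv (val w)"
    using ex_loop[OF u] y val_closed[OF wl] by (metis inv_closed m_closed)
  have "path u (l @ w) v" using l(1) w by (auto simp: gog_loops_def walk_append)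
  moreover have "val (l @ w) = y" using l wl y loops_letters[OF l(1)] val_closed[OF wl] by (simp add: val_append m_assoc)
  ultimately show ?thesis using that by blast
qed

lemma loop_power: "u \<in> gog_loops \<G> v \<Longrightarrow> power_word n u \<in> gog_loops \<G> v \<and> val (power_word n u) = val u [^] n"
proof (induction n)
  case 0
  then show ?case by (simp add: gog_loops_def)
next
  case (Suc n)
  then have "power_word n u @ u \<in> gog_loops \<G> v" using loops_append by blast
  moreover have "val (power_word n u @ u) = val u [^] Suc n" 
    using Suc loops_letters[of u v] loops_letters[of "power_word n u" v] by (simp add: val_append)
  ultimately show ?case by (simp add: power_word_Suc_right del: power_word_simps(2))
qed

text \<open>
  A path to the other base point acts as an affine map, and conjugation by it changes the displacements by a bounded amount.
\<close>

lemma escapes_of_loop: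
  assumes \<alpha>: "compatible \<alpha>" and aff: "\<And>x. x \<in> gog_letters \<G> \<Longrightarrow> is_affine (\<alpha> x)"
    and v0: "v0 \<in> verts \<G>" and v: "v \<in> verts \<G>" and u: "u \<in> gog_loops \<G> v" and y: "y \<in> carrier G"
    and unb: "\<And>k. \<exists>n. k < card (eval \<alpha> (power_word n u) {})"
  shows "escapes G (extension \<alpha> v0) (y \<otimes> val u \<otimes> inv y)"
  unfolding escapes_def
proof
  fix k
  obtain p where p: "path v0 p v" "val p = y" using ex_path[OF v0 v y] .
  have pl: "set p \<subseteq> gog_letters \<G>" using p(1) by (rule path_letters)
  have pil: "set (path_inverse p) \<subseteq> gog_letters \<G>" using path_letters[OF path_inverse[OF p(1)]] .
  have evaff: "is_affine (eval \<alpha> w)" if "set w \<subseteq> gog_letters \<G>" for w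
    using that by (induction w) (auto simp: is_affine_id is_affine_comp aff)
  obtain n where n: "k + 2 * card (eval \<alpha> (path_inverse p) {}) < card (eval \<alpha> (power_word n u) {})"
    using unb by blast
  note un = loop_power[OF u, of n]
  have loop: "p @ power_word n u @ path_inverse p \<in> gog_loops \<G> v0"
    using p(1) path_inverse[OF p(1)] un by (auto simp: gog_loops_def walk_append)
  have uc: "val u \<in> carrier G" using u loops_letters val_closed by blast
  have "val (p @ power_word n u @ path_inverse p) = y \<otimes> val u [^] n \<otimes> inv y"
    using un pl pil loops_letters[of "power_word n u" v] p(2) y uc by (simp add: val_append val_path_inverse m_assoc)
  also have "\<dots> = (y \<otimes> val u \<otimes> inv y) [^] n"
  proof (induction n)
    case (Suc n)
    have "(y \<otimes> val u [^] n \<otimes> inv y) \<otimes> (y \<otimes> val u \<otimes> inv y) = y \<otimes> val u [^] n \<otimes> (inv y \<otimes> y) \<otimes> val u \<otimes> inv y"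
      using y uc by (simp add: m_assoc inv_cancel)
    then show ?case using Suc y uc by (simp add: m_assoc)
  qed (use y in simp)
  finally have "extension \<alpha> v0 ((y \<otimes> val u \<otimes> inv y) [^] n) = eval \<alpha> p \<circ> eval \<alpha> (power_word n u) \<circ> eval \<alpha> (path_inverse p)"
    using extension_val[OF \<alpha> v0 loop] by (simp add: comp_assoc)
  then have "card (eval \<alpha> (power_word n u) {}) \<le>
      card (extension \<alpha> v0 ((y \<otimes> val u \<otimes> inv y) [^] n) {}) + 2 * card (eval \<alpha> (path_inverse p) {})"
    using card_affine_conjugate[OF evaff[OF pl] evaff[OF pil] evaff eval_path_inverse[OF \<alpha> pl], of "power_word n u"]
      un loops_letters[of "power_word n u" v] by simp
  then show "\<exists>n::nat. k < card (extension \<alpha> v0 ((y \<otimes> val u \<otimes> inv y) [^] n) {})"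
    using n by (intro exI[of _ n]) linarith
qed

lemma escapes_of_vertex_element:
  assumes \<alpha>: "compatible \<alpha>" and aff: "\<And>x. x \<in> gog_letters \<G> \<Longrightarrow> is_affine (\<alpha> x)"
    and v0: "v0 \<in> verts \<G>" and v: "v \<in> verts \<G>" and h: "h \<in> VG v" and y: "y \<in> carrier G"
    and unb: "\<And>k. \<exists>n. k < card (\<alpha> (Grp v (h [^] (n::nat))) {})"
  shows "escapes G (extension \<alpha> v0) (y \<otimes> h \<otimes> inv y)"
proof -
  have u: "[Grp v h] \<in> gog_loops \<G> v" using v h by (simp add: gog_loops_def gog_letters_def)
  have pow: "h [^] n \<in> VG v" for n :: nat
    using h by (induction n) (auto intro: subgroup.one_closed[OF VG_subgroup[OF v]] subgroup.m_closed[OF VG_subgroup[OF v]])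
  have hc: "h \<in> carrier G" using VG_carrier[OF v h] .
  have "eval \<alpha> (power_word n [Grp v h]) = \<alpha> (Grp v (h [^] n))" for n
  proof -
    have "[Grp v (h [^] n)] \<in> gog_loops \<G> v" using v pow by (simp add: gog_loops_def gog_letters_def)
    moreover have "val (power_word n [Grp v h]) = val [Grp v (h [^] n)]"
      using loop_power[OF u, of n] hc by (simp add: val_Cons)
    ultimately show ?thesis using eval_of_val[OF \<alpha> v] loop_power[OF u, of n] by fastforce
  qed
  then have "\<exists>n. k < card (eval \<alpha> (power_word n [Grp v h]) {})" for k using unb[of k] by simp
  then have "escapes G (extension \<alpha> v0) (y \<otimes> val [Grp v h] \<otimes> inv y)"
    using escapes_of_loop[OF \<alpha> aff v0 v u y] by blast
  then show ?thesis using hc by (simp add: val_Cons)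
qed

end

section \<open>Sums modulo two\<close>

definition odd_set :: "'z list \<Rightarrow> 'z set" where
  "odd_set xs = {z. odd (count_list xs z)}"

lemma odd_set_Nil [simp]: "odd_set [] = {}"
  by (simp add: odd_set_def)

lemma odd_set_append: "odd_set (xs @ ys) = odd_set xs \<triangle> odd_set ys"
  by (auto simp: odd_set_def)

lemma odd_set_singleton [simp]: "odd_set [x] = {x}"
  by (auto simp: odd_set_def)

lemma odd_set_Cons: "odd_set (x # xs) = {x} \<triangle> odd_set xs"
  using odd_set_append[of "[x]" xs] by simp

lemma odd_set_subset: "odd_set xs \<subseteq> set xs"
  by (auto simp: odd_set_def) (metis count_notin even_zero)

lemma finite_odd_set [simp]: "finite (odd_set xs)"
  using odd_set_subset by (rule finite_subset) simp

lemma odd_set_map: "inj f \<Longrightarrow> odd_set (map f xs) = f ` odd_set xs"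
  by (induction xs) (simp_all add: odd_set_Cons image_symdiff)

lemma odd_set_distinct: "distinct xs \<Longrightarrow> odd_set xs = set xs"
  by (induction xs) (simp_all add: odd_set_Cons set_eq_iff, blast)

section \<open>The edges of the Bass--Serre tree\<close>

text \<open>The extension by the identity makes it a permutation of the whole type.\<close>

definition left_mult :: "('g, 'm) monoid_scheme \<Rightarrow> 'g \<Rightarrow> 'g \<Rightarrow> 'g" where
  "left_mult G g x = (if x \<in> carrier G then g \<otimes>\<^bsub>G\<^esub> x else x)"

lemma (in group) left_mult_comp:
  "g \<in> carrier G \<Longrightarrow> h \<in> carrier G \<Longrightarrow> left_mult G g \<circ> left_mult G h = left_mult G (g \<otimes> h)"
  by (auto simp: left_mult_def fun_eq_iff m_assoc)

lemma (in group) left_mult_one: "left_mult G \<one> = id"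
  by (auto simp: left_mult_def fun_eq_iff)

lemma (in group) bij_left_mult: "g \<in> carrier G \<Longrightarrow> bij (left_mult G g)"
  by (rule o_bij[of "left_mult G (inv g)"]) (simp_all add: left_mult_comp left_mult_one)

lemma (in group) left_mult_image_comp:
  "g \<in> carrier G \<Longrightarrow> h \<in> carrier G \<Longrightarrow> left_mult G g ` left_mult G h ` A = left_mult G (g \<otimes> h) ` A"
  using left_mult_comp[of g h] by (metis image_comp)

lemma (in group) left_mult_subgroup:
  assumes "subgroup A G" "g \<in> carrier G" "h \<in> carrier G"
  shows "left_mult G g ` A = left_mult G h ` A \<longleftrightarrow> inv g \<otimes> h \<in> A"
proof -
  have A: "A \<subseteq> carrier G" using assms(1) by (rule subgroup.subset)
  have stab: "left_mult G a ` A = A \<longleftrightarrow> a \<in> A" if a: "a \<in> carrier G" for a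
  proof
    assume "left_mult G a ` A = A"
    moreover have "a \<in> left_mult G a ` A"
      using subgroup.one_closed[OF assms(1)] a by (auto simp: left_mult_def image_iff intro!: bexI[of _ \<one>])
    ultimately show "a \<in> A" by simp
  next
    assume aA: "a \<in> A"
    have "left_mult G b ` A \<subseteq> A" if "b \<in> A" for b
      using that A subgroup.m_closed[OF assms(1)] by (auto simp: left_mult_def)
    then have "left_mult G a ` A \<subseteq> A" "left_mult G (inv a) ` A \<subseteq> A"
      using aA subgroup.m_inv_closed[OF assms(1)] by simp_all
    moreover from this(2) have "left_mult G a ` left_mult G (inv a) ` A \<subseteq> left_mult G a ` A"
      by (rule image_mono)
    moreover have "left_mult G a ` left_mult G (inv a) ` A = A"
      using left_mult_image_comp[of a "inv a" A] left_mult_one a by simp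
    ultimately show "left_mult G a ` A = A" by simp
  qed
  have "left_mult G g ` A = left_mult G h ` A \<longleftrightarrow> left_mult G (inv g) ` left_mult G g ` A = left_mult G (inv g) ` left_mult G h ` A"
    using inj_image_eq_iff[OF bij_is_inj[OF bij_left_mult[of "inv g"]]] assms(2) by simp
  also have "\<dots> \<longleftrightarrow> A = left_mult G (inv g \<otimes> h) ` A"
    using left_mult_image_comp[of "inv g" g A] left_mult_image_comp[of "inv g" h A] assms left_mult_one by simp
  also have "\<dots> \<longleftrightarrow> inv g \<otimes> h \<in> A" using stab[of "inv g \<otimes> h"] assms by auto
  finally show ?thesis .
qed

context split_group
begin

abbreviation AG where "AG e \<equiv> tail_emb \<G> e ` EG e"

lemma AG_subgroup: assumes "e \<in> arcs \<G>" shows "subgroup (AG e) G"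
proof -
  have gr: "group (egrp \<G> e)" "group (vgrp \<G> (tail \<G> e))" "tail_emb \<G> e \<in> hom (egrp \<G> e) (vgrp \<G> (tail \<G> e))"
    using assms wf ends_in_verts by (auto simp: wf_graph_of_groups_def mon_def)
  then have "group_hom (egrp \<G> e) (vgrp \<G> (tail \<G> e)) (tail_emb \<G> e)"
    by (simp add: group_hom_def group_hom_axioms_def)
  then have "subgroup (AG e) (vgrp \<G> (tail \<G> e))" by (rule group_hom.img_is_subgroup)
  moreover have "vgrp \<G> (tail \<G> e) = G\<lparr>carrier := VG (tail \<G> e)\<rparr>"
    using splits assms ends_in_verts by (simp add: splits_as_def)
  ultimately show ?thesis using incl_subgroup[OF VG_subgroup[OF ends_in_verts(1)[OF assms]]] by metis
qed

lemma AG_closed: "e \<in> arcs \<G> \<Longrightarrow> a \<in> AG e \<Longrightarrow> a \<in> VG (tail \<G> e) \<and> a \<in> carrier G"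
  using emb_closed ends_in_verts VG_carrier by blast

lemma AG_head:
  assumes "e \<in> arcs \<G>" "a \<in> AG e"
  shows "inv (s e) \<otimes> a \<otimes> s e \<in> VG (head \<G> e)"
proof -
  obtain c where c: "c \<in> EG e" "a = tail_emb \<G> e c" using assms by blast
  have h: "head_emb \<G> e c \<in> VG (head \<G> e)" using emb_closed assms c by blast
  then have "head_emb \<G> e c \<in> carrier G" using VG_carrier ends_in_verts assms by blast
  then have "inv (s e) \<otimes> (s e \<otimes> head_emb \<G> e c \<otimes> inv (s e)) \<otimes> s e = head_emb \<G> e c"
    using assms by (simp add: m_assoc inv_cancel)
  then have "inv (s e) \<otimes> a \<otimes> s e = head_emb \<G> e c"
    using edge_relation[OF assms(1) c(1)] c by simp
  then show ?thesis using h by simp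
qed

definition tree_shift :: "'g \<Rightarrow> 'e \<times> 'g set \<Rightarrow> 'e \<times> 'g set" where
  "tree_shift g = map_prod id (image (left_mult G g))"

text \<open>
  The word \<open>Dart e True\<close> crosses the edge \<open>AG e\<close> of the tree, and the inverse dart its translate by \<open>(s e)\<inverse>\<close>.
\<close>

fun tree_letter :: "('v, 'e, 'g) gog_letter \<Rightarrow> ('e \<times> 'g set) set \<Rightarrow> ('e \<times> 'g set) set" where
  "tree_letter (Grp v g) = affine_map (tree_shift g) {}"
| "tree_letter (Dart e b) =
    (if b then affine_map (tree_shift (s e)) {(e, AG e)}
     else affine_map (tree_shift (inv (s e))) {(e, left_mult G (inv (s e)) ` AG e)})"

text \<open>The edges that a path crosses, starting from the base vertex translated by \<open>x\<close>, with directions.\<close>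

fun crossed :: "'g \<Rightarrow> ('v, 'e, 'g) gog_letter list \<Rightarrow> (('e \<times> 'g set) \<times> bool) list" where
  "crossed x [] = []"
| "crossed x (Grp v g # w) = crossed (x \<otimes> g) w"
| "crossed x (Dart e b # w) =
    (if b then ((e, left_mult G x ` AG e), True) # crossed (x \<otimes> s e) w
     else ((e, left_mult G (x \<otimes> inv (s e)) ` AG e), False) # crossed (x \<otimes> inv (s e)) w)"

abbreviation dart_val :: "'e \<Rightarrow> bool \<Rightarrow> 'g" where
  "dart_val e b \<equiv> (if b then s e else inv (s e))"

lemma tree_shift_comp:
  "g \<in> carrier G \<Longrightarrow> h \<in> carrier G \<Longrightarrow> tree_shift g \<circ> tree_shift h = tree_shift (g \<otimes> h)"
  by (auto simp: tree_shift_def fun_eq_iff left_mult_image_comp)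

lemma tree_shift_one: "tree_shift \<one> = id"
  by (simp add: tree_shift_def left_mult_one prod.map_id fun_eq_iff)

lemma bij_tree_shift: "g \<in> carrier G \<Longrightarrow> bij (tree_shift g)"
  by (rule o_bij[of "tree_shift (inv g)"]) (simp_all add: tree_shift_comp tree_shift_one)

lemma affine_tree_shift_comp:
  assumes "g \<in> carrier G" "h \<in> carrier G"
  shows "affine_map (tree_shift g) D \<circ> affine_map (tree_shift h) D' =
    affine_map (tree_shift (g \<otimes> h)) (tree_shift g ` D' \<triangle> D)"
  using affine_map_comp[OF bij_is_inj[OF bij_tree_shift[OF assms(1)]]] tree_shift_comp[OF assms] by simp

lemma tree_letter_affine: "x \<in> gog_letters \<G> \<Longrightarrow> is_affine (tree_letter x)"
  using VG_carrier by (auto simp: gog_letters_def intro!: is_affineI bij_tree_shift)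

lemma tree_compatible: "compatible tree_letter"
  unfolding compatible_iff
proof (intro conjI ballI allI)
  fix v assume "v \<in> verts \<G>"
  show "tree_letter (Grp v \<one>) = id" by (simp add: tree_shift_one)
next
  fix v g h assume "v \<in> verts \<G>" "g \<in> VG v" "h \<in> VG v"
  then have "g \<in> carrier G" "h \<in> carrier G" using VG_carrier by auto
  then show "tree_letter (Grp v g) \<circ> tree_letter (Grp v h) = tree_letter (Grp v (g \<otimes> h))"
    using affine_tree_shift_comp[of g h "{}" "{}"] by simp
next
  fix e b assume e: "e \<in> arcs \<G>"
  have "tree_shift (s e) (e, left_mult G (inv (s e)) ` AG e) = (e, AG e)"
    using e left_mult_image_comp[of "s e" "inv (s e)" "AG e"] left_mult_one by (simp add: tree_shift_def)
  moreover have "tree_shift (inv (s e)) (e, AG e) = (e, left_mult G (inv (s e)) ` AG e)"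
    by (simp add: tree_shift_def)
  ultimately show "tree_letter (Dart e b) \<circ> tree_letter (Dart e (\<not> b)) = id"
    using e by (cases b) (simp_all add: affine_tree_shift_comp tree_shift_one)
next
  fix e c assume e: "e \<in> arcs \<G>" and c: "c \<in> EG e"
  let ?a = "tail_emb \<G> e c" and ?h = "head_emb \<G> e c"
  have h: "?h \<in> carrier G" using emb_closed ends_in_verts VG_carrier e c by blast
  have a: "?a \<in> AG e" "?a \<in> carrier G" using AG_closed e c by blast+
  have "left_mult G (inv \<one> \<otimes> ?a) ` AG e = left_mult G \<one> ` AG e"
    using left_mult_subgroup[OF AG_subgroup[OF e], of \<one> ?a] a by simp
  then have fix_edge: "tree_shift ?a (e, AG e) = (e, AG e)"
    using a left_mult_one by (simp add: tree_shift_def)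
  have "tree_shift (s e \<otimes> ?h) (e, left_mult G (inv (s e)) ` AG e) = tree_shift ?a (e, AG e)"
    using e h edge_relation[OF e c] left_mult_image_comp[of "s e \<otimes> ?h" "inv (s e)" "AG e"]
    by (simp add: tree_shift_def)
  then show "tree_letter (Dart e True) \<circ> tree_letter (Grp (head \<G> e) ?h) \<circ> tree_letter (Dart e False) =
      tree_letter (Grp (tail \<G> e) ?a)"
    using e h edge_relation[OF e c] fix_edge by (simp add: affine_tree_shift_comp)
qed

lemma crossed_append:
  "set u \<subseteq> gog_letters \<G> \<Longrightarrow> x \<in> carrier G \<Longrightarrow> crossed x (u @ w) = crossed x u @ crossed (x \<otimes> val u) w"
proof (induction u arbitrary: x)
  case (Cons y u)
  then have y: "letter_val G s y \<in> carrier G" "val u \<in> carrier G" using letter_val_closed val_closed by auto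
  then show ?case using Cons by (cases y) (auto simp: val_Cons m_assoc)
qed simp

abbreviation tree_shift_dir where "tree_shift_dir g \<equiv> map_prod (tree_shift g) (id :: bool \<Rightarrow> bool)"

lemma crossed_shift:
  "set w \<subseteq> gog_letters \<G> \<Longrightarrow> g \<in> carrier G \<Longrightarrow> x \<in> carrier G \<Longrightarrow>
    crossed (g \<otimes> x) w = map (tree_shift_dir g) (crossed x w)"
proof (induction w arbitrary: x)
  case (Cons y w)
  then have y: "letter_val G s y \<in> carrier G" using letter_val_closed by auto
  have l: "left_mult G (g \<otimes> z) ` A = left_mult G g ` left_mult G z ` A" if "z \<in> carrier G" for z A
    using that Cons.prems left_mult_image_comp by simp
  show ?case
  proof (cases y)
    case (Grp v h)
    then show ?thesis using Cons.IH[of "x \<otimes> h"] Cons.prems y by (simp add: m_assoc)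
  next
    case (Dart e b)
    then have "s e \<in> carrier G" using Cons.prems by (auto simp: gog_letters_def)
    then show ?thesis
      using Dart Cons.IH[of "x \<otimes> s e"] Cons.IH[of "x \<otimes> inv (s e)"] Cons.prems l[of x] l[of "x \<otimes> inv (s e)"]
      by (cases b) (simp_all add: m_assoc tree_shift_def)
  qed
qed simp

lemma eval_tree_letter:
  "set w \<subseteq> gog_letters \<G> \<Longrightarrow> eval tree_letter w {} = odd_set (map fst (crossed \<one> w))"
proof (induction w)
  case (Cons y w)
  then have y: "letter_val G s y \<in> carrier G" using letter_val_closed by auto
  have w: "set w \<subseteq> gog_letters \<G>" using Cons.prems by simp
  have sh: "odd_set (map fst (crossed g w)) = tree_shift g ` odd_set (map fst (crossed \<one> w))" if g: "g \<in> carrier G" for g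
  proof -
    have "map fst (crossed g w) = map (tree_shift g) (map fst (crossed \<one> w))"
      using crossed_shift[OF w g, of \<one>] g by (simp add: comp_def)
    then show ?thesis using odd_set_map[OF bij_is_inj[OF bij_tree_shift[OF g]]] by metis
  qed
  show ?case
  proof (cases y)
    case (Grp v g)
    then show ?thesis using y Cons.IH[OF w] sh[of g] by (simp add: affine_map_def)
  next
    case (Dart e b)
    then have "e \<in> arcs \<G>" using Cons.prems by (auto simp: gog_letters_def)
    then show ?thesis using Dart Cons.IH[OF w] sh[of "s e"] sh[of "inv (s e)"]
      by (auto simp: affine_map_def odd_set_Cons left_mult_one symdiff_commute)
  qed
qed simp

lemma crossed_split:
  assumes "crossed x w = ls @ [((E, C), b)] @ rs" "set w \<subseteq> gog_letters \<G>" "x \<in> carrier G"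
  obtains w1 w2 where "w = w1 @ [Dart E b] @ w2" "crossed x w1 = ls"
    "crossed (x \<otimes> val w1 \<otimes> dart_val E b) w2 = rs"
    "C = left_mult G (x \<otimes> val w1 \<otimes> (if b then \<one> else inv (s E))) ` AG E"
proof -
  have "\<exists>w1 w2. w = w1 @ [Dart E b] @ w2 \<and> crossed x w1 = ls \<and>
    crossed (x \<otimes> val w1 \<otimes> dart_val E b) w2 = rs \<and>
    C = left_mult G (x \<otimes> val w1 \<otimes> (if b then \<one> else inv (s E))) ` AG E"
    using assms
  proof (induction w arbitrary: x ls)
    case (Cons y w)
    have y: "letter_val G s y \<in> carrier G" using Cons.prems(2) letter_val_closed by auto
    have step: ?case if st: "crossed (x \<otimes> letter_val G s y) w = ls' @ [((E, C), b)] @ rs"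
      "\<And>w1. crossed x (y # w1) = take (length ls - length ls') ls @ crossed (x \<otimes> letter_val G s y) w1"
      "take (length ls - length ls') ls @ ls' = ls" for ls'
    proof -
      obtain w1 w2 where w: "w = w1 @ [Dart E b] @ w2" "crossed (x \<otimes> letter_val G s y) w1 = ls'"
        "crossed (x \<otimes> letter_val G s y \<otimes> val w1 \<otimes> dart_val E b) w2 = rs"
        "C = left_mult G (x \<otimes> letter_val G s y \<otimes> val w1 \<otimes> (if b then \<one> else inv (s E))) ` AG E"
        using Cons.IH[OF st(1)] Cons.prems y by auto
      have "val w1 \<in> carrier G" using w Cons.prems val_closed by auto
      then have "y # w = (y # w1) @ [Dart E b] @ w2 \<and> crossed x (y # w1) = ls \<and>
        crossed (x \<otimes> val (y # w1) \<otimes> dart_val E b) w2 = rs \<and>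
        C = left_mult G (x \<otimes> val (y # w1) \<otimes> (if b then \<one> else inv (s E))) ` AG E"
        using w st(2)[of w1] st(3) Cons.prems(3) y by (auto simp: val_Cons m_assoc)
      then show ?thesis by blast
    qed
    show ?case
    proof (cases y)
      case (Grp v g)
      then show ?thesis using step[of ls] Cons.prems(1) by simp
    next
      case (Dart f d)
      then have f: "f \<in> arcs \<G>" using Cons.prems(2) by (auto simp: gog_letters_def)
      show ?thesis
      proof (cases ls)
        case Nil
        then have "y # w = [] @ [Dart E b] @ w \<and> crossed x [] = ls \<and>
          crossed (x \<otimes> val [] \<otimes> dart_val E b) w = rs \<and>
          C = left_mult G (x \<otimes> val [] \<otimes> (if b then \<one> else inv (s E))) ` AG E"
          using Dart Cons.prems(1,3) by (auto split: if_splits)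
        then show ?thesis by blast
      next
        case (Cons l ls')
        then show ?thesis using step[of ls'] Dart Cons.prems(1) by (auto split: if_splits)
      qed
    qed
  qed simp
  then show ?thesis using that by blast
qed

text \<open>
  A subpath that starts and ends at the same edge of the tree is closed up to an element of a vertex
  group, and may therefore be replaced by that element.
\<close>

lemma return_opposite:
  assumes path: "path v (w1 @ [Dart E b] @ w2 @ [Dart E (\<not> b)] @ w3) v'"
    and eq: "left_mult G (x \<otimes> (if b then \<one> else inv (s E))) ` AG E =
      left_mult G (x \<otimes> dart_val E b \<otimes> val w2 \<otimes> (if b then inv (s E) else \<one>)) ` AG E"
    and x: "x \<in> carrier G"
  obtains p q h where "p \<in> verts \<G>" "path p w2 p" "val w2 \<in> VG p"
    "h \<in> VG q" "path v (w1 @ [Grp q h] @ w3) v'"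
    "val (w1 @ [Grp q h] @ w3) = val (w1 @ [Dart E b] @ w2 @ [Dart E (\<not> b)] @ w3)"
proof -
  have E: "E \<in> arcs \<G>" using path_letters[OF path] by (auto simp: gog_letters_def)
  define p q where "p = (if b then head \<G> E else tail \<G> E)" and "q = (if b then tail \<G> E else head \<G> E)"
  have pq: "p \<in> verts \<G>" "q \<in> verts \<G>" using E ends_in_verts by (auto simp: p_def q_def)
  have paths: "path v w1 q" "path p w2 p" "path q w3 v'" using path by (auto simp: walk_append p_def q_def)
  note letters = paths[THEN path_letters]
  note vals = letters[THEN val_closed]
  have sE: "s E \<in> carrier G" using E by simp
  define h where "h = dart_val E b \<otimes> val w2 \<otimes> inv (dart_val E b)"
  have "val w2 \<in> VG p \<and> h \<in> VG q"
  proof (cases b)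
    case True
    have "inv x \<otimes> (x \<otimes> s E \<otimes> val w2 \<otimes> inv (s E)) \<in> AG E"
      using eq True x sE vals left_mult_subgroup[OF AG_subgroup[OF E], of x "x \<otimes> s E \<otimes> val w2 \<otimes> inv (s E)"] by simp
    then have a: "s E \<otimes> val w2 \<otimes> inv (s E) \<in> AG E" using x sE vals by (simp add: m_assoc inv_cancel)
    have "inv (s E) \<otimes> (s E \<otimes> val w2 \<otimes> inv (s E)) \<otimes> s E = val w2" using sE vals by (simp add: m_assoc inv_cancel)
    then show ?thesis using AG_head[OF E a] AG_closed[OF E a] True by (simp add: p_def q_def h_def)
  next
    case False
    have "inv (x \<otimes> inv (s E)) \<otimes> (x \<otimes> inv (s E) \<otimes> val w2) \<in> AG E"
      using eq False x sE vals left_mult_subgroup[OF AG_subgroup[OF E], of "x \<otimes> inv (s E)" "x \<otimes> inv (s E) \<otimes> val w2"] by simp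
    moreover have "inv (x \<otimes> inv (s E)) \<otimes> (x \<otimes> inv (s E) \<otimes> val w2) = val w2"
      using x sE vals by (simp add: inv_cancel)
    ultimately have a: "val w2 \<in> AG E" by simp
    show ?thesis using AG_head[OF E a] AG_closed[OF E a] False sE by (simp add: p_def q_def h_def)
  qed
  moreover have "path v (w1 @ [Grp q h] @ w3) v'"
    using paths calculation pq by (auto simp: walk_append gog_letters_def)
  moreover have "val (w1 @ [Grp q h] @ w3) = val (w1 @ [Dart E b] @ w2 @ [Dart E (\<not> b)] @ w3)"
  proof -
    have hl: "set [Grp q h] \<subseteq> gog_letters \<G>" using calculation pq by (auto simp: gog_letters_def)
    have hc: "h \<in> carrier G" using calculation pq VG_carrier by blast
    have dl: "Dart E d \<in> gog_letters \<G>" for d using E by (simp add: gog_letters_def)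
    have "val ([Dart E b] @ w2 @ [Dart E (\<not> b)]) = h"
      using letters dl sE vals by (cases b) (simp_all add: val_append val_Cons h_def m_assoc)
    then have "val [Grp q h] = val ([Dart E b] @ w2 @ [Dart E (\<not> b)])" using hc by (simp add: val_Cons)
    moreover have "set ([Dart E b] @ w2 @ [Dart E (\<not> b)]) \<subseteq> gog_letters \<G>" using letters dl by simp
    ultimately have "val (w1 @ [Grp q h] @ w3) = val (w1 @ ([Dart E b] @ w2 @ [Dart E (\<not> b)]) @ w3)"
      using letters hl by (simp only: val_append set_append Un_subset_iff simp_thms)
    then show ?thesis by simp
  qed
  ultimately show ?thesis using that pq paths by blast
qed

lemma return_same:
  assumes path: "path v (w1 @ [Dart E b] @ w2 @ [Dart E b] @ w3) v'"
    and eq: "left_mult G (x \<otimes> (if b then \<one> else inv (s E))) ` AG E =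
      left_mult G (x \<otimes> dart_val E b \<otimes> val w2 \<otimes> (if b then \<one> else inv (s E))) ` AG E"
    and x: "x \<in> carrier G"
  obtains q where "q \<in> verts \<G>" "path q ([Dart E b] @ w2) q" "val ([Dart E b] @ w2) \<in> VG q"
proof -
  have E: "E \<in> arcs \<G>" using path_letters[OF path] by (auto simp: gog_letters_def)
  define q where "q = (if b then tail \<G> E else head \<G> E)"
  have q: "q \<in> verts \<G>" using E ends_in_verts by (auto simp: q_def)
  have paths: "path q ([Dart E b] @ w2) q" using path by (auto simp: walk_append q_def)
  then have w2: "val w2 \<in> carrier G" using path_letters val_closed by fastforce
  have sE: "s E \<in> carrier G" using E by simp
  have "val ([Dart E b] @ w2) \<in> VG q"
  proof (cases b)
    case True
    have "inv x \<otimes> (x \<otimes> s E \<otimes> val w2) \<in> AG E"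
      using eq True x sE w2 left_mult_subgroup[OF AG_subgroup[OF E], of x "x \<otimes> s E \<otimes> val w2"] by simp
    then have "s E \<otimes> val w2 \<in> AG E" using x sE w2 by (simp add: m_assoc inv_cancel)
    then show ?thesis using AG_closed[OF E] True by (simp add: q_def val_Cons)
  next
    case False
    have "inv (x \<otimes> inv (s E)) \<otimes> (x \<otimes> inv (s E) \<otimes> val w2 \<otimes> inv (s E)) \<in> AG E"
      using eq False x sE w2
        left_mult_subgroup[OF AG_subgroup[OF E], of "x \<otimes> inv (s E)" "x \<otimes> inv (s E) \<otimes> val w2 \<otimes> inv (s E)"] by simp
    moreover have "inv (x \<otimes> inv (s E)) \<otimes> (x \<otimes> inv (s E) \<otimes> val w2 \<otimes> inv (s E)) = val w2 \<otimes> inv (s E)"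
      using x sE w2 by (simp add: inv_mult_group m_assoc inv_cancel)
    ultimately have a: "val w2 \<otimes> inv (s E) \<in> AG E" by simp
    have "inv (s E) \<otimes> (val w2 \<otimes> inv (s E)) \<otimes> s E = inv (s E) \<otimes> val w2" using sE w2 by (simp add: m_assoc)
    then show ?thesis using AG_head[OF E a] False by (simp add: q_def val_Cons)
  qed
  then show ?thesis using that paths q by blast
qed

text \<open>
  The path has the same value as a single letter, which crosses nothing.
\<close>

lemma closed_path_crosses_evenly:
  assumes "q \<in> verts \<G>" "path q w q" "val w \<in> VG q"
  shows "odd_set (map fst (crossed \<one> w)) = {}"
proof -
  have "w \<in> gog_loops \<G> q" "[Grp q (val w)] \<in> gog_loops \<G> q"
    using assms by (auto simp: gog_loops_def gog_letters_def)
  moreover have "val w = val [Grp q (val w)]" using VG_carrier[OF assms(1,3)] by (simp add: val_Cons)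
  ultimately have "eval tree_letter w = eval tree_letter [Grp q (val w)]"
    by (intro eval_of_val[OF tree_compatible assms(1)])
  then show ?thesis using eval_tree_letter[OF path_letters[OF assms(2)]] by (simp add: affine_map_def)
qed

definition no_return :: "('e \<times> 'g set) \<times> bool \<Rightarrow> ('e \<times> 'g set) \<times> bool \<Rightarrow> bool" where
  "no_return a b \<longleftrightarrow> \<not> (fst a = fst b \<and> snd a \<noteq> snd b)"

lemma first_repetition:
  "\<not> distinct xs \<Longrightarrow> \<exists>as a bs cs. xs = as @ [a] @ bs @ [a] @ cs \<and> distinct (a # bs)"
proof (induction xs rule: rev_induct)
  case (snoc x xs)
  show ?case
  proof (cases "distinct xs")
    case True
    then have "x \<in> set xs" using snoc.prems by simp
    then obtain as bs where "xs = as @ x # bs" by (meson split_list)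
    then have "xs @ [x] = as @ [x] @ bs @ [x] @ [] \<and> distinct (x # bs)" using True by auto
    then show ?thesis by blast
  next
    case False
    then obtain as a bs cs where "xs = as @ [a] @ bs @ [a] @ cs" "distinct (a # bs)" using snoc.IH by blast
    then have "xs @ [x] = as @ [a] @ bs @ [a] @ (cs @ [x]) \<and> distinct (a # bs)" by simp
    then show ?thesis by blast
  qed
qed simp

text \<open>
  Take two crossings of the same edge with distinct other edges in between.  If the directions are opposite, the path in between
  is closed up to an element of a vertex group, so it crosses every edge an even number of times, that is, none, and the
  path backtracks.  If the directions agree, the same holds with one of the two crossings included, which is absurd.
\<close>

lemma crossed_distinct:
  assumes path: "path v w v'" and red: "successively no_return (crossed \<one> w)"
  shows "distinct (map fst (crossed \<one> w))"
proof (rule ccontr)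
  assume "\<not> ?thesis"
  then obtain as a bs cs where dec: "map fst (crossed \<one> w) = as @ [a] @ bs @ [a] @ cs" and dist: "distinct (a # bs)"
    using first_repetition by blast
  obtain E C where a: "a = (E, C)" by (cases a)
  have split: "\<exists>us b vs. zs = us @ ((E, C), b) # vs \<and> map fst us = ys \<and> map fst vs = ys'"
    if zs: "map fst zs = ys @ (E, C) # ys'" for zs :: "(('e \<times> 'g set) \<times> bool) list" and ys ys'
  proof -
    obtain us z vs where z: "zs = us @ z # vs" "map fst us = ys" "fst z = (E, C)" "map fst vs = ys'"
      using zs by (auto simp: map_eq_append_conv)
    then have "z = ((E, C), snd z)" by (metis prod.collapse)
    then show ?thesis using z by blast
  qed
  obtain as' b zs where "crossed \<one> w = as' @ ((E, C), b) # zs" and "map fst zs = bs @ (E, C) # cs"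
    using split[of "crossed \<one> w" as] dec unfolding a by auto
  moreover then obtain bs' b' cs' where "zs = bs' @ ((E, C), b') # cs'" and bs: "map fst bs' = bs"
    using split by blast
  ultimately have dec': "crossed \<one> w = as' @ [((E, C), b)] @ bs' @ [((E, C), b')] @ cs'" by simp
  have wl: "set w \<subseteq> gog_letters \<G>" using path by (rule path_letters)
  obtain w1 u where w1: "w = w1 @ [Dart E b] @ u"
    "crossed (\<one> \<otimes> val w1 \<otimes> dart_val E b) u = bs' @ [((E, C), b')] @ cs'"
    "C = left_mult G (\<one> \<otimes> val w1 \<otimes> (if b then \<one> else inv (s E))) ` AG E"
    using crossed_split[OF dec' wl one_closed] by metis
  have ul: "set u \<subseteq> gog_letters \<G>" "set w1 \<subseteq> gog_letters \<G>" "Dart E b \<in> gog_letters \<G>" using wl w1(1) by auto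
  define x where "x = val w1"
  have x: "x \<in> carrier G" "x \<otimes> dart_val E b \<in> carrier G" "dart_val E b \<in> carrier G"
    using val_closed[OF ul(2)] letter_val_closed[OF ul(3)] by (simp_all add: x_def)
  have w1': "crossed (x \<otimes> dart_val E b) u = bs' @ [((E, C), b')] @ cs'"
    "C = left_mult G (x \<otimes> (if b then \<one> else inv (s E))) ` AG E"
    using w1(2,3) x unfolding x_def[symmetric] by (simp_all only: l_one)
  obtain w2 w3 where w2: "u = w2 @ [Dart E b'] @ w3" "crossed (x \<otimes> dart_val E b) w2 = bs'"
    "C = left_mult G (x \<otimes> dart_val E b \<otimes> val w2 \<otimes> (if b' then \<one> else inv (s E))) ` AG E"
    using crossed_split[OF w1'(1) ul(1) x(2)] by metis
  have w2l: "set w2 \<subseteq> gog_letters \<G>" using ul w2(1) by simp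
  have path': "path v (w1 @ [Dart E b] @ w2 @ [Dart E b'] @ w3) v'" using path w1(1) w2(1) by simp
  have shift: "odd_set (map fst (map (tree_shift_dir g) L)) = tree_shift g ` odd_set (map fst L)"
    if "g \<in> carrier G" for g L
  proof -
    have "map fst (map (tree_shift_dir g) L) = map (tree_shift g) (map fst L)" by (simp add: comp_def)
    then show ?thesis using odd_set_map[OF bij_is_inj[OF bij_tree_shift[OF that]]] by metis
  qed
  show False
  proof (cases "b' = b")
    case False
    then have b': "b' = (\<not> b)" by simp
    have "left_mult G (x \<otimes> (if b then \<one> else inv (s E))) ` AG E =
      left_mult G (x \<otimes> dart_val E b \<otimes> val w2 \<otimes> (if b then inv (s E) else \<one>)) ` AG E"
      using w1'(2) w2(3) x(1) unfolding b' by (cases b) simp_all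
    from return_opposite[OF path'[unfolded b'] this x(1)]
    obtain p where p: "p \<in> verts \<G>" "path p w2 p" "val w2 \<in> VG p" by blast
    have "odd_set (map fst bs') = {}"
      using closed_path_crosses_evenly[OF p] crossed_shift[OF w2l x(2) one_closed] shift[OF x(2)] w2(2) x(2)
      by (metis image_empty r_one)
    then have "bs' = []" using dist bs odd_set_distinct[of bs] by simp
    then have "successively no_return (as' @ [((E, C), b)] @ [((E, C), b')] @ cs')" using red dec' by simp
    then show False using False by (simp add: successively_append_iff no_return_def)
  next
    case True
    have "left_mult G (x \<otimes> (if b then \<one> else inv (s E))) ` AG E =
      left_mult G (x \<otimes> dart_val E b \<otimes> val w2 \<otimes> (if b then \<one> else inv (s E))) ` AG E"
      using w1'(2) w2(3) unfolding True by (rule trans[OF sym])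
    from return_same[OF path'[unfolded True] this x(1)]
    obtain q where q: "q \<in> verts \<G>" "path q ([Dart E b] @ w2) q" "val ([Dart E b] @ w2) \<in> VG q" .
    have "crossed x ([Dart E b] @ w2) = ((E, C), b) # bs'"
      using w1'(2) w2(2) x(1) by (cases b) simp_all
    moreover have "crossed x ([Dart E b] @ w2) = map (tree_shift_dir x) (crossed \<one> ([Dart E b] @ w2))"
      using crossed_shift[OF path_letters[OF q(2)] x(1) one_closed] x(1) by simp
    ultimately have "odd_set (map fst (((E, C), b) # bs')) = {}"
      using closed_path_crosses_evenly[OF q] shift[OF x(1)] by (metis image_empty)
    then have "odd_set (a # bs) = {}" using a bs by simp
    then show False using odd_set_distinct[OF dist] by simp
  qed
qed


fun dart_count :: "('v, 'e, 'g) gog_letter list \<Rightarrow> nat" where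
  "dart_count [] = 0"
| "dart_count (Grp v g # w) = dart_count w"
| "dart_count (Dart e b # w) = Suc (dart_count w)"

lemma length_crossed: "length (crossed x w) = dart_count w"
  by (induction x w rule: crossed.induct) auto

lemma dart_count_append [simp]: "dart_count (u @ w) = dart_count u + dart_count w"
  by (induction u rule: dart_count.induct) auto

lemma val_dart_free:
  "path v w v' \<Longrightarrow> dart_count w = 0 \<Longrightarrow> v \<in> verts \<G> \<Longrightarrow> v' = v \<and> val w \<in> VG v"
proof (induction w)
  case Nil
  then show ?case using subgroup.one_closed[OF VG_subgroup] by simp
next
  case (Cons x w)
  then obtain g where x: "x = Grp v g" "g \<in> VG v" "path v w v'" by (cases x) (auto simp: gog_letters_def)
  then show ?case using Cons subgroup.m_closed[OF VG_subgroup] by (simp add: val_Cons)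
qed

text \<open>
  An element is represented, up to conjugation, by a loop with as few darts as possible.  If it has
  no darts, the element fixes a vertex of the tree.  Otherwise neither the loop nor its powers
  backtrack, and the distance by which the base vertex is moved grows linearly.
\<close>

theorem elliptic_or_escapes:
  assumes v0: "v0 \<in> verts \<G>" and g: "g \<in> carrier G"
  shows "(\<exists>v\<in>verts \<G>. \<exists>y\<in>carrier G. \<exists>h\<in>VG v. g = y \<otimes> h \<otimes> inv y) \<or> escapes G (extension tree_letter v0) g"
proof -
  define S where "S = {n. \<exists>v u y. v \<in> verts \<G> \<and> u \<in> gog_loops \<G> v \<and> y \<in> carrier G \<and>
    g = y \<otimes> val u \<otimes> inv y \<and> n = dart_count u}"
  obtain u0 where "u0 \<in> gog_loops \<G> v0" "val u0 = g" using ex_loop v0 g by blast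
  then have "dart_count u0 \<in> S" unfolding S_def using v0 g by (auto intro!: exI[of _ v0] exI[of _ u0] exI[of _ \<one>])
  then have "(LEAST n. n \<in> S) \<in> S" by (rule LeastI)
  then obtain v u y where v: "v \<in> verts \<G>" and u: "u \<in> gog_loops \<G> v" and y: "y \<in> carrier G"
    and gy: "g = y \<otimes> val u \<otimes> inv y" and least: "(LEAST n. n \<in> S) = dart_count u"
    unfolding S_def by blast
  have minimal: "dart_count u \<le> dart_count u'"
    if "v' \<in> verts \<G>" "u' \<in> gog_loops \<G> v'" "y' \<in> carrier G" "g = y' \<otimes> val u' \<otimes> inv y'" for v' u' y'
    unfolding least[symmetric] by (rule Least_le) (use that in \<open>auto simp: S_def\<close>)
  have path: "path v u v" using u by (simp add: gog_loops_def)
  have ul: "set u \<subseteq> gog_letters \<G>" using u by (rule loops_letters)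
  have uc: "val u \<in> carrier G" using ul by (rule val_closed)
  show ?thesis
  proof (cases "dart_count u = 0")
    case True
    then have "val u \<in> VG v" using val_dart_free[OF path] v by blast
    then show ?thesis using v y gy by blast
  next
    case False
    define L where "L = crossed \<one> u"
    have Lne: "L \<noteq> []" using False length_crossed[of \<one> u] by (auto simp: L_def)
    have red: "successively no_return L"
    proof (rule ccontr)
      assume "\<not> ?thesis"
      then obtain as c d bs where L: "L = as @ [c, d] @ bs" and cd: "\<not> no_return c d"
        by (rule not_successively_split)
      obtain E C b where c: "c = ((E, C), b)" by (metis surj_pair)
      have d: "d = ((E, C), \<not> b)" using cd unfolding c no_return_def by (cases d) auto
      obtain w1 r where w1: "u = w1 @ [Dart E b] @ r" "crossed (\<one> \<otimes> val w1 \<otimes> dart_val E b) r = [((E, C), \<not> b)] @ bs"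
        "C = left_mult G (\<one> \<otimes> val w1 \<otimes> (if b then \<one> else inv (s E))) ` AG E"
      proof -
        have "crossed \<one> u = as @ [((E, C), b)] @ ([((E, C), \<not> b)] @ bs)" using L unfolding c d L_def by simp
        from crossed_split[OF this ul one_closed] show ?thesis using that by metis
      qed
      have w1c: "val w1 \<in> carrier G" "dart_val E b \<in> carrier G" "set r \<subseteq> gog_letters \<G>"
        using ul w1(1) val_closed[of w1] by (auto simp: gog_letters_def)
      have xc: "\<one> \<otimes> val w1 \<otimes> dart_val E b \<in> carrier G" using w1c by simp
      obtain w2 w3 where w2: "r = w2 @ [Dart E (\<not> b)] @ w3"
        "C = left_mult G (\<one> \<otimes> val w1 \<otimes> dart_val E b \<otimes> val w2 \<otimes> (if \<not> b then \<one> else inv (s E))) ` AG E"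
      proof -
        have "crossed (\<one> \<otimes> val w1 \<otimes> dart_val E b) r = [] @ [((E, C), \<not> b)] @ bs" using w1(2) by simp
        from crossed_split[OF this w1c(3) xc] show ?thesis using that by metis
      qed
      have "path v (w1 @ [Dart E b] @ w2 @ [Dart E (\<not> b)] @ w3) v" using path w1(1) w2(1) by simp
      moreover have "left_mult G (val w1 \<otimes> (if b then \<one> else inv (s E))) ` AG E =
          left_mult G (val w1 \<otimes> dart_val E b \<otimes> val w2 \<otimes> (if b then inv (s E) else \<one>)) ` AG E"
        using w1(3) w2(2) w1c by (cases b) simp_all
      ultimately obtain q h where q: "path v (w1 @ [Grp q h] @ w3) v"
        "val (w1 @ [Grp q h] @ w3) = val (w1 @ [Dart E b] @ w2 @ [Dart E (\<not> b)] @ w3)"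
        using return_opposite w1c(1) by metis
      then have "dart_count u \<le> dart_count (w1 @ [Grp q h] @ w3)"
        using minimal[OF v, of "w1 @ [Grp q h] @ w3" y] y gy w1(1) w2(1) by (simp add: gog_loops_def)
      then show False unfolding w1(1) w2(1) by simp
    qed
    \<comment> \<open>if the loop backtracked at its base point, a rotated loop could be shortened\<close>
    have turn: "no_return (last L) (tree_shift_dir (val u) (hd L))"
    proof (rule ccontr)
      assume bad: "\<not> ?thesis"
      obtain E C b where hd: "hd L = ((E, C), b)" by (metis surj_pair)
      have last: "last L = ((E, left_mult G (val u) ` C), \<not> b)"
        using bad unfolding hd no_return_def by (cases "last L") (auto simp: tree_shift_def)
      have "tl L \<noteq> []"
      proof
        assume "tl L = []"
        then have "L = [hd L]" using Lne by (cases L) auto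
        then have "last L = hd L" by (metis last.simps)
        then show False using hd last by simp
      qed
      then have L: "L = [((E, C), b)] @ butlast (tl L) @ [((E, left_mult G (val u) ` C), \<not> b)]"
      proof -
        have "tl L = butlast (tl L) @ [last L]" using \<open>tl L \<noteq> []\<close> by (cases L) auto
        moreover have "L = [hd L] @ tl L" using Lne by simp
        ultimately show ?thesis using hd last by metis
      qed
      obtain w1 r where w1: "u = w1 @ [Dart E b] @ r"
        "crossed (\<one> \<otimes> val w1 \<otimes> dart_val E b) r = butlast (tl L) @ [((E, left_mult G (val u) ` C), \<not> b)]"
        "C = left_mult G (\<one> \<otimes> val w1 \<otimes> (if b then \<one> else inv (s E))) ` AG E"
      proof -
        have "crossed \<one> u = [] @ [((E, C), b)] @ (butlast (tl L) @ [((E, left_mult G (val u) ` C), \<not> b)])"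
          using L unfolding L_def by simp
        from crossed_split[OF this ul one_closed] show ?thesis using that by metis
      qed
      have E: "E \<in> arcs \<G>" using ul w1(1) by (auto simp: gog_letters_def)
      have w1c: "val w1 \<in> carrier G" "dart_val E b \<in> carrier G" "set r \<subseteq> gog_letters \<G>" "set w1 \<subseteq> gog_letters \<G>"
        using ul w1(1) val_closed[of w1] E by auto
      have xc: "\<one> \<otimes> val w1 \<otimes> dart_val E b \<in> carrier G" using w1c by simp
      obtain w2 w4 where w2: "r = w2 @ [Dart E (\<not> b)] @ w4"
        "left_mult G (val u) ` C =
          left_mult G (\<one> \<otimes> val w1 \<otimes> dart_val E b \<otimes> val w2 \<otimes> (if \<not> b then \<one> else inv (s E))) ` AG E"
      proof -
        have "crossed (\<one> \<otimes> val w1 \<otimes> dart_val E b) r =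
            butlast (tl L) @ [((E, left_mult G (val u) ` C), \<not> b)] @ []" using w1(2) by simp
        from crossed_split[OF this w1c(3) xc] show ?thesis using that by metis
      qed
      have w2l: "set w2 \<subseteq> gog_letters \<G>" "set w4 \<subseteq> gog_letters \<G>" using w1c w2(1) by auto
      define x where "x = val w1 \<otimes> dart_val E b \<otimes> val w2"
      define z where "z = dart_val E (\<not> b) \<otimes> val w4"
      have vc: "val w2 \<in> carrier G" "val w4 \<in> carrier G" "dart_val E (\<not> b) \<in> carrier G"
        using w2l val_closed E by auto
      have xz: "x \<in> carrier G" "z \<in> carrier G" using w1c vc by (auto simp: x_def z_def)
      have dl: "Dart E d \<in> gog_letters \<G>" for d using E by (simp add: gog_letters_def)
      have valu: "val u = x \<otimes> z"
        unfolding w1(1) w2(1) x_def z_def using w1c w2l vc dl by (simp add: val_append val_Cons m_assoc)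
      define q where "q = gog_org \<G> (Dart E (\<not> b) :: ('v, 'e, 'g) gog_letter)"
      have paths: "path v (w1 @ [Dart E b] @ w2) q" "path q ([Dart E (\<not> b)] @ w4) v" "q \<in> verts \<G>"
        using path E ends_in_verts unfolding w1(1) w2(1) by (auto simp: walk_append q_def)
      have rot: "path q ([] @ [Dart E (\<not> b)] @ (w4 @ w1) @ [Dart E (\<not> \<not> b)] @ w2) q"
        using paths(1,2) by (auto simp: walk_append)
      have ug: "left_mult G (val u) ` C = left_mult G (val u \<otimes> (val w1 \<otimes> (if b then \<one> else inv (s E)))) ` AG E"
        unfolding w1(3) using left_mult_image_comp[of "val u"] uc w1c E by simp
      have "left_mult G (x \<otimes> (if \<not> b then \<one> else inv (s E))) ` AG E = left_mult G (val u) ` C"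
        using w2(2) w1c vc unfolding x_def by simp
      also note ug
      also have "left_mult G (val u \<otimes> (val w1 \<otimes> (if b then \<one> else inv (s E)))) ` AG E =
          left_mult G (x \<otimes> dart_val E (\<not> b) \<otimes> val (w4 @ w1) \<otimes> (if \<not> b then inv (s E) else \<one>)) ` AG E"
        unfolding valu z_def using xz vc w1c w2l E by (cases b) (simp_all add: val_append m_assoc)
      finally have eq: "left_mult G (x \<otimes> (if \<not> b then \<one> else inv (s E))) ` AG E =
        left_mult G (x \<otimes> dart_val E (\<not> b) \<otimes> val (w4 @ w1) \<otimes> (if \<not> b then inv (s E) else \<one>)) ` AG E" .
      from return_opposite[OF rot eq xz(1)] obtain q' h where q': "path q ([] @ [Grp q' h] @ w2) q"
        "val ([] @ [Grp q' h] @ w2) = val ([] @ [Dart E (\<not> b)] @ (w4 @ w1) @ [Dart E (\<not> \<not> b)] @ w2)"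
        by metis
      have "val ([] @ [Dart E (\<not> b)] @ (w4 @ w1) @ [Dart E (\<not> \<not> b)] @ w2) = z \<otimes> x"
        unfolding x_def z_def using w1c w2l vc dl by (simp add: val_append val_Cons m_assoc)
      then have "val ([Grp q' h] @ w2) = z \<otimes> x" using q'(2) by simp
      moreover have "g = (y \<otimes> x) \<otimes> (z \<otimes> x) \<otimes> inv (y \<otimes> x)"
        unfolding gy valu using y xz by (simp add: inv_mult_group m_assoc inv_cancel)
      ultimately have "dart_count u \<le> dart_count ([Grp q' h] @ w2)"
        using minimal[OF paths(3), of "[Grp q' h] @ w2" "y \<otimes> x"] q'(1) y xz by (auto simp: gog_loops_def)
      then show False unfolding w1(1) w2(1) by simp
    qed
    have power: "successively no_return (crossed \<one> (power_word n u)) \<and> (0 < n \<longrightarrow> hd (crossed \<one> (power_word n u)) = hd L)"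
      for n
    proof (induction n)
      case (Suc n)
      have pl: "set (power_word n u) \<subseteq> gog_letters \<G>" using loop_power[OF u, of n] loops_letters by blast
      let ?M = "crossed \<one> (power_word n u)"
      have eq: "crossed \<one> (power_word (Suc n) u) = L @ map (tree_shift_dir (val u)) ?M"
        using crossed_append[OF ul one_closed, of "power_word n u"] crossed_shift[OF pl uc one_closed] uc by (simp add: L_def)
      have "no_return (tree_shift_dir (val u) a) (tree_shift_dir (val u) b) = no_return a b" for a b
        using inj_eq[OF bij_is_inj[OF bij_tree_shift[OF uc]]] by (simp add: no_return_def)
      then have "successively no_return (map (tree_shift_dir (val u)) ?M)"
        using Suc by (simp add: successively_map)
      moreover have "no_return (last L) (hd (map (tree_shift_dir (val u)) ?M))" if "?M \<noteq> []"
      proof -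
        have "0 < n" using that by (cases n) auto
        then show ?thesis using Suc turn that by (simp add: hd_map)
      qed
      ultimately show ?case unfolding eq using red Lne by (auto simp: successively_append_iff)
    qed simp
    have "\<exists>n. k < card (eval tree_letter (power_word n u) {})" for k
    proof -
      let ?n = "Suc k"
      have pl: "path v (power_word ?n u) v" using loop_power[OF u, of ?n] by (simp add: gog_loops_def)
      have "card (eval tree_letter (power_word ?n u) {}) = length (crossed \<one> (power_word ?n u))"
        using eval_tree_letter[OF path_letters[OF pl]] crossed_distinct[OF pl] power[of ?n]
        by (metis odd_set_distinct distinct_card length_map)
      also have "\<dots> = ?n * dart_count u"
      proof -
        have "dart_count (power_word m u) = m * dart_count u" for m by (induction m) auto
        then show ?thesis by (simp only: length_crossed)
      qed
      finally have "card (eval tree_letter (power_word ?n u) {}) = ?n * dart_count u" .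
      moreover have "?n * 1 \<le> ?n * dart_count u" using False by (intro mult_le_mono2) simp
      ultimately have "Suc k \<le> card (eval tree_letter (power_word ?n u) {})" by (simp only: mult_1_right)
      then show ?thesis by (meson Suc_le_lessD)
    qed
    then show ?thesis
      using escapes_of_loop[OF tree_compatible tree_letter_affine v0 v u y] gy by simp
  qed
qed

end

section \<open>Additive functions on subgroups\<close>

definition additive :: "('g, 'm) monoid_scheme \<Rightarrow> 'g set \<Rightarrow> ('g \<Rightarrow> int) \<Rightarrow> bool" where
  "additive G H h \<longleftrightarrow> (\<forall>x\<in>H. \<forall>y\<in>H. h (x \<otimes>\<^bsub>G\<^esub> y) = h x + h y)"

lemma additive_add: "additive G H h \<Longrightarrow> additive G H h' \<Longrightarrow> additive G H (\<lambda>x. h x + h' x)"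
  by (simp add: additive_def)

lemma additive_scale: "additive G H h \<Longrightarrow> additive G H (\<lambda>x. a * h x)"
  by (simp add: additive_def distrib_left)

lemma additive_sum: "(\<And>i. i \<in> A \<Longrightarrow> additive G H (h i)) \<Longrightarrow> additive G H (\<lambda>x. \<Sum>i\<in>A. h i x)"
  by (simp add: additive_def sum.distrib)

context group
begin

lemma additive_one: "additive G H h \<Longrightarrow> subgroup H G \<Longrightarrow> h \<one> = 0"
  using subgroup.one_closed[of H G] by (force simp: additive_def)

lemma additive_inv: "additive G H h \<Longrightarrow> subgroup H G \<Longrightarrow> x \<in> H \<Longrightarrow> h (inv x) = - h x"
proof -
  assume *: "additive G H h" "subgroup H G" "x \<in> H"
  have "h (x \<otimes> inv x) = h x + h (inv x)"
    using * subgroup.m_inv_closed[OF *(2,3)] by (simp add: additive_def)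
  moreover have "h (x \<otimes> inv x) = 0"
    using * additive_one subgroup.mem_carrier[OF *(2,3)] by simp
  ultimately show ?thesis by simp
qed

lemma subgroup_nat_pow: "subgroup H G \<Longrightarrow> x \<in> H \<Longrightarrow> x [^] (n::nat) \<in> H"
  by (induction n) (auto intro: subgroup.one_closed subgroup.m_closed)

lemma subgroup_int_pow: "subgroup H G \<Longrightarrow> x \<in> H \<Longrightarrow> x [^] (n::int) \<in> H"
  using subgroup_nat_pow subgroup.m_inv_closed[of H G] subgroup.mem_carrier[of H G x]
  by (cases n rule: int_cases2) (auto simp: int_pow_int int_pow_neg)

lemma additive_nat_pow:
  "additive G H h \<Longrightarrow> subgroup H G \<Longrightarrow> x \<in> H \<Longrightarrow> h (x [^] (n::nat)) = int n * h x"
proof (induction n)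
  case (Suc n)
  then have "h (x [^] n \<otimes> x) = h (x [^] n) + h x" using subgroup_nat_pow by (simp add: additive_def)
  then show ?case using Suc by (simp add: algebra_simps)
qed (simp add: additive_one)

lemma additive_int_pow:
  assumes "additive G H h" "subgroup H G" "x \<in> H"
  shows "h (x [^] (n::int)) = n * h x"
proof (cases n rule: int_cases2)
  case (nonneg k)
  then show ?thesis using additive_nat_pow[OF assms] by (simp add: int_pow_int)
next
  case (nonpos k)
  then show ?thesis
    using additive_nat_pow[OF assms, of k] additive_inv[OF assms(1,2) subgroup_nat_pow[OF assms(2,3)]]
      subgroup.mem_carrier[OF assms(2,3)]
    by (simp add: int_pow_int int_pow_neg)
qed

end

lemma idp_facts:
  fixes G :: "'g monoid" (structure)
  assumes "group G" "internal_direct_product G A B H"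
  shows "subgroup A G" "subgroup B G" "subgroup H G"
    and "a \<in> A \<Longrightarrow> b \<in> B \<Longrightarrow> a \<otimes> b = b \<otimes> a" and "a \<in> A \<Longrightarrow> a \<in> H" and "b \<in> B \<Longrightarrow> b \<in> H"
    and "x \<in> H \<Longrightarrow> \<exists>a\<in>A. \<exists>b\<in>B. x = a \<otimes> b"
proof -
  interpret group G by (rule assms(1))
  show sub: "subgroup A G" "subgroup B G" "subgroup H G"
    using assms by (auto simp: internal_direct_product_def)
  let ?f = "\<lambda>(a, b). a \<otimes> b"
  have hom: "?f \<in> hom (sub G A \<times>\<times> sub G B) (sub G H)" and bij: "bij_betw ?f (A \<times> B) H"
    using assms by (auto simp: internal_direct_product_def iso_def DirProd_def)
  have one: "\<one> \<in> A" "\<one> \<in> B" using sub subgroup.one_closed by auto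
  have car: "a \<in> A \<Longrightarrow> a \<in> carrier G" "b \<in> B \<Longrightarrow> b \<in> carrier G" for a b
    using subgroup.mem_carrier[OF sub(1)] subgroup.mem_carrier[OF sub(2)] by auto
  show "a \<otimes> b = b \<otimes> a" if ab: "a \<in> A" "b \<in> B"
  proof -
    have "?f ((\<one>, b) \<otimes>\<^bsub>sub G A \<times>\<times> sub G B\<^esub> (a, \<one>)) = ?f (\<one>, b) \<otimes>\<^bsub>sub G H\<^esub> ?f (a, \<one>)"
      by (rule hom_mult[OF hom]) (use ab one in \<open>simp_all add: DirProd_def\<close>)
    then show ?thesis using ab car by (simp add: DirProd_def)
  qed
  show "a \<in> H" if "a \<in> A"
  proof -
    have "(a, \<one>) \<in> A \<times> B" using that one by simp
    then have "?f (a, \<one>) \<in> H" by (rule bij_betwE[OF bij, rule_format])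
    then show ?thesis using that car by simp
  qed
  show "b \<in> H" if "b \<in> B"
  proof -
    have "(\<one>, b) \<in> A \<times> B" using that one by simp
    then have "?f (\<one>, b) \<in> H" by (rule bij_betwE[OF bij, rule_format])
    then show ?thesis using that car by simp
  qed
  show "\<exists>a\<in>A. \<exists>b\<in>B. x = a \<otimes> b" if "x \<in> H"
    using bij that unfolding bij_betw_def by (auto simp: image_iff)
qed

section \<open>The data of a torus splitting\<close>

locale torus_data = group G for G :: "'g monoid" (structure) +
  fixes F :: "'g set" and t :: 'g and S :: "('v, 'e, 'g) torus_splitting"
  assumes fbc: "free_by_cyclic G F t" and torus: "torus_splitting_of G F t S"
begin

text \<open>
  The exponent of \<open>t\<close>.
\<close>

definition height :: "'g \<Rightarrow> int" where
  "height g = snd (the_inv_into (F \<times> UNIV) (\<lambda>(f, n). f \<otimes> t [^] (n::int)) g)"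

lemma F_normal: "F \<lhd> G" and t_closed: "t \<in> carrier G"
  and fbc_bij: "bij_betw (\<lambda>(f, n). f \<otimes> t [^] (n::int)) (F \<times> UNIV) (carrier G)"
  using fbc by (simp_all add: free_by_cyclic_def)

lemma F_subgroup: "subgroup F G"
  using F_normal by (rule normal_imp_subgroup)

lemma F_closed: "f \<in> F \<Longrightarrow> f \<in> carrier G"
  by (rule subgroup.mem_carrier[OF F_subgroup])

lemma height_eq: "f \<in> F \<Longrightarrow> height (f \<otimes> t [^] n) = n"
  using the_inv_into_f_f[of "\<lambda>(f, n). f \<otimes> t [^] (n::int)" "F \<times> UNIV" "(f, n)"] fbc_bij
  by (simp add: height_def bij_betw_def)

lemma fibre_decomposition: assumes "g \<in> carrier G" obtains f where "f \<in> F" "g = f \<otimes> t [^] height g"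
proof -
  have "g \<in> (\<lambda>(f, n). f \<otimes> t [^] (n::int)) ` (F \<times> UNIV)" using fbc_bij assms by (simp add: bij_betw_def)
  then obtain f n where "f \<in> F" "g = f \<otimes> t [^] (n::int)" by auto
  then show ?thesis using that height_eq by metis
qed

lemma height_additive: "additive G (carrier G) height"
  unfolding additive_def
proof (intro ballI)
  fix g h assume "g \<in> carrier G" "h \<in> carrier G"
  then obtain f f' where f: "f \<in> F" "g = f \<otimes> t [^] height g" and f': "f' \<in> F" "h = f' \<otimes> t [^] height h"
    using fibre_decomposition by metis
  let ?T = "t [^] height g"
  have c: "f \<in> carrier G" "f' \<in> carrier G" "?T \<in> carrier G" "t [^] height h \<in> carrier G"
    using f f' F_closed t_closed by auto
  have "?T \<otimes> f' \<otimes> inv ?T \<in> F" using normal.inv_op_closed2[OF F_normal c(3) f'(1)] .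
  then have F: "f \<otimes> (?T \<otimes> f' \<otimes> inv ?T) \<in> F" using f(1) subgroup.m_closed[OF F_subgroup] by blast
  have "g \<otimes> h = f \<otimes> (?T \<otimes> f' \<otimes> inv ?T) \<otimes> (?T \<otimes> t [^] height h)"
    by (subst f(2), subst f'(2)) (use c in \<open>simp add: m_assoc inv_cancel\<close>)
  also have "?T \<otimes> t [^] height h = t [^] (height g + height h)" using t_closed by (simp add: int_pow_mult)
  finally show "height (g \<otimes> h) = height g + height h" using height_eq[OF F] by metis
qed

lemma height_mult: "x \<in> carrier G \<Longrightarrow> y \<in> carrier G \<Longrightarrow> height (x \<otimes> y) = height x + height y"
  using height_additive by (simp add: additive_def)

lemma height_F: "f \<in> F \<Longrightarrow> height f = 0"
  using height_eq[of f 0] F_closed by simp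

lemma group_self: "subgroup (carrier G) G"
  by (rule subgroup_self)

abbreviation arcs' where "arcs' \<equiv> arcs (\<Delta> S)"

lemma graph: "torus_graph S" and vertex_groups: "torus_vertex_groups G F t S" and edge_groups: "torus_edge_groups G F S"
  and split: "splits_as G (gog_G G S) (stab S)"
  using torus by (simp_all add: torus_splitting_of_def)

lemma verts_eq: "verts (\<Delta> S) = black S \<union> white S" and black_white: "black S \<inter> white S = {}"
  and tail_black: "e \<in> arcs' \<Longrightarrow> tail (\<Delta> S) e \<in> black S" and head_white: "e \<in> arcs' \<Longrightarrow> head (\<Delta> S) e \<in> white S"
  and finite_arcs: "finite arcs'"
  using graph by (auto simp: torus_graph_def fin_digraph_def fin_digraph_axioms_def)

sublocale sg: split_group G "gog_G G S" "stab S"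
  by unfold_locales (rule split)

lemma gog_simps [simp]:
  "verts (gog_G G S) = verts (\<Delta> S)" "arcs (gog_G G S) = arcs'" "tail (gog_G G S) = tail (\<Delta> S)"
  "head (gog_G G S) = head (\<Delta> S)" "carrier (vgrp (gog_G G S) v) = VG S v" "carrier (egrp (gog_G G S) e) = EG S e"
  "tail_emb (gog_G G S) = embB S" "head_emb (gog_G G S) = embW S"
  by (simp_all add: gog_G_def)

lemma vertex_facts:
  assumes "v \<in> verts (\<Delta> S)"
  shows "VF S v \<subseteq> F" "finite_rank_free (sub G (VF S v))" "tv S v \<in> carrier G" "height (tv S v) = 1"
    "internal_direct_product G (VF S v) (generate G {tv S v}) (VG S v)"
proof -
  show "VF S v \<subseteq> F" "finite_rank_free (sub G (VF S v))"
    "internal_direct_product G (VF S v) (generate G {tv S v}) (VG S v)"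
    using vertex_groups assms by (simp_all add: torus_vertex_groups_def)
  obtain f where f: "f \<in> F" "tv S v = f \<otimes> t"
    using vertex_groups assms by (auto simp: torus_vertex_groups_def r_coset_def)
  then show "tv S v \<in> carrier G" using F_closed t_closed by simp
  show "height (tv S v) = 1" using height_eq[OF f(1), of 1] f(2) t_closed by (simp add: int_pow_1)
qed

lemma VF_subgroup: "v \<in> verts (\<Delta> S) \<Longrightarrow> subgroup (VF S v) G"
  and VG_subgroup: "v \<in> verts (\<Delta> S) \<Longrightarrow> subgroup (VG S v) G"
  using idp_facts[OF is_group vertex_facts(5)] by blast+

lemma tv_in: "v \<in> verts (\<Delta> S) \<Longrightarrow> tv S v \<in> VG S v"
  and VF_VG: "v \<in> verts (\<Delta> S) \<Longrightarrow> f \<in> VF S v \<Longrightarrow> f \<in> VG S v"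
  and tv_commute: "v \<in> verts (\<Delta> S) \<Longrightarrow> f \<in> VF S v \<Longrightarrow> f \<otimes> tv S v = tv S v \<otimes> f"
  using idp_facts[OF is_group vertex_facts(5)] generate.incl[of "tv S v" "{tv S v}" G] by simp_all

lemma VG_closed: "v \<in> verts (\<Delta> S) \<Longrightarrow> g \<in> VG S v \<Longrightarrow> g \<in> carrier G"
  and VF_closed: "v \<in> verts (\<Delta> S) \<Longrightarrow> f \<in> VF S v \<Longrightarrow> f \<in> carrier G"
  and height_VF: "v \<in> verts (\<Delta> S) \<Longrightarrow> f \<in> VF S v \<Longrightarrow> height f = 0"
proof -
  assume v: "v \<in> verts (\<Delta> S)"
  show "g \<in> VG S v \<Longrightarrow> g \<in> carrier G" by (rule subgroup.mem_carrier[OF VG_subgroup[OF v]])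
  show "f \<in> VF S v \<Longrightarrow> f \<in> carrier G" by (rule subgroup.mem_carrier[OF VF_subgroup[OF v]])
  show "height f = 0" if "f \<in> VF S v" using vertex_facts(1)[OF v] that height_F by auto
qed

lemma tv_pow_commute:
  assumes v: "v \<in> verts (\<Delta> S)" and f: "f \<in> VF S v"
  shows "f \<otimes> tv S v [^] (n::int) = tv S v [^] n \<otimes> f"
proof -
  have "tv S v [^] n \<in> generate G {tv S v}"
    using generate_pow[OF vertex_facts(3)[OF v]] by auto
  then show ?thesis using idp_facts(4)[OF is_group vertex_facts(5)[OF v] f] by simp
qed

text \<open>The projection of a vertex group to its intersection with the fibre.\<close>

definition proj :: "'v \<Rightarrow> 'g \<Rightarrow> 'g" where
  "proj v g = g \<otimes> tv S v [^] (- height g)"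

lemma height_tv_pow: "v \<in> verts (\<Delta> S) \<Longrightarrow> height (tv S v [^] (n::int)) = n"
  using additive_int_pow[OF height_additive group_self] vertex_facts(3,4) by simp

lemma proj_in: assumes v: "v \<in> verts (\<Delta> S)" and g: "g \<in> VG S v"
  shows "proj v g \<in> VF S v" "g = proj v g \<otimes> tv S v [^] height g"
proof -
  obtain f b where fb: "f \<in> VF S v" "b \<in> generate G {tv S v}" "g = f \<otimes> b"
    using idp_facts(7)[OF is_group vertex_facts(5)[OF v] g] by blast
  then obtain n :: int where n: "b = tv S v [^] n" using generate_pow[OF vertex_facts(3)[OF v]] by auto
  have c: "f \<in> carrier G" "tv S v \<in> carrier G" using VF_closed v fb vertex_facts(3) by auto
  have "height g = n" using fb n c v height_VF height_tv_pow by (simp add: height_mult)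
  then have "proj v g = f" using fb n c by (simp add: proj_def m_assoc int_pow_neg)
  then show "proj v g \<in> VF S v" "g = proj v g \<otimes> tv S v [^] height g" using fb n \<open>height g = n\<close> by auto
qed

lemma proj_mult: assumes v: "v \<in> verts (\<Delta> S)" and gh: "g \<in> VG S v" "h \<in> VG S v"
  shows "proj v (g \<otimes> h) = proj v g \<otimes> proj v h"
proof -
  note p = proj_in[OF v gh(1)] proj_in[OF v gh(2)]
  let ?t = "tv S v"
  have c: "proj v g \<in> carrier G" "proj v h \<in> carrier G" "?t \<in> carrier G" "g \<in> carrier G" "h \<in> carrier G"
    using p VF_closed VG_closed v vertex_facts(3) gh by auto
  have "g \<otimes> h = proj v g \<otimes> (?t [^] height g \<otimes> proj v h) \<otimes> ?t [^] height h"
    by (subst p(2), subst p(4)) (use c in \<open>simp add: m_assoc\<close>)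
  also have "?t [^] height g \<otimes> proj v h = proj v h \<otimes> ?t [^] height g"
    using tv_pow_commute[OF v p(3)] by simp
  finally have gh_eq: "g \<otimes> h = proj v g \<otimes> proj v h \<otimes> ?t [^] (height g + height h)"
    using c by (simp add: m_assoc int_pow_mult)
  have "proj v (g \<otimes> h) = g \<otimes> h \<otimes> inv (?t [^] (height g + height h))"
    unfolding proj_def[of v "g \<otimes> h"] using c by (simp only: height_mult int_pow_neg)
  then show ?thesis unfolding gh_eq using c by (simp add: m_assoc)
qed

lemma proj_VF: "v \<in> verts (\<Delta> S) \<Longrightarrow> f \<in> VF S v \<Longrightarrow> proj v f = f"
  using VF_closed by (simp add: proj_def height_VF)

lemma proj_tv: "v \<in> verts (\<Delta> S) \<Longrightarrow> proj v (tv S v) = \<one>"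
  using vertex_facts(3,4) by (simp add: proj_def int_pow_neg int_pow_1)

lemma additive_proj:
  "v \<in> verts (\<Delta> S) \<Longrightarrow> additive G (VF S v) \<psi> \<Longrightarrow> additive G (VG S v) (\<lambda>g. \<psi> (proj v g))"
  using proj_in by (simp add: additive_def proj_mult)

lemma additive_height: "v \<in> verts (\<Delta> S) \<Longrightarrow> additive G (VG S v) height"
  using VG_closed by (simp add: additive_def height_mult)

lemma edge_facts:
  assumes e: "e \<in> arcs'"
  shows "re S e \<in> EG S e" "te S e \<in> EG S e" "embB S e ` EG S e = VG S (tail (\<Delta> S) e)"
    "embB S e (re S e) = rv S (tail (\<Delta> S) e)" "embB S e (te S e) = tv S (tail (\<Delta> S) e)"
    "embW S e (re S e) = pe S e" "embW S e (te S e) = pe S e [^] ke S e \<otimes> tv S (head (\<Delta> S) e)"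
    "pe S e \<in> VF S (head (\<Delta> S) e)" "subgroup (EG S e) G" "EG S e = generate G {re S e, te S e}"
proof -
  have *: "re S e \<in> F" "te S e \<in> carrier G"
    "internal_direct_product G (EF G S e) (generate G {te S e}) (EG S e)"
    "embB S e \<in> iso (sub G (EG S e)) (sub G (VG S (tail (\<Delta> S) e)))"
    using edge_groups e by (auto simp: torus_edge_groups_def Let_def)
  show "embB S e (re S e) = rv S (tail (\<Delta> S) e)" "embB S e (te S e) = tv S (tail (\<Delta> S) e)"
    "embW S e (re S e) = pe S e" "embW S e (te S e) = pe S e [^] ke S e \<otimes> tv S (head (\<Delta> S) e)"
    "pe S e \<in> VF S (head (\<Delta> S) e)"
    using edge_groups e by (auto simp: torus_edge_groups_def Let_def)
  show "embB S e ` EG S e = VG S (tail (\<Delta> S) e)" using *(4) by (auto simp: iso_def bij_betw_def)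
  note idp = idp_facts[OF is_group *(3)]
  show sub: "subgroup (EG S e) G" by (rule idp(3))
  show re: "re S e \<in> EG S e" using idp(5) generate.incl[of "re S e" "{re S e}" G] by (simp add: EF_def)
  show te: "te S e \<in> EG S e" using idp(6) generate.incl[of "te S e" "{te S e}" G] by simp
  show "EG S e = generate G {re S e, te S e}"
  proof
    show "generate G {re S e, te S e} \<subseteq> EG S e"
      using generate_subgroup_incl[OF _ sub] re te by simp
    show "EG S e \<subseteq> generate G {re S e, te S e}"
    proof
      fix c assume "c \<in> EG S e"
      then obtain a b where ab: "a \<in> generate G {re S e}" "b \<in> generate G {te S e}" "c = a \<otimes> b"
        using idp(7) unfolding EF_def by blast
      have "a \<in> generate G {re S e, te S e}" "b \<in> generate G {re S e, te S e}"
        using mono_generate[of "{re S e}" "{re S e, te S e}"] mono_generate[of "{te S e}" "{re S e, te S e}"] ab by auto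
      then show "c \<in> generate G {re S e, te S e}" unfolding ab(3) by (rule generate.eng)
    qed
  qed
qed

lemma emb_mult:
  assumes e: "e \<in> arcs'" and c: "c \<in> EG S e" "d \<in> EG S e"
  shows "embB S e (c \<otimes> d) = embB S e c \<otimes> embB S e d" "embW S e (c \<otimes> d) = embW S e c \<otimes> embW S e d"
proof -
  have "embB S e \<in> hom (sub G (EG S e)) (sub G (VG S (tail (\<Delta> S) e)))"
    "embW S e \<in> hom (sub G (EG S e)) (sub G (VG S (head (\<Delta> S) e)))"
    using edge_groups e by (auto simp: torus_edge_groups_def Let_def iso_def mon_def)
  then show "embB S e (c \<otimes> d) = embB S e c \<otimes> embB S e d" "embW S e (c \<otimes> d) = embW S e c \<otimes> embW S e d"
    using c by (auto simp: hom_def)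
qed

lemma emb_in:
  "e \<in> arcs' \<Longrightarrow> c \<in> EG S e \<Longrightarrow> embB S e c \<in> VG S (tail (\<Delta> S) e)"
  "e \<in> arcs' \<Longrightarrow> c \<in> EG S e \<Longrightarrow> embW S e c \<in> VG S (head (\<Delta> S) e)"
  using sg.emb_closed[of e c] by simp_all

lemma additive_edge_eq:
  assumes e: "e \<in> arcs'" and h: "additive G (EG S e) h" and h': "additive G (EG S e) h'"
    and "h (re S e) = h' (re S e)" "h (te S e) = h' (te S e)" and c: "c \<in> EG S e"
  shows "h c = h' c"
proof -
  note sub = edge_facts(9)[OF e]
  have "c \<in> generate G {re S e, te S e}" using c edge_facts(10)[OF e] by simp
  then show ?thesis
  proof (induction rule: generate.induct)
    case (inv x)
    then have "x \<in> EG S e" using edge_facts(1,2)[OF e] by auto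
    then show ?case using additive_inv[OF h sub] additive_inv[OF h' sub] inv assms by auto
  next
    case (eng x y)
    then have "x \<in> EG S e" "y \<in> EG S e" using edge_facts(10)[OF e] by auto
    then show ?case using eng h h' by (simp add: additive_def)
  qed (use assms additive_one[OF h sub] additive_one[OF h' sub] in auto)
qed

lemma additive_emb:
  assumes e: "e \<in> arcs'"
  shows "additive G (VG S (tail (\<Delta> S) e)) h \<Longrightarrow> additive G (EG S e) (\<lambda>c. h (embB S e c))"
    and "additive G (VG S (head (\<Delta> S) e)) h \<Longrightarrow> additive G (EG S e) (\<lambda>c. h (embW S e c))"
  using emb_in[OF e] emb_mult[OF e] by (simp_all add: additive_def)

text \<open>The exponent of \<open>r\<close>, which is well defined as \<open>F\<^sub>b\<close> is torsion-free and not trivial.\<close>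

lemma ex_black_coordinate:
  assumes b: "b \<in> black S"
  obtains \<chi> where "additive G (VG S b) \<chi>" "\<chi> (rv S b) = 1" "\<chi> (tv S b) = 0"
    "\<And>f. f \<in> VF S b \<Longrightarrow> f \<noteq> \<one> \<Longrightarrow> \<chi> f \<noteq> 0"
proof -
  have v: "b \<in> verts (\<Delta> S)" using b verts_eq by simp
  have r: "rv S b \<in> VF S b" "generate G {rv S b} = VF S b" using edge_groups b by (auto simp: torus_edge_groups_def)
  have rc: "rv S b \<in> carrier G" using VF_closed[OF v r(1)] .
  obtain B where B: "free_basis (sub G (VF S b)) B" "finite B" "card B = 1"
    using vertex_groups b by (auto simp: torus_vertex_groups_def free_of_rank_def)
  interpret free: based_free_group "sub G (VF S b)" B by unfold_locales (rule B(1))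
  obtain x where x: "B = {x}" using B(3) by (rule card_1_singletonE)
  have "x \<noteq> \<one>"
  proof
    assume "x = \<one>"
    then have "word_val (sub G (VF S b)) [(x, True)] = word_val (sub G (VF S b)) []"
      by (simp add: word_val_def)
    then have "[(x, True)] = []"
      using free.reduced_val_inj[of "[(x, True)]" "[]"] x by (simp add: reduced_words_def)
    then show False by simp
  qed
  have pow: "rv S b [^] (n::nat) \<noteq> \<one>" if "n \<noteq> 0" for n
  proof -
    have "rv S b \<noteq> \<one>"
    proof
      assume "rv S b = \<one>"
      then have "VF S b = {\<one>}" using r(2) generate_one by simp
      then show False using free.B_carrier x \<open>x \<noteq> \<one>\<close> by simp
    qed
    then have "rv S b [^]\<^bsub>sub G (VF S b)\<^esub> n \<noteq> \<one>" using free.torsion_free[of "rv S b" n] r(1) that by simp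
    then show ?thesis using nat_pow_consistent by metis
  qed
  have inj: "m = n" if "rv S b [^] (m::int) = rv S b [^] n" for m n
  proof (rule ccontr)
    assume ne: "m \<noteq> n"
    have one: "rv S b [^] (m - n) = \<one>" "rv S b [^] (n - m) = \<one>" using that rc by (simp_all add: int_pow_diff)
    have "rv S b [^] int (nat \<bar>m - n\<bar>) = \<one>" using one by (cases "m \<ge> n") (simp_all add: abs_if)
    then show False using pow[of "nat \<bar>m - n\<bar>"] ne by (simp add: int_pow_int del: int_nat_eq)
  qed
  define \<chi>0 where "\<chi>0 f = (THE n::int. f = rv S b [^] n)" for f
  have \<chi>0: "\<chi>0 (rv S b [^] n) = n" for n unfolding \<chi>0_def using inj by (intro the_equality) auto
  have VF: "f \<in> VF S b \<longleftrightarrow> (\<exists>n::int. f = rv S b [^] n)" for f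
    using generate_pow[OF rc] r(2) by auto
  have add: "additive G (VF S b) \<chi>0"
    unfolding additive_def
  proof (intro ballI)
    fix x y assume "x \<in> VF S b" "y \<in> VF S b"
    then obtain m n :: int where "x = rv S b [^] m" "y = rv S b [^] n" using VF by blast
    then show "\<chi>0 (x \<otimes> y) = \<chi>0 x + \<chi>0 y" using rc \<chi>0 by (simp flip: int_pow_mult)
  qed
  show ?thesis
  proof (rule that[of "\<lambda>g. \<chi>0 (proj b g)"])
    show "additive G (VG S b) (\<lambda>g. \<chi>0 (proj b g))" by (rule additive_proj[OF v add])
    show "\<chi>0 (proj b (rv S b)) = 1" using proj_VF[OF v r(1)] \<chi>0[of 1] rc by (simp add: int_pow_1)
    show "\<chi>0 (proj b (tv S b)) = 0" using proj_tv[OF v] \<chi>0[of 0] by simp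
    show "\<chi>0 (proj b f) \<noteq> 0" if f: "f \<in> VF S b" "f \<noteq> \<one>" for f
      using f VF \<chi>0 by (metis int_pow_0 proj_VF[OF v])
  qed
qed

end

section \<open>Conjugates of edge elements\<close>

context torus_data
begin

lemma edge_s_closed: "e \<in> arcs' \<Longrightarrow> stab S e \<in> carrier G"
  using split by (simp add: splits_as_def)

lemma edge_conj: "e \<in> arcs' \<Longrightarrow> c \<in> EG S e \<Longrightarrow> stab S e \<otimes> embW S e c \<otimes> inv (stab S e) = embB S e c"
  using sg.edge_relation[of e c] by simp

lemma edge_conj_inv:
  assumes e: "e \<in> arcs'" and c: "c \<in> EG S e"
  shows "inv (stab S e) \<otimes> embB S e c \<otimes> stab S e = embW S e c"
proof -
  have cl: "stab S e \<in> carrier G" "embW S e c \<in> carrier G"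
    using edge_s_closed[OF e] VG_closed[OF _ emb_in(2)[OF e c]] head_white[OF e] verts_eq by auto
  show ?thesis unfolding edge_conj[OF e c, symmetric] using cl by (simp add: m_assoc inv_cancel)
qed

lemma edge_verts: "e \<in> arcs' \<Longrightarrow> tail (\<Delta> S) e \<in> verts (\<Delta> S)" "e \<in> arcs' \<Longrightarrow> head (\<Delta> S) e \<in> verts (\<Delta> S)"
  using tail_black head_white verts_eq by auto

lemma embW_hom: assumes e: "e \<in> arcs'" shows "group_hom (sub G (EG S e)) G (embW S e)"
  proof (intro group_hom.intro group_hom_axioms.intro)
    show "Group.group (sub G (EG S e))" using subgroup.subgroup_is_group[OF edge_facts(9)[OF e] is_group] .
  qed (use emb_mult(2)[OF e] VG_closed[OF edge_verts(2)[OF e] emb_in(2)[OF e]] in \<open>auto simp: hom_def\<close>)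

lemma embW_re_pow:
  assumes e: "e \<in> arcs'"
  shows "embW S e (re S e [^] n) = pe S e [^] (n::int)"
proof -
  have sub: "subgroup (EG S e) G" by (rule edge_facts(9)[OF e])
  interpret h: group_hom "sub G (EG S e)" G "embW S e" by (rule embW_hom[OF e])
  show ?thesis
    using h.hom_int_pow[of "re S e" n] edge_facts(1,6)[OF e] int_pow_consistent[OF sub edge_facts(1)[OF e]] by simp
qed

text \<open>The height of the image of \<open>r\<^sup>m t\<^sup>n\<close> is \<open>n\<close>.\<close>

lemma white_edge_fibre:
  assumes e: "e \<in> arcs'" and c: "c \<in> EG S e" "embW S e c \<in> VF S (head (\<Delta> S) e)"
  shows "embW S e c \<in> generate G {pe S e}"
proof -
  let ?w = "head (\<Delta> S) e"
  have wv: "?w \<in> verts (\<Delta> S)" using edge_verts[OF e] by simp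
  have sub: "subgroup (EG S e) G" by (rule edge_facts(9)[OF e])
  have re: "re S e \<in> carrier G" "te S e \<in> carrier G"
    using subgroup.mem_carrier[OF sub] edge_facts(1,2)[OF e] by auto
  have "internal_direct_product G (EF G S e) (generate G {te S e}) (EG S e)"
    using edge_groups e by (auto simp: torus_edge_groups_def Let_def)
  then obtain m n :: int where mn: "c = re S e [^] m \<otimes> te S e [^] n"
    using idp_facts(7)[OF is_group _ c(1)] generate_pow[OF re(1)] generate_pow[OF re(2)]
    unfolding EF_def by fastforce
  have pw: "re S e [^] m \<in> EG S e" "te S e [^] n \<in> EG S e"
    using subgroup_int_pow[OF sub] edge_facts(1,2)[OF e] by auto
  have pc: "pe S e \<in> carrier G" using VF_closed[OF wv edge_facts(8)[OF e]] .
  have add: "additive G (EG S e) (\<lambda>c. height (embW S e c))" using additive_emb(2)[OF e additive_height[OF wv]] .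
  have hp: "height (pe S e [^] k) = 0" for k :: int
    using height_VF[OF wv] subgroup_int_pow[OF VF_subgroup[OF wv] edge_facts(8)[OF e]] by blast
  have "height (embW S e (te S e)) = 1"
    using edge_facts(7)[OF e] pc vertex_facts(3,4)[OF wv] hp by (simp add: height_mult)
  then have "height (embW S e (te S e [^] n)) = n"
    using additive_int_pow[OF add sub edge_facts(2)[OF e], of n] by simp
  moreover have "height (embW S e c) = 0" using height_VF[OF wv c(2)] .
  ultimately have "n = 0"
    using add pw mn hp embW_re_pow[OF e] by (simp add: additive_def)
  then have "embW S e c = pe S e [^] m" using mn re embW_re_pow[OF e] by simp
  then show ?thesis using generate_pow[OF pc] by blast
qed

lemma pe_power_nontrivial:
  assumes e: "e \<in> arcs'" and a: "a \<noteq> 0"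
  shows "pe S e [^] (a::int) \<noteq> \<one>"
proof
  assume one: "pe S e [^] a = \<one>"
  obtain \<chi> where \<chi>: "additive G (VG S (tail (\<Delta> S) e)) \<chi>" "\<chi> (rv S (tail (\<Delta> S) e)) = 1"
    using ex_black_coordinate[OF tail_black[OF e]] by metis
  have re: "re S e \<in> EG S e" and sub: "subgroup (EG S e) G" using edge_facts[OF e] by simp_all
  have reG: "re S e \<in> carrier G" using subgroup.mem_carrier[OF sub re] .
  have rea: "re S e [^] a \<in> EG S e" by (rule subgroup_int_pow[OF sub re])
  have "embW S e (re S e [^] a) = embW S e (re S e [^] (0::int))"
    using one embW_re_pow[OF e, of a] embW_re_pow[OF e, of 0] by simp
  then have "embW S e (re S e [^] a) = embW S e \<one>" by simp
  moreover have "inj_on (embW S e) (EG S e)"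
    using edge_groups e by (auto simp: torus_edge_groups_def Let_def mon_def)
  ultimately have "re S e [^] a = \<one>" using rea subgroup.one_closed[OF sub] by (auto dest: inj_onD)
  then have "a * \<chi> (embB S e (re S e)) = 0"
    using additive_int_pow[OF additive_emb(1)[OF e \<chi>(1)] sub re, of a]
      additive_one[OF additive_emb(1)[OF e \<chi>(1)] sub] by simp
  then show False using a \<chi>(2) edge_facts(4)[OF e] by simp
qed

text \<open>
  An edge of the Bass--Serre tree at the white vertex \<open>VG w\<close>: its black end is the coset of
  \<open>x s\<inverse>\<close>, whose stabiliser contains \<open>x p x\<inverse>\<close> and the central element \<open>t\<^sub>w\<close>.
\<close>

lemma white_star:
  fixes x :: 'g
  assumes e: "e \<in> edges_at_white S w" and x: "x \<in> VF S w"
  defines "y \<equiv> x \<otimes> inv (stab S e)"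
    and "T \<equiv> Bass_Serre_tree G (gog_G G S) (stab S)" and "b \<equiv> tail (\<Delta> S) e"
  shows "(e, y <# VG S b) \<in> arcs T" "tail T (e, y <# VG S b) = (b, y <# VG S b)"
    "head T (e, y <# VG S b) = (w, VG S w)"
    "x \<otimes> pe S e [^] (a::int) \<otimes> inv x \<in> coset_stabiliser G (b, y <# VG S b)"
    "tv S w \<in> coset_stabiliser G (b, y <# VG S b)"
proof -
  have e': "e \<in> arcs'" and w: "w = head (\<Delta> S) e" using e by (auto simp: edges_at_white_def)
  have wv: "w \<in> verts (\<Delta> S)" and bv: "b \<in> verts (\<Delta> S)" using edge_verts[OF e'] w b_def by auto
  let ?s = "stab S e"
  have s: "?s \<in> carrier G" by (rule edge_s_closed[OF e'])
  have xc: "x \<in> carrier G" by (rule VF_closed[OF wv x])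
  have yc: "y \<in> carrier G" using s xc by (simp add: y_def)
  have subB: "subgroup (VG S b) G" "VG S b \<subseteq> carrier G" using VG_subgroup[OF bv] VG_closed[OF bv] by auto
  have subW: "subgroup (VG S w) G" using VG_subgroup[OF wv] .
  have img: "embB S e ` EG S e = VG S b" using edge_facts(3)[OF e'] b_def by simp
  show "(e, y <# VG S b) \<in> arcs T"
    using e' yc img by (auto simp: T_def Bass_Serre_tree_def LCOSETS_def)
  show "tail T (e, y <# VG S b) = (b, y <# VG S b)"
    using setmult_lcos_assoc[OF subB(2,2) yc] subgroup_mult_id[OF subB(1)]
    by (simp add: T_def Bass_Serre_tree_def b_def)
  have elem: "y \<otimes> embB S e c \<otimes> ?s = x \<otimes> embW S e c" if c: "c \<in> EG S e" for c
  proof -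
    have "embB S e c \<in> carrier G" using VG_closed[OF bv] emb_in(1)[OF e' c] b_def by simp
    then show ?thesis unfolding edge_conj_inv[OF e' c, symmetric] y_def using s xc by (simp add: m_assoc)
  qed
  have "((y <# VG S b) #> ?s) <#> VG S w = VG S w"
  proof
    show "((y <# VG S b) #> ?s) <#> VG S w \<subseteq> VG S w"
    proof
      fix z assume "z \<in> ((y <# VG S b) #> ?s) <#> VG S w"
      then obtain h k where hk: "h \<in> VG S b" "k \<in> VG S w" "z = y \<otimes> h \<otimes> ?s \<otimes> k"
        by (auto simp: set_mult_def r_coset_def l_coset_def)
      then obtain c where c: "c \<in> EG S e" "h = embB S e c" using img by auto
      have "x \<otimes> embW S e c \<in> VG S w"
        using emb_in(2)[OF e' c(1)] VF_VG[OF wv x] subgroup.m_closed[OF subW] w by simp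
      then show "z \<in> VG S w" using hk c elem subgroup.m_closed[OF subW] by simp
    qed
    show "VG S w \<subseteq> ((y <# VG S b) #> ?s) <#> VG S w"
    proof
      fix k assume k: "k \<in> VG S w"
      have kc: "k \<in> carrier G" by (rule VG_closed[OF wv k])
      have "inv x \<otimes> k \<in> VG S w"
        using subgroup.m_closed[OF subW subgroup.m_inv_closed[OF subW VF_VG[OF wv x]] k] .
      moreover have "y \<otimes> \<one> \<otimes> ?s \<otimes> (inv x \<otimes> k) = k" using s xc kc by (simp add: y_def m_assoc inv_cancel)
      moreover have "\<one> \<in> VG S b" using subgroup.one_closed[OF subB(1)] .
      ultimately show "k \<in> ((y <# VG S b) #> ?s) <#> VG S w"
        by (force simp: set_mult_def r_coset_def l_coset_def)
    qed
  qed
  then show "head T (e, y <# VG S b) = (w, VG S w)" by (simp add: T_def Bass_Serre_tree_def w)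
  have stabI: "y \<otimes> embB S e c \<otimes> inv y \<in> coset_stabiliser G (b, y <# VG S b)" if c: "c \<in> EG S e" for c
  proof -
    have h: "embB S e c \<in> VG S b" using emb_in(1)[OF e' c] b_def by simp
    have hc: "embB S e c \<in> carrier G" by (rule VG_closed[OF bv h])
    have "(y \<otimes> embB S e c \<otimes> inv y) <# (y <# VG S b) = (y \<otimes> embB S e c) <# VG S b"
      using yc hc subB(2) by (simp add: lcos_m_assoc m_assoc)
    also have "\<dots> = y <# (embB S e c <# VG S b)" using yc hc subB(2) by (simp add: lcos_m_assoc)
    also have "embB S e c <# VG S b = VG S b" using coset_join3[OF hc subB(1) h] .
    finally show ?thesis using yc hc by (simp add: coset_stabiliser_def)
  qed
  have conj: "y \<otimes> embB S e c \<otimes> inv y = x \<otimes> embW S e c \<otimes> inv x" if c: "c \<in> EG S e" for c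
  proof -
    have "embW S e c \<in> carrier G" using VG_closed[OF wv] emb_in(2)[OF e' c] w by simp
    then show ?thesis unfolding edge_conj[OF e' c, symmetric] y_def
      using s xc by (simp add: m_assoc inv_cancel inv_mult_group)
  qed
  have pcar: "pe S e \<in> VF S w" "pe S e \<in> carrier G" using edge_facts(8)[OF e'] VF_closed[OF wv] w by auto
  have sub: "subgroup (EG S e) G" by (rule edge_facts(9)[OF e'])
  note emb_pow = embW_re_pow[OF e']
  have re: "re S e [^] n \<in> EG S e" for n :: int by (rule subgroup_int_pow[OF sub edge_facts(1)[OF e']])
  show "x \<otimes> pe S e [^] a \<otimes> inv x \<in> coset_stabiliser G (b, y <# VG S b)"
    using stabI[OF re[of a]] conj[OF re[of a]] emb_pow by simp
  let ?c = "re S e [^] (- ke S e) \<otimes> te S e"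
  have c: "?c \<in> EG S e" using re edge_facts(2)[OF e'] subgroup.m_closed[OF sub] by blast
  have tc: "tv S w \<in> carrier G" by (rule vertex_facts(3)[OF wv])
  have "embW S e ?c = pe S e [^] (- ke S e) \<otimes> (pe S e [^] ke S e \<otimes> tv S w)"
    using emb_mult(2)[OF e' re edge_facts(2)[OF e']] emb_pow edge_facts(7)[OF e'] w by simp
  also have "\<dots> = tv S w" using pcar tc by (simp add: int_pow_neg inv_cancel)
  finally have "x \<otimes> embW S e ?c \<otimes> inv x = tv S w"
    using tv_commute[OF wv x] xc tc by (simp add: m_assoc)
  then show "tv S w \<in> coset_stabiliser G (b, y <# VG S b)" using stabI[OF c] conj[OF c] by simp
qed

end

locale starred_torus_data = torus_data G F t S
  for G :: "'g monoid" (structure) and F t and S :: "('v, 'e, 'g) torus_splitting" +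
  assumes starred: "starred S"
begin

text \<open>
  Conjugates of edge elements at a white vertex are commensurable only for the obvious reason: the
  stabilisers of two black neighbours of a white vertex of the Bass--Serre tree both contain \<open>t\<^sub>w\<close>,
  so an intersection that is cyclic contains no nontrivial element of the fibre.  Two edges
  of \<open>\<Delta>\<close> at \<open>w\<close> have different black ends as there are no \<open>2\<close>-cycles.
\<close>

lemma commensurable_edge_conjugates:
  assumes w: "w \<in> white S" and e: "e \<in> edges_at_white S w" and f: "f \<in> edges_at_white S w"
    and x: "x \<in> VF S w" "x' \<in> VF S w" and a: "(a::int) \<noteq> 0"
    and eq: "x \<otimes> pe S e [^] a \<otimes> inv x = x' \<otimes> pe S f [^] (b::int) \<otimes> inv x'"
  shows "e = f" "inv x \<otimes> x' \<in> generate G {pe S e}"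
proof -
  have wv: "w \<in> verts (\<Delta> S)" using w verts_eq by simp
  let ?T = "Bass_Serre_tree G (gog_G G S) (stab S)"
  let ?y = "x \<otimes> inv (stab S e)" and ?y' = "x' \<otimes> inv (stab S f)"
  let ?b = "tail (\<Delta> S) e" and ?b' = "tail (\<Delta> S) f"
  let ?A = "(e, ?y <# VG S ?b)" and ?A' = "(f, ?y' <# VG S ?b')"
  have e': "e \<in> arcs'" "head (\<Delta> S) e = w" and f': "f \<in> arcs'" "head (\<Delta> S) f = w"
    using e f by (auto simp: edges_at_white_def)
  let ?p = "x \<otimes> pe S e [^] a \<otimes> inv x"
  have xc: "x \<in> carrier G" "x' \<in> carrier G" using VF_closed[OF wv] x by auto
  have pc: "pe S e \<in> carrier G" "pe S e \<in> VF S w" using edge_facts(8)[OF e'(1)] VF_closed[OF wv] e'(2) by auto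
  have p1: "?p \<noteq> \<one>"
  proof
    assume "?p = \<one>"
    then have "inv x \<otimes> ?p \<otimes> x = \<one>" using xc by simp
    then have "pe S e [^] a = \<one>" using xc pc by (simp add: m_assoc inv_cancel)
    then show False using pe_power_nontrivial[OF e'(1) a] by simp
  qed
  have "tail ?T ?A = tail ?T ?A'"
  proof (rule ccontr)
    assume ne: "tail ?T ?A \<noteq> tail ?T ?A'"
    have "is_cyclic G (coset_stabiliser G (tail ?T ?A) \<inter> coset_stabiliser G (tail ?T ?A'))"
      using torus white_star(1,3)[OF e x(1)] white_star(1,3)[OF f x(2)] ne
      unfolding torus_splitting_of_def Let_def by metis
    then obtain c where c: "c \<in> carrier G"
      "coset_stabiliser G (tail ?T ?A) \<inter> coset_stabiliser G (tail ?T ?A') = generate G {c}"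
      unfolding is_cyclic_def by blast
    have "?p \<in> generate G {c}" "tv S w \<in> generate G {c}"
      using white_star(2,4,5)[OF e x(1)] white_star(2,4,5)[OF f x(2)] eq c(2) by (metis IntI)+
    then obtain m n :: int where mn: "?p = c [^] m" "tv S w = c [^] n"
      using generate_pow[OF c(1)] by auto
    have hp: "height ?p = 0"
      using height_VF[OF wv] x pc xc subgroup_int_pow[OF VF_subgroup[OF wv] pc(2)]
        additive_inv[OF height_additive group_self xc(1)] by (simp add: height_mult)
    have "m * height c = 0" "n * height c = 1"
      using hp mn additive_int_pow[OF height_additive group_self c(1)] vertex_facts(4)[OF wv] by metis+
    then have "m = 0" by auto
    then show False using mn p1 by simp
  qed
  then have tails: "?b = ?b'" "?y <# VG S ?b = ?y' <# VG S ?b'"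
    using white_star(2)[OF e x(1)] white_star(2)[OF f x(2)] by (metis Pair_inject)+
  then show ef: "e = f" using starred e' f' unfolding starred_def by metis
  have bv: "?b \<in> verts (\<Delta> S)" using edge_verts[OF e'(1)] by simp
  have s: "stab S e \<in> carrier G" by (rule edge_s_closed[OF e'(1)])
  have "?y' \<otimes> \<one> \<in> ?y <# VG S ?b"
    unfolding tails(2) using subgroup.one_closed[OF VG_subgroup[OF bv]] tails(1) by (force simp: l_coset_def)
  then obtain h where h: "h \<in> VG S ?b" "?y' \<otimes> \<one> = ?y \<otimes> h" by (auto simp: l_coset_def)
  obtain c where c: "c \<in> EG S e" "h = embB S e c" using h(1) edge_facts(3)[OF e'(1)] by auto
  have hc: "h \<in> carrier G" by (rule VG_closed[OF bv h(1)])
  have "x' = ?y' \<otimes> \<one> \<otimes> stab S e" using ef s xc by (simp add: m_assoc)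
  also have "\<dots> = x \<otimes> (inv (stab S e) \<otimes> h \<otimes> stab S e)" unfolding h(2) using s xc hc by (simp add: m_assoc)
  also have "\<dots> = x \<otimes> embW S e c" using edge_conj_inv[OF e'(1) c(1)] c(2) by simp
  finally have x'_eq: "x' = x \<otimes> embW S e c" .
  have wc: "embW S e c \<in> carrier G" using VG_closed[OF wv] emb_in(2)[OF e'(1) c(1)] e'(2) by simp
  have eqW: "inv x \<otimes> x' = embW S e c" unfolding x'_eq using xc wc by (simp add: inv_cancel)
  have VF: "inv x \<otimes> x' \<in> VF S w"
    using subgroup.m_closed[OF VF_subgroup[OF wv] subgroup.m_inv_closed[OF VF_subgroup[OF wv] x(1)] x(2)] .
  show "inv x \<otimes> x' \<in> generate G {pe S e}"
    using white_edge_fibre[OF e'(1) c(1)] VF eqW e'(2) by simp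
qed

end

section \<open>Commensurating permutations\<close>

text \<open>
  A permutation \<open>f\<close> that moves only finitely many elements in or out of \<open>A\<close> acts on the sets that differ from \<open>A\<close>
  by a finite set.  These are identified with the finite sets, so that \<open>A\<close> becomes the vertex \<open>{}\<close>.
\<close>

definition commensurate :: "'x set \<Rightarrow> ('x \<Rightarrow> 'x) \<Rightarrow> 'x set \<Rightarrow> 'x set" where
  "commensurate A f = affine_map f (f ` A \<triangle> A)"

lemma commensurate_eq: "inj f \<Longrightarrow> commensurate A f B = f ` (B \<triangle> A) \<triangle> A"
  by (simp add: commensurate_def affine_map_def image_symdiff symdiff_ac)

lemma commensurate_comp: "inj f \<Longrightarrow> inj g \<Longrightarrow> commensurate A f \<circ> commensurate A g = commensurate A (f \<circ> g)"
  by (auto simp: commensurate_eq inj_compose image_comp symdiff_ac symdiff_cancel)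

lemma commensurate_id: "commensurate A id = id"
  by (simp add: commensurate_def affine_map_def fun_eq_iff)

lemma is_affine_commensurate: "bij f \<Longrightarrow> finite (f ` A \<triangle> A) \<Longrightarrow> is_affine (commensurate A f)"
  unfolding commensurate_def by (rule is_affineI)

section \<open>Interleaved sheets\<close>

text \<open>
  The line is divided into blocks of length \<open>\<rho> = R / a\<close>, and the blocks are dealt out to \<open>a\<close> lines in turn:
  \<open>n\<close> is the number of the line.  A translation by \<open>\<rho>\<close> of all of them is a translation by \<open>R\<close>.
\<close>

definition interleave :: "int \<Rightarrow> nat \<Rightarrow> nat \<times> int \<Rightarrow> int" where
  "interleave R a = (\<lambda>(n, z). R * (z div (R div int a)) + int n * (R div int a) + z mod (R div int a))"

context
  fixes R :: int and a :: nat
  assumes R: "R > 0" and a: "int a dvd R" "a > 0"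
begin

lemma interleave_quotient: "R div int a > 0" "int a * (R div int a) = R"
  using R a by (auto simp: pos_imp_zdiv_pos_iff dvd_imp_le zdvd_imp_le)

lemma interleave_digits:
  assumes n: "n < a"
  defines "\<rho> \<equiv> R div int a"
  shows "interleave R a (n, z) div R = z div \<rho>" "(interleave R a (n, z) mod R) div \<rho> = int n"
    "(interleave R a (n, z) mod R) mod \<rho> = z mod \<rho>"
proof -
  have \<rho>: "\<rho> > 0" "int a * \<rho> = R" using interleave_quotient by (simp_all add: \<rho>_def)
  let ?d = "int n * \<rho> + z mod \<rho>"
  have "int n * \<rho> \<le> (int a - 1) * \<rho>" using n \<rho> by (intro mult_right_mono) auto
  also have "\<dots> = R - \<rho>" using \<rho> by (simp add: algebra_simps)
  finally have "int n * \<rho> \<le> R - \<rho>" .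
  moreover have "z mod \<rho> < \<rho>" "0 \<le> z mod \<rho>" "0 \<le> int n * \<rho>" using \<rho> by auto
  ultimately have d: "0 \<le> ?d" "?d < R" by linarith+
  have eq: "interleave R a (n, z) = R * (z div \<rho>) + ?d" by (simp add: interleave_def \<rho>_def)
  show "interleave R a (n, z) div R = z div \<rho>" unfolding eq using d R by simp
  have m: "interleave R a (n, z) mod R = ?d" unfolding eq using d R by simp
  show "(interleave R a (n, z) mod R) div \<rho> = int n" "(interleave R a (n, z) mod R) mod \<rho> = z mod \<rho>"
    unfolding m using \<rho> by simp_all
qed

lemma interleave_bij: "bij_betw (interleave R a) ({..<a} \<times> UNIV) UNIV"
  unfolding bij_betw_def
proof
  note \<rho> = interleave_quotient
  show "inj_on (interleave R a) ({..<a} \<times> UNIV)"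
  proof (rule inj_onI, clarify)
    fix n z n' z' assume nn: "n < a" "n' < a" and eq: "interleave R a (n, z) = interleave R a (n', z')"
    let ?\<rho> = "R div int a"
    have eqs: "z div ?\<rho> = z' div ?\<rho>" "z mod ?\<rho> = z' mod ?\<rho>" "int n = int n'"
      using interleave_digits[OF nn(1), of z] interleave_digits[OF nn(2), of z'] eq by metis+
    have "z = ?\<rho> * (z div ?\<rho>) + z mod ?\<rho>" by (simp only: mult_div_mod_eq)
    also have "\<dots> = z'" unfolding eqs by (simp only: mult_div_mod_eq)
    finally show "n = n' \<and> z = z'" using eqs by simp
  qed
  show "interleave R a ` ({..<a} \<times> UNIV) = UNIV"
  proof (rule Set.set_eqI, rule iffI)
    fix u :: int
    let ?\<rho> = "R div int a"
    let ?n = "nat ((u mod R) div ?\<rho>)" and ?z = "?\<rho> * (u div R) + (u mod R) mod ?\<rho>"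
    have u: "0 \<le> u mod R" "u mod R < R" using R by auto
    have "(u mod R) div ?\<rho> < int a"
    proof (rule ccontr)
      assume "\<not> (u mod R) div ?\<rho> < int a"
      then have "int a * ?\<rho> \<le> (u mod R) div ?\<rho> * ?\<rho>" using \<rho> by (intro mult_right_mono) auto
      also have "\<dots> \<le> u mod R" using \<rho> div_mult_mod_eq[of "u mod R" ?\<rho>] pos_mod_sign[of ?\<rho> "u mod R"] by linarith
      finally show False using u \<rho> by simp
    qed
    moreover have n0: "0 \<le> (u mod R) div ?\<rho>" using u \<rho> by (simp add: pos_imp_zdiv_nonneg_iff)
    ultimately have "?n < a" by simp
    moreover have "interleave R a (?n, ?z) = u"
    proof -
      have "?z div ?\<rho> = u div R" "?z mod ?\<rho> = (u mod R) mod ?\<rho>" using \<rho> by simp_all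
      then have "interleave R a (?n, ?z) = R * (u div R) + ((u mod R) div ?\<rho> * ?\<rho> + (u mod R) mod ?\<rho>)"
        using n0 by (simp add: interleave_def)
      then show ?thesis by (simp only: div_mult_mod_eq mult_div_mod_eq)
    qed
    ultimately show "u \<in> interleave R a ` ({..<a} \<times> UNIV)"
      by (intro image_eqI[where x = "(?n, ?z)"]) auto
  qed simp
qed

lemma interleave_nonneg: assumes n: "n < a" shows "interleave R a (n, z) \<ge> 0 \<longleftrightarrow> z \<ge> 0"
  using interleave_digits(1)[OF n, of z] interleave_quotient(1) R
  by (metis pos_imp_zdiv_nonneg_iff)

lemma interleave_shift: "interleave R a (n, z + (R div int a) * m) = interleave R a (n, z) + R * m"
  using interleave_quotient by (simp add: interleave_def algebra_simps)

end

text \<open>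
  The two lines \<open>bool \<times> int\<close> are cut into \<open>c\<close> sheets: the first \<open>a\<close> sheets are interleaved to the
  line \<open>False\<close> and the other \<open>c - a\<close> to the line \<open>True\<close>.
\<close>

definition glue_sheets :: "int \<Rightarrow> nat \<Rightarrow> nat \<Rightarrow> nat \<times> int \<Rightarrow> bool \<times> int" where
  "glue_sheets R c a = (\<lambda>(n, z). if n < a then (False, interleave R a (n, z)) else (True, interleave R (c - a) (n - a, z)))"

definition sheets :: "nat \<Rightarrow> (nat \<times> int) set" where
  "sheets c = {..<c} \<times> UNIV"

definition sheet_width :: "int \<Rightarrow> nat \<Rightarrow> nat \<Rightarrow> nat \<Rightarrow> int" where
  "sheet_width R c a n = R div int (if n < a then a else c - a)"

definition sheet_shift :: "(nat \<Rightarrow> int) \<Rightarrow> nat \<times> int \<Rightarrow> nat \<times> int" where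
  "sheet_shift h = (\<lambda>(n, z). (n, z + h n))"

definition line_shift :: "(bool \<Rightarrow> int) \<Rightarrow> bool \<times> int \<Rightarrow> bool \<times> int" where
  "line_shift m = (\<lambda>(s, u). (s, u + m s))"

definition upper :: "(bool \<times> int) set" where "upper = UNIV \<times> {0..}"

lemma sheet_shift_comp: "sheet_shift h \<circ> sheet_shift h' = sheet_shift (\<lambda>n. h n + h' n)"
  and line_shift_comp: "line_shift m \<circ> line_shift m' = line_shift (\<lambda>s. m s + m' s)"
  and sheet_shift_0: "sheet_shift (\<lambda>n. 0) = id" and line_shift_0: "line_shift (\<lambda>s. 0) = id"
  and sheet_shift_in: "x \<in> sheets c \<Longrightarrow> sheet_shift h x \<in> sheets c"
  by (auto simp: sheet_shift_def line_shift_def sheets_def)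

lemma bij_line_shift: "bij (line_shift m)"
proof (rule o_bij)
  show "line_shift (\<lambda>s. - m s) \<circ> line_shift m = id" "line_shift m \<circ> line_shift (\<lambda>s. - m s) = id"
    by (simp_all add: line_shift_comp line_shift_0)
qed

lemma bij_sheet_shift: "bij_betw (sheet_shift h) (sheets c) (sheets c)"
  by (rule bij_betw_byWitness[where f' = "sheet_shift (\<lambda>n. - h n)"]) (auto simp: sheet_shift_def sheets_def)

lemma symdiff_half_line: "{0..} \<triangle> {m..} = (if 0 \<le> m then {0..<m} else {m..<(0::int)})"
  by (auto simp: in_symdiff)

lemma line_shift_upper: "line_shift m ` upper \<triangle> upper = (\<Union>s. {s} \<times> ({0..} \<triangle> {m s..}))"
proof -
  have "(s, u) \<in> line_shift m ` upper \<longleftrightarrow> u \<ge> m s" for s u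
    by (auto simp: line_shift_def upper_def image_iff intro!: bexI[of _ "u - m s"])
  then show ?thesis unfolding set_eq_iff split_paired_All in_symdiff by (auto simp: in_symdiff upper_def)
qed

lemma sheet_shift_upper:
  "sheet_shift h ` (sheets c \<inter> UNIV \<times> {0..}) \<triangle> (sheets c \<inter> UNIV \<times> {0..}) = (\<Union>n<c. {n} \<times> ({0..} \<triangle> {h n..}))"
proof -
  have "(n, z) \<in> sheet_shift h ` (sheets c \<inter> UNIV \<times> {0..}) \<longleftrightarrow> n < c \<and> z \<ge> h n" for n z
    by (auto simp: sheet_shift_def sheets_def image_iff intro!: bexI[of _ "(n, z - h n)"])
  then show ?thesis unfolding set_eq_iff split_paired_All in_symdiff by (auto simp: in_symdiff sheets_def)
qed

lemma finite_half_line [simp]: "finite ({0..} \<triangle> {m..})" for m :: int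
  by (simp add: symdiff_half_line)

lemma card_half_line: "card ({0..} \<triangle> {m..}) = nat \<bar>m\<bar>" for m :: int
  by (simp add: symdiff_half_line)

lemma finite_line_shift: "finite (line_shift m ` upper \<triangle> upper)"
  unfolding line_shift_upper by (intro finite_UN_I finite_cartesian_product) auto

lemma card_line_shift: "nat \<bar>m s\<bar> \<le> card (line_shift m ` upper \<triangle> upper)"
proof -
  have "card ({s} \<times> ({0..} \<triangle> {m s..})) \<le> card (line_shift m ` upper \<triangle> upper)"
    by (rule card_mono[OF finite_line_shift]) (auto simp: line_shift_upper)
  then show ?thesis by (simp add: card_cartesian_product card_half_line)
qed

locale sheet_gluing =
  fixes R :: int and c :: nat
  assumes R_pos: "R > 0" and R_dvd: "\<And>a. 0 < a \<Longrightarrow> a \<le> c \<Longrightarrow> int a dvd R"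
begin

lemma glue_bij: assumes a: "0 < a" "a < c" shows "bij_betw (glue_sheets R c a) (sheets c) UNIV"
proof -
  let ?f = "glue_sheets R c a"
  have d: "int a dvd R" "int (c - a) dvd R" "0 < c - a" using R_dvd[of a] R_dvd[of "c - a"] a by simp_all
  note b1 = interleave_bij[OF R_pos d(1) a(1)] and b2 = interleave_bij[OF R_pos d(2,3)]
  have eq: "sheets c = {..<a} \<times> UNIV \<union> {a..<c} \<times> UNIV" using a by (auto simp: sheets_def)
  have 1: "bij_betw ?f ({..<a} \<times> UNIV) ({False} \<times> UNIV)"
  proof -
    have "bij_betw (\<lambda>u::int. (False, u)) UNIV ({False} \<times> UNIV)" by (auto simp: bij_betw_def inj_on_def)
    from bij_betw_trans[OF b1 this] show ?thesis
      by (rule bij_betw_cong[THEN iffD1, rotated]) (auto simp: glue_sheets_def)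
  qed
  have 2: "bij_betw ?f ({a..<c} \<times> UNIV) ({True} \<times> UNIV)"
  proof -
    have s: "bij_betw (\<lambda>(n, z). (n - a, z)) ({a..<c} \<times> (UNIV::int set)) ({..<c - a} \<times> UNIV)"
      by (rule bij_betw_byWitness[where f' = "\<lambda>(n, z). (n + a, z)"]) auto
    have "bij_betw (\<lambda>u::int. (True, u)) UNIV ({True} \<times> UNIV)" by (auto simp: bij_betw_def inj_on_def)
    from bij_betw_trans[OF bij_betw_trans[OF s b2] this] show ?thesis
      by (rule bij_betw_cong[THEN iffD1, rotated]) (auto simp: glue_sheets_def)
  qed
  have "bij_betw ?f ({..<a} \<times> UNIV \<union> {a..<c} \<times> UNIV) ({False} \<times> UNIV \<union> {True} \<times> UNIV)"
    by (rule bij_betw_combine[OF 1 2]) auto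
  moreover have "{False} \<times> UNIV \<union> {True} \<times> UNIV = (UNIV :: (bool \<times> int) set)" by (auto simp: set_eq_iff)
  ultimately show ?thesis using eq by simp
qed

lemma glue_upper: assumes a: "0 < a" "a < c" and x: "x \<in> sheets c"
  shows "glue_sheets R c a x \<in> upper \<longleftrightarrow> x \<in> UNIV \<times> {0..}"
proof -
  have d: "int a dvd R" "int (c - a) dvd R" "0 < c - a" using R_dvd[of a] R_dvd[of "c - a"] a by simp_all
  show ?thesis using x interleave_nonneg[OF R_pos d(1) a(1)] interleave_nonneg[OF R_pos d(2,3)]
    by (cases x) (simp add: glue_sheets_def upper_def sheets_def)
qed

lemma glue_image_upper: assumes a: "0 < a" "a < c"
  shows "glue_sheets R c a ` (sheets c \<inter> UNIV \<times> {0..}) = upper"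
proof
  show "glue_sheets R c a ` (sheets c \<inter> UNIV \<times> {0..}) \<subseteq> upper" using glue_upper[OF a] by auto
  show "upper \<subseteq> glue_sheets R c a ` (sheets c \<inter> UNIV \<times> {0..})"
  proof
    fix y assume y: "y \<in> upper"
    obtain x where "x \<in> sheets c" "y = glue_sheets R c a x" using glue_bij[OF a] by (metis UNIV_I bij_betw_imp_surj_on imageE)
    then show "y \<in> glue_sheets R c a ` (sheets c \<inter> UNIV \<times> {0..})" using y glue_upper[OF a] by auto
  qed
qed

lemma glue_shift:
  assumes a: "0 < a" "a < c" and n: "n < c"
  shows "glue_sheets R c a (n, z + sheet_width R c a n * m) = line_shift (\<lambda>s. R * m) (glue_sheets R c a (n, z))"
proof -
  have d: "int a dvd R" "int (c - a) dvd R" "0 < c - a" using R_dvd[of a] R_dvd[of "c - a"] a by simp_all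
  show ?thesis using interleave_shift[OF R_pos d(1) a(1)] interleave_shift[OF R_pos d(2,3)]
    by (auto simp: glue_sheets_def line_shift_def sheet_width_def)
qed

definition unglue :: "nat \<Rightarrow> bool \<times> int \<Rightarrow> nat \<times> int" where
  "unglue a = inv_into (sheets c) (glue_sheets R c a)"

lemma unglue: assumes a: "0 < a" "a < c"
  shows "x \<in> sheets c \<Longrightarrow> unglue a (glue_sheets R c a x) = x" "unglue a y \<in> sheets c" "glue_sheets R c a (unglue a y) = y"
    "bij_betw (unglue a) UNIV (sheets c)"
proof -
  note b = glue_bij[OF a]
  show "x \<in> sheets c \<Longrightarrow> unglue a (glue_sheets R c a x) = x"
    using b by (simp add: unglue_def bij_betw_def)
  show "glue_sheets R c a (unglue a y) = y" using b by (simp add: unglue_def bij_betw_def f_inv_into_f)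
  show "bij_betw (unglue a) UNIV (sheets c)" unfolding unglue_def by (rule bij_betw_inv_into[OF b])
  then show "unglue a y \<in> sheets c" by (auto simp: bij_betw_def)
qed

definition sheet_map :: "nat \<Rightarrow> (nat \<Rightarrow> int) \<Rightarrow> bool \<times> int \<Rightarrow> bool \<times> int" where
  "sheet_map a h = glue_sheets R c a \<circ> sheet_shift h \<circ> unglue a"

definition reglue :: "nat \<Rightarrow> nat \<Rightarrow> bool \<times> int \<Rightarrow> bool \<times> int" where
  "reglue a a' = glue_sheets R c a \<circ> unglue a'"

context
  fixes a assumes a: "0 < a" "a < c"
begin

lemma bij_sheet_map: "bij (sheet_map a h)"
  unfolding sheet_map_def using bij_betw_trans[OF bij_betw_trans[OF unglue(4)[OF a] bij_sheet_shift] glue_bij[OF a]]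
  by (simp add: comp_assoc)

lemma sheet_map_comp: "sheet_map a h \<circ> sheet_map a h' = sheet_map a (\<lambda>n. h n + h' n)"
proof
  fix y
  show "(sheet_map a h \<circ> sheet_map a h') y = sheet_map a (\<lambda>n. h n + h' n) y"
    using unglue(1)[OF a sheet_shift_in[OF unglue(2)[OF a]]] fun_cong[OF sheet_shift_comp[of h h'], of "unglue a y"]
    by (simp add: sheet_map_def)
qed

lemma sheet_map_0: "sheet_map a (\<lambda>n. 0) = id"
  by (simp add: sheet_map_def sheet_shift_0 fun_eq_iff unglue(3)[OF a])

lemma unglue_upper: "unglue a ` upper = sheets c \<inter> UNIV \<times> {0..}"
  unfolding glue_image_upper[OF a, symmetric] image_image
  by (rule image_cong[of _ _ _ "\<lambda>x. x", simplified]) (simp_all add: unglue(1)[OF a])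

lemma sheet_map_upper: "sheet_map a h ` upper \<triangle> upper = glue_sheets R c a ` (\<Union>n<c. {n} \<times> ({0..} \<triangle> {h n..}))"
proof -
  let ?U = "sheets c \<inter> UNIV \<times> {0..}"
  have inj: "inj_on (glue_sheets R c a) (sheets c)" using glue_bij[OF a] by (simp add: bij_betw_def)
  have sub: "sheet_shift h ` ?U \<subseteq> sheets c" "?U \<subseteq> sheets c" using sheet_shift_in by auto
  have "sheet_map a h ` upper = glue_sheets R c a ` sheet_shift h ` ?U"
    unfolding sheet_map_def image_comp[symmetric] unglue_upper ..
  then have "sheet_map a h ` upper \<triangle> upper = glue_sheets R c a ` (sheet_shift h ` ?U \<triangle> ?U)"
    using image_symdiff_on[OF inj sub] glue_image_upper[OF a] by simp
  then show ?thesis using sheet_shift_upper by simp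
qed

lemma finite_sheet_map: "finite (sheet_map a h ` upper \<triangle> upper)"
  unfolding sheet_map_upper by (intro finite_imageI finite_UN_I finite_cartesian_product) auto

lemma card_sheet_map: assumes n: "n < c" shows "nat \<bar>h n\<bar> \<le> card (sheet_map a h ` upper \<triangle> upper)"
proof -
  have "inj_on (glue_sheets R c a) ({n} \<times> ({0..} \<triangle> {h n..}))"
    using glue_bij[OF a] n by (auto simp: bij_betw_def sheets_def elim!: inj_on_subset)
  then have "nat \<bar>h n\<bar> = card (glue_sheets R c a ` ({n} \<times> ({0..} \<triangle> {h n..})))"
    by (simp add: card_image card_cartesian_product card_half_line)
  also have "\<dots> \<le> card (sheet_map a h ` upper \<triangle> upper)"
    by (rule card_mono[OF finite_sheet_map]) (use n in \<open>auto simp: sheet_map_upper\<close>)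
  finally show ?thesis .
qed

text \<open>
  The passage from the white to the black end of an edge: the sheets are moved by the white vertex group, the lines
  by the black one.
\<close>

lemma sheet_map_line_shift:
  assumes h: "\<And>n. n < c \<Longrightarrow> h n = sheet_width R c a n * m (a \<le> n)"
  shows "sheet_map a h = line_shift (\<lambda>s. R * m s)"
proof
  fix y
  obtain n z where nz: "unglue a y = (n, z)" by fastforce
  have n: "n < c" using unglue(2)[OF a, of y] nz by (simp add: sheets_def)
  have y: "glue_sheets R c a (n, z) = y" using unglue(3)[OF a, of y] nz by simp
  then have fst: "fst y = (a \<le> n)" by (auto simp: glue_sheets_def split: if_splits)
  have "sheet_map a h y = glue_sheets R c a (n, z + sheet_width R c a n * m (a \<le> n))"
    using h[OF n] nz by (simp add: sheet_map_def sheet_shift_def)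
  also have "\<dots> = line_shift (\<lambda>s. R * m (a \<le> n)) y" using glue_shift[OF a n] y by simp
  also have "\<dots> = line_shift (\<lambda>s. R * m s) y" using fst by (cases y) (simp add: line_shift_def)
  finally show "sheet_map a h y = line_shift (\<lambda>s. R * m s) y" .
qed

end

lemma reglue_facts:
  assumes a: "0 < a" "a < c" and a': "0 < a'" "a' < c"
  shows "bij (reglue a a')" "reglue a a' \<circ> reglue a' a = id" "reglue a a' ` upper = upper"
    "reglue a a' \<circ> sheet_map a' h \<circ> reglue a' a = sheet_map a h"
proof -
  show "bij (reglue a a')" unfolding reglue_def using bij_betw_trans[OF unglue(4)[OF a'] glue_bij[OF a]] .
  show "reglue a a' \<circ> reglue a' a = id"
    using unglue(1)[OF a' unglue(2)[OF a]] unglue(3)[OF a] by (simp add: reglue_def fun_eq_iff)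
  show "reglue a a' ` upper = upper"
    unfolding reglue_def image_comp[symmetric] unglue_upper[OF a'] by (rule glue_image_upper[OF a])
  show "reglue a a' \<circ> sheet_map a' h \<circ> reglue a' a = sheet_map a h"
    using unglue(1)[OF a' unglue(2)[OF a]] unglue(1)[OF a' sheet_shift_in[OF unglue(2)[OF a]]]
    by (simp add: reglue_def sheet_map_def fun_eq_iff)
qed

end

section \<open>The horizontal walls\<close>

lemma iterated_escape:
  assumes "\<And>k. int k * \<bar>m\<bar> \<le> int (c k)" "m \<noteq> (0::int)"
  shows "\<exists>n::nat. k < c n"
proof -
  have "int (Suc k) \<le> int (Suc k) * \<bar>m\<bar>" using assms(2) by (simp add: mult_le_cancel_left1)
  also have "\<dots> \<le> int (c (Suc k))" by (rule assms(1))
  finally show ?thesis by (intro exI[of _ "Suc k"]) simp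
qed

context split_group
begin

lemma compatible_commensurate:
  assumes m: "compatible m" and inj: "\<And>x. x \<in> gog_letters \<G> \<Longrightarrow> inj (m x)"
  shows "compatible (\<lambda>x. commensurate A (m x))"
proof -
  have G: "inj (m (Grp v g))" if "v \<in> verts \<G>" "g \<in> VG v" for v g
    using that by (intro inj) (simp add: gog_letters_def)
  have D: "inj (m (Dart e d))" if "e \<in> arcs \<G>" for e d
    using that by (intro inj) (simp add: gog_letters_def)
  note m = m[unfolded compatible_iff]
  have D': "m (Dart e d) \<circ> m (Dart e (\<not> d)) = id" if "e \<in> arcs \<G>" for e d
    using m that by blast
  have E: "m (Dart e True) \<circ> m (Grp (head \<G> e) (head_emb \<G> e c)) \<circ> m (Dart e False) = m (Grp (tail \<G> e) (tail_emb \<G> e c))"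
    if "e \<in> arcs \<G>" "c \<in> EG e" for e c
    using m that by blast
  show ?thesis
    unfolding compatible_iff
  proof (intro conjI ballI allI)
    fix e d assume e: "e \<in> arcs \<G>"
    show "commensurate A (m (Dart e d)) \<circ> commensurate A (m (Dart e (\<not> d))) = id"
      using D[OF e] by (simp add: commensurate_comp D'[OF e] commensurate_id)
    fix c assume c: "c \<in> EG e"
    have "inj (m (Grp (head \<G> e) (head_emb \<G> e c)))"
      using G[OF ends_in_verts(2)[OF e] emb_closed(2)[OF e c]] .
    then show "commensurate A (m (Dart e True)) \<circ> commensurate A (m (Grp (head \<G> e) (head_emb \<G> e c))) \<circ>
        commensurate A (m (Dart e False)) = commensurate A (m (Grp (tail \<G> e) (tail_emb \<G> e c)))"
      using D[OF e] by (simp add: commensurate_comp inj_compose E[OF e c])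
  qed (use m G in \<open>auto simp: commensurate_id commensurate_comp\<close>)
qed

end

text \<open>
  The form in which good measurements are used: there are homomorphisms whose values on the elements \<open>p\<^sub>e\<close> are prescribed
  in terms of \<open>k(e)\<close>, up to a common factor.
\<close>

locale measured_torus_data = starred_torus_data G F t S
  for G :: "'g monoid" (structure) and F t and S :: "('v, 'e, 'g) torus_splitting" +
  fixes N :: int
  assumes N_pos: "N > 0"
    and measurements: "\<And>w f. w \<in> white S \<Longrightarrow> \<exists>\<psi>. additive G (VF S w) \<psi> \<and>
      (\<forall>e\<in>edges_at_white S w. \<psi> (pe S e) = N * f (ke S e))"
begin

text \<open>
  The number \<open>\<kappa>\<close>, larger than all \<open>\<bar>k(e)\<bar>\<close>.
\<close>

definition twist_bound :: nat where
  "twist_bound = Suc (\<Sum>e\<in>arcs'. nat \<bar>ke S e\<bar>)"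

abbreviation sheet_number :: nat where
  "sheet_number \<equiv> 2 * twist_bound"

text \<open>
  The number \<open>\<kappa> + k(e)\<close> of sheets that are glued to the line \<open>False\<close> along \<open>e\<close>.
\<close>

definition sheets_below :: "'e \<Rightarrow> nat" where
  "sheets_below e = nat (int twist_bound + ke S e)"

text \<open>
  The number \<open>R\<close>, a multiple of \<open>N\<close> times each number of sheets that may be glued to a line.
\<close>

definition period :: int where
  "period = N * fact sheet_number"

definition black_coordinate :: "'v \<Rightarrow> 'g \<Rightarrow> int" where
  "black_coordinate b = (SOME \<chi>. additive G (VG S b) \<chi> \<and> \<chi> (rv S b) = 1 \<and> \<chi> (tv S b) = 0 \<and>
     (\<forall>f\<in>VF S b. f \<noteq> \<one> \<longrightarrow> \<chi> f \<noteq> 0))"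

definition sheet_measurement :: "'v \<Rightarrow> nat \<Rightarrow> 'g \<Rightarrow> int" where
  "sheet_measurement w n = (SOME \<psi>. additive G (VF S w) \<psi> \<and> (\<forall>e\<in>edges_at_white S w. \<psi> (pe S e) =
     (if n < sheets_below e then - 1 else 1) * sheet_width period sheet_number (sheets_below e) n))"

lemma twist_bound: "e \<in> arcs' \<Longrightarrow> \<bar>ke S e\<bar> < int twist_bound"
proof -
  assume "e \<in> arcs'"
  then have "nat \<bar>ke S e\<bar> \<le> (\<Sum>e\<in>arcs'. nat \<bar>ke S e\<bar>)" using finite_arcs by (intro member_le_sum) auto
  then have "nat \<bar>ke S e\<bar> < twist_bound" by (simp add: twist_bound_def)
  then show ?thesis by linarith
qed

lemma sheets_below:
  assumes "e \<in> arcs'"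
  shows "int (sheets_below e) = int twist_bound + ke S e" "0 < sheets_below e" "sheets_below e < sheet_number"
    "int (sheet_number - sheets_below e) = int twist_bound - ke S e"
  using twist_bound[OF assms] by (auto simp: sheets_below_def)

lemma twist_bound_range: "0 < twist_bound" "twist_bound < sheet_number"
  by (simp_all add: twist_bound_def)

sublocale sheet_gluing period sheet_number
proof
  show "period > 0" using N_pos by (simp add: period_def)
  show "int a dvd period" if "0 < a" "a \<le> sheet_number" for a
  proof -
    have "a dvd fact sheet_number" using that by (intro dvd_fact) auto
    then have "int a dvd int (fact sheet_number)" by (simp only: of_nat_dvd_iff)
    then show ?thesis by (simp add: period_def)
  qed
qed

lemma black_coordinate:
  assumes "b \<in> black S"
  shows "additive G (VG S b) (black_coordinate b)" "black_coordinate b (rv S b) = 1" "black_coordinate b (tv S b) = 0"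
    "f \<in> VF S b \<Longrightarrow> f \<noteq> \<one> \<Longrightarrow> black_coordinate b f \<noteq> 0"
proof -
  have "\<exists>\<chi>. additive G (VG S b) \<chi> \<and> \<chi> (rv S b) = 1 \<and> \<chi> (tv S b) = 0 \<and> (\<forall>f\<in>VF S b. f \<noteq> \<one> \<longrightarrow> \<chi> f \<noteq> 0)"
    using ex_black_coordinate[OF assms] by metis
  from someI_ex[OF this] show "additive G (VG S b) (black_coordinate b)" "black_coordinate b (rv S b) = 1" "black_coordinate b (tv S b) = 0"
    "f \<in> VF S b \<Longrightarrow> f \<noteq> \<one> \<Longrightarrow> black_coordinate b f \<noteq> 0"
    by (simp_all add: black_coordinate_def)
qed

lemma sheet_measurement:
  assumes w: "w \<in> white S"
  shows "additive G (VF S w) (sheet_measurement w n)"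
    and "e \<in> edges_at_white S w \<Longrightarrow> sheet_measurement w n (pe S e) =
      (if n < sheets_below e then - 1 else 1) * sheet_width period sheet_number (sheets_below e) n"
proof -
  define f where "f k = (let a = nat (int twist_bound + k) in
    (if n < a then - 1 else 1) * (fact sheet_number div int (if n < a then a else sheet_number - a)))" for k
  obtain \<psi> where \<psi>: "additive G (VF S w) \<psi>" "\<And>e. e \<in> edges_at_white S w \<Longrightarrow> \<psi> (pe S e) = N * f (ke S e)"
    using measurements[OF w, of f] by blast
  have "\<psi> (pe S e) = (if n < sheets_below e then - 1 else 1) * sheet_width period sheet_number (sheets_below e) n"
    if e: "e \<in> edges_at_white S w" for e
  proof -
    have e': "e \<in> arcs'" using e by (simp add: edges_at_white_def)
    have "int a dvd fact sheet_number" if "0 < a" "a \<le> sheet_number" for a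
    proof -
      have "a dvd fact sheet_number" using that by (intro dvd_fact) auto
      then have "int a dvd int (fact sheet_number)" by (simp only: of_nat_dvd_iff)
      then show ?thesis by simp
    qed
    then have "N * (fact sheet_number div int a) = period div int a" if "0 < a" "a \<le> sheet_number" for a
      using that by (simp add: period_def div_mult_swap)
    note div = this[of "sheets_below e"] this[of "sheet_number - sheets_below e"]
    show ?thesis using \<psi>(2)[OF e] sheets_below(2,3)[OF e'] div
      by (simp add: f_def Let_def sheet_width_def sheets_below_def[symmetric])
  qed
  then have "\<exists>\<psi>. additive G (VF S w) \<psi> \<and> (\<forall>e\<in>edges_at_white S w. \<psi> (pe S e) =
     (if n < sheets_below e then - 1 else 1) * sheet_width period sheet_number (sheets_below e) n)"
    using \<psi>(1) by blast
  from someI_ex[OF this] show "additive G (VF S w) (sheet_measurement w n)"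
    "e \<in> edges_at_white S w \<Longrightarrow> sheet_measurement w n (pe S e) =
      (if n < sheets_below e then - 1 else 1) * sheet_width period sheet_number (sheets_below e) n"
    by (simp_all add: sheet_measurement_def)
qed

definition sheet_height :: "'v \<Rightarrow> nat \<Rightarrow> 'g \<Rightarrow> int" where
  "sheet_height w n g = sheet_measurement w n (proj w g) + period * height g"

definition line_height :: "'v \<Rightarrow> bool \<Rightarrow> 'g \<Rightarrow> int" where
  "line_height b s g = (if s then 1 else - 1) * black_coordinate b g + int twist_bound * height g"

lemma additive_sheet_height: "w \<in> white S \<Longrightarrow> additive G (VG S w) (sheet_height w n)"
  unfolding sheet_height_def[abs_def] using verts_eq
  by (intro additive_add additive_scale additive_height additive_proj sheet_measurement) auto

lemma additive_line_height: "b \<in> black S \<Longrightarrow> additive G (VG S b) (line_height b s)"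
  unfolding line_height_def[abs_def] using verts_eq
  by (intro additive_add additive_scale additive_height black_coordinate) auto

text \<open>
  Let \<open>\<rho>\<close> be the width of the sheet \<open>n\<close> along \<open>e\<close>.  On \<open>r\<close> both sides are \<open>-\<rho>\<close> for the line \<open>False\<close>, and \<open>\<rho>\<close> for the line
  \<open>True\<close>.  On \<open>t\<close>, which is \<open>p\<^sup>k t\<close> on the white side, the equations are \<open>R - k \<rho> = \<rho> \<kappa>\<close> and \<open>R + k \<rho> = \<rho> \<kappa>\<close>, and hold because
  \<open>R / \<rho>\<close> is the number \<open>\<kappa> + k\<close> or \<open>\<kappa> - k\<close> of the sheets that are glued to the line.
\<close>

lemma sheet_height_edge:
  assumes e: "e \<in> arcs'" and n: "n < sheet_number" and c: "c \<in> EG S e"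
  shows "sheet_height (head (\<Delta> S) e) n (embW S e c) =
    sheet_width period sheet_number (sheets_below e) n * line_height (tail (\<Delta> S) e) (sheets_below e \<le> n) (embB S e c)"
proof -
  let ?w = "head (\<Delta> S) e" and ?b = "tail (\<Delta> S) e"
  let ?\<rho> = "sheet_width period sheet_number (sheets_below e) n" and ?s = "sheets_below e \<le> n"
  have w: "?w \<in> white S" and b: "?b \<in> black S" and wv: "?w \<in> verts (\<Delta> S)" and bv: "?b \<in> verts (\<Delta> S)"
    using head_white[OF e] tail_black[OF e] edge_verts[OF e] by auto
  have ew: "e \<in> edges_at_white S ?w" using e by (simp add: edges_at_white_def)
  note m = sheet_measurement(2)[OF w ew, of n]
  note pe = edge_facts(8)[OF e] and pec = VF_closed[OF wv edge_facts(8)[OF e]]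
  have tvc: "tv S ?w \<in> carrier G" using vertex_facts(3)[OF wv] .
  have pk: "pe S e [^] ke S e \<in> VF S ?w" by (rule subgroup_int_pow[OF VF_subgroup[OF wv] pe])
  have pr: "proj ?w (pe S e [^] ke S e \<otimes> tv S ?w) = pe S e [^] ke S e"
    using proj_mult[OF wv VF_VG[OF wv pk] tv_in[OF wv]] proj_VF[OF wv pk] proj_tv[OF wv] VF_closed[OF wv pk] by simp
  have ht: "height (pe S e [^] ke S e \<otimes> tv S ?w) = 1"
    using height_VF[OF wv pk] VF_closed[OF wv pk] tvc vertex_facts(4)[OF wv] by (simp add: height_mult)
  have R: "period = ?\<rho> * (int twist_bound + (if ?s then - 1 else 1) * ke S e)"
  proof -
    define d where "d = (if n < sheets_below e then sheets_below e else sheet_number - sheets_below e)"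
    have d: "0 < d" "d \<le> sheet_number" using sheets_below(2,3)[OF e] by (auto simp: d_def)
    have "period div int d * int d = period" using R_dvd[OF d] by simp
    moreover have "int d = int twist_bound + (if ?s then - 1 else 1) * ke S e"
      using sheets_below(1,4)[OF e] by (auto simp: d_def)
    ultimately show ?thesis by (simp add: sheet_width_def d_def[symmetric])
  qed
  show ?thesis
  proof (rule additive_edge_eq[OF e _ _ _ _ c, where h = "\<lambda>c. sheet_height ?w n (embW S e c)"
        and h' = "\<lambda>c. ?\<rho> * line_height ?b ?s (embB S e c)"])
    show "additive G (EG S e) (\<lambda>c. sheet_height ?w n (embW S e c))"
      by (rule additive_emb(2)[OF e additive_sheet_height[OF w]])
    show "additive G (EG S e) (\<lambda>c. ?\<rho> * line_height ?b ?s (embB S e c))"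
      by (rule additive_scale[OF additive_emb(1)[OF e additive_line_height[OF b]]])
    have hr: "height (rv S ?b) = 0" using edge_groups b height_VF[OF bv] by (auto simp: torus_edge_groups_def)
    show "sheet_height ?w n (embW S e (re S e)) = ?\<rho> * line_height ?b ?s (embB S e (re S e))"
      using edge_facts(4,6)[OF e] m proj_VF[OF wv pe] height_VF[OF wv pe] hr black_coordinate(2)[OF b]
      by (simp add: sheet_height_def line_height_def)
    have "sheet_height ?w n (embW S e (te S e)) = ke S e * sheet_measurement ?w n (pe S e) + period"
      using edge_facts(7)[OF e] pr ht additive_int_pow[OF sheet_measurement(1)[OF w] VF_subgroup[OF wv] pe]
      by (simp add: sheet_height_def)
    also have "\<dots> = ?\<rho> * int twist_bound" by (subst R) (simp add: m algebra_simps)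
    finally show "sheet_height ?w n (embW S e (te S e)) = ?\<rho> * line_height ?b ?s (embB S e (te S e))"
      using edge_facts(5)[OF e] vertex_facts(4)[OF bv] black_coordinate(3)[OF b] by (simp add: line_height_def)
  qed
qed

fun horizontal_move :: "('v, 'e, 'g) gog_letter \<Rightarrow> bool \<times> int \<Rightarrow> bool \<times> int" where
  "horizontal_move (Grp v g) = (if v \<in> black S then line_shift (\<lambda>s. period * line_height v s g)
     else sheet_map twist_bound (\<lambda>n. sheet_height v n g))"
| "horizontal_move (Dart e d) = (if d then reglue (sheets_below e) twist_bound else reglue twist_bound (sheets_below e))"

definition horizontal_letter :: "('v, 'e, 'g) gog_letter \<Rightarrow> (bool \<times> int) set \<Rightarrow> (bool \<times> int) set" where
  "horizontal_letter x = commensurate upper (horizontal_move x)"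

lemma horizontal_move_facts:
  assumes "x \<in> gog_letters (gog_G G S)"
  shows "bij (horizontal_move x)" "finite (horizontal_move x ` upper \<triangle> upper)"
proof -
  have "bij (horizontal_move x) \<and> finite (horizontal_move x ` upper \<triangle> upper)"
  proof (cases x)
    case (Grp v g)
    then show ?thesis using bij_line_shift finite_line_shift bij_sheet_map finite_sheet_map twist_bound_range by simp
  next
    case (Dart e d)
    then have "e \<in> arcs'" using assms by (auto simp: gog_letters_def)
    note f = reglue_facts[OF sheets_below(2,3)[OF this] twist_bound_range]
      reglue_facts[OF twist_bound_range sheets_below(2,3)[OF this]]
    then show ?thesis using Dart by simp
  qed
  then show "bij (horizontal_move x)" "finite (horizontal_move x ` upper \<triangle> upper)" by auto
qed

lemma horizontal_affine: "x \<in> gog_letters (gog_G G S) \<Longrightarrow> is_affine (horizontal_letter x)"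
  unfolding horizontal_letter_def by (intro is_affine_commensurate horizontal_move_facts)

lemma horizontal_vertex:
  assumes v: "v \<in> verts (\<Delta> S)"
  shows "horizontal_move (Grp v \<one>) = id"
    and "g \<in> VG S v \<Longrightarrow> h \<in> VG S v \<Longrightarrow> horizontal_move (Grp v g) \<circ> horizontal_move (Grp v h) = horizontal_move (Grp v (g \<otimes> h))"
proof -
  note sub = VG_subgroup[OF v]
  have "horizontal_move (Grp v \<one>) = id \<and> (g \<in> VG S v \<longrightarrow> h \<in> VG S v \<longrightarrow>
    horizontal_move (Grp v g) \<circ> horizontal_move (Grp v h) = horizontal_move (Grp v (g \<otimes> h)))"
  proof (cases "v \<in> black S")
    case True
    note add = additive_line_height[OF True]
    show ?thesis using True additive_one[OF add sub] add
      by (simp add: line_shift_0 line_shift_comp additive_def distrib_left)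
  next
    case False
    then have "v \<in> white S" using v verts_eq by simp
    note add = additive_sheet_height[OF this]
    show ?thesis using False additive_one[OF add sub] add
      by (simp add: sheet_map_0[OF twist_bound_range] sheet_map_comp[OF twist_bound_range] additive_def)
  qed
  then show "horizontal_move (Grp v \<one>) = id"
    "g \<in> VG S v \<Longrightarrow> h \<in> VG S v \<Longrightarrow> horizontal_move (Grp v g) \<circ> horizontal_move (Grp v h) = horizontal_move (Grp v (g \<otimes> h))"
    by auto
qed

lemma horizontal_edge:
  assumes e: "e \<in> arcs'" and c: "c \<in> EG S e"
  shows "horizontal_move (Dart e True) \<circ> horizontal_move (Grp (head (\<Delta> S) e) (embW S e c)) \<circ> horizontal_move (Dart e False) =
    horizontal_move (Grp (tail (\<Delta> S) e) (embB S e c))"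
proof -
  have nb: "head (\<Delta> S) e \<notin> black S" using head_white[OF e] black_white by auto
  note a = sheets_below(2,3)[OF e]
  have "sheet_map (sheets_below e) (\<lambda>n. sheet_height (head (\<Delta> S) e) n (embW S e c)) =
    line_shift (\<lambda>s. period * line_height (tail (\<Delta> S) e) s (embB S e c))"
    by (rule sheet_map_line_shift[OF a]) (rule sheet_height_edge[OF e _ c])
  then show ?thesis
    using nb tail_black[OF e] reglue_facts(4)[OF a twist_bound_range] by simp
qed

lemma horizontal_compatible: "sg.compatible horizontal_letter"
  unfolding horizontal_letter_def[abs_def]
proof (rule sg.compatible_commensurate)
  have D: "horizontal_move (Dart e d) \<circ> horizontal_move (Dart e (\<not> d)) = id" if e: "e \<in> arcs'" for e d
    using reglue_facts(2)[OF sheets_below(2,3)[OF e] twist_bound_range]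
      reglue_facts(2)[OF twist_bound_range sheets_below(2,3)[OF e]] by simp
  show "sg.compatible horizontal_move"
    unfolding sg.compatible_iff gog_simps
    using horizontal_vertex D horizontal_edge by blast
  show "inj (horizontal_move x)" if "x \<in> gog_letters (gog_G G S)" for x
    using horizontal_move_facts(1)[OF that] by (rule bij_is_inj)
qed

lemma horizontal_escape_black:
  assumes v0: "v0 \<in> verts (\<Delta> S)" and b: "b \<in> black S" and h: "h \<in> VF S b" "h \<noteq> \<one>" and y: "y \<in> carrier G"
  shows "escapes G (sg.extension horizontal_letter v0) (y \<otimes> h \<otimes> inv y)"
proof (rule sg.escapes_of_vertex_element[OF horizontal_compatible horizontal_affine])
  have bv: "b \<in> verts (\<Delta> S)" using b verts_eq by simp
  note add = additive_line_height[OF b, of True]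
  have hG: "h \<in> VG S b" by (rule VF_VG[OF bv h(1)])
  show "\<exists>n. k < card (horizontal_letter (Grp b (h [^] (n::nat))) {})" for k
  proof (rule iterated_escape)
    show "period * line_height b True h \<noteq> 0"
      using black_coordinate(4)[OF b h] height_VF[OF bv h(1)] R_pos by (simp add: line_height_def)
    fix n :: nat
    have "nat \<bar>period * line_height b True (h [^] n)\<bar> \<le> card (horizontal_letter (Grp b (h [^] n)) {})"
      using card_line_shift[of "\<lambda>s. period * line_height b s (h [^] n)" True] b
      by (simp add: horizontal_letter_def commensurate_def affine_map_def)
    moreover have "line_height b True (h [^] n) = int n * line_height b True h"
      using additive_nat_pow[OF add VG_subgroup[OF bv] hG] .
    ultimately show "int n * \<bar>period * line_height b True h\<bar> \<le> int (card (horizontal_letter (Grp b (h [^] n)) {}))"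
      by (simp add: abs_mult algebra_simps)
  qed
qed (use v0 b verts_eq VF_VG h y in auto)

lemma horizontal_escape_white:
  assumes v0: "v0 \<in> verts (\<Delta> S)" and w: "w \<in> white S" and h: "h \<in> VF S w" and y: "y \<in> carrier G"
    and n: "n < sheet_number" "sheet_measurement w n h \<noteq> 0"
  shows "escapes G (sg.extension horizontal_letter v0) (y \<otimes> h \<otimes> inv y)"
proof (rule sg.escapes_of_vertex_element[OF horizontal_compatible horizontal_affine])
  have wv: "w \<in> verts (\<Delta> S)" and nb: "w \<notin> black S" using w verts_eq black_white by auto
  note add = additive_sheet_height[OF w, of n]
  have hG: "h \<in> VG S w" by (rule VF_VG[OF wv h])
  show "\<exists>m. k < card (horizontal_letter (Grp w (h [^] (m::nat))) {})" for k
  proof (rule iterated_escape)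
    show "sheet_height w n h \<noteq> 0" using n height_VF[OF wv h] proj_VF[OF wv h] by (simp add: sheet_height_def)
    fix m :: nat
    have "nat \<bar>sheet_height w n (h [^] m)\<bar> \<le> card (horizontal_letter (Grp w (h [^] m)) {})"
      using card_sheet_map[OF twist_bound_range n(1), of "\<lambda>n. sheet_height w n (h [^] m)"] nb
      by (simp add: horizontal_letter_def commensurate_def affine_map_def)
    moreover have "sheet_height w n (h [^] m) = int m * sheet_height w n h"
      using additive_nat_pow[OF add VG_subgroup[OF wv] hG] .
    ultimately show "int m * \<bar>sheet_height w n h\<bar> \<le> int (card (horizontal_letter (Grp w (h [^] m)) {}))"
      by (simp add: abs_mult)
  qed
qed (use v0 w verts_eq VF_VG h y in auto)

definition commensurable_to_edge :: "'v \<Rightarrow> 'g \<Rightarrow> bool" where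
  "commensurable_to_edge w h \<longleftrightarrow> (\<exists>e\<in>edges_at_white S w. \<exists>x\<in>VF S w. \<exists>a::nat. \<exists>b::int. b \<noteq> 0 \<and>
     h [^] a = x \<otimes> pe S e [^] b \<otimes> inv x)"

text \<open>
  A homomorphism that does not vanish on \<open>p\<^sub>e\<close> does not vanish on an element that is commensurable to a conjugate of \<open>p\<^sub>e\<close>.
\<close>

lemma horizontal_escape_commensurable:
  assumes v0: "v0 \<in> verts (\<Delta> S)" and w: "w \<in> white S" and h: "h \<in> VF S w" and y: "y \<in> carrier G"
    and c: "commensurable_to_edge w h"
  shows "escapes G (sg.extension horizontal_letter v0) (y \<otimes> h \<otimes> inv y)"
proof -
  obtain e x and a :: nat and b :: int where e: "e \<in> edges_at_white S w" and x: "x \<in> VF S w" and b: "b \<noteq> 0"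
    and eq: "h [^] a = x \<otimes> pe S e [^] b \<otimes> inv x" using c unfolding commensurable_to_edge_def by blast
  have wv: "w \<in> verts (\<Delta> S)" using w verts_eq by simp
  have e': "e \<in> arcs'" "head (\<Delta> S) e = w" using e by (auto simp: edges_at_white_def)
  have p: "pe S e \<in> VF S w" using edge_facts(8)[OF e'(1)] e'(2) by simp
  note sub = VF_subgroup[OF wv] and add = sheet_measurement(1)[OF w, of 0]
  have pb: "pe S e [^] b \<in> VF S w" by (rule subgroup_int_pow[OF sub p])
  have "int a * sheet_measurement w 0 h = sheet_measurement w 0 (h [^] a)"
    using additive_nat_pow[OF add sub h] by simp
  also have "\<dots> = b * sheet_measurement w 0 (pe S e)"
    unfolding eq using add subgroup.m_closed[OF sub] x pb subgroup.m_inv_closed[OF sub x]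
      additive_inv[OF add sub x] additive_int_pow[OF add sub p] by (simp add: additive_def)
  also have "\<dots> \<noteq> 0"
  proof -
    have "sheet_width period sheet_number (sheets_below e) 0 > 0"
      using interleave_quotient(1)[OF R_pos, of "sheets_below e"] R_dvd sheets_below(2,3)[OF e'(1)]
      by (simp add: sheet_width_def)
    then show ?thesis using b sheet_measurement(2)[OF w e, of 0] by auto
  qed
  finally have "sheet_measurement w 0 h \<noteq> 0" by auto
  then show ?thesis using horizontal_escape_white[OF v0 w h y, of 0] twist_bound_range by simp
qed

end

context torus_data
begin

definition height_action :: "'g \<Rightarrow> (bool \<times> int) set \<Rightarrow> (bool \<times> int) set" where
  "height_action g = commensurate upper (line_shift (\<lambda>s. height g))"

lemma wall_action_height: "wall_action G height_action"
  unfolding wall_action_def height_action_def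
  using is_affine_commensurate[OF bij_line_shift finite_line_shift] bij_line_shift[THEN bij_is_inj]
  by (simp add: commensurate_comp line_shift_comp height_mult line_shift_0 commensurate_id
      additive_one[OF height_additive group_self])

lemma height_escape: assumes g: "g \<in> carrier G" "height g \<noteq> 0" shows "escapes G height_action g"
  unfolding escapes_def
proof
  fix k
  show "\<exists>n. k < card (height_action (g [^] (n::nat)) {})"
  proof (rule iterated_escape[OF _ g(2)])
    fix n :: nat
    have "nat \<bar>height (g [^] n)\<bar> \<le> card (height_action (g [^] n) {})"
      using card_line_shift[of "\<lambda>s. height (g [^] n)" True]
      by (simp add: height_action_def commensurate_def affine_map_def)
    then show "int n * \<bar>height g\<bar> \<le> int (card (height_action (g [^] n) {}))"
      using additive_nat_pow[OF height_additive group_self g(1), of n] by (simp add: abs_mult)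
  qed
qed

end

section \<open>The vertical walls of one vertex\<close>

text \<open>
  Here \<open>H\<close> and \<open>t\<close> are \<open>F\<^sub>w\<close> and \<open>t\<^sub>w\<close> for a white vertex \<open>w\<close>, and \<open>P\<close> are the words read along the axes of the
  conjugates of the elements \<open>p\<^sub>e\<close>.
\<close>

locale axis_walls = group G for G :: "'g monoid" (structure) +
  fixes H :: "'g set" and t :: 'g and B :: "'g set" and P :: "('g \<times> bool) list set"
  assumes H: "subgroup H G" and t: "t \<in> carrier G" and t_commute: "h \<in> H \<Longrightarrow> h \<otimes> t = t \<otimes> h"
    and t_H: "t [^] (j::int) \<in> H \<Longrightarrow> j = 0" and words: "independent_words (sub G H) B P"
begin

sublocale w: independent_words "sub G H" B P
  by (rule words)

abbreviation val where "val \<equiv> w.val"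

lemma H_closed: "h \<in> H \<Longrightarrow> h \<in> carrier G"
  by (rule subgroup.mem_carrier[OF H])

lemma H_ops: "g \<in> H \<Longrightarrow> h \<in> H \<Longrightarrow> g \<otimes> h \<in> H" "h \<in> H \<Longrightarrow> inv h \<in> H" "\<one> \<in> H"
  using subgroup.m_closed[OF H] subgroup.m_inv_closed[OF H] subgroup.one_closed[OF H] by auto

lemma H_inv: "h \<in> H \<Longrightarrow> inv\<^bsub>sub G H\<^esub> h = inv h"
  by (rule m_inv_consistent[OF H])

lemma H_pow: "h [^]\<^bsub>sub G H\<^esub> (n::nat) = h [^] n"
  by (rule nat_pow_consistent[symmetric])

lemma H_pow_closed: "h \<in> H \<Longrightarrow> h [^] (n::nat) \<in> H"
  by (rule subgroup_nat_pow[OF H])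

lemma val_H: "u \<in> words_over B \<Longrightarrow> val u \<in> H"
  using w.val_closed by simp

lemma val_G: "u \<in> words_over B \<Longrightarrow> val u \<in> carrier G"
  using val_H H_closed by blast

lemma B_H: "b \<in> B \<Longrightarrow> b \<in> H"
  using w.B_carrier by auto

lemma val_app: "u \<in> words_over B \<Longrightarrow> v \<in> words_over B \<Longrightarrow> val (u @ v) = val u \<otimes> val v"
  using w.val_append by simp

lemma val_inv: "u \<in> words_over B \<Longrightarrow> val (winv u) = inv (val u)"
  using w.val_winv val_H by (simp add: H_inv)

lemma val_pow: "u \<in> words_over B \<Longrightarrow> val (power_word n u) = val u [^] n"
  using w.val_power_word by (simp add: H_pow)

lemma val_letter: "fst d \<in> B \<Longrightarrow> val [d] = (if snd d then fst d else inv (fst d))"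
  using w.val_singleton[of d] B_H by (simp add: H_inv)

lemma val_one: "val [] = \<one>"
  using w.val_Nil by simp

lemma t_pow_commute: "h \<in> H \<Longrightarrow> h \<otimes> t [^] (j::int) = t [^] j \<otimes> h"
proof -
  assume h: "h \<in> H"
  then have hc: "h \<in> carrier G" by (rule H_closed)
  have nat: "h \<otimes> t [^] n = t [^] n \<otimes> h" for n :: nat
  proof (induction n)
    case (Suc n)
    have "h \<otimes> (t [^] n \<otimes> t) = t [^] n \<otimes> (h \<otimes> t)" using Suc hc t by (simp add: m_assoc[symmetric])
    then show ?case using t_commute[OF h] hc t by (simp add: m_assoc)
  qed (use hc in simp)
  have inv: "h \<otimes> inv (t [^] n) = inv (t [^] n) \<otimes> h" for n :: nat
  proof -
    have "inv (t [^] n) \<otimes> (h \<otimes> t [^] n) \<otimes> inv (t [^] n) = h \<otimes> inv (t [^] n)"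
      unfolding nat using hc t by (simp add: m_assoc inv_cancel)
    then show ?thesis using hc t by (simp add: m_assoc)
  qed
  show ?thesis using nat inv t by (cases j rule: int_cases2) (simp_all add: int_pow_int int_pow_neg)
qed

text \<open>
  The axes that pass through the edge from \<open>\<one>\<close> to \<open>b\<close>, described by the words that are read from \<open>\<one>\<close>.  An axis that
  passes in the direction from \<open>b\<close> to \<open>\<one>\<close> has \<open>(b, False)\<close> as the last letter before \<open>\<one>\<close>.
\<close>

definition through :: "'g \<Rightarrow> ('g \<times> bool) list set" where
  "through b = {v \<in> P. hd v = (b, True) \<or> last v = (b, False)}"

definition wall_stabiliser :: "'g \<Rightarrow> 'g set" where
  "wall_stabiliser b = {s \<otimes> t [^] j | s (j::int). s \<in> w.wall_group (through b)}"

definition wall :: "'g \<Rightarrow> 'g \<Rightarrow> 'g \<times> 'g set" where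
  "wall x b = (b, left_mult G x ` wall_stabiliser b)"

text \<open>
  Any other axis through the edge gives the same wall: the quotient of the \<open>K\<close>-th powers is in the wall group.
\<close>

definition power_through :: "'g \<Rightarrow> 'g" where
  "power_through b = val (SOME v. v \<in> through b) [^] w.exponent"

text \<open>
  The edge \<open>(x, b)\<close> crosses its own wall, and, if it lies on some axis, also the wall of the edge at distance \<open>K\<close> periods
  before it.
\<close>

definition edge_walls :: "'g \<Rightarrow> 'g \<Rightarrow> ('g \<times> 'g set) list" where
  "edge_walls x b = wall x b # (if through b = {} then [] else [wall (x \<otimes> inv (power_through b)) b])"

text \<open>The letter \<open>(b, False)\<close> read at \<open>x\<close> runs along the edge \<open>(x b\<inverse>, b)\<close>.\<close>

definition edge_base :: "'g \<Rightarrow> 'g \<times> bool \<Rightarrow> 'g" where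
  "edge_base x d = (if snd d then x else x \<otimes> inv (fst d))"

fun along :: "('g \<Rightarrow> 'g \<Rightarrow> 'z list) \<Rightarrow> 'g \<Rightarrow> ('g \<times> bool) list \<Rightarrow> 'z list" where
  "along \<omega> x [] = []"
| "along \<omega> x (d # u) = \<omega> (edge_base x d) (fst d) @ along \<omega> (x \<otimes> val [d]) u"

abbreviation walls_along :: "'g \<Rightarrow> ('g \<times> bool) list \<Rightarrow> ('g \<times> 'g set) set" where
  "walls_along x u \<equiv> odd_set (along edge_walls x u)"

abbreviation plus_along :: "'g \<Rightarrow> ('g \<times> bool) list \<Rightarrow> ('g \<times> 'g set) set" where
  "plus_along x u \<equiv> odd_set (along (\<lambda>x b. [wall x b]) x u)"

definition shift :: "'g \<Rightarrow> 'g \<times> 'g set \<Rightarrow> 'g \<times> 'g set" where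
  "shift g = map_prod id (image (left_mult G g))"

definition cocycle :: "'g \<Rightarrow> ('g \<times> 'g set) set" where
  "cocycle h = walls_along \<one> (SOME u. u \<in> words_over B \<and> val u = h)"

lemma through_P: "v \<in> through b \<Longrightarrow> v \<in> P" "through b \<subseteq> P"
  by (auto simp: through_def)

lemma P_over: "v \<in> P \<Longrightarrow> v \<in> words_over B"
  by (rule w.P_over)

lemma power_closed: "v \<in> P \<Longrightarrow> val v [^] (n::nat) \<in> H"
  using H_pow_closed val_H P_over by blast

lemma wall_group_subset: "w.wall_group (through b) \<subseteq> H"
  and wall_group_subgroup: "subgroup (w.wall_group (through b)) (sub G H)"
proof -
  have "(\<lambda>(v, v'). val v [^]\<^bsub>sub G H\<^esub> w.exponent \<otimes>\<^bsub>sub G H\<^esub> inv\<^bsub>sub G H\<^esub> (val v' [^]\<^bsub>sub G H\<^esub> w.exponent)) `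
    (through b \<times> through b) \<subseteq> carrier (sub G H)"
    using power_closed through_P(1) by (auto simp: H_pow H_inv intro!: H_ops)
  then show "subgroup (w.wall_group (through b)) (sub G H)"
    unfolding w.wall_group_def by (rule w.generate_is_subgroup)
  from subgroup.subset[OF this] show "w.wall_group (through b) \<subseteq> H" by simp
qed

lemma wall_group_ops:
  "x \<in> w.wall_group (through b) \<Longrightarrow> y \<in> w.wall_group (through b) \<Longrightarrow> x \<otimes> y \<in> w.wall_group (through b)"
  "x \<in> w.wall_group (through b) \<Longrightarrow> inv x \<in> w.wall_group (through b)" "\<one> \<in> w.wall_group (through b)"
  using subgroup.m_closed[OF wall_group_subgroup] subgroup.m_inv_closed[OF wall_group_subgroup]
    subgroup.one_closed[OF wall_group_subgroup] wall_group_subset by (auto simp: H_inv subset_iff)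

lemma wall_group_power:
  assumes "v \<in> through b" "v' \<in> through b"
  shows "val v [^] w.exponent \<otimes> inv (val v' [^] w.exponent) \<in> w.wall_group (through b)"
proof -
  have "val v [^]\<^bsub>sub G H\<^esub> w.exponent \<otimes>\<^bsub>sub G H\<^esub> inv\<^bsub>sub G H\<^esub> (val v' [^]\<^bsub>sub G H\<^esub> w.exponent) \<in> w.wall_group (through b)"
    unfolding w.wall_group_def using assms by (intro generate.incl) auto
  then show ?thesis using power_closed through_P(1) assms by (simp add: H_pow H_inv)
qed

lemma wall_stabiliser_subgroup: "subgroup (wall_stabiliser b) G"
proof
  have W: "s \<in> w.wall_group (through b) \<Longrightarrow> s \<in> H" for s using wall_group_subset by blast
  show "wall_stabiliser b \<subseteq> carrier G" using W H_closed t by (auto simp: wall_stabiliser_def)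
  show "\<one> \<in> wall_stabiliser b"
    unfolding wall_stabiliser_def using wall_group_ops(3)[of b] t
    by (intro CollectI exI[of _ "\<one>"] exI[of _ "0::int"]) simp
  fix x y assume x: "x \<in> wall_stabiliser b" and "y \<in> wall_stabiliser b"
  then obtain s s' and j j' :: int where s: "s \<in> w.wall_group (through b)" "x = s \<otimes> t [^] j"
    and s': "s' \<in> w.wall_group (through b)" "y = s' \<otimes> t [^] j'" by (auto simp: wall_stabiliser_def)
  have c: "s \<in> carrier G" "s' \<in> carrier G" using s s' W H_closed by auto
  have "x \<otimes> y = s \<otimes> (t [^] j \<otimes> s') \<otimes> t [^] j'" using s s' c t by (simp add: m_assoc)
  also have "\<dots> = s \<otimes> s' \<otimes> (t [^] j \<otimes> t [^] j')"
    unfolding t_pow_commute[OF W[OF s'(1)], of j, symmetric] using c t by (simp add: m_assoc)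
  also have "t [^] j \<otimes> t [^] j' = t [^] (j + j')" using t by (simp add: int_pow_mult)
  finally show "x \<otimes> y \<in> wall_stabiliser b"
    unfolding wall_stabiliser_def using wall_group_ops(1)[OF s(1) s'(1)] by blast
next
  fix x assume "x \<in> wall_stabiliser b"
  then obtain s and j :: int where s: "s \<in> w.wall_group (through b)" "x = s \<otimes> t [^] j" by (auto simp: wall_stabiliser_def)
  have sH: "s \<in> H" using s wall_group_subset by blast
  have "inv x = t [^] (- j) \<otimes> inv s" using s H_closed[OF sH] t by (simp add: inv_mult_group int_pow_neg)
  also have "\<dots> = inv s \<otimes> t [^] (- j)" using t_pow_commute[OF H_ops(2)[OF sH]] by simp
  finally show "inv x \<in> wall_stabiliser b" unfolding wall_stabiliser_def using wall_group_ops(2)[OF s(1)] by blast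
qed

lemma wall_stabiliser_H: "x \<in> H \<Longrightarrow> x \<in> wall_stabiliser b \<longleftrightarrow> x \<in> w.wall_group (through b)"
proof
  assume x: "x \<in> H" "x \<in> wall_stabiliser b"
  then obtain s and j :: int where s: "s \<in> w.wall_group (through b)" "x = s \<otimes> t [^] j" by (auto simp: wall_stabiliser_def)
  have sH: "s \<in> H" using s wall_group_subset by blast
  have "t [^] j = inv s \<otimes> x" using s H_closed[OF sH] t by (simp add: inv_cancel)
  then have "j = 0" using t_H H_ops x sH by metis
  then show "x \<in> w.wall_group (through b)" using s H_closed[OF sH] by simp
next
  assume x: "x \<in> H" "x \<in> w.wall_group (through b)"
  then show "x \<in> wall_stabiliser b"
    unfolding wall_stabiliser_def using H_closed by (intro CollectI exI[of _ x] exI[of _ "0::int"]) simp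
qed

lemma wall_eq:
  assumes "x \<in> carrier G" "y \<in> carrier G"
  shows "wall x b = wall y b' \<longleftrightarrow> b = b' \<and> inv x \<otimes> y \<in> wall_stabiliser b"
  unfolding wall_def prod.inject using left_mult_subgroup[OF wall_stabiliser_subgroup assms] by metis

lemma shift_wall: "g \<in> carrier G \<Longrightarrow> x \<in> carrier G \<Longrightarrow> shift g (wall x b) = wall (g \<otimes> x) b"
  by (simp add: shift_def wall_def left_mult_image_comp)

lemma shift_comp: "g \<in> carrier G \<Longrightarrow> h \<in> carrier G \<Longrightarrow> shift g \<circ> shift h = shift (g \<otimes> h)"
  by (auto simp: shift_def fun_eq_iff left_mult_image_comp)

lemma shift_one: "shift \<one> = id"
  by (simp add: shift_def left_mult_one prod.map_id fun_eq_iff)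

lemma bij_shift: "g \<in> carrier G \<Longrightarrow> bij (shift g)"
  by (rule o_bij[of "shift (inv g)"]) (simp_all add: shift_comp shift_one)

lemma shift_image_comp: "g \<in> carrier G \<Longrightarrow> h \<in> carrier G \<Longrightarrow> shift g ` shift h ` A = shift (g \<otimes> h) ` A"
  by (metis image_comp shift_comp)

lemma power_through:
  assumes "v \<in> through b" "x \<in> carrier G"
  shows "power_through b \<in> H" "wall (x \<otimes> inv (power_through b)) b = wall (x \<otimes> inv (val v [^] w.exponent)) b"
proof -
  have s: "(SOME v. v \<in> through b) \<in> through b" using assms(1) by (rule someI)
  then show H: "power_through b \<in> H" using power_closed through_P(1) by (simp add: power_through_def)
  let ?p = "power_through b" and ?q = "val v [^] w.exponent"
  have q: "?q \<in> H" using power_closed through_P(1) assms by simp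
  have "inv (x \<otimes> inv ?p) \<otimes> (x \<otimes> inv ?q) = ?p \<otimes> inv ?q"
    using assms(2) H_closed[OF H] H_closed[OF q] by (simp add: inv_mult_group m_assoc inv_cancel)
  also have "\<dots> \<in> wall_stabiliser b"
    using wall_group_power[OF s assms(1)] H q by (subst wall_stabiliser_H) (auto simp: power_through_def intro: H_ops)
  finally show "wall (x \<otimes> inv ?p) b = wall (x \<otimes> inv ?q) b"
    using assms(2) H_closed[OF H] H_closed[OF q] by (simp add: wall_eq)
qed

lemma power_through_closed: "through b \<noteq> {} \<Longrightarrow> power_through b \<in> carrier G"
  using power_through(1)[OF _ one_closed] H_closed by blast

lemma edge_base_closed: "x \<in> carrier G \<Longrightarrow> fst d \<in> B \<Longrightarrow> edge_base x d \<in> carrier G"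
  using B_H H_closed by (simp add: edge_base_def)

lemma edge_base_mult: "g \<in> carrier G \<Longrightarrow> x \<in> carrier G \<Longrightarrow> fst d \<in> B \<Longrightarrow> edge_base (g \<otimes> x) d = g \<otimes> edge_base x d"
  using B_H H_closed by (simp add: edge_base_def m_assoc)

lemma along_append:
  "u \<in> words_over B \<Longrightarrow> v \<in> words_over B \<Longrightarrow> x \<in> carrier G \<Longrightarrow> along \<omega> x (u @ v) = along \<omega> x u @ along \<omega> (x \<otimes> val u) v"
proof (induction u arbitrary: x)
  case (Cons d u)
  then have d: "[d] \<in> words_over B" and u: "u \<in> words_over B" by auto
  have "val (d # u) = val [d] \<otimes> val u" using val_app[OF d u] by simp
  then show ?case using Cons u val_G[OF d] val_G[OF u] by (simp add: m_assoc)
qed (simp add: val_one)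

lemma along_shift:
  assumes \<omega>: "\<And>x b. x \<in> carrier G \<Longrightarrow> b \<in> B \<Longrightarrow> \<omega> (g \<otimes> x) b = map (shift g) (\<omega> x b)" and g: "g \<in> carrier G"
  shows "u \<in> words_over B \<Longrightarrow> x \<in> carrier G \<Longrightarrow> along \<omega> (g \<otimes> x) u = map (shift g) (along \<omega> x u)"
proof (induction u arbitrary: x)
  case (Cons d u)
  then have d: "[d] \<in> words_over B" and u: "u \<in> words_over B" and b: "fst d \<in> B" by auto
  have "along \<omega> (g \<otimes> x) (d # u) = \<omega> (g \<otimes> edge_base x d) (fst d) @ along \<omega> (g \<otimes> (x \<otimes> val [d])) u"
    using edge_base_mult[OF g Cons.prems(2) b] g Cons.prems(2) val_G[OF d] by (simp add: m_assoc)
  then show ?case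
    using Cons.IH[OF u, of "x \<otimes> val [d]"] \<omega>[OF edge_base_closed[OF Cons.prems(2) b] b] Cons.prems(2) val_G[OF d] by simp
qed simp

lemma edge_walls_shift: "g \<in> carrier G \<Longrightarrow> x \<in> carrier G \<Longrightarrow> edge_walls (g \<otimes> x) b = map (shift g) (edge_walls x b)"
  using power_through_closed[of b] by (simp add: edge_walls_def shift_wall m_assoc)

lemma walls_along_shift:
  "g \<in> carrier G \<Longrightarrow> u \<in> words_over B \<Longrightarrow> x \<in> carrier G \<Longrightarrow> walls_along (g \<otimes> x) u = shift g ` walls_along x u"
  using along_shift[of edge_walls g u x] edge_walls_shift by (simp add: odd_set_map bij_shift[THEN bij_is_inj])

lemma plus_along_shift:
  "g \<in> carrier G \<Longrightarrow> u \<in> words_over B \<Longrightarrow> x \<in> carrier G \<Longrightarrow> plus_along (g \<otimes> x) u = shift g ` plus_along x u"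
  using along_shift[of "\<lambda>x b. [wall x b]" g u x] shift_wall by (simp add: odd_set_map bij_shift[THEN bij_is_inj])

lemma walls_along_append:
  "u \<in> words_over B \<Longrightarrow> v \<in> words_over B \<Longrightarrow> x \<in> carrier G \<Longrightarrow> walls_along x (u @ v) = walls_along x u \<triangle> walls_along (x \<otimes> val u) v"
  by (simp add: along_append odd_set_append)

lemma plus_along_append:
  "u \<in> words_over B \<Longrightarrow> v \<in> words_over B \<Longrightarrow> x \<in> carrier G \<Longrightarrow> plus_along x (u @ v) = plus_along x u \<triangle> plus_along (x \<otimes> val u) v"
  by (simp add: along_append odd_set_append)

lemma walls_along_cancel: "fst d \<in> B \<Longrightarrow> x \<in> carrier G \<Longrightarrow> walls_along x [d, flip d] = {}"
proof -
  assume d: "fst d \<in> B" and x: "x \<in> carrier G"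
  have b: "fst d \<in> carrier G" using d B_H H_closed by blast
  have "edge_base (x \<otimes> val [d]) (flip d) = edge_base x d"
    using d x b by (simp add: val_letter edge_base_def flip_def m_assoc)
  then show ?thesis by (simp add: odd_set_append flip_def)
qed

text \<open>
  An edge contributes the same walls in both directions, so the parities are not changed by free cancellation.
\<close>

lemma cocycle_val: assumes u: "u \<in> words_over B" shows "cocycle (val u) = walls_along \<one> u"
proof -
  let ?v = "SOME v. v \<in> words_over B \<and> val v = val u"
  have v: "?v \<in> words_over B" "val ?v = val u" using someI[of "\<lambda>v. v \<in> words_over B \<and> val v = val u" u] u by auto
  have "walls_along \<one> ?v = walls_along \<one> u"
  proof (rule w.cancellation_invariant[OF _ v(1) u v(2)])
    fix a d c assume "a @ [d, flip d] @ c \<in> words_over B"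
    then have o: "a \<in> words_over B" "fst d \<in> B" "c \<in> words_over B" "[d, flip d] \<in> words_over B" "[d, flip d] @ c \<in> words_over B" by auto
    have "val [d, flip d] = \<one>" using w.val_cancel[OF o(2)] by simp
    then show "walls_along \<one> (a @ [d, flip d] @ c) = walls_along \<one> (a @ c)"
      using walls_along_append[OF o(1,5)] walls_along_append[OF o(4,3)] walls_along_append[OF o(1,3)]
        walls_along_cancel[OF o(2)] val_G[OF o(1)] by simp
  qed
  then show ?thesis by (simp add: cocycle_def)
qed

lemma ex_word: assumes "h \<in> H" obtains u where "u \<in> words_over B" "val u = h"
  using w.ex_reduced_word[of h] assms by (auto simp: reduced_words_def)

lemma cocycle_mult:
  assumes "g \<in> H" "h \<in> H" shows "cocycle (g \<otimes> h) = cocycle g \<triangle> shift g ` cocycle h"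
proof -
  obtain u v where uv: "u \<in> words_over B" "val u = g" "v \<in> words_over B" "val v = h" using ex_word assms by metis
  have "cocycle (g \<otimes> h) = walls_along \<one> (u @ v)" using cocycle_val[of "u @ v"] uv val_app by simp
  also have "\<dots> = walls_along \<one> u \<triangle> walls_along (g \<otimes> \<one>) v" using uv val_G[of u] walls_along_append[OF uv(1,3) one_closed] by simp
  also have "walls_along (g \<otimes> \<one>) v = shift g ` walls_along \<one> v" using walls_along_shift[of g v \<one>] uv val_G by blast
  finally show ?thesis using cocycle_val uv by metis
qed

lemma cocycle_one: "cocycle \<one> = {}"
  using cocycle_val[of "[]"] val_one by simp

lemma finite_cocycle: "finite (cocycle h)"
  by (simp add: cocycle_def)

text \<open>Everything that has been built from paths in \<open>H\<close> is fixed by \<open>t\<close>, which is central.\<close>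

definition near :: "('g \<times> 'g set) set" where
  "near = {wall x b | x b. x \<in> H}"

lemma shift_t: assumes z: "z \<in> near" shows "shift (t [^] (j::int)) z = z"
proof -
  obtain x b where xb: "x \<in> H" "z = wall x b" using z by (auto simp: near_def)
  have x: "x \<in> carrier G" using xb H_closed by simp
  have tj: "t [^] j \<in> carrier G" using t by simp
  have "inv x \<otimes> (t [^] j \<otimes> x) = t [^] j" using t_pow_commute[OF xb(1), of j, symmetric] x t by (simp add: inv_cancel)
  also have "t [^] j \<in> wall_stabiliser b"
    unfolding wall_stabiliser_def using wall_group_ops(3)[of b] t
    by (intro CollectI exI[of _ "\<one>"] exI[of _ j]) simp
  finally have "wall x b = wall (t [^] j \<otimes> x) b" using x tj by (simp add: wall_eq)
  then show ?thesis unfolding xb(2) shift_wall[OF tj x] by (rule sym)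
qed

lemma shift_t_image:
  assumes "A \<subseteq> near" "g \<in> carrier G" shows "shift (g \<otimes> t [^] (j::int)) ` A = shift g ` A"
proof -
  have "shift (t [^] j) ` A = (\<lambda>z. z) ` A"
    by (rule image_cong[OF refl]) (rule shift_t[OF subsetD[OF assms(1)]])
  then have "shift (t [^] j) ` A = A" by simp
  then show ?thesis using shift_image_comp[OF assms(2), of "t [^] j" A] t by simp
qed

lemma along_near:
  assumes \<omega>: "\<And>x b. x \<in> H \<Longrightarrow> set (\<omega> x b) \<subseteq> near"
  shows "u \<in> words_over B \<Longrightarrow> x \<in> H \<Longrightarrow> set (along \<omega> x u) \<subseteq> near"
proof (induction u arbitrary: x)
  case (Cons d u)
  have "edge_base x d \<in> H" using Cons.prems B_H H_ops by (simp add: edge_base_def)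
  moreover have "x \<otimes> val [d] \<in> H" using Cons.prems H_ops(1) val_H[of "[d]"] by simp
  ultimately show ?case using Cons \<omega> by simp
qed simp

lemma walls_near: "u \<in> words_over B \<Longrightarrow> x \<in> H \<Longrightarrow> walls_along x u \<subseteq> near"
  and plus_near: "u \<in> words_over B \<Longrightarrow> x \<in> H \<Longrightarrow> plus_along x u \<subseteq> near"
proof -
  have "set (edge_walls x b) \<subseteq> near" if "x \<in> H" for x b
    using that power_through(1)[OF _ one_closed, of _ b] H_ops by (auto simp: edge_walls_def near_def)
  note e = this
  show "walls_along x u \<subseteq> near" if "u \<in> words_over B" "x \<in> H"
    by (rule subset_trans[OF odd_set_subset along_near[OF e that]])
  have "set [wall x b] \<subseteq> near" if "x \<in> H" for x b using that by (auto simp: near_def)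
  note p = this
  show "plus_along x u \<subseteq> near" if "u \<in> words_over B" "x \<in> H"
    by (rule subset_trans[OF odd_set_subset along_near[OF p that]])
qed

lemma cocycle_near: "h \<in> H \<Longrightarrow> cocycle h \<subseteq> near"
  using ex_word[of h] cocycle_val walls_near[OF _ H_ops(3)] by metis

section \<open>The walls along an axis\<close>

text \<open>
  By definition, the second wall of an edge on the axis is the wall of its translate by \<open>g\<close>, whichever direction
  the edge has.
\<close>

lemma walls_along_axis:
  assumes c: "c \<in> P" and x: "x \<in> carrier G"
  defines "g \<equiv> x \<otimes> inv (val c [^] w.exponent) \<otimes> inv x"
  shows "walls_along x c = plus_along x c \<triangle> shift g ` plus_along x c"
proof -
  have cc: "val c [^] n \<in> carrier G" for n :: nat using power_closed[OF c] H_closed by blast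
  have g: "g \<in> carrier G" using x cc by (simp add: g_def)
  have one: "edge_walls (edge_base (x \<otimes> val u) d) (fst d) =
      [wall (edge_base (x \<otimes> val u) d) (fst d), shift g (wall (edge_base (x \<otimes> val u) d) (fst d))]"
    if split: "c = u @ d # u'" for u d u'
  proof -
    have o: "u \<in> words_over B" "[d] \<in> words_over B" "fst d \<in> B" "u' \<in> words_over B" using P_over[OF c] split by auto
    define z where "z = (if snd d then u else u @ [d])"
    define z' where "z' = (if snd d then d # u' else u')"
    have zz: "c = z @ z'" "z \<in> words_over B" "z' \<in> words_over B" using split o by (auto simp: z_def z'_def)
    have v: "z' @ z \<in> through (fst d)"
    proof -
      have "z' @ z = rotate (length z) c" unfolding zz(1) by (simp add: rotate_append)
      then have "z' @ z \<in> P" using w.P_rotate_n[OF c] by simp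
      then show ?thesis by (cases d; cases "snd d") (simp_all add: through_def z_def z'_def)
    qed
    have zG: "val z \<in> carrier G" "val z' \<in> carrier G" using val_G zz by auto
    have base: "edge_base (x \<otimes> val u) d = x \<otimes> val z"
      using val_app[OF o(1,2)] val_letter[OF o(3)] val_G[OF o(1)] B_H[OF o(3)] H_closed x
      by (simp add: edge_base_def z_def m_assoc)
    have conj: "val c [^] n = val z \<otimes> val (z' @ z) [^] n \<otimes> inv (val z)" for n :: nat
    proof -
      have "val z \<otimes> val (z' @ z) [^] n = val c [^] n \<otimes> val z"
      proof (induction n)
        case (Suc n)
        have a: "val c = val z \<otimes> val z'" "val (z' @ z) = val z' \<otimes> val z"
          using val_app[OF zz(3,2)] val_app[OF zz(2,3)] zz(1) by simp_all
        have "val z \<otimes> val (z' @ z) [^] Suc n = (val z \<otimes> val (z' @ z) [^] n) \<otimes> (val z' \<otimes> val z)"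
          using zG a by (simp add: m_assoc)
        also have "\<dots> = val c [^] n \<otimes> (val z \<otimes> val z') \<otimes> val z" unfolding Suc using zG a by (simp add: m_assoc)
        finally show ?case using a zG by simp
      qed (use zG in simp)
      then show ?thesis using zG val_G[of "z' @ z"] zz cc by (simp add: m_assoc)
    qed
    let ?q = "val (z' @ z) [^] w.exponent"
    have q: "?q \<in> carrier G" using zz val_G[of "z' @ z"] by simp
    have "g \<otimes> (x \<otimes> val z) = x \<otimes> val z \<otimes> inv ?q"
      unfolding g_def conj using x zG q by (simp add: m_assoc inv_mult_group inv_cancel)
    then have "shift g (wall (x \<otimes> val z) (fst d)) = wall (x \<otimes> val z \<otimes> inv (power_through (fst d))) (fst d)"
      using power_through(2)[OF v, of "x \<otimes> val z"] x zG g by (simp add: shift_wall)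
    then show ?thesis unfolding base using v by (auto simp: edge_walls_def)
  qed
  have "walls_along (x \<otimes> val u) u' = plus_along (x \<otimes> val u) u' \<triangle> shift g ` plus_along (x \<otimes> val u) u'" if "c = u @ u'" for u u'
    using that
  proof (induction u' arbitrary: u)
    case (Cons d u')
    have o: "u \<in> words_over B" "[d] \<in> words_over B" using P_over[OF c] Cons.prems by auto
    have vv: "x \<otimes> val (u @ [d]) = x \<otimes> val u \<otimes> val [d]" using val_app[OF o] val_G o x by (simp add: m_assoc)
    show ?case
      using Cons.IH[of "u @ [d]"] Cons.prems one[OF Cons.prems]
      unfolding along.simps odd_set_append vv
      by (simp add: odd_set_Cons image_symdiff bij_shift[OF g, THEN bij_is_inj] symdiff_ac)
  qed simp
  from this[of "[]" c] show ?thesis using x by (simp add: val_one)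
qed

text \<open>
  The walls on the way from \<open>\<one>\<close> to the axis at \<open>q\<close>, and the walls of the \<open>K\<close> periods of the axis before \<open>q\<close>.
\<close>

definition coboundary :: "('g \<times> bool) list \<Rightarrow> ('g \<times> bool) list \<Rightarrow> ('g \<times> 'g set) set" where
  "coboundary q c = walls_along \<one> q \<triangle> plus_along (val q \<otimes> inv (val c [^] w.exponent)) (power_word w.exponent c)"

lemma coboundary_finite: "finite (coboundary q c)"
  by (simp add: coboundary_def)

lemma coboundary_near:
  assumes q: "q \<in> words_over B" and c: "c \<in> P" shows "coboundary q c \<subseteq> near"
proof -
  have "power_word w.exponent c \<in> words_over B" by (rule w.power_word_over[OF P_over[OF c]])
  moreover have "val q \<otimes> inv (val c [^] w.exponent) \<in> H" using val_H[OF q] power_closed[OF c] H_ops by simp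
  ultimately show ?thesis
    unfolding coboundary_def using walls_near[OF q H_ops(3)] plus_near by (intro symdiff_subset) auto
qed

text \<open>
  The walls along the path \<open>q c q\<inverse>\<close> are those of \<open>q\<close> and their translates by \<open>p\<close>, and the walls of the edges in two periods
  of the axis at distance \<open>K\<close>.  The latter remain when the walls of \<open>K\<close> consecutive periods are compared with their
  translates by \<open>p\<close>.
\<close>

lemma cocycle_axis:
  assumes q: "q \<in> words_over B" and c: "c \<in> P"
  defines "p \<equiv> val q \<otimes> val c \<otimes> inv (val q)"
  shows "cocycle p = coboundary q c \<triangle> shift p ` coboundary q c"
proof -
  let ?K = w.exponent
  have co: "c \<in> words_over B" by (rule P_over[OF c])
  have qG: "val q \<in> carrier G" and cG: "val c \<in> carrier G" using val_G q co by auto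
  have pG: "p \<in> carrier G" using qG cG by (simp add: p_def)
  have wq: "winv q \<in> words_over B" and cK: "power_word ?K c \<in> words_over B" using q co w.power_word_over by auto
  have go_back: "walls_along x q \<triangle> walls_along (x \<otimes> val q) (winv q) = {}" if x: "x \<in> carrier G" for x
  proof -
    have "q @ winv q \<in> words_over B" "val (q @ winv q) = val []"
      using q qG by (simp_all add: val_app val_inv val_one)
    then have "walls_along \<one> (q @ winv q) = {}" using cocycle_val[of "q @ winv q"] cocycle_val[of "[]"] by simp
    then have "walls_along (x \<otimes> \<one>) (q @ winv q) = {}" using walls_along_shift[OF x _ one_closed, of "q @ winv q"] q by simp
    then show ?thesis using walls_along_append[OF q wq x] x by simp
  qed
  let ?y = "val q \<otimes> inv (val c [^] ?K)"
  have yG: "?y \<in> carrier G" using qG cG by simp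
  define Q A M where "Q = walls_along \<one> q" and "A = plus_along (val q) c" and "M = plus_along ?y (power_word ?K c)"
  define A' where "A' = plus_along ?y c"
  let ?g = "val q \<otimes> inv (val c [^] ?K) \<otimes> inv (val q)"
  have A': "shift ?g ` A = A'"
  proof -
    have "?g \<otimes> val q = ?y" using qG cG by (simp add: m_assoc)
    then show ?thesis using plus_along_shift[of ?g c "val q"] qG cG co by (simp add: A_def A'_def)
  qed
  have axis: "walls_along (val q) c = A \<triangle> A'" using walls_along_axis[OF c qG] A' by (simp add: A_def)
  have word: "val (q @ c @ winv q) = p" using q co qG cG by (simp add: val_app val_inv p_def m_assoc)
  have pq: "p \<otimes> val q = val q \<otimes> val c" using qG cG by (simp add: p_def m_assoc)
  have last: "walls_along (val q \<otimes> val c) (winv q) = shift p ` Q"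
  proof -
    have "walls_along p q \<triangle> walls_along (p \<otimes> val q) (winv q) = {}" by (rule go_back[OF pG])
    moreover have "walls_along (p \<otimes> \<one>) q = shift p ` Q" unfolding Q_def by (rule walls_along_shift[OF pG q one_closed])
    ultimately show ?thesis using pq pG by (metis r_one symdiff_cancel symdiff_empty(1))
  qed
  have "cocycle p = walls_along \<one> (q @ c @ winv q)" using cocycle_val[of "q @ c @ winv q"] word q co by simp
  also have "\<dots> = Q \<triangle> ((A \<triangle> A') \<triangle> shift p ` Q)"
    using walls_along_append[OF q _ one_closed, of "c @ winv q"] walls_along_append[OF co wq qG] co wq qG axis last by (simp add: Q_def)
  finally have coc: "cocycle p = Q \<triangle> ((A \<triangle> A') \<triangle> shift p ` Q)" .
  have pM: "M \<triangle> shift p ` M = A \<triangle> A'"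
  proof -
    have yc: "?y \<otimes> val c = p \<otimes> ?y"
    proof -
      have comm: "inv (val c [^] ?K) \<otimes> val c = val c \<otimes> inv (val c [^] ?K)"
      proof -
        have "val c [^] ?K \<otimes> val c = val c \<otimes> val c [^] ?K" using cG nat_pow_comm[OF cG, of ?K 1] by simp
        then have "inv (val c [^] ?K) \<otimes> (val c [^] ?K \<otimes> val c) \<otimes> inv (val c [^] ?K) =
            inv (val c [^] ?K) \<otimes> (val c \<otimes> val c [^] ?K) \<otimes> inv (val c [^] ?K)" by simp
        then show ?thesis using cG by (simp add: m_assoc inv_cancel)
      qed
      show ?thesis unfolding p_def using qG cG comm by (simp add: m_assoc inv_cancel)
    qed
    have "shift p ` M = plus_along (?y \<otimes> val c) (power_word ?K c)"
      unfolding yc M_def by (rule plus_along_shift[OF pG cK yG, symmetric])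
    moreover have "plus_along ?y (c @ power_word ?K c) = A' \<triangle> plus_along (?y \<otimes> val c) (power_word ?K c)"
      unfolding A'_def by (rule plus_along_append[OF co cK yG])
    moreover have "plus_along ?y (power_word ?K c @ c) = M \<triangle> A"
    proof -
      have "?y \<otimes> val (power_word ?K c) = val q" using val_pow[OF co] qG cG by (simp add: m_assoc)
      then show ?thesis unfolding M_def A_def using plus_along_append[OF cK co yG] by simp
    qed
    moreover have "c @ power_word ?K c = power_word ?K c @ c" using power_word_Suc_right[of ?K c] by simp
    ultimately have "A' \<triangle> shift p ` M = M \<triangle> A" by simp
    then have "M \<triangle> (A' \<triangle> (A' \<triangle> shift p ` M)) = M \<triangle> (A' \<triangle> (M \<triangle> A))" by simp
    then show ?thesis by (simp add: symdiff_ac)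
  qed
  have "coboundary q c \<triangle> shift p ` coboundary q c = (Q \<triangle> shift p ` Q) \<triangle> (M \<triangle> shift p ` M)"
    unfolding coboundary_def Q_def[symmetric] M_def[symmetric]
    by (simp add: image_symdiff bij_shift[OF pG, THEN bij_is_inj] symdiff_ac)
  then show ?thesis unfolding coc pM by (simp add: symdiff_ac)
qed

end

section \<open>Walls along the axis of an unrelated element\<close>

lemma rotate_add_period: "rotate (i + k * length c) c = rotate i c"
  by (simp add: rotate_conv_mod[of "i + k * length c"] rotate_conv_mod[of i])

lemma card_symdiff_le: "finite A \<Longrightarrow> finite A' \<Longrightarrow> card (A \<triangle> A') \<le> card A + card A'"
  by (rule order_trans[OF card_mono[OF _ symdiff_subset_Un] card_Un_le]) auto

lemma count_list_concat: "count_list (concat xss) z = (\<Sum>xs\<leftarrow>xss. count_list xs z)"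
  by (induction xss) auto

context axis_walls
begin

lemma along_segment:
  assumes c: "c \<in> words_over B" "c \<noteq> []" and x: "x \<in> carrier G"
  shows "along \<omega> x (segment c 0 N) =
    concat (map (\<lambda>m. \<omega> (edge_base (x \<otimes> val (segment c 0 m)) (periodic c m)) (fst (periodic c m))) [0..<N])"
proof (induction N)
  case (Suc N)
  have seg: "segment c 0 (Suc N) = segment c 0 N @ [periodic c N]" by (simp add: segment_def)
  have o: "segment c 0 N \<in> words_over B" "[periodic c N] \<in> words_over B"
    using c set_segment[OF c(2), of 0 "Suc N"] unfolding seg by (auto simp: words_over_def)
  show ?case using along_append[OF o x, of \<omega>] Suc unfolding seg by simp
qed (simp add: segment_def)

context
  fixes c :: "('g \<times> bool) list"
  assumes c: "c \<in> words_over B" "cyc_reduced c"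
begin

lemma c_nonempty: "c \<noteq> []"
  using c(2) by (simp add: cyc_reduced_def)

definition vertex :: "nat \<Rightarrow> 'g" where "vertex i = val (segment c 0 i)"

text \<open>Index of the vertex at which the \<open>m\<close>-th edge of the axis is based.\<close>

definition base_index :: "nat \<Rightarrow> nat" where
  "base_index m = (if snd (periodic c m) then m else Suc m)"

definition axis_wall :: "nat \<Rightarrow> 'g \<times> 'g set" where
  "axis_wall m = wall (vertex (base_index m)) (fst (periodic c m))"

lemma segment_over: "segment c i j \<in> words_over B"
  using c(1) set_segment[OF c_nonempty, of i j] by (auto simp: words_over_def)

lemma letter_over: "fst (periodic c m) \<in> B"
  using segment_over[of m "Suc m"] by (simp add: segment_def)

lemma vertex_H: "vertex i \<in> H"
  using val_H segment_over by (simp add: vertex_def)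

lemma vertex_G: "vertex i \<in> carrier G"
  using vertex_H H_closed by blast

lemma edge_base_vertex: "edge_base (vertex m) (periodic c m) = vertex (base_index m)"
proof -
  have "segment c 0 (Suc m) = segment c 0 m @ [periodic c m]" by (simp add: segment_def)
  then have "vertex (Suc m) = vertex m \<otimes> val [periodic c m]"
    using val_app[of "segment c 0 m" "[periodic c m]"] segment_over letter_over by (simp add: vertex_def)
  then show ?thesis using val_letter[OF letter_over] by (simp add: edge_base_def base_index_def)
qed

lemma vertex_inj: "vertex i = vertex j \<Longrightarrow> i = j"
proof -
  assume "vertex i = vertex j"
  then have "segment c 0 i = segment c 0 j"
    using w.reduced_val_inj[of "segment c 0 i" "segment c 0 j"] reduced_segment[OF c(2)] segment_over
    by (simp add: reduced_words_def vertex_def)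
  then have "length (segment c 0 i) = length (segment c 0 j)" by simp
  then show "i = j" by simp
qed

lemma base_index_inj:
  assumes "base_index m = base_index m'" "fst (periodic c m) = fst (periodic c m')"
  shows "m = m'"
proof -
  have no: False if "m = Suc m'" "snd (periodic c m)" "\<not> snd (periodic c m')" "fst (periodic c m) = fst (periodic c m')" for m m'
  proof -
    have "segment c m' (Suc m) = [periodic c m', periodic c m]" using that(1) by (simp add: segment_def)
    then have "periodic c m \<noteq> flip (periodic c m')"
      using reduced_segment[OF c(2), of m' "Suc m"] by (simp add: reduced_def)
    then show False using that by (simp add: flip_def prod_eq_iff)
  qed
  show ?thesis using assms no[of m m'] no[of m' m] by (auto simp: base_index_def split: if_splits)
qed

text \<open>
  Another edge of the axis with this wall would be the image of the edge under an element of the wall group, or of its other coset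
  for the second wall; both send a clear vertex off the axis.
\<close>

lemma clear_wall_isolated:
  assumes clear: "w.clear (rotate (base_index m) c)"
  shows "count_list (edge_walls (vertex (base_index m')) (fst (periodic c m'))) (axis_wall m) = (if m' = m then 1 else 0)"
proof -
  let ?b = "fst (periodic c m)" and ?i = "base_index m" and ?i' = "base_index m'"
  have plus: "wall (vertex ?i') (fst (periodic c m')) = axis_wall m \<longleftrightarrow> m' = m"
  proof
    assume "wall (vertex ?i') (fst (periodic c m')) = axis_wall m"
    then have b: "fst (periodic c m') = ?b" and "inv (vertex ?i) \<otimes> vertex ?i' \<in> wall_stabiliser ?b"
      using wall_eq[OF vertex_G vertex_G, of ?i ?b ?i' "fst (periodic c m')"] unfolding axis_wall_def by auto
    then have s: "inv (vertex ?i) \<otimes> vertex ?i' \<in> w.wall_group (through ?b)" (is "?s \<in> _")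
      using wall_stabiliser_H vertex_H H_ops by blast
    have eq: "vertex ?i' = vertex ?i \<otimes> ?s" using vertex_G by (simp add: inv_cancel)
    have "?s = \<one>" using w.clear_isolated(1)[OF c clear through_P(2) s, of ?i'] eq by (simp add: vertex_def)
    then have "vertex ?i' = vertex ?i" using eq vertex_G by simp
    then show "m' = m" using vertex_inj base_index_inj b by blast
  qed (simp add: axis_wall_def)
  have minus: "wall (vertex ?i' \<otimes> inv (power_through (fst (periodic c m')))) (fst (periodic c m')) \<noteq> axis_wall m"
    if ne: "through (fst (periodic c m')) \<noteq> {}"
  proof
    let ?p = "power_through (fst (periodic c m'))"
    obtain v where v: "v \<in> through (fst (periodic c m'))" using ne by blast
    have pH: "?p \<in> H" using power_through(1)[OF v one_closed] .
    have vp: "vertex ?i' \<otimes> inv ?p \<in> H" using vertex_H pH H_ops by simp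
    assume "wall (vertex ?i' \<otimes> inv ?p) (fst (periodic c m')) = axis_wall m"
    then have b: "fst (periodic c m') = ?b" and "inv (vertex ?i) \<otimes> (vertex ?i' \<otimes> inv ?p) \<in> wall_stabiliser ?b"
      using wall_eq[OF vertex_G H_closed[OF vp], of ?i ?b "fst (periodic c m')"] unfolding axis_wall_def by auto
    then have s: "inv (vertex ?i) \<otimes> (vertex ?i' \<otimes> inv ?p) \<in> w.wall_group (through ?b)" (is "?s \<in> _")
      using wall_stabiliser_H vertex_H vp H_ops by blast
    have eq: "vertex ?i' = vertex ?i \<otimes> (?s \<otimes> ?p)"
      using vertex_G H_closed[OF pH] by (simp add: m_assoc inv_cancel)
    have "(SOME v. v \<in> through ?b) \<in> through ?b" using v b by (metis someI)
    from w.clear_isolated(2)[OF c clear through_P(2) s this, of ?i'] show False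
      using eq b by (simp add: vertex_def power_through_def H_pow)
  qed
  show ?thesis using plus minus by (auto simp: edge_walls_def)
qed

text \<open>
  There is a clear edge in each of the \<open>n\<close> periods, and the wall of each of them is crossed exactly once.
\<close>

lemma clear_axis_count:
  assumes j: "j < length c" "w.clear (rotate j c)" "w.clear (rotate (Suc j) c)"
  shows "n \<le> card (walls_along \<one> (power_word n c))"
proof -
  let ?m = "\<lambda>k. j + k * length c" and ?N = "n * length c"
  have clear: "w.clear (rotate (base_index (?m k)) c)" for k
  proof -
    have "base_index (?m k) = (if snd (periodic c j) then j else Suc j) + k * length c"
      by (simp add: base_index_def)
    then show ?thesis using j(2,3) by (simp only: rotate_add_period) simp
  qed
  note iso = clear_wall_isolated[OF clear]
  have walls: "along edge_walls \<one> (power_word n c) =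
      concat (map (\<lambda>m. edge_walls (vertex (base_index m)) (fst (periodic c m))) [0..<?N])"
    using along_segment[OF c(1) c_nonempty one_closed, of edge_walls ?N] vertex_G edge_base_vertex
    by (simp add: segment_power_word flip: vertex_def)
  have odd: "axis_wall (?m k) \<in> walls_along \<one> (power_word n c)" if k: "k < n" for k
  proof -
    have "Suc k * length c \<le> ?N" using k by (intro mult_le_mono1) simp
    then have m: "?m k < ?N" using j(1) by simp
    have "count_list (along edge_walls \<one> (power_word n c)) (axis_wall (?m k)) = (\<Sum>m<?N. if m = ?m k then 1 else 0)"
      unfolding walls count_list_concat map_map comp_def iso
      by (simp add: interv_sum_list_conv_sum_set_nat atLeast0LessThan)
    also have "\<dots> = 1" using m by simp
    finally show ?thesis by (simp add: odd_set_def)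
  qed
  have inj: "inj_on (\<lambda>k. axis_wall (?m k)) {..<n}"
  proof (rule inj_onI)
    fix k k' assume eq: "axis_wall (?m k) = axis_wall (?m k')"
    have "axis_wall (?m k') \<in> set (edge_walls (vertex (base_index (?m k'))) (fst (periodic c (?m k'))))"
      by (simp add: edge_walls_def axis_wall_def)
    then have "count_list (edge_walls (vertex (base_index (?m k'))) (fst (periodic c (?m k')))) (axis_wall (?m k)) \<noteq> 0"
      using eq by (simp add: count_list_0_iff)
    then have "?m k' = ?m k" unfolding iso by (simp split: if_splits)
    then show "k = k'" using c_nonempty by simp
  qed
  have "n = card ((\<lambda>k. axis_wall (?m k)) ` {..<n})" using inj by (simp add: card_image)
  also have "\<dots> \<le> card (walls_along \<one> (power_word n c))" using odd by (intro card_mono) auto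
  finally show ?thesis .
qed

end

text \<open>
  The axis of \<open>h\<close> is a translate of the axis of its cyclic reduction.  The paths to the axis contribute a bounded
  number of walls.
\<close>

lemma cocycle_unbounded:
  assumes h: "h \<in> H" "h \<noteq> \<one>"
    and unrelated: "\<And>x v a b. x \<in> H \<Longrightarrow> v \<in> P \<Longrightarrow> 0 < (a::nat) \<Longrightarrow> b \<noteq> (0::int) \<Longrightarrow> h [^] a \<noteq> x \<otimes> val v [^] b \<otimes> inv x"
  shows "\<exists>C. \<forall>n. n \<le> card (cocycle (h [^] (n::nat))) + C"
proof -
  obtain q c where q: "q \<in> words_over B" and c: "c \<in> words_over B" "cyc_reduced c"
    and hqc: "h = val q \<otimes> val c \<otimes> inv (val q)"
    using w.ex_cyc_reduction[of h] h val_H H_inv by auto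
  have qG: "val q \<in> carrier G" and cG: "val c \<in> carrier G" using val_G q c by auto
  have hn: "h [^] n = val q \<otimes> val c [^] n \<otimes> inv (val q)" for n :: nat
    unfolding hqc using qG cG by (induction n) (simp_all add: m_assoc inv_cancel)
  have ne: "c \<noteq> []" using c(2) by (simp add: cyc_reduced_def)
  have "\<exists>j. w.clear (rotate j c) \<and> w.clear (rotate (Suc j) c)"
  proof (rule w.ex_clear_edge[OF c(1) ne])
    fix i v and a b :: nat
    assume v: "v \<in> w.R" and ab: "0 < a" "0 < b"
    show "val (rotate i c) [^]\<^bsub>sub G H\<^esub> a \<noteq> val v [^]\<^bsub>sub G H\<^esub> b"
    proof
      assume eq: "val (rotate i c) [^]\<^bsub>sub G H\<^esub> a = val v [^]\<^bsub>sub G H\<^esub> b"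
      define k where "k = i mod length c"
      have o: "take k c \<in> words_over B" "drop k c \<in> words_over B"
        using c(1) set_take_subset[of k c] set_drop_subset[of k c] by (auto simp: words_over_def)
      let ?z = "val (take k c)" and ?y = "val (drop k c)"
      have zy: "?z \<in> carrier G" "?y \<in> carrier G" using val_G o by auto
      have rot: "val (rotate i c) = ?y \<otimes> ?z" using val_app[OF o(2,1)] by (simp add: rotate_drop_take k_def)
      have whole: "val c = ?z \<otimes> ?y" using val_app[OF o] by simp
      have "?z \<otimes> (?y \<otimes> ?z) [^] a = (?z \<otimes> ?y) [^] a \<otimes> ?z"
      proof (induction a)
        case (Suc a)
        have "?z \<otimes> (?y \<otimes> ?z) [^] Suc a = (?z \<otimes> (?y \<otimes> ?z) [^] a) \<otimes> (?y \<otimes> ?z)" using zy by (simp add: m_assoc)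
        then show ?case unfolding Suc using zy by (simp add: m_assoc)
      qed (use zy in simp)
      then have "val c [^] a \<otimes> ?z = ?z \<otimes> val v [^] b" using eq rot whole by (simp add: H_pow)
      moreover have vR: "v \<in> words_over B" using v by (rule w.R_over)
      ultimately have "val c [^] a = ?z \<otimes> val v [^] b \<otimes> inv ?z"
        using zy cG val_G[OF vR] by (metis inv_solve_right m_closed nat_pow_closed)
      then have ha: "h [^] a = (val q \<otimes> ?z) \<otimes> val v [^] b \<otimes> inv (val q \<otimes> ?z)"
        unfolding hn using qG zy val_G[OF vR] by (simp add: m_assoc inv_mult_group)
      have x: "val q \<otimes> ?z \<in> H" using val_H q o H_ops by simp
      show False
      proof (cases "v \<in> P")
        case True
        then show False using unrelated[OF x True ab(1), of "int b"] ha ab by (simp add: int_pow_int)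
      next
        case False
        then obtain p where p: "p \<in> P" "v = winv p" using v by (auto simp: w.R_def)
        then have "val v [^] b = val p [^] (- int b)"
          using val_inv[OF P_over[OF p(1)]] val_G[OF P_over[OF p(1)]] by (simp add: int_pow_neg int_pow_int nat_pow_inv)
        then show False using unrelated[OF x p(1) ab(1), of "- int b"] ha ab by simp
      qed
    qed
  qed
  then obtain j where j: "w.clear (rotate j c)" "w.clear (rotate (Suc j) c)" by blast
  define j' where "j' = j mod length c"
  have j': "j' < length c" "w.clear (rotate j' c)" "w.clear (rotate (Suc j') c)"
    using j ne rotate_conv_mod[of j c] by (simp_all add: j'_def)
  have wq: "winv q \<in> words_over B" using q by simp
  define Q L where "Q = walls_along \<one> q" and "L = walls_along \<one> (winv q)"
  have "n \<le> card (cocycle (h [^] n)) + (card Q + card L)" for n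
  proof -
    let ?c = "power_word n c" and ?x = "val q \<otimes> val c [^] n"
    have cn: "?c \<in> words_over B" by (rule w.power_word_over[OF c(1)])
    have xG: "?x \<in> carrier G" using qG cG by simp
    have word: "val (q @ ?c @ winv q) = h [^] n"
      using q cn wq qG cG by (simp add: val_app val_inv val_pow[OF c(1)] hn m_assoc)
    define W where "W = walls_along \<one> ?c"
    have W: "walls_along (val q) ?c = shift (val q) ` W"
      using walls_along_shift[OF qG cn one_closed] qG by (simp add: W_def)
    have L': "walls_along ?x (winv q) = shift ?x ` L"
      using walls_along_shift[OF xG wq one_closed] xG by (simp add: L_def)
    have "cocycle (h [^] n) = walls_along \<one> (q @ ?c @ winv q)"
      using cocycle_val[of "q @ ?c @ winv q"] word q cn by simp
    also have "\<dots> = Q \<triangle> (shift (val q) ` W \<triangle> shift ?x ` L)"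
      using walls_along_append[OF q _ one_closed, of "?c @ winv q"] walls_along_append[OF cn wq qG] cn wq qG W L'
      by (simp add: Q_def val_pow[OF c(1)])
    finally have "shift (val q) ` W = cocycle (h [^] n) \<triangle> (Q \<triangle> shift ?x ` L)" by (simp add: symdiff_ac)
    then have "card (shift (val q) ` W) \<le> card (cocycle (h [^] n)) + (card Q + card (shift ?x ` L))"
      using card_symdiff_le[of "cocycle (h [^] n)" "Q \<triangle> shift ?x ` L"] card_symdiff_le[of Q "shift ?x ` L"] finite_cocycle
      by (simp add: Q_def L_def)
    moreover have "card (shift (val q) ` W) = card W" "card (shift ?x ` L) = card L"
      using bij_shift[OF qG, THEN bij_is_inj] bij_shift[OF xG, THEN bij_is_inj] by (simp_all add: card_image inj_on_subset)
    ultimately show ?thesis using clear_axis_count[OF c j', of n] by (simp add: W_def)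
  qed
  then show ?thesis by blast
qed

end

section \<open>The vertical walls\<close>

lemma (in group) conj_int_pow:
  assumes "x \<in> carrier G" "p \<in> carrier G"
  shows "(x \<otimes> p \<otimes> inv x) [^] (n::int) = x \<otimes> p [^] n \<otimes> inv x"
proof -
  have nat: "(x \<otimes> p \<otimes> inv x) [^] k = x \<otimes> p [^] k \<otimes> inv x" for k :: nat
    using assms by (induction k) (simp_all add: m_assoc inv_cancel)
  show ?thesis using assms nat by (cases n rule: int_cases2) (simp_all add: int_pow_int int_pow_neg inv_mult_group m_assoc)
qed

context measured_torus_data
begin

text \<open>
  Conjugation by a power of \<open>p\<^sub>e\<close> fixes \<open>p\<^sub>e\<close>.
\<close>

lemma edge_conjugate_unique:
  assumes w: "w \<in> white S" and e: "e \<in> edges_at_white S w" and f: "f \<in> edges_at_white S w"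
    and x: "x \<in> VF S w" "x' \<in> VF S w" and a: "(a::int) \<noteq> 0"
    and eq: "x \<otimes> pe S e [^] a \<otimes> inv x = x' \<otimes> pe S f [^] (b::int) \<otimes> inv x'"
  shows "e = f" "a = b" "x \<otimes> pe S e [^] (n::int) \<otimes> inv x = x' \<otimes> pe S f [^] n \<otimes> inv x'"
proof -
  have wv: "w \<in> verts (\<Delta> S)" using w verts_eq by simp
  have e': "e \<in> arcs'" "head (\<Delta> S) e = w" using e by (auto simp: edges_at_white_def)
  have p: "pe S e \<in> carrier G" using edge_facts(8)[OF e'(1)] VF_closed[OF wv] e'(2) by simp
  have xc: "x \<in> carrier G" "x' \<in> carrier G" using VF_closed[OF wv] x by auto
  show ef: "e = f" by (rule commensurable_edge_conjugates(1)[OF w e f x a eq])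
  obtain m :: int where m: "inv x \<otimes> x' = pe S e [^] m"
    using commensurable_edge_conjugates(2)[OF w e f x a eq] generate_pow[OF p] by auto
  have x': "x' = x \<otimes> pe S e [^] m" unfolding m[symmetric] using xc by (simp add: inv_cancel)
  show conj: "x \<otimes> pe S e [^] n \<otimes> inv x = x' \<otimes> pe S f [^] n \<otimes> inv x'" for n :: int
  proof -
    have "x' \<otimes> pe S f [^] n \<otimes> inv x' = x \<otimes> (pe S e [^] m \<otimes> (pe S e [^] n \<otimes> inv (pe S e [^] m))) \<otimes> inv x"
      unfolding ef[symmetric] x' using xc p by (simp add: inv_mult_group m_assoc)
    also have "pe S e [^] m \<otimes> (pe S e [^] n \<otimes> inv (pe S e [^] m)) = (pe S e [^] m \<otimes> pe S e [^] n) \<otimes> inv (pe S e [^] m)"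
      using p by (simp add: m_assoc)
    also have "pe S e [^] m \<otimes> pe S e [^] n = pe S e [^] n \<otimes> pe S e [^] m"
      using p by (simp add: int_pow_mult[symmetric] add.commute)
    finally show ?thesis using p by (simp add: m_assoc)
  qed
  have "x \<otimes> pe S e [^] a \<otimes> inv x = x \<otimes> pe S e [^] b \<otimes> inv x" using eq conj[of b] by simp
  then have "pe S e [^] a = pe S e [^] b" using xc p by simp
  then have "pe S e [^] (a - b) = \<one>" using p by (simp add: int_pow_diff)
  then show "a = b" using pe_power_nontrivial[OF e'(1), of "a - b"] by auto
qed

definition white_basis :: "'v \<Rightarrow> 'g set" where
  "white_basis w = (SOME B. finite B \<and> free_basis (sub G (VF S w)) B)"

abbreviation white_val where "white_val w \<equiv> word_val (sub G (VF S w))"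

definition axis_words :: "'e \<Rightarrow> ('g \<times> bool) list \<times> ('g \<times> bool) list" where
  "axis_words e = (let w = head (\<Delta> S) e in SOME (q, c). q \<in> words_over (white_basis w) \<and> c \<in> words_over (white_basis w) \<and>
    cyc_reduced c \<and> pe S e = white_val w q \<otimes> white_val w c \<otimes> inv (white_val w q))"

definition periods :: "'v \<Rightarrow> ('g \<times> bool) list set" where
  "periods w = {rotate i (snd (axis_words e)) | i e. e \<in> edges_at_white S w}"

lemma white_basis: assumes w: "w \<in> white S"
  shows "finite (white_basis w)" "free_basis (sub G (VF S w)) (white_basis w)"
proof -
  have "w \<in> verts (\<Delta> S)" using w verts_eq by simp
  then have "\<exists>B. finite B \<and> free_basis (sub G (VF S w)) B"
    using vertex_facts(2) by (auto simp: finite_rank_free_def free_of_rank_def)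
  from someI_ex[OF this] show "finite (white_basis w)" "free_basis (sub G (VF S w)) (white_basis w)"
    by (simp_all add: white_basis_def)
qed

lemma axis_words: assumes w: "w \<in> white S" and e: "e \<in> edges_at_white S w"
  obtains q c where "axis_words e = (q, c)" "q \<in> words_over (white_basis w)" "c \<in> words_over (white_basis w)" "cyc_reduced c"
    "pe S e = white_val w q \<otimes> white_val w c \<otimes> inv (white_val w q)"
proof -
  have wv: "w \<in> verts (\<Delta> S)" using w verts_eq by simp
  have e': "e \<in> arcs'" "head (\<Delta> S) e = w" using e by (auto simp: edges_at_white_def)
  interpret f: based_free_group "sub G (VF S w)" "white_basis w" by unfold_locales (rule white_basis(2)[OF w])
  have p: "pe S e \<in> VF S w" "pe S e \<noteq> \<one>"
    using edge_facts(8)[OF e'(1)] e'(2) pe_power_nontrivial[OF e'(1), of 1] VF_closed[OF wv] by (auto simp: int_pow_1)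
  obtain q c where qc: "q \<in> words_over (white_basis w)" "c \<in> words_over (white_basis w)" "cyc_reduced c"
    "pe S e = f.val q \<otimes>\<^bsub>sub G (VF S w)\<^esub> f.val c \<otimes>\<^bsub>sub G (VF S w)\<^esub> inv\<^bsub>sub G (VF S w)\<^esub> (f.val q)"
    using f.ex_cyc_reduction[of "pe S e"] p by auto
  then have "\<exists>qc. case qc of (q, c) \<Rightarrow> q \<in> words_over (white_basis w) \<and> c \<in> words_over (white_basis w) \<and>
    cyc_reduced c \<and> pe S e = white_val w q \<otimes> white_val w c \<otimes> inv (white_val w q)"
    using m_inv_consistent[OF VF_subgroup[OF wv], of "f.val q"] f.val_closed[OF qc(1)] by auto
  from someI_ex[OF this] show ?thesis using that e'(2) unfolding axis_words_def Let_def by (auto split: prod.splits)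
qed

lemma period_conjugate:
  assumes w: "w \<in> white S" and v: "v \<in> periods w"
  shows "v \<in> words_over (white_basis w)" "cyc_reduced v"
    "\<exists>e\<in>edges_at_white S w. \<exists>y\<in>VF S w. white_val w v = y \<otimes> pe S e \<otimes> inv y"
proof -
  have wv: "w \<in> verts (\<Delta> S)" using w verts_eq by simp
  interpret f: based_free_group "sub G (VF S w)" "white_basis w" by unfold_locales (rule white_basis(2)[OF w])
  note sub = VF_subgroup[OF wv]
  obtain i e where e: "e \<in> edges_at_white S w" and v: "v = rotate i (snd (axis_words e))"
    using v by (auto simp: periods_def)
  obtain q c where qc: "axis_words e = (q, c)" "q \<in> words_over (white_basis w)" "c \<in> words_over (white_basis w)" "cyc_reduced c"
    "pe S e = white_val w q \<otimes> white_val w c \<otimes> inv (white_val w q)"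
    by (rule axis_words[OF w e])
  show "v \<in> words_over (white_basis w)" "cyc_reduced v"
    using qc cyc_reduced_rotate v by (auto simp: words_over_def)
  define k where "k = i mod length c"
  have o: "take k c \<in> words_over (white_basis w)" "drop k c \<in> words_over (white_basis w)"
    using qc(3) set_take_subset[of k c] set_drop_subset[of k c] by (auto simp: words_over_def)
  let ?z = "f.val (take k c)" and ?y = "f.val (drop k c)" and ?q = "f.val q"
  have F: "?z \<in> VF S w" "?y \<in> VF S w" "?q \<in> VF S w" using f.val_closed o qc by auto
  then have C: "?z \<in> carrier G" "?y \<in> carrier G" "?q \<in> carrier G" using VF_closed[OF wv] by auto
  have cv: "f.val c = ?z \<otimes> ?y" "f.val v = ?y \<otimes> ?z"
    using f.val_append[OF o] f.val_append[OF o(2,1)] v qc(1) by (simp_all add: rotate_drop_take k_def)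
  have "f.val v = (inv ?z \<otimes> inv ?q) \<otimes> pe S e \<otimes> inv (inv ?z \<otimes> inv ?q)"
    unfolding qc(5) cv using C by (simp add: inv_mult_group m_assoc inv_cancel)
  moreover have "inv ?z \<otimes> inv ?q \<in> VF S w"
    using subgroup.m_closed[OF sub] subgroup.m_inv_closed[OF sub] F by blast
  ultimately show "\<exists>e\<in>edges_at_white S w. \<exists>y\<in>VF S w. white_val w v = y \<otimes> pe S e \<otimes> inv y" using e by blast
qed

lemma finite_periods: "finite (periods w)"
proof -
  have "periods w \<subseteq> (\<Union>e\<in>edges_at_white S w. (\<lambda>i. rotate i (snd (axis_words e))) ` {..length (snd (axis_words e))})"
  proof
    fix v assume "v \<in> periods w"
    then obtain i e where e: "e \<in> edges_at_white S w" "v = rotate i (snd (axis_words e))" by (auto simp: periods_def)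
    let ?c = "snd (axis_words e)"
    have "v = rotate (i mod length ?c) ?c" using e rotate_conv_mod by metis
    moreover have "i mod length ?c \<le> length ?c \<or> ?c = []" by (cases "?c = []") (auto intro: less_imp_le)
    ultimately show "v \<in> (\<Union>e\<in>edges_at_white S w. (\<lambda>i. rotate i (snd (axis_words e))) ` {..length (snd (axis_words e))})"
      using e by (intro UN_I[OF e(1)]) auto
  qed
  moreover have "finite (edges_at_white S w)" using finite_arcs by (simp add: edges_at_white_def)
  ultimately show ?thesis by (auto intro: finite_subset)
qed

text \<open>
  The values of the words are conjugates of \<open>p\<^sub>e\<close>, and of \<open>p\<^sub>e\<inverse>\<close> for the inverse words, to which
  \<open>edge_conjugate_unique\<close> applies.
\<close>

lemma independent_periods: assumes w: "w \<in> white S"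
  shows "independent_words (sub G (VF S w)) (white_basis w) (periods w)"
proof -
  have wv: "w \<in> verts (\<Delta> S)" using w verts_eq by simp
  interpret f: based_free_group "sub G (VF S w)" "white_basis w" by unfold_locales (rule white_basis(2)[OF w])
  note sub = VF_subgroup[OF wv]
  have pF: "pe S e \<in> VF S w" "pe S e \<in> carrier G" if "e \<in> edges_at_white S w" for e
    using that edge_facts(8)[of e] VF_closed[OF wv] by (auto simp: edges_at_white_def)
  let ?rep = "\<lambda>v s. \<exists>e\<in>edges_at_white S w. \<exists>y\<in>VF S w. white_val w v = y \<otimes> pe S e [^] (s::int) \<otimes> inv y"
  have rep: "?rep v 1" if v: "v \<in> periods w" for v
    using period_conjugate(3)[OF w v] pF by (metis int_pow_1)
  have rep': "?rep v (- 1)" if v: "v \<in> winv ` periods w" for v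
  proof -
    obtain p where p: "p \<in> periods w" "v = winv p" using v by blast
    obtain e y where e: "e \<in> edges_at_white S w" and y: "y \<in> VF S w" and eq: "white_val w p = y \<otimes> pe S e \<otimes> inv y"
      using period_conjugate(3)[OF w p(1)] by blast
    note po = period_conjugate(1)[OF w p(1)]
    have yc: "y \<in> carrier G" using VF_closed[OF wv y] .
    have "white_val w v = inv (white_val w p)"
      using f.val_winv[OF po] f.val_closed[OF po] m_inv_consistent[OF sub] p(2) by simp
    also have "\<dots> = y \<otimes> pe S e [^] (- 1 :: int) \<otimes> inv y"
      unfolding eq using yc pF[OF e] by (simp add: inv_mult_group m_assoc int_pow_neg int_pow_1)
    finally show ?thesis using e y by blast
  qed
  have word: "v \<in> words_over (white_basis w) \<and> cyc_reduced v" if "v \<in> periods w \<union> winv ` periods w" for v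
    using that period_conjugate(1,2)[OF w] cyc_reduced_winv by auto
  have core: "s = s' \<and> v = v'"
    if v: "v \<in> periods w \<union> winv ` periods w" "?rep v s" "\<bar>s\<bar> = 1" and v': "v' \<in> periods w \<union> winv ` periods w" "?rep v' s'" "\<bar>s'\<bar> = 1"
      and ab: "0 < a" "0 < b" and eq: "white_val w v [^]\<^bsub>sub G (VF S w)\<^esub> (a::nat) = white_val w v' [^]\<^bsub>sub G (VF S w)\<^esub> (b::nat)"
    for v v' s s' a b
  proof -
    obtain e y where e: "e \<in> edges_at_white S w" and y: "y \<in> VF S w" and vy: "white_val w v = y \<otimes> pe S e [^] s \<otimes> inv y"
      using v(2) by blast
    obtain e' y' where e': "e' \<in> edges_at_white S w" and y': "y' \<in> VF S w" and vy': "white_val w v' = y' \<otimes> pe S e' [^] s' \<otimes> inv y'"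
      using v'(2) by blast
    have yc: "y \<in> carrier G" "y' \<in> carrier G" using VF_closed[OF wv] y y' by auto
    have "white_val w v [^] int a = white_val w v' [^] int b"
      using eq by (simp add: int_pow_int nat_pow_consistent[symmetric])
    then have "y \<otimes> pe S e [^] (s * int a) \<otimes> inv y = y' \<otimes> pe S e' [^] (s' * int b) \<otimes> inv y'"
      unfolding vy vy' using yc pF e e' by (simp add: conj_int_pow int_pow_pow)
    note u = edge_conjugate_unique[OF w e e' y y' _ this]
    have sa: "s * int a = s' * int b" using u(2) ab v(3) by auto
    have "s = s'"
      using sa ab v(3) v'(3) by (auto simp: abs_if split: if_splits)
    moreover have "white_val w v = white_val w v'" using u(3)[of s] ab v(3) vy vy' calculation by auto
    then have "v = v'"
      using f.reduced_val_inj[of v v'] word[OF v(1)] word[OF v'(1)] by (auto simp: reduced_words_def cyc_reduced_def reduced_append)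
    ultimately show ?thesis by blast
  qed
  show ?thesis
  proof
    show "finite (periods w)" by (rule finite_periods)
    show "p \<in> words_over (white_basis w)" "cyc_reduced p" if "p \<in> periods w" for p using word that by auto
    show "rotate1 p \<in> periods w" if p: "p \<in> periods w" for p
    proof -
      obtain i e where "e \<in> edges_at_white S w" "p = rotate i (snd (axis_words e))" using p by (auto simp: periods_def)
      then show ?thesis unfolding periods_def by (intro CollectI exI[of _ "Suc i"] exI[of _ e]) simp
    qed
    show "winv p \<notin> periods w" if p: "p \<in> periods w" for p
    proof
      assume wp: "winv p \<in> periods w"
      have "(1::int) = - 1 \<and> winv p = winv p"
        by (rule core[of _ 1 _ "- 1" 1 1]) (use p wp rep[OF wp] rep'[of "winv p"] in auto)
      then show False by simp
    qed
    show "p = p'" if p: "p \<in> periods w \<union> winv ` periods w" "p' \<in> periods w \<union> winv ` periods w" "0 < a" "0 < b"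
      "white_val w p [^]\<^bsub>sub G (VF S w)\<^esub> (a::nat) = white_val w p' [^]\<^bsub>sub G (VF S w)\<^esub> (b::nat)" for p p' a b
    proof -
      obtain s s' :: int where "?rep p s" "\<bar>s\<bar> = 1" "?rep p' s'" "\<bar>s'\<bar> = 1"
        using rep rep' p(1,2) by (metis UnE abs_1 abs_minus_cancel)
      then show ?thesis using core[OF p(1) _ _ p(2) _ _ p(3,4,5)] by blast
    qed
  qed
qed

lemma white_axis_walls: assumes w: "w \<in> white S"
  shows "axis_walls G (VF S w) (tv S w) (white_basis w) (periods w)"
proof -
  have wv: "w \<in> verts (\<Delta> S)" using w verts_eq by simp
  show ?thesis
  proof (intro axis_walls.intro axis_walls_axioms.intro is_group)
    show "j = 0" if "tv S w [^] (j::int) \<in> VF S w" for j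
      using height_VF[OF wv that] height_tv_pow[OF wv] by simp
  qed (use VF_subgroup[OF wv] vertex_facts(3)[OF wv] tv_commute[OF wv] independent_periods[OF w] in auto)
qed

abbreviation white_cocycle where
  "white_cocycle w \<equiv> axis_walls.cocycle G (VF S w) (tv S w) (white_basis w) (periods w)"

abbreviation white_coboundary where
  "white_coboundary w \<equiv> axis_walls.coboundary G (VF S w) (tv S w) (periods w)"

definition vertical_shift :: "'g \<Rightarrow> 'v \<times> 'g \<times> 'g set \<Rightarrow> 'v \<times> 'g \<times> 'g set" where
  "vertical_shift g = map_prod id (map_prod id (image (left_mult G g)))"

definition edge_correction :: "'e \<Rightarrow> ('v \<times> 'g \<times> 'g set) set" where
  "edge_correction e = (let w = head (\<Delta> S) e in Pair w ` white_coboundary w (fst (axis_words e)) (snd (axis_words e)))"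

definition vertex_walls :: "'v \<Rightarrow> 'g \<Rightarrow> ('v \<times> 'g \<times> 'g set) set" where
  "vertex_walls v g = (if v \<in> white S then Pair v ` white_cocycle v (proj v g) else {})"

text \<open>
  Crossing an edge \<open>e\<close> is corrected by the set whose coboundary is the cocycle on the edge group.  The elements of the black
  vertex groups and, after the correction, those of the edge groups, fix the vertex \<open>{}\<close>.
\<close>

fun vertical_letter :: "('v, 'e, 'g) gog_letter \<Rightarrow> ('v \<times> 'g \<times> 'g set) set \<Rightarrow> ('v \<times> 'g \<times> 'g set) set" where
  "vertical_letter (Grp v g) = affine_map (vertical_shift g) (vertex_walls v g)"
| "vertical_letter (Dart e d) = (if d then affine_map (vertical_shift (stab S e)) (vertical_shift (stab S e) ` edge_correction e)
     else affine_map (vertical_shift (inv (stab S e))) (edge_correction e))"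

lemma vertical_shift_comp: "g \<in> carrier G \<Longrightarrow> h \<in> carrier G \<Longrightarrow> vertical_shift g \<circ> vertical_shift h = vertical_shift (g \<otimes> h)"
  by (auto simp: vertical_shift_def fun_eq_iff left_mult_image_comp)

lemma vertical_shift_one: "vertical_shift \<one> = id"
  by (simp add: vertical_shift_def left_mult_one prod.map_id fun_eq_iff)

lemma bij_vertical_shift: "g \<in> carrier G \<Longrightarrow> bij (vertical_shift g)"
  by (rule o_bij[of "vertical_shift (inv g)"]) (simp_all add: vertical_shift_comp vertical_shift_one)

lemma vertical_shift_Pair: "vertical_shift g ` Pair w ` A = Pair w ` axis_walls.shift G g ` A" if "w \<in> white S"
  using axis_walls.shift_def[OF white_axis_walls[OF that]] by (simp add: image_image vertical_shift_def)

lemma affine_vertical_comp: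
  assumes "g \<in> carrier G" "h \<in> carrier G"
  shows "affine_map (vertical_shift g) D \<circ> affine_map (vertical_shift h) D' =
    affine_map (vertical_shift (g \<otimes> h)) (vertical_shift g ` D' \<triangle> D)"
  using affine_map_comp[OF bij_is_inj[OF bij_vertical_shift[OF assms(1)]]] vertical_shift_comp[OF assms] by simp

lemma vertex_walls_mult:
  assumes v: "v \<in> verts (\<Delta> S)" and g: "g \<in> VG S v" "h \<in> VG S v"
  shows "vertex_walls v (g \<otimes> h) = vertex_walls v g \<triangle> vertical_shift g ` vertex_walls v h"
proof (cases "v \<in> white S")
  case True
  interpret a: axis_walls G "VF S v" "tv S v" "white_basis v" "periods v" by (rule white_axis_walls[OF True])
  note p = proj_in[OF v g(1)] proj_in[OF v g(2)]
  have "a.shift g ` a.cocycle (proj v h) = a.shift (proj v g) ` a.cocycle (proj v h)"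
    using a.shift_t_image[OF a.cocycle_near[OF p(3)] VF_closed[OF v p(1)], of "height g"] p(2) by simp
  then show ?thesis
    using True a.cocycle_mult[OF p(1,3)]
    by (simp add: vertex_walls_def proj_mult[OF v g] vertical_shift_Pair image_symdiff inj_on_def)
qed (simp add: vertex_walls_def)

lemma vertex_walls_one: "v \<in> verts (\<Delta> S) \<Longrightarrow> vertex_walls v \<one> = {}"
  using axis_walls.cocycle_one[OF white_axis_walls, of v] proj_VF[of v \<one>] subgroup.one_closed[OF VF_subgroup, of v]
  by (simp add: vertex_walls_def)

lemma finite_vertex_walls: "finite (vertex_walls v g)"
  using axis_walls.finite_cocycle[OF white_axis_walls] by (simp add: vertex_walls_def)

lemma finite_edge_correction: "e \<in> arcs' \<Longrightarrow> finite (edge_correction e)"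
  using axis_walls.coboundary_finite[OF white_axis_walls[OF head_white]] by (simp add: edge_correction_def Let_def)

text \<open>
  The elements with this property form a subgroup.  It contains \<open>p\<^sub>e\<close> by \<open>cocycle_axis\<close>, and \<open>t\<^sub>w\<close> as it fixes all
  walls that come from the Cayley tree of \<open>F\<^sub>w\<close>.
\<close>

lemma edge_correction:
  assumes e: "e \<in> arcs'" and c: "c \<in> EG S e"
  shows "vertex_walls (head (\<Delta> S) e) (embW S e c) = edge_correction e \<triangle> vertical_shift (embW S e c) ` edge_correction e"
proof -
  let ?w = "head (\<Delta> S) e" and ?M = "edge_correction e"
  have w: "?w \<in> white S" and wv: "?w \<in> verts (\<Delta> S)" using head_white[OF e] edge_verts[OF e] by auto
  interpret a: axis_walls G "VF S ?w" "tv S ?w" "white_basis ?w" "periods ?w" by (rule white_axis_walls[OF w])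
  have ew: "e \<in> edges_at_white S ?w" using e by (simp add: edges_at_white_def)
  obtain q c0 where qc: "axis_words e = (q, c0)" "q \<in> words_over (white_basis ?w)" "c0 \<in> words_over (white_basis ?w)"
    "pe S e = a.val q \<otimes> a.val c0 \<otimes> inv (a.val q)" using axis_words[OF w ew] by metis
  have c0: "c0 \<in> periods ?w" unfolding periods_def using ew qc(1) by (intro CollectI exI[of _ 0] exI[of _ e]) simp
  have M: "?M = Pair ?w ` a.coboundary q c0" using qc(1) by (simp add: edge_correction_def Let_def)
  define K where "K = {g \<in> VG S ?w. vertex_walls ?w g = ?M \<triangle> vertical_shift g ` ?M}"
  note sub = VG_subgroup[OF wv]
  have G: "g \<in> carrier G" if "g \<in> VG S ?w" for g using VG_closed[OF wv that] .
  have inj: "inj (vertical_shift g)" if "g \<in> carrier G" for g using bij_vertical_shift[OF that] by (rule bij_is_inj)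
  have two: "vertical_shift g ` vertical_shift h ` A = vertical_shift (g \<otimes> h) ` A" if "g \<in> carrier G" "h \<in> carrier G" for g h A
    by (metis image_comp vertical_shift_comp[OF that])
  have mult: "g \<otimes> h \<in> K" if "g \<in> K" "h \<in> K" for g h
    using that subgroup.m_closed[OF sub] vertex_walls_mult[OF wv, of g h] G
    by (simp add: K_def image_symdiff inj two symdiff_ac)
  have invK: "inv g \<in> K" if g: "g \<in> K" for g
  proof -
    have gV: "g \<in> VG S ?w" "inv g \<in> VG S ?w" using g subgroup.m_inv_closed[OF sub] by (auto simp: K_def)
    have "vertical_shift (inv g) ` vertex_walls ?w g \<triangle> vertex_walls ?w (inv g) = {}"
      using vertex_walls_mult[OF wv gV(2,1)] G[OF gV(1)] vertex_walls_one[OF wv] by (simp add: symdiff_ac)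
    then have "vertex_walls ?w (inv g) = vertical_shift (inv g) ` vertex_walls ?w g" by (metis symdiff_cancel symdiff_empty(1))
    also have "\<dots> = vertical_shift (inv g) ` ?M \<triangle> ?M"
      using g G[OF gV(1)] by (simp add: K_def image_symdiff inj two vertical_shift_one)
    finally show ?thesis using gV by (simp add: K_def symdiff_ac)
  qed
  have K: "subgroup K G"
  proof
    have "\<one> \<in> VG S ?w" using subgroup.one_closed[OF sub] .
    then show "\<one> \<in> K" using vertex_walls_one[OF wv] by (simp add: K_def vertical_shift_one)
  qed (use mult invK G in \<open>auto simp: K_def\<close>)
  have pe: "pe S e \<in> VF S ?w" by (rule edge_facts(8)[OF e])
  have peK: "pe S e \<in> K"
    using a.cocycle_axis[OF qc(2) c0] VF_VG[OF wv pe] w proj_VF[OF wv pe] qc(4)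
    by (simp add: K_def vertex_walls_def M vertical_shift_Pair image_symdiff inj_on_def)
  have tK: "tv S ?w \<in> K"
  proof -
    have "a.shift (\<one> \<otimes> tv S ?w [^] (1::int)) ` a.coboundary q c0 = a.shift \<one> ` a.coboundary q c0"
      by (rule a.shift_t_image[OF a.coboundary_near[OF qc(2) c0] one_closed])
    then have "a.shift (tv S ?w) ` a.coboundary q c0 = a.coboundary q c0"
      using vertex_facts(3)[OF wv] a.shift_one by (simp add: int_pow_1)
    then show ?thesis
      using w tv_in[OF wv] proj_tv[OF wv] a.cocycle_one by (simp add: K_def vertex_walls_def M vertical_shift_Pair)
  qed
  interpret h: group_hom "sub G (EG S e)" G "embW S e" by (rule embW_hom[OF e])
  have subE: "subgroup (EG S e) G" by (rule edge_facts(9)[OF e])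
  have "embW S e c \<in> K"
    using c unfolding edge_facts(10)[OF e]
  proof (induction rule: generate.induct)
    case one
    then show ?case using h.hom_one subgroup.one_closed[OF K] by simp
  next
    have teK: "embW S e (te S e) \<in> K"
      using edge_facts(7)[OF e] subgroup.m_closed[OF K subgroup_int_pow[OF K peK] tK] by simp
    case (incl x)
    then show ?case using edge_facts(6)[OF e] peK teK by auto
    case (inv x)
    then have x: "x \<in> EG S e" "embW S e x \<in> K" using edge_facts(1,2,6)[OF e] peK teK by auto
    have "embW S e (inv x) = inv (embW S e x)" using h.hom_inv[of x] x(1) m_inv_consistent[OF subE x(1)] by simp
    then show ?case using x subgroup.m_inv_closed[OF K] by simp
  next
    case (eng x y)
    then have "x \<in> EG S e" "y \<in> EG S e" using edge_facts(10)[OF e] by auto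
    then show ?case using eng emb_mult(2)[OF e] mult by simp
  qed
  then show ?thesis by (simp add: K_def)
qed

lemma vertical_affine: "x \<in> gog_letters (gog_G G S) \<Longrightarrow> is_affine (vertical_letter x)"
  using VG_closed edge_s_closed finite_vertex_walls finite_edge_correction
  by (auto simp: gog_letters_def intro!: is_affineI bij_vertical_shift)

lemma vertical_compatible: "sg.compatible vertical_letter"
  unfolding sg.compatible_iff gog_simps
proof (intro conjI ballI allI)
  fix v assume v: "v \<in> verts (\<Delta> S)"
  show "vertical_letter (Grp v \<one>) = id"
    using vertex_walls_one[OF v] by (simp add: vertical_shift_one affine_map_def fun_eq_iff)
  fix g h assume "g \<in> VG S v" "h \<in> VG S v"
  then show "vertical_letter (Grp v g) \<circ> vertical_letter (Grp v h) = vertical_letter (Grp v (g \<otimes> h))"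
    using VG_closed[OF v] vertex_walls_mult[OF v] by (simp add: affine_vertical_comp symdiff_commute)
next
  fix e d assume e: "e \<in> arcs'"
  let ?s = "stab S e" and ?M = "edge_correction e"
  have s: "?s \<in> carrier G" "inv ?s \<in> carrier G" using edge_s_closed[OF e] by auto
  have two: "vertical_shift g ` vertical_shift h ` A = vertical_shift (g \<otimes> h) ` A" if "g \<in> carrier G" "h \<in> carrier G" for g h A
    by (metis image_comp vertical_shift_comp[OF that])
  have inj_vertical: "inj (vertical_shift g)" if "g \<in> carrier G" for g using bij_vertical_shift[OF that] by (rule bij_is_inj)
  have id: "affine_map (vertical_shift \<one>) {} = id" by (simp add: vertical_shift_one affine_map_def fun_eq_iff)
  show "vertical_letter (Dart e d) \<circ> vertical_letter (Dart e (\<not> d)) = id"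
    using s by (simp add: affine_vertical_comp two vertical_shift_one id)
  fix c assume c: "c \<in> EG S e"
  have g: "embW S e c \<in> carrier G" using VG_closed[OF edge_verts(2)[OF e] emb_in(2)[OF e c]] .
  have nw: "tail (\<Delta> S) e \<notin> white S" using tail_black[OF e] black_white by auto
  have "vertical_shift ?s ` (vertical_shift (embW S e c) ` ?M \<triangle> vertex_walls (head (\<Delta> S) e) (embW S e c)) \<triangle> vertical_shift ?s ` ?M = {}"
    unfolding edge_correction[OF e c] by (simp add: symdiff_ac)
  then have "affine_map (vertical_shift ?s) (vertical_shift ?s ` ?M) \<circ> (affine_map (vertical_shift (embW S e c)) (vertex_walls (head (\<Delta> S) e) (embW S e c)) \<circ>
      affine_map (vertical_shift (inv ?s)) ?M) = affine_map (vertical_shift (?s \<otimes> (embW S e c \<otimes> inv ?s))) {}"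
    using s g by (simp only: affine_vertical_comp m_closed)
  moreover have "?s \<otimes> (embW S e c \<otimes> inv ?s) = embB S e c" using edge_conj[OF e c] s g by (simp add: m_assoc)
  ultimately show "vertical_letter (Dart e True) \<circ> vertical_letter (Grp (head (\<Delta> S) e) (embW S e c)) \<circ> vertical_letter (Dart e False) =
      vertical_letter (Grp (tail (\<Delta> S) e) (embB S e c))"
    using nw by (simp add: comp_assoc vertex_walls_def)
qed

lemma vertical_escape:
  assumes v0: "v0 \<in> verts (\<Delta> S)" and w: "w \<in> white S" and h: "h \<in> VF S w" "h \<noteq> \<one>" and y: "y \<in> carrier G"
    and nc: "\<not> commensurable_to_edge w h"
  shows "escapes G (sg.extension vertical_letter v0) (y \<otimes> h \<otimes> inv y)"
proof (rule sg.escapes_of_vertex_element[OF vertical_compatible vertical_affine])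
  have wv: "w \<in> verts (\<Delta> S)" using w verts_eq by simp
  interpret a: axis_walls G "VF S w" "tv S w" "white_basis w" "periods w" by (rule white_axis_walls[OF w])
  have "\<exists>C. \<forall>n. n \<le> card (a.cocycle (h [^] (n::nat))) + C"
  proof (rule a.cocycle_unbounded[OF h])
    fix x v and m :: nat and n :: int
    assume x: "x \<in> VF S w" and v: "v \<in> periods w" and mn: "0 < m" "n \<noteq> 0"
    obtain e z where e: "e \<in> edges_at_white S w" and z: "z \<in> VF S w" and vz: "a.val v = z \<otimes> pe S e \<otimes> inv z"
      using period_conjugate(3)[OF w v] by blast
    have c: "x \<in> carrier G" "z \<in> carrier G" using x z VF_closed[OF wv] by auto
    have p: "pe S e \<in> carrier G" using e edge_facts(8)[of e] VF_closed[OF wv] by (auto simp: edges_at_white_def)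
    have "x \<otimes> a.val v [^] n \<otimes> inv x = (x \<otimes> z) \<otimes> pe S e [^] n \<otimes> inv (x \<otimes> z)"
      unfolding vz conj_int_pow[OF c(2) p] using c p by (simp add: m_assoc inv_mult_group)
    moreover have "x \<otimes> z \<in> VF S w" using subgroup.m_closed[OF VF_subgroup[OF wv]] x z by blast
    ultimately show "h [^] m \<noteq> x \<otimes> a.val v [^] n \<otimes> inv x"
      using nc e mn unfolding commensurable_to_edge_def by metis
  qed
  then obtain C where C: "\<And>n::nat. n \<le> card (a.cocycle (h [^] n)) + C" by blast
  show "\<exists>n. k < card (vertical_letter (Grp w (h [^] (n::nat))) {})" for k
  proof
    have hn: "h [^] n \<in> VF S w" for n :: nat by (rule subgroup_nat_pow[OF VF_subgroup[OF wv] h(1)])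
    have "k < card (a.cocycle (h [^] (Suc k + C)))" using C[of "Suc k + C"] by linarith
    then show "k < card (vertical_letter (Grp w (h [^] (Suc k + C))) {})"
      using w proj_VF[OF wv hn[of "Suc k + C"]] by (simp add: vertex_walls_def card_image inj_on_def del: nat_pow_Suc)
  qed
qed (use v0 w verts_eq VF_VG h y in auto)

end

section \<open>Every element escapes in one of the families\<close>

context measured_torus_data
begin

theorem ex_escaping_action:
  "\<exists>\<Theta> :: 'g \<Rightarrow> ((('e \<times> 'g set) + (bool \<times> int)) + ((bool \<times> int) + ('v \<times> 'g \<times> 'g set))) set \<Rightarrow> _.
    wall_action G \<Theta> \<and> (\<forall>g\<in>carrier G - {\<one>}. escapes G \<Theta> g)"
proof -
  have "verts (\<Delta> S) \<noteq> {}"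
    using graph by (auto simp: torus_graph_def connected_def strongly_connected_def)
  then obtain v0 where v0: "v0 \<in> verts (\<Delta> S)" by blast
  note v0' = v0[folded gog_simps]
  let ?T = "sg.extension sg.tree_letter v0" and ?E = height_action
  let ?H = "sg.extension horizontal_letter v0" and ?V = "sg.extension vertical_letter v0"
  have T: "wall_action G ?T" using sg.wall_action_extension[OF sg.tree_compatible _ sg.tree_letter_affine] v0 by simp
  have Ho: "wall_action G ?H" using sg.wall_action_extension[OF horizontal_compatible _ horizontal_affine] v0 by simp
  have V: "wall_action G ?V" using sg.wall_action_extension[OF vertical_compatible _ vertical_affine] v0 by simp
  note E = wall_action_height
  let ?\<Theta> = "sum_action (sum_action ?T ?E) (sum_action ?H ?V)"
  have TE: "wall_action G (sum_action ?T ?E)" and HV: "wall_action G (sum_action ?H ?V)"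
    by (rule wall_action_sum[OF T E], rule wall_action_sum[OF Ho V])
  have "escapes G ?\<Theta> g" if g: "g \<in> carrier G" "g \<noteq> \<one>" for g
  proof (cases "height g = 0 \<and> \<not> escapes G ?T g")
    case False
    then have "escapes G (sum_action ?T ?E) g" using escapes_sum[OF T E is_group g(1)] height_escape[OF g(1)] by blast
    then show ?thesis using escapes_sum[OF TE HV is_group g(1)] by blast
  next
    case True
    then obtain v y h where v: "v \<in> verts (\<Delta> S)" and y: "y \<in> carrier G" and h: "h \<in> VG S v" and gh: "g = y \<otimes> h \<otimes> inv y"
      using sg.elliptic_or_escapes[of v0 g] v0 g(1) by auto
    have hc: "h \<in> carrier G" by (rule VG_closed[OF v h])
    have "height h = 0"
      using True gh y hc additive_inv[OF height_additive group_self y] by (simp add: height_mult)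
    then have hF: "h \<in> VF S v" using proj_in[OF v h] hc by (simp add: proj_def)
    have h1: "h \<noteq> \<one>" using gh g(2) y by auto
    have "escapes G ?H g \<or> escapes G ?V g"
    proof (cases "v \<in> black S")
      case True
      then show ?thesis using horizontal_escape_black[OF v0 True hF h1 y] gh by simp
    next
      case False
      then have w: "v \<in> white S" using v verts_eq by simp
      show ?thesis
        using horizontal_escape_commensurable[OF v0 w hF y] vertical_escape[OF v0 w hF h1 y] gh by blast
    qed
    then have "escapes G (sum_action ?H ?V) g" using escapes_sum[OF Ho V is_group g(1)] by blast
    then show ?thesis using escapes_sum[OF TE HV is_group g(1)] by blast
  qed
  then show ?thesis using wall_action_sum[OF TE HV] by blast
qed

end

section \<open>Measurements on the vertex groups\<close>

lemma homotopic_in_sym: "homotopic_in P R u v \<Longrightarrow> homotopic_in P R v u"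
  unfolding homotopic_in_def by (rule equivclp_sym)

lemma homotopy_class_eq: "homotopic_in P R u v \<Longrightarrow> homotopy_class P R u = homotopy_class P R v"
  unfolding homotopy_class_def using homotopic_in_trans[of P R] homotopic_in_sym[of P R] by (intro Collect_cong) blast

text \<open>
  The product of two classes is a union of classes, all of which are equal because homotopy is compatible with
  concatenation.
\<close>

lemma loop_group_mult_closed:
  assumes P: "\<And>u v. u \<in> P \<Longrightarrow> v \<in> P \<Longrightarrow> u @ v \<in> P"
    and AB: "A \<in> carrier (loop_group P R)" "B \<in> carrier (loop_group P R)"
  shows "A \<otimes>\<^bsub>loop_group P R\<^esub> B \<in> carrier (loop_group P R)"
proof -
  let ?c = "homotopy_class P R"
  obtain u v where u: "u \<in> P" "A = ?c u" and v: "v \<in> P" "B = ?c v" using AB by (auto simp: loop_group_def)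
  have left: "?c (u' @ v') = ?c (u @ v')" if "u' \<in> A" "v' \<in> P" for u' v'
  proof (rule homotopic_in_invariant[where f = "\<lambda>u. ?c (u @ v')"])
    show "homotopic_in P R u' u" using that u by (auto simp: homotopy_class_def intro: homotopic_in_sym)
    fix x l r y assume "(l, r) \<in> R" "x @ l @ y \<in> P" "x @ r @ y \<in> P"
    then have "homotopic_in P R (x @ l @ (y @ v')) (x @ r @ (y @ v'))"
      using P[of "x @ l @ y" v'] P[of "x @ r @ y" v'] that by (intro homotopic_in_move) auto
    then show "?c ((x @ l @ y) @ v') = ?c ((x @ r @ y) @ v')" using homotopy_class_eq by simp
  qed
  have right: "?c (u @ v') = ?c (u @ v)" if "v' \<in> B" for v'
  proof (rule homotopic_in_invariant[where f = "\<lambda>v. ?c (u @ v)"])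
    show "homotopic_in P R v' v" using that v by (auto simp: homotopy_class_def intro: homotopic_in_sym)
    fix x l r y assume "(l, r) \<in> R" "x @ l @ y \<in> P" "x @ r @ y \<in> P"
    then have "homotopic_in P R ((u @ x) @ l @ y) ((u @ x) @ r @ y)"
      using P[of u "x @ l @ y"] P[of u "x @ r @ y"] u by (intro homotopic_in_move) auto
    then show "?c (u @ (x @ l @ y)) = ?c (u @ (x @ r @ y))" using homotopy_class_eq by simp
  qed
  have sub: "B \<subseteq> P" "u \<in> A" "v \<in> B" using u v by (auto simp: homotopy_class_def homotopic_in_refl)
  have "(\<Union>u'\<in>A. \<Union>v'\<in>B. ?c (u' @ v')) = (\<Union>u'\<in>A. \<Union>v'\<in>B. ?c (u @ v))"
    using left right sub(1) by (intro SUP_cong refl) auto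
  also have "\<dots> = ?c (u @ v)" using sub by blast
  finally show ?thesis using P[OF u(1) v(1)] by (simp add: loop_group_def)
qed

lemma walk_rev_flip: "edge_path \<Gamma> x q y \<Longrightarrow> edge_path \<Gamma> y (rev (map flip q)) x"
proof (induction q arbitrary: x)
  case (Cons d q)
  have "edge_path \<Gamma> (ter \<Gamma> d) [flip d] x" using Cons.prems by (auto simp: darts_def flip_def org_def ter_def)
  then show ?case using Cons by (auto simp: walk_append)
qed simp

lemma represented_class_subset:
  assumes "circuit \<Gamma> c" shows "represented_class \<Gamma> x c \<subseteq> carrier (graph_pi1 \<Gamma> x)"
proof
  fix A assume "A \<in> represented_class \<Gamma> x c"
  then obtain q where q: "A = path_class \<Gamma> x (q @ c @ rev (map flip q))" "edge_path \<Gamma> x q (org \<Gamma> (hd c))"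
    by (auto simp: represented_class_def)
  have "q @ c @ rev (map flip q) \<in> closed_paths \<Gamma> x"
    using q(2) walk_rev_flip[OF q(2)] assms by (auto simp: closed_paths_def circuit_def walk_append)
  then show "A \<in> carrier (graph_pi1 \<Gamma> x)" using q(1) by (simp add: graph_pi1_def loop_group_def path_class_def)
qed

lemma transported_additive:
  assumes iso: "\<iota> \<in> iso (graph_pi1 \<Gamma> x) (sub G H)" and hom: "m \<in> hom (graph_pi1 \<Gamma> x) integer_group"
  obtains \<pi> where "additive G H \<pi>" "\<And>A. A \<in> carrier (graph_pi1 \<Gamma> x) \<Longrightarrow> \<pi> (\<iota> A) = m A"
proof -
  let ?P = "graph_pi1 \<Gamma> x"
  have bij: "bij_betw \<iota> (carrier ?P) H" and i: "\<iota> \<in> hom ?P (sub G H)" using iso by (auto simp: iso_def)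
  have closed: "A \<otimes>\<^bsub>?P\<^esub> B \<in> carrier ?P" if "A \<in> carrier ?P" "B \<in> carrier ?P" for A B
    using that loop_group_mult_closed[of "closed_paths \<Gamma> x" A "backtracks \<Gamma>" B]
    by (auto simp: graph_pi1_def closed_paths_def walk_append)
  define \<pi> where "\<pi> g = m (inv_into (carrier ?P) \<iota> g)" for g
  have \<pi>: "\<pi> (\<iota> A) = m A" if "A \<in> carrier ?P" for A using that bij by (simp add: \<pi>_def bij_betw_def)
  moreover have "additive G H \<pi>"
    unfolding additive_def
  proof (intro ballI)
    fix g h assume "g \<in> H" "h \<in> H"
    then have "g \<in> \<iota> ` carrier ?P" "h \<in> \<iota> ` carrier ?P" using bij by (simp_all add: bij_betw_def)
    then obtain A B where A: "A \<in> carrier ?P" "g = \<iota> A" and B: "B \<in> carrier ?P" "h = \<iota> B" by blast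
    have "g \<otimes>\<^bsub>G\<^esub> h = \<iota> (A \<otimes>\<^bsub>?P\<^esub> B)" using hom_mult[OF i A(1) B(1)] A B by simp
    then show "\<pi> (g \<otimes>\<^bsub>G\<^esub> h) = \<pi> g + \<pi> h" using \<pi> closed A B hom_mult[OF hom A(1) B(1)] by simp
  qed
  ultimately show ?thesis using that by blast
qed

text \<open>
  The homomorphism is the sum of the \<open>N f(k\<^sub>i) / K\<^sub>i\<close>-fold measurements for the blocks \<open>i\<close>, where \<open>k\<^sub>i\<close> is the common value
  of \<open>k\<close> on the block, and \<open>N\<close> is a multiple of all the \<open>K\<^sub>i\<close>.
\<close>

lemma (in torus_data) scaled_measurements:
  assumes Y: "graph_of_spaces_for G F t S Y" and M: "edge_measurements_for S Y M" and good: "good_edge_measurements S Y M"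
  obtains N where "N > 0" "\<And>w f. w \<in> white S \<Longrightarrow> \<exists>\<psi>. additive G (VF S w) \<psi> \<and>
      (\<forall>e\<in>edges_at_white S w. \<psi> (pe S e) = N * f (ke S e))"
proof -
  have fin_white: "finite (white S)"
    using graph verts_eq by (auto simp: torus_graph_def fin_digraph_def fin_digraph_axioms_def)
  have part: "disjoint_family_on (block M w) (J M w)" "\<And>i. i \<in> J M w \<Longrightarrow> block M w i \<noteq> {}"
    "(\<Union>i\<in>J M w. block M w i) = edges_at_white S w" if "w \<in> white S" for w
    using M that by (auto simp: edge_measurements_for_def edge_partition_def)
  have finJ: "finite (J M w)" if w: "w \<in> white S" for w
  proof (rule finite_imageD)
    let ?f = "\<lambda>i. SOME e. e \<in> block M w i"
    have f: "?f i \<in> block M w i" if "i \<in> J M w" for i using part(2)[OF w that] by (simp add: some_in_eq)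
    have "finite (edges_at_white S w)" using finite_arcs by (simp add: edges_at_white_def)
    moreover have "?f ` J M w \<subseteq> edges_at_white S w" using f part(3)[OF w] by blast
    ultimately show "finite (?f ` J M w)" by (rule finite_subset[rotated])
    show "inj_on ?f (J M w)"
      using f part(1)[OF w] unfolding inj_on_def disjoint_family_on_def by (metis disjoint_iff)
  qed
  define K where "K w i = (SOME K. K \<noteq> 0 \<and> (\<forall>e\<in>block M w i. \<forall>g\<in>circ_class Y w e. meas M w i g = K))" for w i
  have K: "K w i \<noteq> 0" "\<And>e g. e \<in> block M w i \<Longrightarrow> g \<in> circ_class Y w e \<Longrightarrow> meas M w i g = K w i"
    if "w \<in> white S" "i \<in> J M w" for w i
  proof -
    have "\<exists>K. K \<noteq> 0 \<and> (\<forall>e\<in>block M w i. \<forall>g\<in>circ_class Y w e. meas M w i g = K)"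
      using good that unfolding good_edge_measurements_def by blast
    from someI_ex[OF this, folded K_def] show "K w i \<noteq> 0"
      "\<And>e g. e \<in> block M w i \<Longrightarrow> g \<in> circ_class Y w e \<Longrightarrow> meas M w i g = K w i" by blast+
  qed
  define N where "N = (\<Prod>w\<in>white S. \<Prod>i\<in>J M w. \<bar>K w i\<bar>)"
  have N: "N > 0" unfolding N_def using K(1) by (intro prod_pos ballI) auto
  have KN: "K w i dvd N" if "w \<in> white S" "i \<in> J M w" for w i
  proof -
    have "\<bar>K w i\<bar> dvd (\<Prod>i\<in>J M w. \<bar>K w i\<bar>)" using dvd_prodI[OF finJ[OF that(1)] that(2), of "\<lambda>i. \<bar>K w i\<bar>"] .
    also have "\<dots> dvd N" unfolding N_def using dvd_prodI[OF fin_white that(1), of "\<lambda>w. \<Prod>i\<in>J M w. \<bar>K w i\<bar>"] .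
    finally show ?thesis by simp
  qed
  have "\<exists>\<psi>. additive G (VF S w) \<psi> \<and> (\<forall>e\<in>edges_at_white S w. \<psi> (pe S e) = N * f (ke S e))" if w: "w \<in> white S" for w and f :: "int \<Rightarrow> int"
  proof -
    have wv: "w \<in> verts (\<Delta> S)" using w verts_eq by simp
    have iso: "ident Y w \<in> iso (graph_pi1 (X Y w) (bp Y w)) (sub G (VF S w))"
      using Y wv by (simp add: graph_of_spaces_for_def)
    have "\<exists>\<pi>. additive G (VF S w) \<pi> \<and> (\<forall>A\<in>carrier (graph_pi1 (X Y w) (bp Y w)). \<pi> (ident Y w A) = meas M w i A)" if "i \<in> J M w" for i
    proof -
      have "meas M w i \<in> hom (graph_pi1 (X Y w) (bp Y w)) integer_group"
        using M w that by (simp add: edge_measurements_for_def)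
      then show ?thesis using transported_additive[OF iso] by metis
    qed
    then obtain \<pi> where \<pi>: "\<And>i. i \<in> J M w \<Longrightarrow> additive G (VF S w) (\<pi> i)"
      "\<And>i A. i \<in> J M w \<Longrightarrow> A \<in> carrier (graph_pi1 (X Y w) (bp Y w)) \<Longrightarrow> \<pi> i (ident Y w A) = meas M w i A" by metis
    have \<pi>_pe: "\<pi> i (pe S e) = (if e \<in> block M w i then K w i else 0)" if i: "i \<in> J M w" and e: "e \<in> edges_at_white S w" for i e
    proof -
      have e': "e \<in> arcs'" "head (\<Delta> S) e = w" using e by (auto simp: edges_at_white_def)
      have circ: "circuit (X Y w) (circ Y e)" and img: "ident Y w ` circ_class Y w e = {f \<otimes> pe S e \<otimes> inv f | f. f \<in> VF S w}"
      proof -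
        have "\<forall>e\<in>arcs'. let w = head (\<Delta> S) e in immersed_circuit (X Y w) (circ Y e) \<and>
          ident Y w ` circ_class Y w e = {f \<otimes> pe S e \<otimes> inv f | f. f \<in> VF S w}"
          using Y unfolding graph_of_spaces_for_def by blast
        from bspec[OF this e'(1)] show "circuit (X Y w) (circ Y e)"
          "ident Y w ` circ_class Y w e = {f \<otimes> pe S e \<otimes> inv f | f. f \<in> VF S w}"
          unfolding e'(2) Let_def by (simp_all add: immersed_circuit_def)
      qed
      have "pe S e = \<one> \<otimes> pe S e \<otimes> inv \<one>" using VF_closed[OF wv] edge_facts(8)[OF e'(1)] e'(2) by simp
      then have "pe S e \<in> ident Y w ` circ_class Y w e"
        unfolding img using subgroup.one_closed[OF VF_subgroup[OF wv]] by blast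
      then obtain A where A: "A \<in> circ_class Y w e" "ident Y w A = pe S e" by auto
      have "A \<in> carrier (graph_pi1 (X Y w) (bp Y w))" using represented_class_subset[OF circ] A(1) by blast
      then have "\<pi> i (pe S e) = meas M w i A" using \<pi>(2)[OF i] A(2) by metis
      also have "\<dots> = (if e \<in> block M w i then K w i else 0)"
        using K(2)[OF w i _ A(1)] M w i e A(1) by (auto simp: edge_measurements_for_def)
      finally show ?thesis .
    qed
    define k where "k i = ke S (SOME e. e \<in> block M w i)" for i
    have k: "k i = ke S e" if i: "i \<in> J M w" and e: "e \<in> block M w i" for i e
    proof -
      have "(SOME e. e \<in> block M w i) \<in> block M w i" using e by (rule someI)
      then show ?thesis using M w i e unfolding k_def edge_measurements_for_def by blast
    qed
    let ?\<psi> = "\<lambda>g. \<Sum>i\<in>J M w. N div K w i * f (k i) * \<pi> i g"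
    have "additive G (VF S w) ?\<psi>" using \<pi>(1) by (intro additive_sum additive_scale)
    moreover have "?\<psi> (pe S e) = N * f (ke S e)" if e: "e \<in> edges_at_white S w" for e
    proof -
      obtain i0 where i0: "i0 \<in> J M w" "e \<in> block M w i0" using part(3)[OF w] e by blast
      have "e \<notin> block M w i" if "i \<in> J M w" "i \<noteq> i0" for i
        using part(1)[OF w] i0 that unfolding disjoint_family_on_def by blast
      then have "?\<psi> (pe S e) = (\<Sum>i\<in>J M w. if i = i0 then N div K w i0 * f (ke S e) * K w i0 else 0)"
        using \<pi>_pe[OF _ e] i0 k[OF i0] by (intro sum.cong refl) auto
      also have "\<dots> = N div K w i0 * K w i0 * f (ke S e)" using finJ[OF w] i0 by simp
      finally show ?thesis using KN[OF w i0(1)] by simp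
    qed
    ultimately show ?thesis by blast
  qed
  then show ?thesis using that N by blast
qed

section \<open>Free-by-cyclic groups act freely\<close>

context group
begin

lemma Inn_subset: "Inn G \<subseteq> auto G"
proof
  fix f assume "f \<in> Inn G"
  then obtain h where h: "h \<in> carrier G" "f = (\<lambda>x\<in>carrier G. h \<otimes> x \<otimes> inv h)" by (auto simp: Inn_def)
  have "bij_betw f (carrier G) (carrier G)"
    by (rule bij_betw_byWitness[where f' = "\<lambda>x. inv h \<otimes> x \<otimes> h"])
      (use h in \<open>auto simp: m_assoc inv_cancel\<close>)
  moreover have "f \<in> hom G G" using h by (auto simp: hom_def m_assoc inv_cancel)
  ultimately show "f \<in> auto G" using h by (simp add: auto_def Bij_def)
qed

lemma outer_representative: assumes "\<Phi> \<in> carrier (Out G)" "\<phi> \<in> \<Phi>" shows "\<phi> \<in> carrier (AutoGroup G)"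
proof -
  interpret A: group "AutoGroup G" by (rule AutoGroup)
  have "\<Phi> \<in> rcosets\<^bsub>AutoGroup G\<^esub> (Inn G)" using assms(1) by (simp add: Out_def FactGroup_def)
  then obtain \<psi> where \<psi>: "\<psi> \<in> carrier (AutoGroup G)" "\<Phi> = Inn G #>\<^bsub>AutoGroup G\<^esub> \<psi>" by (auto simp: RCOSETS_def)
  then obtain \<iota> where "\<iota> \<in> Inn G" "\<phi> = \<iota> \<otimes>\<^bsub>AutoGroup G\<^esub> \<psi>" using assms(2) by (auto simp: r_coset_def)
  then show ?thesis using Inn_subset \<psi>(1) by (auto simp: AutoGroup_def intro: A.m_closed[unfolded AutoGroup_def, simplified])
qed

context
  fixes \<phi> assumes \<phi>: "\<phi> \<in> carrier (AutoGroup G)"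
begin

abbreviation iterate where "iterate \<equiv> \<lambda>n::int. \<phi> [^]\<^bsub>AutoGroup G\<^esub> n"

lemma iterate_auto: "iterate n \<in> auto G"
proof -
  interpret A: group "AutoGroup G" by (rule AutoGroup)
  have "iterate n \<in> carrier (AutoGroup G)" using \<phi> by simp
  then show ?thesis by (simp add: AutoGroup_def)
qed

lemma iterate_closed: "x \<in> carrier G \<Longrightarrow> iterate n x \<in> carrier G"
  and iterate_mult: "x \<in> carrier G \<Longrightarrow> y \<in> carrier G \<Longrightarrow> iterate n (x \<otimes> y) = iterate n x \<otimes> iterate n y"
  using iterate_auto[of n] by (auto simp: auto_def hom_def)

lemma iterate_add: "x \<in> carrier G \<Longrightarrow> iterate m (iterate n x) = iterate (m + n) x"
proof -
  interpret A: group "AutoGroup G" by (rule AutoGroup)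
  assume x: "x \<in> carrier G"
  have "iterate (m + n) = iterate m \<otimes>\<^bsub>AutoGroup G\<^esub> iterate n" using \<phi> by (simp add: A.int_pow_mult)
  also have "\<dots> = compose (carrier G) (iterate m) (iterate n)"
    using iterate_auto by (simp add: AutoGroup_def BijGroup_def auto_def)
  finally show ?thesis using x by (simp add: compose_def)
qed

lemma iterate_0: "x \<in> carrier G \<Longrightarrow> \<one>\<^bsub>AutoGroup G\<^esub> x = x"
  by (simp add: AutoGroup_def BijGroup_def)

lemma iterate_one: "iterate n \<one> = \<one>"
proof -
  have "iterate n \<one> \<otimes> iterate n \<one> = iterate n \<one> \<otimes> \<one>"
    using iterate_mult[of \<one> \<one> n] iterate_closed[of \<one> n] by simp
  then show ?thesis using iterate_closed[of \<one> n] by simp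
qed

lemma group_semidirect: "group (semidirect_Z G \<phi>)"
proof (rule groupI)
  fix x assume "x \<in> carrier (semidirect_Z G \<phi>)"
  then obtain f m where x: "x = (f, m)" "f \<in> carrier G" by (auto simp: semidirect_Z_def)
  let ?y = "(iterate (- m) (inv f), - m)"
  have "?y \<otimes>\<^bsub>semidirect_Z G \<phi>\<^esub> x = \<one>\<^bsub>semidirect_Z G \<phi>\<^esub>"
    using x iterate_mult[of "inv f" f "- m"] iterate_one by (simp add: semidirect_Z_def)
  moreover have "?y \<in> carrier (semidirect_Z G \<phi>)" using x iterate_closed by (simp add: semidirect_Z_def)
  ultimately show "\<exists>y\<in>carrier (semidirect_Z G \<phi>). y \<otimes>\<^bsub>semidirect_Z G \<phi>\<^esub> x = \<one>\<^bsub>semidirect_Z G \<phi>\<^esub>" by blast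
qed (auto simp: semidirect_Z_def iterate_closed iterate_mult iterate_add iterate_0 m_assoc add.assoc)

lemma semidirect_torsion_free:
  assumes tf: "\<And>f n. f \<in> carrier G \<Longrightarrow> f \<noteq> \<one> \<Longrightarrow> n \<noteq> 0 \<Longrightarrow> f [^] (n::nat) \<noteq> \<one>"
    and g: "g \<in> carrier (semidirect_Z G \<phi>)" "g \<noteq> \<one>\<^bsub>semidirect_Z G \<phi>\<^esub>" and n: "n \<noteq> 0"
  shows "g [^]\<^bsub>semidirect_Z G \<phi>\<^esub> (n::nat) \<noteq> \<one>\<^bsub>semidirect_Z G \<phi>\<^esub>"
proof -
  interpret S: group "semidirect_Z G \<phi>" by (rule group_semidirect)
  obtain f m where fm: "g = (f, m)" "f \<in> carrier G" using g by (auto simp: semidirect_Z_def)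
  have snd: "snd (g [^]\<^bsub>semidirect_Z G \<phi>\<^esub> k) = int k * m" for k :: nat
  proof (induction k)
    case (Suc k)
    obtain a b where ab: "g [^]\<^bsub>semidirect_Z G \<phi>\<^esub> k = (a, b)" by fastforce
    have "snd (g [^]\<^bsub>semidirect_Z G \<phi>\<^esub> Suc k) = b + m" using ab fm(1) by (simp add: semidirect_Z_def)
    then show ?case using Suc ab by (simp add: algebra_simps)
  qed (simp add: semidirect_Z_def)
  show ?thesis
  proof (cases "m = 0")
    case True
    have "g [^]\<^bsub>semidirect_Z G \<phi>\<^esub> k = (f [^] k, 0)" for k :: nat
    proof (induction k)
      case (Suc k)
      then have "g [^]\<^bsub>semidirect_Z G \<phi>\<^esub> Suc k = (f [^] k, 0) \<otimes>\<^bsub>semidirect_Z G \<phi>\<^esub> (f, 0)" using fm True by simp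
      also have "\<dots> = (f [^] Suc k, 0)" using iterate_0[OF fm(2)] by (simp add: semidirect_Z_def)
      finally show ?case .
    qed (simp add: semidirect_Z_def)
    moreover have "f \<noteq> \<one>" using g fm True by (simp add: semidirect_Z_def)
    ultimately show ?thesis using tf[OF fm(2) _ n] by (simp add: semidirect_Z_def)
  next
    case False
    then have "snd (g [^]\<^bsub>semidirect_Z G \<phi>\<^esub> n) \<noteq> 0" using snd n by simp
    then show ?thesis by (auto simp: semidirect_Z_def)
  qed
qed

end

end

lemma ex_escaping_action_of_good_measurements:
  fixes G :: "'g monoid"
  assumes "group G" and fbc: "free_by_cyclic G F t" and good: "has_good_edge_measurements G F t"
  shows "\<exists>\<Theta> :: 'g \<Rightarrow> (((nat \<times> 'g set) + (bool \<times> int)) + ((bool \<times> int) + (nat \<times> 'g \<times> 'g set))) set \<Rightarrow> _.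
    wall_action G \<Theta> \<and> (\<forall>g\<in>carrier G - {\<one>\<^bsub>G\<^esub>}. escapes G \<Theta> g)"
proof -
  obtain S :: "(nat, nat, 'g) torus_splitting" and Y M where S: "torus_splitting_of G F t S"
    "graph_of_spaces_for G F t S Y" "starred S" "edge_measurements_for S Y M" "good_edge_measurements S Y M"
    using good unfolding has_good_edge_measurements_def by blast
  interpret torus_data G F t S
    by (intro torus_data.intro torus_data_axioms.intro assms S)
  obtain N where "N > 0" "\<And>w f. w \<in> white S \<Longrightarrow> \<exists>\<psi>. additive G (VF S w) \<psi> \<and>
      (\<forall>e\<in>edges_at_white S w. \<psi> (pe S e) = N * f (ke S e))"
    using scaled_measurements[OF S(2,4,5)] by metis
  then interpret measured_torus_data G F t S N
    by unfold_locales (use S(3) in auto)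
  show ?thesis by (rule ex_escaping_action)
qed

theorem proposition5p5:
  fixes F :: "'a monoid" and \<Phi> :: "('a \<Rightarrow> 'a) set" and \<phi> :: "'a \<Rightarrow> 'a" and G :: "('a \<times> int) monoid"
  assumes "finite_rank_free F"
    and "\<Phi> \<in> carrier (Out F)"
    and "linearly_growing F \<Phi>"
    and "\<phi> \<in> \<Phi>"
    and "G = semidirect_Z F \<phi>"
    and "virtually_has_good_edge_measurements G (fibre F)"
  shows "acts_freely_on_CAT0_cube_complex G"
proof -
  obtain B where B: "finite B" "free_basis F B"
    using assms(1) by (auto simp: finite_rank_free_def free_of_rank_def)
  interpret F: based_free_group F B by unfold_locales (rule B(2))
  have \<phi>: "\<phi> \<in> carrier (AutoGroup F)" by (rule F.outer_representative[OF assms(2,4)])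
  have G: "group G" using F.group_semidirect[OF \<phi>] assms(5) by simp
  interpret group G by (rule G)
  obtain H t where sub: "subgroup H G" and index: "finite (rcosets\<^bsub>G\<^esub> H)" and data: "free_by_cyclic (sub G H) (H \<inter> fibre F) t"
    "has_good_edge_measurements (sub G H) (H \<inter> fibre F) t"
    using assms(6) unfolding virtually_has_good_edge_measurements_def by blast
  interpret finite_index_subgroup G H by (intro finite_index_subgroup.intro finite_index_subgroup_axioms.intro G sub index)
  obtain \<Theta> :: "('a \<times> int) \<Rightarrow> (((nat \<times> ('a \<times> int) set) + (bool \<times> int)) + ((bool \<times> int) + (nat \<times> ('a \<times> int) \<times> ('a \<times> int) set))) set \<Rightarrow> _"
    where \<Theta>: "wall_action (sub G H) \<Theta>" "\<And>h. h \<in> H \<Longrightarrow> h \<noteq> \<one>\<^bsub>G\<^esub> \<Longrightarrow> escapes (sub G H) \<Theta> h"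
    using ex_escaping_action_of_good_measurements[OF subgroup.subgroup_is_group[OF sub G] data] by auto
  show ?thesis
  proof (rule acts_freely_of_wall_action[OF G _ wall_action_induced[OF \<Theta>(1)], where \<iota> = "\<lambda>n. {(undefined, int n)}"])
    have "carrier G = carrier F \<times> UNIV" by (simp add: assms(5) semidirect_Z_def)
    then show "countable (carrier G)" using F.countable_carrier[OF B(1)] by simp
    show "inj (\<lambda>n. {(undefined :: 'a, int n)})" by (simp add: inj_def)
    fix g assume g: "g \<in> carrier G" "g \<noteq> \<one>\<^bsub>G\<^esub>"
    obtain m :: nat where m: "0 < m" "g [^]\<^bsub>G\<^esub> m \<in> H" using finite_index_power[OF g(1)] by blast
    have "g [^]\<^bsub>G\<^esub> m \<noteq> \<one>\<^bsub>G\<^esub>"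
      using F.semidirect_torsion_free[OF \<phi> F.torsion_free, of g m] g m(1) assms(5) by simp
    then have "escapes G (induced \<Theta>) (g [^]\<^bsub>G\<^esub> m)" using escapes_induced[OF \<Theta>(1) m(2)] \<Theta>(2)[OF m(2)] by blast
    then show "escapes G (induced \<Theta>) g" by (rule escapes_power[OF G g(1)])
  qed
qed

end
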